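(* Let $p$ be an odd prime and $N$ a prime with $N\equiv1\pmod p$. The Selmer group $H^1_\Lambda(G_\mathbb{Q},\mathbb{F}_p(1))$ is $1$-dimensional over $\mathbb{F}_p$ and is generated by the class of $b$.
   Context: $\mathbb{F}_p(1)$ is $\mathbb{F}_p$ with $G_\mathbb{Q}$ acting via the mod $p$ cyclotomic character, identified with $\langle\zeta_p\rangle$. $b:G_\mathbb{Q}\to\mathbb{F}_p(1)$ is the cocycle $\sigma\mapsto\sigma(N^{1/p})/N^{1/p}$. $H^1_\Lambda(G_\mathbb{Q},A)$ consists of classes in $H^1(G_\mathbb{Q},A)$ unramified at all primes $\ell\ne N,p$, arbitrary at $N$, and whose restriction to $G_{L_p}$ is unramified, where $L_p=\mathbb{Q}_p(\zeta_p,N^{1/p})$. *)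

theory Defs
  imports
    Complex_Main
    "HOL-Analysis.Function_Topology"
    "HOL-Computational_Algebra.Polynomial"
    "HOL-Algebra.Algebraic_Closure"
    "HOL-Algebra.Generated_Fields"
    "HOL-Number_Theory.Residues"
    "Jordan_Normal_Form.Missing_VectorSpace"
begin

hide_const (open) Divisibility.prime

section \<open>Topological groups and continuous cohomology in degree one\<close>

record 'g top_group = "'g monoid" +
  gtop :: "'g topology"

definition top_subgroup :: "'g top_group \<Rightarrow> 'g set \<Rightarrow> 'g top_group" where
  "top_subgroup G H = G\<lparr>carrier := H, gtop := subtopology (gtop G) H\<rparr>"

text \<open>The coefficients are a discrete module \<open>A\<close> over a ring of scalars, with a group action
  \<open>act\<close>. Cochains are extensional functions, so that they are determined by their values on the
  group.\<close>

definition cocycles ::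
    "'g top_group \<Rightarrow> ('k, 'a) module \<Rightarrow> ('g \<Rightarrow> 'a \<Rightarrow> 'a) \<Rightarrow> ('g \<Rightarrow> 'a) set" where
  "cocycles G A act =
     {c \<in> carrier G \<rightarrow>\<^sub>E carrier A.
        continuous_map (gtop G) (discrete_topology (carrier A)) c \<and>
        (\<forall>\<sigma>\<in>carrier G. \<forall>\<tau>\<in>carrier G. c (\<sigma> \<otimes>\<^bsub>G\<^esub> \<tau>) = c \<sigma> \<oplus>\<^bsub>A\<^esub> act \<sigma> (c \<tau>))}"

definition coboundaries ::
    "'g top_group \<Rightarrow> ('k, 'a) module \<Rightarrow> ('g \<Rightarrow> 'a \<Rightarrow> 'a) \<Rightarrow> ('g \<Rightarrow> 'a) set" where
  "coboundaries G A act = (\<lambda>a. \<lambda>\<sigma>\<in>carrier G. act \<sigma> a \<ominus>\<^bsub>A\<^esub> a) ` carrier A"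

text \<open>Only the additive structure and the scalar multiplication of a \<^typ>\<open>('k, 'a) module\<close>
  record matter here; its ring multiplication and one are unspecified.\<close>

definition Z1 ::
    "'g top_group \<Rightarrow> ('k, 'a) module \<Rightarrow> ('g \<Rightarrow> 'a \<Rightarrow> 'a) \<Rightarrow> ('k, 'g \<Rightarrow> 'a) module" where
  "Z1 G A act =
     \<lparr>carrier = cocycles G A act, monoid.mult = undefined, one = undefined,
      zero = (\<lambda>\<sigma>\<in>carrier G. \<zero>\<^bsub>A\<^esub>),
      add = (\<lambda>c d. \<lambda>\<sigma>\<in>carrier G. c \<sigma> \<oplus>\<^bsub>A\<^esub> d \<sigma>),
      smult = (\<lambda>k c. \<lambda>\<sigma>\<in>carrier G. k \<odot>\<^bsub>A\<^esub> c \<sigma>)\<rparr>"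

definition H1_class ::
    "'g top_group \<Rightarrow> ('k, 'a) module \<Rightarrow> ('g \<Rightarrow> 'a \<Rightarrow> 'a) \<Rightarrow> ('g \<Rightarrow> 'a) \<Rightarrow> ('g \<Rightarrow> 'a) set" where
  "H1_class G A act c = coboundaries G A act +>\<^bsub>Z1 G A act\<^esub> c"

definition H1 ::
    "'g top_group \<Rightarrow> ('k, 'a) module \<Rightarrow> ('g \<Rightarrow> 'a \<Rightarrow> 'a) \<Rightarrow> ('k, ('g \<Rightarrow> 'a) set) module" where
  "H1 G A act =
     \<lparr>carrier = a_rcosets\<^bsub>Z1 G A act\<^esub> (coboundaries G A act),
      monoid.mult = undefined, one = undefined,
      zero = coboundaries G A act,
      add = set_add (Z1 G A act),
      smult = (\<lambda>k \<xi>. \<Union>c\<in>\<xi>. H1_class G A act (k \<odot>\<^bsub>Z1 G A act\<^esub> c))\<rparr>"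

text \<open>Pullback of a class along a homomorphism \<open>\<phi>\<close> from \<open>H\<close>; the group \<open>H\<close> acts on \<open>A\<close>
  through \<open>\<phi>\<close>.\<close>

definition H1_pullback ::
    "'h top_group \<Rightarrow> ('h \<Rightarrow> 'g) \<Rightarrow> ('k, 'a) module \<Rightarrow> ('g \<Rightarrow> 'a \<Rightarrow> 'a) \<Rightarrow>
     ('g \<Rightarrow> 'a) set \<Rightarrow> ('h \<Rightarrow> 'a) set" where
  "H1_pullback H \<phi> A act \<xi> =
     (\<Union>c\<in>\<xi>. H1_class H A (\<lambda>\<tau>. act (\<phi> \<tau>)) (\<lambda>\<tau>\<in>carrier H. c (\<phi> \<tau>)))"


section \<open>Galois groups\<close>

text \<open>The topology is that of pointwise convergence with \<open>L\<close> discrete, i.e. the Krull topology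
  when \<open>L\<close> is algebraic over \<open>K\<close>.\<close>

definition galois_group :: "'a ring \<Rightarrow> 'a set \<Rightarrow> ('a \<Rightarrow> 'a) top_group" where
  "galois_group L K =
     (let G = {\<sigma> \<in> ring_iso L L \<inter> extensional (carrier L). \<forall>x\<in>K. \<sigma> x = x} in
      \<lparr>carrier = G, monoid.mult = compose (carrier L), one = (\<lambda>x\<in>carrier L. x),
       gtop = subtopology
         (product_topology (\<lambda>_. discrete_topology (carrier L)) (carrier L)) G\<rparr>)"

definition Qbar :: "complex ring" where
  "Qbar = \<lparr>carrier = {x. algebraic x}, monoid.mult = (*), one = 1, zero = 0, add = (+)\<rparr>"

definition G_Q :: "(complex \<Rightarrow> complex) top_group" where
  "G_Q = galois_group Qbar \<rat>"

text \<open>Restriction of automorphisms along an embedding \<open>j\<close> of \<^const>\<open>Qbar\<close> into a bigger field,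
  whose image is stable under automorphisms.\<close>

definition galois_restrict :: "(complex \<Rightarrow> 'b) \<Rightarrow> ('b \<Rightarrow> 'b) \<Rightarrow> complex \<Rightarrow> complex" where
  "galois_restrict j \<sigma> = (\<lambda>x\<in>carrier Qbar. inv_into (carrier Qbar) j (\<sigma> (j x)))"


section \<open>The fields of l-adic numbers and their algebraic closures\<close>

definition padic_abs :: "nat \<Rightarrow> rat \<Rightarrow> real" where
  "padic_abs l x =
     (if x = 0 then 0
      else real l powi (int (multiplicity (int l) (snd (quotient_of x)))
                      - int (multiplicity (int l) (fst (quotient_of x)))))"

definition padic_cauchy_ring :: "nat \<Rightarrow> (nat \<Rightarrow> rat) ring" where
  "padic_cauchy_ring l =
     \<lparr>carrier = {f. \<forall>e>0. \<exists>M. \<forall>m\<ge>M. \<forall>n\<ge>M. padic_abs l (f m - f n) < e},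
      monoid.mult = (\<lambda>f g n. f n * g n), one = (\<lambda>_. 1), zero = (\<lambda>_. 0),
      add = (\<lambda>f g n. f n + g n)\<rparr>"

definition padic_null :: "nat \<Rightarrow> (nat \<Rightarrow> rat) set" where
  "padic_null l = {f. (\<lambda>n. padic_abs l (f n)) \<longlonglongrightarrow> 0}"

type_synonym padic = "(nat \<Rightarrow> rat) set"

text \<open>\<open>\<rat>\<^sub>l\<close>, the completion of \<open>\<rat>\<close> for the \<open>l\<close>-adic absolute value.\<close>

definition padic_field :: "nat \<Rightarrow> padic ring" where
  "padic_field l = padic_cauchy_ring l Quot padic_null l"

definition padic_integers :: "nat \<Rightarrow> padic set" where
  "padic_integers l = {\<xi> \<in> carrier (padic_field l). \<exists>f\<in>\<xi>. \<forall>n. padic_abs l (f n) \<le> 1}"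

type_synonym padic_bar = "(padic list \<times> nat) multiset \<Rightarrow> padic"

definition Qlbar :: "nat \<Rightarrow> padic_bar ring" where
  "Qlbar l = field.alg_closure (padic_field l)"

definition Ql :: "nat \<Rightarrow> padic_bar set" where
  "Ql l = ring.indexed_const (padic_field l) ` carrier (padic_field l)"

definition Zl :: "nat \<Rightarrow> padic_bar set" where
  "Zl l = ring.indexed_const (padic_field l) ` padic_integers l"


section \<open>Inertia and unramified classes\<close>

definition integral_closure_in :: "'a ring \<Rightarrow> 'a set \<Rightarrow> 'a set" where
  "integral_closure_in L S =
     {x \<in> carrier L. \<exists>f \<in> carrier (univ_poly L S).
        f \<noteq> [] \<and> hd f = \<one>\<^bsub>L\<^esub> \<and> ring.eval L f x = \<zero>\<^bsub>L\<^esub>}"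

definition Zlbar :: "nat \<Rightarrow> padic_bar ring" where
  "Zlbar l = (Qlbar l)\<lparr>carrier := integral_closure_in (Qlbar l) (Zl l)\<rparr>"

text \<open>For a prime \<open>l\<close> and a field \<open>K\<close> between \<open>\<rat>\<^sub>l\<close> and its algebraic closure: the automorphisms over \<open>K\<close> that act
  trivially on the residue field of the local ring \<^term>\<open>Zlbar l\<close>, whose maximal ideal is the set
  of non-units.\<close>

definition inertia :: "nat \<Rightarrow> padic_bar set \<Rightarrow> (padic_bar \<Rightarrow> padic_bar) set" where
  "inertia l K =
     {\<sigma> \<in> carrier (galois_group (Qlbar l) K).
        \<forall>x \<in> carrier (Zlbar l).
          \<sigma> x \<ominus>\<^bsub>Qlbar l\<^esub> x \<in> carrier (Zlbar l) - Units (Zlbar l)}"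

definition unramified ::
    "nat \<Rightarrow> padic_bar set \<Rightarrow> ('k, 'a) module \<Rightarrow> ((padic_bar \<Rightarrow> padic_bar) \<Rightarrow> 'a \<Rightarrow> 'a) \<Rightarrow>
     ((padic_bar \<Rightarrow> padic_bar) \<Rightarrow> 'a) set \<Rightarrow> bool" where
  "unramified l K A act Y \<longleftrightarrow>
     (let I = top_subgroup (galois_group (Qlbar l) K) (inertia l K) in
      H1_pullback I id A act Y = \<zero>\<^bsub>H1 I A act\<^esub>)"

text \<open>The class \<open>\<xi>\<close> of \<^const>\<open>G_Q\<close> becomes unramified after restriction to the absolute Galois group
  of \<open>K\<close>, taken along an embedding \<open>j\<close> of \<^const>\<open>Qbar\<close> into \<^term>\<open>Qlbar l\<close>.\<close>

definition unramified_over ::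
    "nat \<Rightarrow> (complex \<Rightarrow> padic_bar) \<Rightarrow> padic_bar set \<Rightarrow>
     ('k, 'a) module \<Rightarrow> ((complex \<Rightarrow> complex) \<Rightarrow> 'a \<Rightarrow> 'a) \<Rightarrow>
     ((complex \<Rightarrow> complex) \<Rightarrow> 'a) set \<Rightarrow> bool" where
  "unramified_over l j K A act \<xi> \<longleftrightarrow>
     unramified l K A (\<lambda>\<tau>. act (galois_restrict j \<tau>))
       (H1_pullback (galois_group (Qlbar l) K) (galois_restrict j) A act \<xi>)"


section \<open>The Selmer group\<close>

text \<open>\<open>L\<^sub>p = \<rat>\<^sub>p(\<zeta>\<^sub>p, N\<^sup>1\<^sup>/\<^sup>p)\<close>, for the chosen root of unity \<open>\<zeta>\<close>, the chosen \<open>p\<close>-th root \<open>\<nu>\<close> of \<open>N\<close>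
  and the chosen embedding \<open>j\<close> at \<open>p\<close>.\<close>

definition Lp :: "nat \<Rightarrow> (complex \<Rightarrow> padic_bar) \<Rightarrow> complex \<Rightarrow> complex \<Rightarrow> padic_bar set" where
  "Lp p j \<zeta> \<nu> = generate_field (Qlbar p) (Ql p \<union> {j \<zeta>, j \<nu>})"

definition H1_Lambda ::
    "nat \<Rightarrow> nat \<Rightarrow> (nat \<Rightarrow> complex \<Rightarrow> padic_bar) \<Rightarrow> complex \<Rightarrow> complex \<Rightarrow>
     ('k, 'a) module \<Rightarrow> ((complex \<Rightarrow> complex) \<Rightarrow> 'a \<Rightarrow> 'a) \<Rightarrow>
     ('k, ((complex \<Rightarrow> complex) \<Rightarrow> 'a) set) module" where
  "H1_Lambda p N \<iota> \<zeta> \<nu> A act =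
     (H1 G_Q A act)\<lparr>carrier :=
        {\<xi> \<in> carrier (H1 G_Q A act).
           (\<forall>l. prime l \<and> l \<noteq> N \<and> l \<noteq> p \<longrightarrow> unramified_over l (\<iota> l) (Ql l) A act \<xi>) \<and>
           unramified_over p (\<iota> p) (Lp p (\<iota> p) \<zeta> \<nu>) A act \<xi>}\<rparr>"


section \<open>The Galois module \<open>\<bbbF>\<^sub>p(1)\<close> and the Kummer cocycle\<close>

text \<open>The identification of the group generated by a primitive \<open>p\<close>-th root of unity \<open>\<zeta>\<close> with
  \<open>\<bbbF>\<^sub>p\<close>, sending \<open>\<zeta>\<close> to \<open>1\<close>.\<close>

definition zeta_log :: "nat \<Rightarrow> complex \<Rightarrow> complex \<Rightarrow> int" where
  "zeta_log p \<zeta> x = (THE k. k \<in> carrier (residue_ring (int p)) \<and> x = \<zeta> ^ nat k)"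

definition cyclotomic_char :: "nat \<Rightarrow> complex \<Rightarrow> (complex \<Rightarrow> complex) \<Rightarrow> int" where
  "cyclotomic_char p \<zeta> \<sigma> = zeta_log p \<zeta> (\<sigma> \<zeta>)"

definition Fp_module :: "nat \<Rightarrow> (int, int) module" where
  "Fp_module p =
     (let F = residue_ring (int p) in
      \<lparr>carrier = carrier F, monoid.mult = monoid.mult F, one = one F, zero = zero F, add = add F,
       smult = monoid.mult F\<rparr>)"

definition Fp1_action :: "nat \<Rightarrow> complex \<Rightarrow> (complex \<Rightarrow> complex) \<Rightarrow> int \<Rightarrow> int" where
  "Fp1_action p \<zeta> \<sigma> a = cyclotomic_char p \<zeta> \<sigma> \<otimes>\<^bsub>residue_ring (int p)\<^esub> a"

definition kummer_cocycle ::
    "nat \<Rightarrow> complex \<Rightarrow> complex \<Rightarrow> (complex \<Rightarrow> complex) \<Rightarrow> int" where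
  "kummer_cocycle p \<zeta> \<nu> = (\<lambda>\<sigma>\<in>carrier G_Q. zeta_log p \<zeta> (\<sigma> \<nu> / \<nu>))"

end

theory Submission
  imports Defs
    "HOL-Decision_Procs.Algebra_Aux"
    "HOL-Algebra.Chinese_Remainder"
    "HOL-Computational_Algebra.Fundamental_Theorem_Algebra"
    "HOL-Computational_Algebra.Nth_Powers"
begin

text \<open>By continuity and Hilbert 90, a cocycle \<open>c\<close> has the form \<open>\<sigma>(\<beta>)/\<beta> = \<zeta>\<^sup>c\<close> with \<open>\<beta>\<^sup>p = A\<close> for a
  positive integer \<open>A\<close>. If the class is unramified at a prime \<open>l \<noteq> N, p\<close>, then, after multiplication
  by a power of \<open>\<zeta>\<close>, \<open>\<beta>\<close> is fixed by inertia and so lies in the maximal unramified extension of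
  \<open>\<rat>\<^sub>l\<close>, where \<open>l\<close> remains a uniformiser; hence \<open>p\<close> divides the \<open>l\<close>-adic valuation of \<open>A\<close>. At \<open>p\<close> the
  element \<open>\<beta>\<close> is unramified over \<open>L\<^sub>p\<close>. By Kummer theory a power of \<open>N\<^sup>1\<^sup>/\<^sup>p\<close> times \<open>\<beta>\<close> is then unramified
  over \<open>\<rat>\<^sub>p(\<zeta>)\<close>, whose degree over \<open>\<rat>\<^sub>p\<close> is prime to \<open>p\<close>, so that \<open>p\<close> divides the \<open>p\<close>-adic valuation
  of \<open>A\<close> as well. Therefore \<open>A = N\<^sup>k r\<^sup>p\<close>, and \<open>c\<close> is cohomologous to \<open>k b\<close>. Conversely \<open>b\<close> satisfies
  the local conditions, and its class does not vanish because \<open>N\<close> has no rational \<open>p\<close>-th root.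

  The maximal unramified extension is obtained by adjoining to \<open>\<rat>\<^sub>l\<close> all roots of unity of order
  prime to \<open>l\<close>. That an automorphism fixing it lies in inertia, and that \<open>l\<close> remains a uniformiser
  in it, is shown without ramification theory, from the fact that an integer of the algebraic
  closure of \<open>\<rat>\<^sub>l\<close> which is not a unit has a power divisible by \<open>l\<close>.\<close>

section \<open>Integral elements\<close>

text \<open>The algebraic closure of Q_l is an abstract one and carries no valuation. Integrality
  over Z_l takes its place: divisibility by \<open>l\<close> in the integral closure measures size,
  and the nonunits stand for positive valuation. That the nonunits form an ideal says that a single
  prime lies over \<open>l\<close>. It rests on completeness, which lifts an idempotent modulo
  \<open>l\<close> to one in a domain, where it is 0 or 1. Galois theory enters mainly in one form:
  an element outside a ring between the base field and the closure is moved by some automorphism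
  over that ring. Extensions can thus be handled as subrings given by generators, and membership in
  them is proved by invariance. Qbar and the closure of Q_l are two models of one locale, so this is
  done once. Oddness of \<open>p\<close> lets the sign of a Kummer radicand be absorbed into a
  \<open>p\<close>-th power, so that primes alone decide the shape of the radicand. At
  \<open>p\<close>, comparison with \<open>N\<close> leaves the valuation unchanged, since
  \<open>N \<equiv> 1\<close> modulo \<open>p\<close> makes \<open>N\<close> a \<open>p\<close>-adic
  unit.\<close>

inductive_set lin_span :: "('a, 'b) ring_scheme \<Rightarrow> 'a set \<Rightarrow> 'a set \<Rightarrow> 'a set"
  for R (structure) and A B where
    zero: "\<zero>\<^bsub>R\<^esub> \<in> lin_span R A B"
  | add: "a \<in> A \<Longrightarrow> b \<in> B \<Longrightarrow> w \<in> lin_span R A B \<Longrightarrow> a \<otimes>\<^bsub>R\<^esub> b \<oplus>\<^bsub>R\<^esub> w \<in> lin_span R A B"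

text \<open>In a discrete valuation ring a term of least valuation divides all the others. The condition
  also holds for fields, and it makes finitely spanned modules noetherian.\<close>

definition dvr_like :: "('a, 'b) ring_scheme \<Rightarrow> 'a set \<Rightarrow> bool" where
  "dvr_like R A \<longleftrightarrow> (\<forall>c::nat \<Rightarrow> 'a. (\<forall>n. c n \<in> A) \<longrightarrow>
     (\<exists>m. \<forall>n. \<exists>q\<in>A. c n = q \<otimes>\<^bsub>R\<^esub> c m))"

text \<open>A monic equation of degree \<open>n\<close> is phrased as membership of the
  \<open>n\<close>-th power in the span of the lower powers, which is the shape in which the
  noetherian argument delivers it.\<close>

definition integral_over :: "('a, 'b) ring_scheme \<Rightarrow> 'a set \<Rightarrow> 'a \<Rightarrow> bool" where
  "integral_over R A x \<longleftrightarrow> x \<in> carrier R \<and>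
     (\<exists>n. x [^]\<^bsub>R\<^esub> (n::nat) \<in> lin_span R A ((\<lambda>i. x [^]\<^bsub>R\<^esub> i) ` {..<n}))"

text \<open>\<open>C\<close> only has to lie inside a finitely spanned module, which is what the
  chain argument of \<open>lin_span_noetherian\<close> consumes; the module may contain elements
  outside \<open>C\<close>.\<close>

definition finite_alg :: "('a, 'b) ring_scheme \<Rightarrow> 'a set \<Rightarrow> 'a set \<Rightarrow> bool" where
  "finite_alg R A C \<longleftrightarrow> subring C R \<and> A \<subseteq> C \<and>
     (\<exists>B\<subseteq>carrier R. finite B \<and> C \<subseteq> lin_span R A B)"

context cring
begin

lemma lin_span_closed:
  assumes "A \<subseteq> carrier R" "B \<subseteq> carrier R" "x \<in> lin_span R A B"
  shows "x \<in> carrier R"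
  using assms(3) by induction (use assms in auto)

lemma lin_span_mono:
  assumes "A \<subseteq> A'" "B \<subseteq> B'"
  shows "lin_span R A B \<subseteq> lin_span R A' B'"
proof
  fix x assume "x \<in> lin_span R A B"
  then show "x \<in> lin_span R A' B'"
    by induction (use assms in \<open>auto intro: lin_span.intros\<close>)
qed

lemma lin_span_plus:
  assumes "A \<subseteq> carrier R" "B \<subseteq> carrier R" "x \<in> lin_span R A B" "y \<in> lin_span R A B"
  shows "x \<oplus> y \<in> lin_span R A B"
  using assms(3)
proof induction
  case zero
  then show ?case using assms lin_span_closed by auto
next
  case (add a b w)
  then have "a \<otimes> b \<oplus> w \<oplus> y = a \<otimes> b \<oplus> (w \<oplus> y)"
    using assms lin_span_closed by (intro a_assoc) auto
  then show ?case using add by (auto intro: lin_span.intros)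
qed

lemma lin_span_smult:
  assumes "subring A R" "B \<subseteq> carrier R" "x \<in> lin_span R A B" "c \<in> A"
  shows "c \<otimes> x \<in> lin_span R A B"
  using assms(3)
proof induction
  case zero
  have "c \<otimes> \<zero> = \<zero>" using assms subringE(1)[OF assms(1)] by auto
  then show ?case by (simp add: lin_span.zero)
next
  case (add a b w)
  note A = subringE(1)[OF assms(1)]
  have c: "a \<in> carrier R" "b \<in> carrier R" "w \<in> carrier R" "c \<in> carrier R"
    using add A assms lin_span_closed by auto
  then have "c \<otimes> (a \<otimes> b \<oplus> w) = (c \<otimes> a) \<otimes> b \<oplus> c \<otimes> w"
    by (simp add: r_distr m_assoc)
  then show ?case using add subringE(6)[OF assms(1)] assms(4) by (auto intro: lin_span.intros)
qed

lemma lin_span_incl: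
  assumes "subring A R" "B \<subseteq> carrier R" "x \<in> B"
  shows "x \<in> lin_span R A B"
proof -
  have "\<one> \<otimes> x \<oplus> \<zero> \<in> lin_span R A B"
    using assms subringE(3)[OF assms(1)] by (auto intro!: lin_span.intros)
  then show ?thesis using assms by (simp add: subset_iff)
qed

lemma lin_span_uminus:
  assumes "subring A R" "B \<subseteq> carrier R" "x \<in> lin_span R A B"
  shows "\<ominus> x \<in> lin_span R A B"
proof -
  have "x \<in> carrier R" using assms lin_span_closed subringE(1) by blast
  moreover have "(\<ominus> \<one>) \<otimes> x \<in> lin_span R A B"
    using assms by (intro lin_span_smult) (auto intro: subringE(3,5))
  ultimately show ?thesis by (simp add: l_minus)
qed

lemma lin_span_minus:
  assumes "subring A R" "B \<subseteq> carrier R" "x \<in> lin_span R A B" "y \<in> lin_span R A B"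
  shows "x \<ominus> y \<in> lin_span R A B"
  unfolding a_minus_def using assms lin_span_plus lin_span_uminus subringE(1) by metis

lemma lin_span_trans:
  assumes "subring A R" "C \<subseteq> carrier R" "B \<subseteq> lin_span R A C" "x \<in> lin_span R A B"
  shows "x \<in> lin_span R A C"
  using assms(4)
proof induction
  case zero
  then show ?case by (rule lin_span.intros)
next
  case (add a b w)
  then show ?case using assms lin_span_plus lin_span_smult subringE(1)[OF assms(1)]
    by (meson subset_iff)
qed

lemma lin_span_insert:
  assumes "subring A R" "B \<subseteq> carrier R" "b \<in> carrier R" "x \<in> lin_span R A (insert b B)"
  shows "\<exists>a\<in>A. \<exists>w\<in>lin_span R A B. x = a \<otimes> b \<oplus> w"
  using assms(4)
proof induction
  case zero
  show ?case using subringE(2)[OF assms(1)] assms(3)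
    by (intro bexI[of _ \<zero>]) (auto intro: lin_span.intros)
next
  case (add a c w)
  note A = subringE(1)[OF assms(1)]
  from add.IH obtain a' w' where w: "a' \<in> A" "w' \<in> lin_span R A B" "w = a' \<otimes> b \<oplus> w'" by blast
  have c: "a \<in> carrier R" "a' \<in> carrier R" "w' \<in> carrier R" "c \<in> carrier R"
    using add A w lin_span_closed[OF A assms(2)] assms by auto
  show ?case
  proof (cases "c = b")
    case True
    have "a \<otimes> c \<oplus> w = (a \<oplus> a') \<otimes> b \<oplus> w'"
      using c assms(3) True w by (simp add: l_distr a_assoc)
    then show ?thesis using w add subringE(7)[OF assms(1)] by blast
  next
    case False
    then have "c \<in> B" using add by simp
    have "a \<otimes> c \<oplus> w = a' \<otimes> b \<oplus> (a \<otimes> c \<oplus> w')"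
      using c assms(3) w by (simp add: a_lcomm)
    then show ?thesis using w add \<open>c \<in> B\<close> by (blast intro: lin_span.intros)
  qed
qed

lemma lin_span_empty: "x \<in> lin_span R A {} \<Longrightarrow> x = \<zero>"
  by (induction rule: lin_span.induct) auto

lemma lin_span_tower:
  assumes "subring A R" "B \<subseteq> carrier R" "C \<subseteq> carrier R" "D \<subseteq> lin_span R A B"
    and "x \<in> lin_span R D C"
  shows "x \<in> lin_span R A ((\<lambda>(b, c). b \<otimes> c) ` (B \<times> C))"
proof -
  let ?P = "(\<lambda>(b, c). b \<otimes> c) ` (B \<times> C)"
  note A = subringE(1)[OF assms(1)]
  have P: "?P \<subseteq> carrier R" using assms by auto
  have one: "d \<otimes> c \<in> lin_span R A ?P" if d: "d \<in> lin_span R A B" and "c \<in> C" for d c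
    using d
  proof induction
    case zero
    have "\<zero> \<otimes> c = \<zero>" using that assms by auto
    then show ?case by (simp add: lin_span.zero)
  next
    case (add a b w)
    have "a \<in> carrier R" "b \<in> carrier R" "c \<in> carrier R" "w \<in> carrier R"
      using A assms add that lin_span_closed by auto
    then have "(a \<otimes> b \<oplus> w) \<otimes> c = a \<otimes> (b \<otimes> c) \<oplus> w \<otimes> c"
      by (simp add: l_distr m_assoc)
    moreover have "b \<otimes> c \<in> ?P" using add \<open>c \<in> C\<close> by auto
    ultimately show ?case using add lin_span.add[of a A "b \<otimes> c" ?P "w \<otimes> c"] by simp
  qed
  show ?thesis using assms(5)
  proof induction
    case zero
    then show ?case by (rule lin_span.intros)
  next
    case (add d c w)
    then show ?case using one assms(4) lin_span_plus[OF A P] by blast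
  qed
qed

lemma lin_span_mult:
  assumes "subring A R" "B \<subseteq> carrier R" "C \<subseteq> carrier R"
    and "x \<in> lin_span R A B" "y \<in> lin_span R A C"
  shows "x \<otimes> y \<in> lin_span R A ((\<lambda>(b, c). b \<otimes> c) ` (B \<times> C))"
proof -
  note A = subringE(1)[OF assms(1)]
  have D: "lin_span R A B \<subseteq> lin_span R A B" by simp
  have "x \<otimes> y \<in> lin_span R (lin_span R A B) C"
    using assms(5)
  proof induction
    case zero
    then show ?case using assms lin_span_closed[OF A] by (auto intro: lin_span.intros)
  next
    case (add a b w)
    have c: "a \<in> carrier R" "b \<in> carrier R" "x \<in> carrier R" "w \<in> carrier R"
      using A assms add lin_span_closed by auto
    then have "x \<otimes> (a \<otimes> b \<oplus> w) = (a \<otimes> x) \<otimes> b \<oplus> x \<otimes> w"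
      by (simp add: r_distr m_ac)
    then show ?case using add assms lin_span_smult by (auto intro: lin_span.intros)
  qed
  then show ?thesis using lin_span_tower[OF assms(1-3) D] by simp
qed

text \<open>Once \<open>x [^] n\<close> reduces to lower powers, multiplication by \<open>x\<close>
  maps the span into itself; hence it contains all powers of \<open>x\<close>, and products of two
  such powers stay inside.\<close>

lemma lin_span_powers_subring:
  fixes n :: nat
  assumes A: "subring A R" and x: "x \<in> carrier R"
    and n: "x [^] n \<in> lin_span R A ((\<lambda>i. x [^] i) ` {..<n})"
  defines "C \<equiv> lin_span R A ((\<lambda>i. x [^] i) ` {..<n})"
  shows "x [^] (m::nat) \<in> C" "subring C R" "A \<subseteq> C"
proof -
  let ?B = "(\<lambda>i. x [^] i) ` {..<n}"
  have B: "?B \<subseteq> carrier R" using x by auto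
  note Ac = subringE(1)[OF A]
  have step: "x \<otimes> y \<in> C" if "y \<in> C" for y
    using that unfolding C_def
  proof induction
    case zero
    then show ?case using x by (auto intro: lin_span.intros)
  next
    case (add a b w)
    then obtain i where i: "i < n" "b = x [^] i" by auto
    have c: "a \<in> carrier R" "b \<in> carrier R" "w \<in> carrier R"
      using Ac add x i lin_span_closed[OF Ac B] by auto
    have eq: "x \<otimes> (a \<otimes> b \<oplus> w) = a \<otimes> x [^] Suc i \<oplus> x \<otimes> w"
      using c x i by (simp add: r_distr m_ac)
    have "x [^] Suc i \<in> lin_span R A ?B"
    proof (cases "Suc i = n")
      case True then show ?thesis using n by simp
    next
      case False then show ?thesis using i by (intro lin_span_incl[OF A B] imageI) auto
    qed
    then show ?case unfolding eq
      using add lin_span_smult[OF A B] lin_span_plus[OF Ac B] by blast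
  qed
  show pow: "x [^] (m::nat) \<in> C" for m
  proof (induction m)
    case 0
    show ?case
    proof (cases "n = 0")
      case True then show ?thesis using n C_def by simp
    next
      case False then show ?thesis unfolding C_def
        by (intro lin_span_incl[OF A B] image_eqI[of _ _ 0]) auto
    qed
  next
    case (Suc m)
    then show ?case using step[OF Suc] x by (simp add: m_comm)
  qed
  have closed: "C \<subseteq> carrier R" unfolding C_def using lin_span_closed[OF Ac B] by auto
  have mult: "y \<otimes> z \<in> C" if "y \<in> C" "z \<in> C" for y z
  proof -
    have "y \<otimes> z \<in> lin_span R A ((\<lambda>(b, c). b \<otimes> c) ` (?B \<times> ?B))"
      using lin_span_mult[OF A B B] that unfolding C_def by blast
    moreover have "(\<lambda>(b, c). b \<otimes> c) ` (?B \<times> ?B) \<subseteq> lin_span R A ?B"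
      using pow x by (auto simp: nat_pow_mult C_def)
    ultimately show ?thesis unfolding C_def using lin_span_trans[OF A B] by blast
  qed
  have one: "\<one> \<in> C" using pow[of 0] x by simp
  show "subring C R"
    by (rule subringI) (use closed one mult lin_span_uminus[OF A B] lin_span_plus[OF Ac B] C_def in auto)
  show "A \<subseteq> C"
  proof
    fix a assume "a \<in> A"
    then have "a \<otimes> \<one> \<in> C" using one lin_span_smult[OF A B] C_def by blast
    then show "a \<in> C" using \<open>a \<in> A\<close> Ac by (auto simp: subset_iff)
  qed
qed

lemma add_cancel_minus:
  assumes "x \<in> carrier R" "y \<in> carrier R" "z \<in> carrier R"
  shows "(x \<oplus> y) \<ominus> (x \<oplus> z) = y \<ominus> z"
proof -
  have "x \<oplus> (\<ominus> x \<oplus> (y \<oplus> \<ominus> z)) = y \<oplus> \<ominus> z" using assms by (intro r_neg2) auto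
  then show ?thesis using assms by (simp add: a_minus_def minus_add a_assoc a_lcomm[of y "\<ominus> x"])
qed

text \<open>Induction on the generators. Among the coefficients of \<open>b\<close> one, say that of
  \<open>v m\<close>, divides all the others, so subtracting multiples of \<open>v m\<close> removes
  \<open>b\<close> and leaves a sequence in the smaller span. A relation there is a relation for
  \<open>v\<close>.\<close>

lemma lin_span_noetherian:
  assumes A: "subring A R" and d: "dvr_like R A" and "finite B" "B \<subseteq> carrier R"
    and "\<And>n::nat. v n \<in> lin_span R A B"
  shows "\<exists>n. v n \<in> lin_span R A (v ` {..<n})"
  using assms(3-5)
proof (induction B arbitrary: v rule: finite_induct)
  case empty
  then have "v 0 = \<zero>" using lin_span_empty by blast
  then show ?case by (intro exI[of _ 0]) (auto intro: lin_span.intros)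
next
  case (insert b B)
  note Ac = subringE(1)[OF A]
  have b: "b \<in> carrier R" "B \<subseteq> carrier R" using insert by auto
  have vc: "v n \<in> carrier R" for n
    using lin_span_closed[OF Ac] insert.prems by blast
  have "\<exists>a w. a \<in> A \<and> w \<in> lin_span R A B \<and> v n = a \<otimes> b \<oplus> w" for n
    using lin_span_insert[OF A b(2,1) insert.prems(2)[of n]] by blast
  then obtain c w where cw: "\<And>n. c n \<in> A" "\<And>n. w n \<in> lin_span R A B"
    "\<And>n. v n = c n \<otimes> b \<oplus> w n" by metis
  have wc: "w n \<in> carrier R" for n using lin_span_closed[OF Ac b(2)] cw by blast
  obtain m where "\<forall>n. \<exists>q\<in>A. c n = q \<otimes> c m"
    using d cw(1) unfolding dvr_like_def by blast
  then obtain q where q: "\<And>n. q n \<in> A" "\<And>n. c n = q n \<otimes> c m" by metis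
  \<comment> \<open>The shift by \<open>Suc m\<close> puts \<open>v m\<close> among the terms
    preceding each remaining one, so that the subtracted multiples stay in the span of earlier
    terms.\<close>
  define u where "u i = v (Suc m + i) \<ominus> q (Suc m + i) \<otimes> v m" for i
  have u_eq: "u i = w (Suc m + i) \<ominus> q (Suc m + i) \<otimes> w m" for i
  proof -
    define Q W W' V V' C where "Q = q (Suc m + i)" "W = w m" "W' = w (Suc m + i)" "V = v m"
      "V' = v (Suc m + i)" "C = c m"
    have e: "V' = (Q \<otimes> C) \<otimes> b \<oplus> W'" "V = C \<otimes> b \<oplus> W"
      using cw(3)[of "Suc m + i"] cw(3)[of m] q(2)[of "Suc m + i"] unfolding Q_W_W'_V_V'_C_def by auto
    have m: "Q \<in> carrier R" "C \<in> carrier R" "W \<in> carrier R" "W' \<in> carrier R" "b \<in> carrier R"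
      using subsetD[OF Ac q(1)] subsetD[OF Ac cw(1)] wc b(1) unfolding Q_W_W'_V_V'_C_def by simp_all
    have "V' \<ominus> Q \<otimes> V = ((Q \<otimes> C) \<otimes> b \<oplus> W') \<ominus> ((Q \<otimes> C) \<otimes> b \<oplus> Q \<otimes> W)"
      unfolding e using m by (simp add: r_distr m_assoc)
    also have "\<dots> = W' \<ominus> Q \<otimes> W" using m by (intro add_cancel_minus) simp_all
    finally have "V' \<ominus> Q \<otimes> V = W' \<ominus> Q \<otimes> W" .
    then show ?thesis unfolding u_def Q_W_W'_V_V'_C_def .
  qed
  have "u i \<in> lin_span R A B" for i
    unfolding u_eq using cw(2) q(1) by (intro lin_span_minus[OF A b(2)] lin_span_smult[OF A b(2)]) auto
  with insert.IH[OF b(2)] obtain i where i: "u i \<in> lin_span R A (u ` {..<i})" by blast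
  let ?V = "v ` {..<Suc m + i}"
  have V: "?V \<subseteq> carrier R" using vc by auto
  have vm: "q n \<otimes> v m \<in> lin_span R A ?V" for n
    using q(1) by (intro lin_span_smult[OF A V] lin_span_incl[OF A V]) auto
  have "u ` {..<i} \<subseteq> lin_span R A ?V"
  proof clarify
    fix j assume "j < i"
    then show "u j \<in> lin_span R A ?V"
      unfolding u_def by (intro lin_span_minus[OF A V lin_span_incl[OF A V] vm]) auto
  qed
  then have "u i \<in> lin_span R A ?V" using i lin_span_trans[OF A V] by blast
  then have "u i \<oplus> q (Suc m + i) \<otimes> v m \<in> lin_span R A ?V"
    using vm lin_span_plus[OF Ac V] by blast
  moreover have "u i \<oplus> q (Suc m + i) \<otimes> v m = v (Suc m + i)"
  proof -
    define Q V V' where "Q = q (Suc m + i)" "V = v m" "V' = v (Suc m + i)"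
    have m: "Q \<in> carrier R" "V \<in> carrier R" "V' \<in> carrier R"
      using subsetD[OF Ac q(1)] vc unfolding Q_V_V'_def by simp_all
    have "V' \<ominus> Q \<otimes> V \<oplus> Q \<otimes> V = V'" using m by (simp add: a_minus_def a_assoc l_neg)
    then show ?thesis unfolding u_def Q_V_V'_def .
  qed
  ultimately show ?case by auto
qed

lemma integral_over_closed: "integral_over R A x \<Longrightarrow> x \<in> carrier R"
  by (simp add: integral_over_def)

lemma integral_over_mono: "integral_over R A x \<Longrightarrow> A \<subseteq> C \<Longrightarrow> integral_over R C x"
  unfolding integral_over_def using lin_span_mono[of A C] by blast

text \<open>The powers of \<open>x\<close> all lie in one finitely spanned module, so one of them
  depends on its predecessors. This replaces the determinant trick and is the reason for
  \<open>dvr_like\<close>.\<close>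

lemma finite_alg_integral:
  assumes "subring A R" "dvr_like R A" "finite_alg R A C" "x \<in> C"
  shows "integral_over R A x"
proof -
  obtain B where B: "B \<subseteq> carrier R" "finite B" "C \<subseteq> lin_span R A B" and C: "subring C R"
    using assms(3) unfolding finite_alg_def by blast
  have "x [^] (n::nat) \<in> C" for n
    using assms(4) by (induction n) (auto intro: subringE(3,6)[OF C])
  then show ?thesis
    using lin_span_noetherian[OF assms(1,2) B(2,1), of "\<lambda>n. x [^] n"] B(3)
      subsetD[OF subringE(1)[OF C] assms(4)]
    unfolding integral_over_def by (simp add: subset_iff)
qed

lemma finite_alg_adjoin:
  assumes "subring A R" "integral_over R A x"
  obtains C where "finite_alg R A C" "x \<in> C"
proof -
  obtain n :: nat where x: "x \<in> carrier R" and n: "x [^] n \<in> lin_span R A ((\<lambda>i. x [^] i) ` {..<n})"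
    using assms(2) unfolding integral_over_def by blast
  note * = lin_span_powers_subring[OF assms(1) x n]
  have "finite_alg R A (lin_span R A ((\<lambda>i. x [^] i) ` {..<n}))"
    unfolding finite_alg_def using *(2,3) x
    by (intro conjI exI[of _ "(\<lambda>i. x [^] i) ` {..<n}"]) auto
  moreover have "x \<in> lin_span R A ((\<lambda>i. x [^] i) ` {..<n})"
    using *(1)[of 1] x by simp
  ultimately show ?thesis using that by blast
qed

lemma finite_alg_trans:
  assumes "subring A R" "finite_alg R A C" "finite_alg R C D"
  shows "finite_alg R A D"
proof -
  obtain B where B: "B \<subseteq> carrier R" "finite B" "C \<subseteq> lin_span R A B"
    using assms(2) unfolding finite_alg_def by blast
  obtain E where E: "E \<subseteq> carrier R" "finite E" "D \<subseteq> lin_span R C E"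
    using assms(3) unfolding finite_alg_def by blast
  have "D \<subseteq> lin_span R A ((\<lambda>(b, c). b \<otimes> c) ` (B \<times> E))"
    using lin_span_tower[OF assms(1) B(1) E(1) B(3)] E(3) by blast
  moreover have "(\<lambda>(b, c). b \<otimes> c) ` (B \<times> E) \<subseteq> carrier R" using B E by auto
  ultimately show ?thesis
    using assms(2,3) B(2) E(2) unfolding finite_alg_def by blast
qed

lemma finite_alg_refl:
  assumes "subring A R" shows "finite_alg R A A"
proof -
  have "a \<in> lin_span R A {\<one>}" if "a \<in> A" for a
    using lin_span_smult[OF assms _ lin_span_incl[OF assms], of "{\<one>}" \<one> a] that subringE(1)[OF assms]
    by auto
  then have "\<exists>B\<subseteq>carrier R. finite B \<and> A \<subseteq> lin_span R A B" by (intro exI[of _ "{\<one>}"]) auto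
  then show ?thesis unfolding finite_alg_def using assms by blast
qed

lemma finite_alg_adjoin_set:
  assumes A: "subring A R" and "finite S" "\<And>x. x \<in> S \<Longrightarrow> integral_over R A x"
  shows "\<exists>C. finite_alg R A C \<and> S \<subseteq> C"
  using assms(2,3)
proof (induction S rule: finite_induct)
  case empty
  then show ?case using finite_alg_refl[OF A] by blast
next
  case (insert x S)
  then obtain C where C: "finite_alg R A C" "S \<subseteq> C" by auto
  then have sC: "subring C R" "A \<subseteq> C" unfolding finite_alg_def by auto
  obtain D where "finite_alg R C D" "x \<in> D"
    using finite_alg_adjoin[OF sC(1)] integral_over_mono[OF insert.prems sC(2)] by blast
  moreover from this have "C \<subseteq> D" unfolding finite_alg_def by blast
  ultimately show ?case using finite_alg_trans[OF A C(1)] C(2) by blast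
qed

text \<open>\<open>x\<close> and \<open>y\<close> lie in a common finite algebra, which contains
  their sum, product and negatives, and every element of it is integral.\<close>

lemma integral_over_ring:
  assumes "subring A R" "dvr_like R A" "integral_over R A x" "integral_over R A y"
  shows "integral_over R A (x \<oplus> y)" "integral_over R A (x \<otimes> y)" "integral_over R A (\<ominus> x)"
proof -
  obtain C where C: "finite_alg R A C" "{x, y} \<subseteq> C"
    using finite_alg_adjoin_set[OF assms(1), of "{x, y}"] assms(3,4) by auto
  then have "subring C R" unfolding finite_alg_def by auto
  then have "x \<oplus> y \<in> C" "x \<otimes> y \<in> C" "\<ominus> x \<in> C"
    using C(2) subringE(5-7) by auto
  then show "integral_over R A (x \<oplus> y)" "integral_over R A (x \<otimes> y)" "integral_over R A (\<ominus> x)"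
    using finite_alg_integral[OF assms(1,2) C(1)] by auto
qed

text \<open>Passage between spans and polynomials. \<open>eval\<close> reads the leading coefficient
  first, and the list has length exactly \<open>n\<close> with zeros allowed in front, so that no
  degree has to be tracked.\<close>

lemma lin_span_powers_eval:
  fixes n :: nat
  assumes A: "subring A R" and x: "x \<in> carrier R"
  shows "y \<in> lin_span R A ((\<lambda>i. x [^] i) ` {..<n}) \<longleftrightarrow>
         (\<exists>cs. set cs \<subseteq> A \<and> length cs = n \<and> y = eval cs x)"
proof (induction n arbitrary: y)
  case 0
  then show ?case using lin_span_empty by (auto intro: lin_span.intros)
next
  case (Suc n)
  note Ac = subringE(1)[OF A]
  let ?B = "\<lambda>n::nat. (\<lambda>i. x [^] i) ` {..<n}"
  have B: "?B n \<subseteq> carrier R" for n using x by auto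
  show ?case
  proof
    assume "y \<in> lin_span R A (?B (Suc n))"
    then obtain a w where aw: "a \<in> A" "w \<in> lin_span R A (?B n)" "y = a \<otimes> x [^] n \<oplus> w"
      using lin_span_insert[OF A B, of "x [^] n" y n] x by (auto simp: lessThan_Suc)
    then obtain cs where "set cs \<subseteq> A" "length cs = n" "w = eval cs x" using Suc by blast
    then show "\<exists>cs. set cs \<subseteq> A \<and> length cs = Suc n \<and> y = eval cs x"
      using aw by (intro exI[of _ "a # cs"]) auto
  next
    assume "\<exists>cs. set cs \<subseteq> A \<and> length cs = Suc n \<and> y = eval cs x"
    then obtain a cs where cs: "set (a # cs) \<subseteq> A" "length cs = n" "y = eval (a # cs) x"
      by (metis length_Suc_conv)
    then have "eval cs x \<in> lin_span R A (?B n)" using Suc by auto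
    then have "eval cs x \<in> lin_span R A (?B (Suc n))"
      using lin_span_mono[of A A "?B n" "?B (Suc n)"] by (auto simp: lessThan_Suc)
    then show "y \<in> lin_span R A (?B (Suc n))"
      using cs by (auto intro!: lin_span.intros(2))
  qed
qed

lemma integral_over_iff:
  assumes A: "subring A R" and x: "x \<in> carrier R"
  shows "integral_over R A x \<longleftrightarrow> (\<exists>cs. set cs \<subseteq> A \<and> eval (\<one> # cs) x = \<zero>)"
proof
  note Ac = subringE(1)[OF A]
  assume "integral_over R A x"
  then obtain n :: nat where "x [^] n \<in> lin_span R A ((\<lambda>i. x [^] i) ` {..<n})"
    unfolding integral_over_def by blast
  then have "\<ominus> (x [^] n) \<in> lin_span R A ((\<lambda>i. x [^] i) ` {..<n})"
    using lin_span_uminus[OF A, of "(\<lambda>i. x [^] i) ` {..<n}"] x by auto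
  then obtain cs where cs: "set cs \<subseteq> A" "length cs = n" "\<ominus> (x [^] n) = eval cs x"
    unfolding lin_span_powers_eval[OF A x] by blast
  then have "eval (\<one> # cs) x = \<zero>" using x by (simp add: cs(3)[symmetric] r_neg)
  then show "\<exists>cs. set cs \<subseteq> A \<and> eval (\<one> # cs) x = \<zero>" using cs by blast
next
  note Ac = subringE(1)[OF A]
  assume "\<exists>cs. set cs \<subseteq> A \<and> eval (\<one> # cs) x = \<zero>"
  then obtain cs where cs: "set cs \<subseteq> A" "eval (\<one> # cs) x = \<zero>" by blast
  then have c: "eval cs x \<in> carrier R" using Ac x by (intro eval_in_carrier) auto
  have "\<ominus> (x [^] length cs) = eval cs x"
    using cs(2) c x by (simp add: minus_equality a_comm)
  then have "\<ominus> (x [^] length cs) \<in> lin_span R A ((\<lambda>i. x [^] i) ` {..<length cs})"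
    unfolding lin_span_powers_eval[OF A x] using cs by blast
  then have "\<ominus> (\<ominus> (x [^] length cs)) \<in> lin_span R A ((\<lambda>i. x [^] i) ` {..<length cs})"
    using lin_span_uminus[OF A, of "(\<lambda>i. x [^] i) ` {..<length cs}"] x by blast
  then have "x [^] length cs \<in> lin_span R A ((\<lambda>i. x [^] i) ` {..<length cs})"
    using x by (simp only: minus_minus nat_pow_closed)
  then show "integral_over R A x" unfolding integral_over_def using x by blast
qed

text \<open>The coefficients lie in a finite algebra \<open>C\<close>, over which \<open>x\<close>
  is integral; adjoining \<open>x\<close> gives an algebra finite over \<open>C\<close>, hence over
  \<open>A\<close>.\<close>

lemma integral_over_trans:
  assumes A: "subring A R" and d: "dvr_like R A" and x: "x \<in> carrier R"
    and cs: "\<And>c. c \<in> set cs \<Longrightarrow> integral_over R A c" and e: "eval (\<one> # cs) x = \<zero>"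
  shows "integral_over R A x"
proof -
  obtain C where C: "finite_alg R A C" "set cs \<subseteq> C"
    using finite_alg_adjoin_set[OF A, of "set cs"] cs by auto
  then have sC: "subring C R" unfolding finite_alg_def by auto
  then have "integral_over R C x"
    using integral_over_iff[OF sC x] C e by blast
  then obtain D where D: "finite_alg R C D" "x \<in> D" using finite_alg_adjoin[OF sC] by blast
  then show ?thesis using finite_alg_integral[OF A d] finite_alg_trans[OF A C(1)] by blast
qed

lemma integral_over_base:
  assumes "subring A R" "x \<in> A" shows "integral_over R A x"
proof -
  have "x \<in> carrier R" using assms subringE(1) by blast
  moreover have "eval [\<one>, \<ominus> x] x = \<zero>" using calculation by (simp add: r_neg)
  ultimately show ?thesis using integral_over_iff[OF assms(1), of x] assms(2) subringE(5)[OF assms(1)]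
    by (metis empty_set insert_subset list.simps(15) empty_subsetI)
qed

end

section \<open>Automorphisms of algebraically closed fields\<close>

context cring
begin

text \<open>Horner division by \<open>X - \<eta>\<close>, keeping all coefficients in
  \<open>B\<close>. The clauses on \<open>Q ! 0\<close> and \<open>Q ! 1\<close> record the two
  leading coefficients: they show that a monic polynomial has a monic quotient and let the sum of
  the roots be tracked.\<close>

lemma eval_root_divide:
  assumes B: "subring B R" and "set P \<subseteq> B" and \<eta>: "\<eta> \<in> B"
  shows "\<exists>Q. set Q \<subseteq> B \<and> length Q = length P - 1 \<and>
      (\<forall>x\<in>carrier R. eval P x = (x \<ominus> \<eta>) \<otimes> eval Q x \<oplus> eval P \<eta>) \<and>
      (2 \<le> length P \<longrightarrow> Q ! 0 = P ! 0) \<and> (3 \<le> length P \<longrightarrow> Q ! 1 = P ! 0 \<otimes> \<eta> \<oplus> P ! 1)"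
  using assms(2)
proof (induction P rule: rev_induct)
  case Nil
  then show ?case using subringE(1)[OF B] \<eta> by (intro exI[of _ "[]"]) (auto simp: a_minus_def)
next
  case (snoc a P)
  note Bc = subringE(1)[OF B]
  have \<eta>c: "\<eta> \<in> carrier R" and ac: "a \<in> carrier R" and aB: "a \<in> B" and PB: "set P \<subseteq> B"
    and Pc: "set P \<subseteq> carrier R"
    using Bc \<eta> snoc.prems by auto
  have ev: "eval P \<eta> \<in> B" if "set P \<subseteq> B" for P
    using that
  proof (induction P)
    case (Cons p P)
    have "\<eta> [^] n \<in> B" for n :: nat by (induction n) (use \<eta> subringE(3,6)[OF B] in auto)
    with Cons show ?case using subringE(6,7)[OF B] by auto
  qed (use subringE(2)[OF B] in auto)
  show ?case
  proof (cases "P = []")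
    case True
    then show ?thesis using \<eta>c ac by (intro exI[of _ "[]"]) (auto simp: a_minus_def)
  next
    case False
    obtain Q where Q: "set Q \<subseteq> B" "length Q = length P - 1"
      "\<And>x. x \<in> carrier R \<Longrightarrow> eval P x = (x \<ominus> \<eta>) \<otimes> eval Q x \<oplus> eval P \<eta>"
      "2 \<le> length P \<Longrightarrow> Q ! 0 = P ! 0" "3 \<le> length P \<Longrightarrow> Q ! 1 = P ! 0 \<otimes> \<eta> \<oplus> P ! 1"
      using snoc.IH PB by blast
    have Qc: "set Q \<subseteq> carrier R" using Q(1) Bc by blast
    \<comment> \<open>Appending \<open>a\<close> multiplies by \<open>X\<close> and adds
      \<open>a\<close>; the quotient gains the former remainder as its last coefficient.\<close>
    define Q' where "Q' = Q @ [eval P \<eta>]"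
    have evc: "eval P \<eta> \<in> carrier R" using ev[OF PB] Bc by blast
    have "eval (P @ [a]) x = (x \<ominus> \<eta>) \<otimes> eval Q' x \<oplus> eval (P @ [a]) \<eta>" if x: "x \<in> carrier R" for x
    proof -
      define p q where "p = eval P \<eta>" "q = eval Q x"
      have c: "p \<in> carrier R" "q \<in> carrier R" using evc eval_in_carrier[OF Qc x] unfolding p_q_def by auto
      have "eval (P @ [a]) x = ((x \<ominus> \<eta>) \<otimes> q \<oplus> p) \<otimes> x \<oplus> a"
        using eval_append_aux[OF Pc ac x] Q(3)[OF x] unfolding p_q_def by simp
      also have "\<dots> = (x \<ominus> \<eta>) \<otimes> (q \<otimes> x \<oplus> p) \<oplus> (p \<otimes> \<eta> \<oplus> a)"
        using c x \<eta>c ac by algebra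
      also have "\<dots> = (x \<ominus> \<eta>) \<otimes> eval Q' x \<oplus> eval (P @ [a]) \<eta>"
        unfolding Q'_def using eval_append_aux[OF Pc ac \<eta>c] eval_append_aux[OF Qc evc x]
        unfolding p_q_def by simp
      finally show ?thesis .
    qed
    moreover have "set Q' \<subseteq> B" using Q(1) ev[OF PB] unfolding Q'_def by auto
    moreover have "length Q' = length (P @ [a]) - 1" using Q(2) False unfolding Q'_def
      by (cases P) auto
    moreover have "Q' ! 0 = (P @ [a]) ! 0" if "2 \<le> length (P @ [a])"
    proof (cases "length P = 1")
      case True
      then obtain b where "P = [b]" by (auto simp: length_Suc_conv)
      then show ?thesis using Q(2) Pc \<eta>c unfolding Q'_def by auto
    next
      case False
      then have "2 \<le> length P" "0 < length Q" using that Q(2) by auto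
      then show ?thesis using Q(4) unfolding Q'_def by (cases P) (simp_all add: nth_append)
    qed
    moreover have "Q' ! 1 = (P @ [a]) ! 0 \<otimes> \<eta> \<oplus> (P @ [a]) ! 1" if "3 \<le> length (P @ [a])"
    proof (cases "length P = 2")
      case True
      then obtain b c where "P = [b, c]" by (auto simp: length_Suc_conv numeral_2_eq_2)
      then show ?thesis using Q(2) Pc \<eta>c unfolding Q'_def by (auto simp: nth_append)
    next
      case False
      then have "3 \<le> length P" "1 < length Q" using that Q(2) by auto
      then have "(P @ [a]) ! 0 = P ! 0" "(P @ [a]) ! 1 = P ! 1" "Q' ! 1 = Q ! 1"
        unfolding Q'_def by (auto simp: nth_append)
      then show ?thesis using Q(5) \<open>3 \<le> length P\<close> by simp
    qed
    ultimately show ?thesis by blast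
  qed
qed

lemma monic_root_divide:
  assumes B: "subring B R" and "set cs \<subseteq> B" and \<eta>: "\<eta> \<in> B" and cs: "cs \<noteq> []"
    and root: "eval (\<one> # cs) \<eta> = \<zero>"
  obtains ds where "set ds \<subseteq> B" "length cs = Suc (length ds)"
    "\<And>x. x \<in> carrier R \<Longrightarrow> eval (\<one> # cs) x = (x \<ominus> \<eta>) \<otimes> eval (\<one> # ds) x"
    "ds \<noteq> [] \<Longrightarrow> ds ! 0 = \<eta> \<oplus> cs ! 0"
proof -
  have P: "set (\<one> # cs) \<subseteq> B" using assms subringE(3)[OF B] by auto
  note Bc = subringE(1)[OF B]
  obtain Q where Q: "set Q \<subseteq> B" "length Q = length cs"
      "\<And>x. x \<in> carrier R \<Longrightarrow> eval (\<one> # cs) x = (x \<ominus> \<eta>) \<otimes> eval Q x \<oplus> \<zero>"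
      "Q ! 0 = \<one>" "2 \<le> length cs \<Longrightarrow> Q ! 1 = \<one> \<otimes> \<eta> \<oplus> cs ! 0"
    using eval_root_divide[OF B P \<eta>] cs unfolding root
    by (auto simp: Suc_le_eq numeral_2_eq_2 numeral_3_eq_3)
  then obtain ds where ds: "Q = \<one> # ds" using cs by (cases Q) auto
  have \<eta>c: "\<eta> \<in> carrier R" using Bc \<eta> by auto
  have "eval (\<one> # cs) x = (x \<ominus> \<eta>) \<otimes> eval (\<one> # ds) x" if x: "x \<in> carrier R" for x
  proof -
    have "eval (\<one> # ds) x \<in> carrier R" using Q(1) Bc x ds by (intro eval_in_carrier) auto
    then show ?thesis using Q(3)[OF x] x \<eta>c unfolding ds by (simp del: eval.simps)
  qed
  moreover have "ds \<noteq> [] \<Longrightarrow> ds ! 0 = \<eta> \<oplus> cs ! 0" using Q(2,5) \<eta>c unfolding ds by (cases ds) auto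
  moreover have "set ds \<subseteq> B" "length cs = Suc (length ds)" using Q(1,2) unfolding ds by auto
  ultimately show ?thesis using that by blast
qed

lemma eval_map_mult:
  assumes "set cs \<subseteq> carrier R" "c \<in> carrier R" "x \<in> carrier R"
  shows "eval (map ((\<otimes>) c) cs) x = c \<otimes> eval cs x"
  using assms(1)
proof (induction cs)
  case (Cons a cs)
  moreover have "eval cs x \<in> carrier R" using Cons.prems assms by (intro eval_in_carrier) auto
  ultimately show ?case using assms by (simp add: r_distr m_assoc)
qed (use assms in auto)

end

lemma (in domain) finite_monic_roots:
  assumes "set cs \<subseteq> carrier R"
  shows "finite {x \<in> carrier R. eval (\<one> # cs) x = \<zero>}"
  using assms
proof (induction "length cs" arbitrary: cs)
  case 0
  then show ?case by simp
next
  case (Suc n)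
  show ?case
  proof (cases "\<exists>\<eta>\<in>carrier R. eval (\<one> # cs) \<eta> = \<zero>")
    case True
    then obtain \<eta> where \<eta>: "\<eta> \<in> carrier R" "eval (\<one> # cs) \<eta> = \<zero>" by blast
    have "cs \<noteq> []" using Suc.hyps by auto
    then obtain ds where ds: "set ds \<subseteq> carrier R" "length cs = Suc (length ds)"
      "\<And>x. x \<in> carrier R \<Longrightarrow> eval (\<one> # cs) x = (x \<ominus> \<eta>) \<otimes> eval (\<one> # ds) x"
      using monic_root_divide[OF carrier_is_subring Suc.prems \<eta>(1) _ \<eta>(2)] by metis
    have "{x \<in> carrier R. eval (\<one> # cs) x = \<zero>} \<subseteq> insert \<eta> {x \<in> carrier R. eval (\<one> # ds) x = \<zero>}"
    proof (rule subsetI)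
      fix x assume "x \<in> {x \<in> carrier R. eval (\<one> # cs) x = \<zero>}"
      then have x: "x \<in> carrier R" "eval (\<one> # cs) x = \<zero>" by blast+
      show "x \<in> insert \<eta> {x \<in> carrier R. eval (\<one> # ds) x = \<zero>}"
      proof (cases "eval (\<one> # ds) x = \<zero>")
        case False
      have "eval (\<one> # ds) x \<in> carrier R" using ds(1) x(1) by (intro eval_in_carrier) auto
      then have "x \<ominus> \<eta> = \<zero>"
        using ds(3)[OF x(1)] x \<eta>(1) False integral[of "x \<ominus> \<eta>" "eval (\<one> # ds) x"] by (metis minus_closed)
      then show ?thesis using x \<eta> by simp
    qed (use x in blast)
    qed
    moreover have "finite {x \<in> carrier R. eval (\<one> # ds) x = \<zero>}"
      using Suc.hyps ds by auto
    ultimately show ?thesis by (meson finite_insert finite_subset)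
  next
    case False
    then have "{x \<in> carrier R. eval (\<one> # cs) x = \<zero>} = {}" by blast
    then show ?thesis by (metis finite.emptyI)
  qed
qed

text \<open>An algebraic closure of a field of characteristic zero, stated through monic equations
  so that the results on \<open>integral_over\<close> apply directly. \<open>Qbar\<close> and
  \<open>Qlbar l\<close> are its two models.\<close>

locale closed_field = field R for R :: "'a ring" (structure) +
  fixes k :: "'a set"
  assumes k_subfield: "subfield k R"
    and k_algebraic: "x \<in> carrier R \<Longrightarrow> integral_over R k x"
    and monic_root: "set cs \<subseteq> carrier R \<Longrightarrow> cs \<noteq> [] \<Longrightarrow> \<exists>x\<in>carrier R. eval (\<one> # cs) x = \<zero>"
    and char_zero: "\<guillemotleft>i\<guillemotright> = \<zero> \<Longrightarrow> i = 0"
begin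

lemma k_subring: "subring k R"
  using k_subfield by (rule subfieldE)

lemma k_carrier: "k \<subseteq> carrier R"
  using k_subring by (rule subringE)

lemma k_inv: "x \<in> k \<Longrightarrow> x \<noteq> \<zero> \<Longrightarrow> inv x \<in> k"
  using subfield_m_inv(1)[OF k_subfield] by auto

text \<open>A ring between \<open>k\<close> and an algebraic extension is a field: in a monic
  equation of least degree for \<open>x\<close> the constant term is nonzero, since otherwise
  \<open>x\<close> could be cancelled, and solving for it gives the inverse. Generated subrings can
  therefore serve as extension fields.\<close>

lemma subring_inverse:
  assumes K: "subring K R" "k \<subseteq> K" and x: "x \<in> K" "x \<noteq> \<zero>"
  shows "inv x \<in> K"
proof -
  have xc: "x \<in> carrier R" using K x subringE(1) by blast
  define P where "P n \<longleftrightarrow> (\<exists>cs. set cs \<subseteq> k \<and> length cs = n \<and> eval (\<one> # cs) x = \<zero>)" for n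
  have "\<exists>n. P n" using k_algebraic[OF xc] unfolding integral_over_iff[OF k_subring xc] P_def by blast
  then have min: "P (LEAST n. P n)" "\<And>m. P m \<Longrightarrow> (LEAST n. P n) \<le> m" by (auto intro: LeastI_ex Least_le)
  then obtain cs where cs: "set cs \<subseteq> k" "length cs = (LEAST n. P n)" "eval (\<one> # cs) x = \<zero>"
    unfolding P_def by blast
  have "cs \<noteq> []" using cs(3) by auto
  then obtain ds c where ds: "cs = ds @ [c]" by (metis rev_exhaust)
  have sc: "set (\<one> # ds) \<subseteq> carrier R" "c \<in> carrier R" "c \<in> k" using cs(1) k_carrier unfolding ds by auto
  have ec: "eval (\<one> # ds) x \<in> carrier R" using sc xc by (intro eval_in_carrier) auto
  have eq: "eval (\<one> # ds) x \<otimes> x \<oplus> c = \<zero>"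
    using eval_append_aux[OF sc(1,2) xc] cs(3) unfolding ds by (simp del: eval.simps)
  have c0: "c \<noteq> \<zero>"
  proof
    assume "c = \<zero>"
    then have "eval (\<one> # ds) x \<otimes> x = \<zero>" using eq ec xc by (simp del: eval.simps)
    then have "eval (\<one> # ds) x = \<zero>" using integral[OF _ ec xc] x by blast
    then have "P (length ds)" using cs(1) unfolding P_def ds by auto
    then have "length cs \<le> length ds" using min(2) cs(2) by simp
    then show False unfolding ds by simp
  qed
  define y where "y = \<ominus> (inv c) \<otimes> eval (\<one> # ds) x"
  have evK: "eval es x \<in> K" if "set es \<subseteq> K" for es
    using that
  proof (induction es)
    case (Cons p P)
    have "x [^] n \<in> K" for n :: nat by (induction n) (use x subringE(3,6)[OF K(1)] in auto)
    with Cons show ?case using subringE(6,7)[OF K(1)] by auto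
  qed (use subringE(2)[OF K(1)] in auto)
  have "set (\<one> # ds) \<subseteq> K" using cs(1) K subringE(3)[OF K(1)] unfolding ds by auto
  then have "y \<in> K" unfolding y_def
    using evK k_inv[OF sc(3) c0] K subringE(5,6)[OF K(1)] by blast
  moreover have "x \<otimes> y = \<one>"
  proof -
    define e where "e = eval (\<one> # ds) x"
    have e: "e \<in> carrier R" "e \<otimes> x = \<ominus> c" "inv c \<in> carrier R"
      using ec eq sc xc c0 k_inv[OF sc(3) c0] k_carrier unfolding e_def
      by (auto simp del: eval.simps intro!: minus_equality[symmetric])
    have "x \<otimes> y = \<ominus> (inv c) \<otimes> (e \<otimes> x)" unfolding y_def e_def[symmetric]
      using e(1,3) xc by (simp add: m_ac l_minus r_minus)
    also have "\<dots> = inv c \<otimes> c" unfolding e(2) using e(3) sc by (simp add: l_minus r_minus)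
    finally show ?thesis using sc c0 by (simp add: field_Units)
  qed
  ultimately show ?thesis using xc x K subringE(1)[OF K(1)]
    by (metis comm_inv_char subsetD)
qed

text \<open>If \<open>x\<close> is the only root, splitting off roots shows that the polynomial is a
  power of \<open>X - x\<close>. In characteristic zero \<open>x\<close> can be recovered from the
  second coefficient, which is how separability enters.\<close>

lemma single_root_coeff:
  assumes "set cs \<subseteq> carrier R" "cs \<noteq> []" "x \<in> carrier R"
    and "\<And>y. y \<in> carrier R \<Longrightarrow> eval (\<one> # cs) y = \<zero> \<Longrightarrow> y = x"
  shows "cs ! 0 = \<ominus> (\<guillemotleft>int (length cs)\<guillemotright> \<otimes> x)"
  using assms(1,2,4)
proof (induction "length cs" arbitrary: cs)
  case 0
  then show ?case by simp
next
  case (Suc n)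
  obtain y where "y \<in> carrier R" "eval (\<one> # cs) y = \<zero>" using monic_root Suc.prems by blast
  then have root: "eval (\<one> # cs) x = \<zero>" using Suc.prems by blast
  obtain ds where ds: "set ds \<subseteq> carrier R" "length cs = Suc (length ds)"
    "\<And>x'. x' \<in> carrier R \<Longrightarrow> eval (\<one> # cs) x' = (x' \<ominus> x) \<otimes> eval (\<one> # ds) x'"
    "ds \<noteq> [] \<Longrightarrow> ds ! 0 = x \<oplus> cs ! 0"
    using monic_root_divide[OF carrier_is_subring Suc.prems(1) assms(3) Suc.prems(2) root] by metis
  have c0: "cs ! 0 \<in> carrier R" using Suc.prems by (cases cs) auto
  show ?case
  proof (cases "ds = []")
    case True
    then obtain a where a: "cs = [a]" using ds(2) by (auto simp: length_Suc_conv)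
    have ac: "a \<in> carrier R" using Suc.prems a by auto
    have "x \<oplus> a = \<zero>" using root ac assms(3) unfolding a by simp
    then have "a = \<ominus> x" using ac assms(3) by (metis a_comm minus_equality)
    then show ?thesis using assms(3) unfolding a by simp
  next
    case False
    have "y = x" if y: "y \<in> carrier R" "eval (\<one> # ds) y = \<zero>" for y
      using ds(3)[OF y(1)] y assms(3) Suc.prems(3)[OF y(1)] by (simp del: eval.simps)
    then have "ds ! 0 = \<ominus> (\<guillemotleft>int (length ds)\<guillemotright> \<otimes> x)"
      using Suc.hyps ds False by auto
    then have "x \<oplus> cs ! 0 = \<ominus> (\<guillemotleft>int (length ds)\<guillemotright> \<otimes> x)" using ds(4) False by simp
    moreover have "cs ! 0 = \<ominus> x \<oplus> (x \<oplus> cs ! 0)"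
      using c0 assms(3) by (simp add: r_neg1)
    moreover have "\<guillemotleft>int (length cs)\<guillemotright> \<otimes> x = x \<oplus> \<guillemotleft>int (length ds)\<guillemotright> \<otimes> x"
      using ds(2) assms(3) by (simp add: l_distr)
    ultimately show ?thesis using assms(3) by (simp add: minus_add a_comm)
  qed
qed

text \<open>Partial homomorphisms over \<open>K\<close> are represented by their graphs.\<close>

definition partial_aut :: "'a set \<Rightarrow> ('a \<times> 'a) set \<Rightarrow> bool" where
  "partial_aut K \<Gamma> \<longleftrightarrow> subring \<Gamma> (RDirProd R R) \<and> (\<forall>a\<in>K. (a, a) \<in> \<Gamma>) \<and>
     (\<forall>b. (\<zero>, b) \<in> \<Gamma> \<longrightarrow> b = \<zero>)"

abbreviation "RR \<equiv> RDirProd R R"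

lemma RR_simps [simp]:
  "carrier RR = carrier R \<times> carrier R" "\<zero>\<^bsub>RR\<^esub> = (\<zero>, \<zero>)" "\<one>\<^bsub>RR\<^esub> = (\<one>, \<one>)"
  "p \<oplus>\<^bsub>RR\<^esub> q = (fst p \<oplus> fst q, snd p \<oplus> snd q)"
  "p \<otimes>\<^bsub>RR\<^esub> q = (fst p \<otimes> fst q, snd p \<otimes> snd q)"
  by (auto simp: RDirProd_def DirProd_def monoid.defs split: prod.splits)

lemma RR_cring: "cring RR"
proof -
  interpret RR: ring RR by (rule RDirProd_ring) (rule ring_axioms)+
  show ?thesis
  proof
    fix x y assume "x \<in> carrier RR" "y \<in> carrier RR"
    then show "x \<otimes>\<^bsub>RR\<^esub> y = y \<otimes>\<^bsub>RR\<^esub> x" by (auto simp: m_comm)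
  qed
qed

lemma RR_uminus: "p \<in> carrier RR \<Longrightarrow> \<ominus>\<^bsub>RR\<^esub> p = (\<ominus> fst p, \<ominus> snd p)"
proof -
  interpret RR: cring RR by (rule RR_cring)
  assume p: "p \<in> carrier RR"
  show ?thesis by (rule RR.minus_equality) (use p in \<open>auto simp: l_neg\<close>)
qed

lemma RR_pow: "p [^]\<^bsub>RR\<^esub> (n::nat) = (fst p [^] n, snd p [^] n)"
  by (induction n) (auto simp: nat_pow_def)

lemma RR_eval:
  "ring.eval RR cs p = (eval (map fst cs) (fst p), eval (map snd cs) (snd p))"
proof -
  interpret RR: cring RR by (rule RR_cring)
  show ?thesis by (induction cs) (auto simp: RR_pow)
qed

text \<open>The coefficients are pairs: the first components give a monic equation of least degree
  for \<open>w\<close> over the domain of \<open>\<Gamma>\<close>, the second its transport by the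
  partial map. Every root \<open>w'\<close> of the transported equation is an admissible image of
  \<open>w\<close>; leaving it free lets \<open>galois_moves\<close> choose one different from
  \<open>w\<close>.\<close>

lemma partial_aut_extend:
  assumes K: "k \<subseteq> K" and \<Gamma>: "partial_aut K \<Gamma>" and w: "w \<in> carrier R"
  shows "\<exists>cs. set cs \<subseteq> \<Gamma> \<and> cs \<noteq> [] \<and> (\<forall>w'\<in>carrier R. eval (\<one> # map snd cs) w' = \<zero> \<longrightarrow>
       (\<exists>\<Gamma>'. partial_aut K \<Gamma>' \<and> \<Gamma> \<subseteq> \<Gamma>' \<and> (w, w') \<in> \<Gamma>'))"
proof -
  interpret RR: cring RR by (rule RR_cring)
  have sub: "subring \<Gamma> RR" and diag: "\<And>a. a \<in> K \<Longrightarrow> (a, a) \<in> \<Gamma>"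
    and graph: "\<And>b. (\<zero>, b) \<in> \<Gamma> \<Longrightarrow> b = \<zero>"
    using \<Gamma> unfolding partial_aut_def by auto
  note \<Gamma>c = subringE(1)[OF sub]
  have fst_sub: "subring (fst ` \<Gamma>) R"
  proof (rule subringI)
    show "fst ` \<Gamma> \<subseteq> carrier R" using \<Gamma>c by auto
    show "\<one> \<in> fst ` \<Gamma>" using subringE(3)[OF sub] by (force simp: image_iff)
    show "\<ominus> h \<in> fst ` \<Gamma>" if h: "h \<in> fst ` \<Gamma>" for h
    proof -
      obtain g where g: "g \<in> \<Gamma>" "h = fst g" using h by blast
      then have "\<ominus>\<^bsub>RR\<^esub> g \<in> \<Gamma>" "\<ominus>\<^bsub>RR\<^esub> g = (\<ominus> fst g, \<ominus> snd g)"
        using subringE(5)[OF sub] RR_uminus \<Gamma>c by blast+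
      then show ?thesis using g by (metis fst_conv imageI)
    qed
    show "h1 \<otimes> h2 \<in> fst ` \<Gamma>" if "h1 \<in> fst ` \<Gamma>" "h2 \<in> fst ` \<Gamma>" for h1 h2
      using that subringE(6)[OF sub] by (force simp: image_iff)
    show "h1 \<oplus> h2 \<in> fst ` \<Gamma>" if "h1 \<in> fst ` \<Gamma>" "h2 \<in> fst ` \<Gamma>" for h1 h2
      using that subringE(7)[OF sub] by (force simp: image_iff)
  qed
  have kf: "k \<subseteq> fst ` \<Gamma>" using K diag by force
  define P where "P n \<longleftrightarrow> (\<exists>cs. set cs \<subseteq> \<Gamma> \<and> length cs = n \<and> eval (\<one> # map fst cs) w = \<zero>)" for n
  obtain es where es: "set es \<subseteq> k" "eval (\<one> # es) w = \<zero>"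
    using k_algebraic[OF w] unfolding integral_over_iff[OF k_subring w] by blast
  have "P (length es)" unfolding P_def
    using es K diag by (intro exI[of _ "map (\<lambda>a. (a, a)) es"]) (auto simp: comp_def)
  then have min: "P (LEAST n. P n)" "\<And>m. P m \<Longrightarrow> (LEAST n. P n) \<le> m" by (auto intro: LeastI_ex Least_le)
  define d where "d = (LEAST n. P n)"
  obtain cs where cs: "set cs \<subseteq> \<Gamma>" "length cs = d" "eval (\<one> # map fst cs) w = \<zero>"
    using min(1) unfolding P_def d_def by blast
  have ne: "cs \<noteq> []" using cs(3) by auto
  \<comment> \<open>By minimality of \<open>d\<close>, a relation for \<open>w\<close> with at most
    \<open>d\<close> coefficients is trivial: dividing by a nonzero leading coefficient, whose
    inverse lies in the domain, would give a monic equation of smaller degree.\<close>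
  have zeros: "\<forall>e\<in>set es. e = (\<zero>, \<zero>)"
    if "set es \<subseteq> \<Gamma>" "length es \<le> d" "eval (map fst es) w = \<zero>" for es
    using that
  proof (induction es)
    case (Cons e es)
    have ec: "e \<in> \<Gamma>" "fst e \<in> carrier R" "set (map fst es) \<subseteq> carrier R" using Cons.prems \<Gamma>c by auto
    have evc: "eval (map fst es) w \<in> carrier R" by (rule eval_in_carrier[OF ec(3) w])
    show ?case
    proof (cases "fst e = \<zero>")
      case True
      then have "e = (\<zero>, \<zero>)" using ec graph by (metis prod.collapse)
      moreover have "eval (map fst es) w = \<zero>" using Cons.prems True w evc by simp
      ultimately show ?thesis using Cons by auto
    next
      case False
      obtain c where c: "c \<in> \<Gamma>" "fst c = inv (fst e)"
        using subring_inverse[OF fst_sub kf, of "fst e"] ec(1) False by (metis imageE imageI)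
      have cc: "fst c \<in> carrier R" using c \<Gamma>c by auto
      define fs where "fs = map ((\<otimes>\<^bsub>RR\<^esub>) c) es"
      have fs: "map fst fs = map ((\<otimes>) (fst c)) (map fst es)" unfolding fs_def by simp
      have "eval (\<one> # map fst fs) w = fst c \<otimes> eval (map fst (e # es)) w"
        unfolding fs using eval_map_mult[OF ec(3) cc w] cc ec(2) evc w c(2) False
        by (simp add: r_distr m_assoc[symmetric] field_Units del: map_map)
      then have "eval (\<one> # map fst fs) w = \<zero>" using Cons.prems(3) cc by simp
      moreover have "set fs \<subseteq> \<Gamma>" unfolding fs_def using Cons.prems(1) c(1) subringE(6)[OF sub] by auto
      ultimately have "P (length fs)" unfolding P_def by blast
      then have "d \<le> length es" using min(2) unfolding d_def fs_def by auto
      then show ?thesis using Cons.prems(2) by simp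
    qed
  qed simp
  have "\<exists>\<Gamma>'. partial_aut K \<Gamma>' \<and> \<Gamma> \<subseteq> \<Gamma>' \<and> (w, w') \<in> \<Gamma>'"
    if w': "w' \<in> carrier R" "eval (\<one> # map snd cs) w' = \<zero>" for w'
  proof -
    let ?v = "(w, w')"
    have v: "?v \<in> carrier RR" using w w' by simp
    let ?B = "(\<lambda>i. ?v [^]\<^bsub>RR\<^esub> i) ` {..<d}"
    let ?C = "lin_span RR \<Gamma> ?B"
    have "RR.eval (\<one>\<^bsub>RR\<^esub> # cs) ?v = \<zero>\<^bsub>RR\<^esub>"
      using cs(3) w'(2) unfolding RR_eval by (simp del: eval.simps)
    moreover have ecs: "RR.eval cs ?v \<in> carrier RR"
      using cs(1) \<Gamma>c v by (intro RR.eval_in_carrier) auto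
    moreover have "RR.eval (\<one>\<^bsub>RR\<^esub> # cs) ?v = ?v [^]\<^bsub>RR\<^esub> d \<oplus>\<^bsub>RR\<^esub> RR.eval cs ?v"
      using v cs(2) by (simp add: RR_pow del: RR_simps(3)) (simp add: RR_pow)
    ultimately have "?v [^]\<^bsub>RR\<^esub> d = \<ominus>\<^bsub>RR\<^esub> RR.eval cs ?v"
      using v RR.minus_equality[symmetric] by (metis RR.nat_pow_closed)
    moreover have "RR.eval cs ?v \<in> ?C"
      unfolding RR.lin_span_powers_eval[OF sub v] using cs by blast
    moreover have "?B \<subseteq> carrier RR" using v by (auto simp: RR_pow)
    ultimately have n: "?v [^]\<^bsub>RR\<^esub> d \<in> ?C" using RR.lin_span_uminus[OF sub] by metis
    note * = RR.lin_span_powers_subring[OF sub v n]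
    \<comment> \<open>An element of the new graph above \<open>\<zero>\<close> is a relation for
      \<open>w\<close> with \<open>d\<close> coefficients. They all vanish, hence so does the second
      component: the graph remains single valued.\<close>
    have "b = \<zero>" if b: "(\<zero>, b) \<in> ?C" for b
    proof -
      obtain es where es: "set es \<subseteq> \<Gamma>" "length es = d" "(\<zero>, b) = RR.eval es ?v"
        using b unfolding RR.lin_span_powers_eval[OF sub v] by blast
      then have "eval (map fst es) w = \<zero>" "b = eval (map snd es) w'" unfolding RR_eval by auto
      moreover from this have "\<forall>e\<in>set es. e = (\<zero>, \<zero>)" using zeros es by auto
      then have "eval (map snd es) w' = \<zero>"
        by (induction es) (use w' in auto)
      ultimately show ?thesis by simp
    qed
    moreover have "?v \<in> ?C" using *(1)[of 1] v by (metis RR.nat_pow_eone)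
    ultimately show ?thesis using *(2,3) diag unfolding partial_aut_def by blast
  qed
  with cs(1) ne show ?thesis by blast
qed

text \<open>Zorn's lemma on graphs ordered by inclusion. A maximal one is total, because the
  transported equation of any missing element has a root.\<close>

lemma partial_aut_total:
  assumes K: "k \<subseteq> K" and \<Gamma>0: "partial_aut K \<Gamma>0"
  obtains \<Gamma> where "partial_aut K \<Gamma>" "\<Gamma>0 \<subseteq> \<Gamma>" "fst ` \<Gamma> = carrier R"
proof -
  interpret RR: cring RR by (rule RR_cring)
  let ?A = "{\<Gamma>. partial_aut K \<Gamma> \<and> \<Gamma>0 \<subseteq> \<Gamma>}"
  have "\<exists>M\<in>?A. \<forall>Y\<in>?A. M \<subseteq> Y \<longrightarrow> Y = M"
  proof (rule subset_Zorn_nonempty)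
    show "?A \<noteq> {}" using \<Gamma>0 by blast
    fix C assume C: "C \<noteq> {}" "subset.chain ?A C"
    then have CA: "\<And>Y. Y \<in> C \<Longrightarrow> partial_aut K Y" "\<And>Y. Y \<in> C \<Longrightarrow> \<Gamma>0 \<subseteq> Y"
      and lin: "\<And>Y Z. Y \<in> C \<Longrightarrow> Z \<in> C \<Longrightarrow> Y \<subseteq> Z \<or> Z \<subseteq> Y"
      unfolding subset_chain_def by auto
    have sub: "\<And>Y. Y \<in> C \<Longrightarrow> subring Y RR" using CA unfolding partial_aut_def by auto
    have common: "\<exists>Z\<in>C. x \<in> Z \<and> y \<in> Z" if "x \<in> \<Union>C" "y \<in> \<Union>C" for x y
      using that lin by blast
    have "subring (\<Union>C) RR"
    proof (rule RR.subringI)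
      show "\<Union>C \<subseteq> carrier RR" using sub subringE(1) by (meson Union_least)
      show "\<one>\<^bsub>RR\<^esub> \<in> \<Union>C" using C(1) sub subringE(3) by (metis UnionI ex_in_conv)
      show "\<ominus>\<^bsub>RR\<^esub> h \<in> \<Union>C" if "h \<in> \<Union>C" for h
        using that sub subringE(5) by (meson UnionE UnionI)
      show "h1 \<otimes>\<^bsub>RR\<^esub> h2 \<in> \<Union>C" if "h1 \<in> \<Union>C" "h2 \<in> \<Union>C" for h1 h2
        using common[OF that] sub subringE(6) by (meson UnionI)
      show "h1 \<oplus>\<^bsub>RR\<^esub> h2 \<in> \<Union>C" if "h1 \<in> \<Union>C" "h2 \<in> \<Union>C" for h1 h2
        using common[OF that] sub subringE(7) by (meson UnionI)
    qed
    then show "\<Union>C \<in> ?A" using C(1) CA unfolding partial_aut_def by blast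
  qed
  then obtain \<Gamma> where \<Gamma>A: "\<Gamma> \<in> ?A" and max': "\<forall>Y\<in>?A. \<Gamma> \<subseteq> Y \<longrightarrow> Y = \<Gamma>" by (rule bexE)
  then have \<Gamma>: "partial_aut K \<Gamma>" "\<Gamma>0 \<subseteq> \<Gamma>" by auto
  have max: "Y = \<Gamma>" if "partial_aut K Y" "\<Gamma> \<subseteq> Y" for Y
    using max' that \<Gamma>(2) by auto
  have \<Gamma>c: "\<Gamma> \<subseteq> carrier RR" using \<Gamma>(1) subringE(1) unfolding partial_aut_def by blast
  have "w \<in> fst ` \<Gamma>" if w: "w \<in> carrier R" for w
  proof -
    from partial_aut_extend[OF K \<Gamma>(1) w] obtain cs where
      cs: "set cs \<subseteq> \<Gamma> \<and> cs \<noteq> [] \<and> (\<forall>w'\<in>carrier R. eval (\<one> # map snd cs) w' = \<zero> \<longrightarrow>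
       (\<exists>\<Gamma>'. partial_aut K \<Gamma>' \<and> \<Gamma> \<subseteq> \<Gamma>' \<and> (w, w') \<in> \<Gamma>'))" ..
    have "set (map snd cs) \<subseteq> carrier R" using cs \<Gamma>c by auto
    then obtain w' where "w' \<in> carrier R" "eval (\<one> # map snd cs) w' = \<zero>"
      using monic_root cs by (metis map_is_Nil_conv)
    then obtain \<Gamma>' where "partial_aut K \<Gamma>'" "\<Gamma> \<subseteq> \<Gamma>'" "(w, w') \<in> \<Gamma>'" using cs by blast
    then have "(w, w') \<in> \<Gamma>" using max by blast
    then show ?thesis by (metis fst_conv imageI)
  qed
  moreover have "fst ` \<Gamma> \<subseteq> carrier R" using \<Gamma>c by auto
  ultimately show ?thesis using that \<Gamma> by blast
qed

text \<open>Injectivity is automatic for fields. For surjectivity, the map sends the finite root set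
  of a monic polynomial over \<open>k\<close> injectively into itself, hence onto it, and every
  element is such a root.\<close>

lemma endomorphism_in_galois_group:
  assumes hom: "\<phi> \<in> ring_hom R R" and ext: "\<phi> \<in> extensional (carrier R)"
    and K: "k \<subseteq> K" "K \<subseteq> carrier R" and fix_K: "\<And>x. x \<in> K \<Longrightarrow> \<phi> x = x"
  shows "\<phi> \<in> carrier (galois_group R K)"
proof -
  interpret \<phi>: ring_hom_ring R R \<phi> using hom by (intro ring_hom_ringI2) (rule ring_axioms)+
  have inj: "inj_on \<phi> (carrier R)"
  proof (rule \<phi>.trivial_ker_imp_inj)
    have "x = \<zero>" if "x \<in> carrier R" "\<phi> x = \<zero>" for x
    proof (rule ccontr)
      assume "x \<noteq> \<zero>"
      then have "\<phi> x \<otimes> \<phi> (inv x) = \<one>" using that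
        by (metis \<phi>.hom_mult \<phi>.hom_one inv_closed r_inv)
      then show False using that \<open>x \<noteq> \<zero>\<close> by simp
    qed
    then show "a_kernel R R \<phi> = {\<zero>}" unfolding a_kernel_def' by auto
  qed
  have "y \<in> \<phi> ` carrier R" if y: "y \<in> carrier R" for y
  proof -
    obtain es where es: "set es \<subseteq> k" "eval (\<one> # es) y = \<zero>"
      using k_algebraic[OF y] unfolding integral_over_iff[OF k_subring y] by blast
    let ?Z = "{x \<in> carrier R. eval (\<one> # es) x = \<zero>}"
    have esc: "set (\<one> # es) \<subseteq> carrier R" using es k_carrier by auto
    have fin: "finite ?Z" using finite_monic_roots esc by auto
    have "\<phi> x \<in> ?Z" if x: "x \<in> ?Z" for x
    proof -
      have "map \<phi> (\<one> # es) = \<one> # es" using fix_K es K by (auto intro!: map_idI)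
      then show ?thesis using \<phi>.eval_hom'[of x "\<one> # es"] x esc
        by (simp del: eval.simps list.map)
    qed
    then have "\<phi> ` ?Z \<subseteq> ?Z" by blast
    moreover have "inj_on \<phi> ?Z" using inj by (rule inj_on_subset) auto
    ultimately have "\<phi> ` ?Z = ?Z" using fin by (simp add: endo_inj_surj)
    then show ?thesis using y es(2) by blast
  qed
  then have "bij_betw \<phi> (carrier R) (carrier R)" using inj unfolding bij_betw_def by auto
  then show ?thesis
    using hom fix_K ext unfolding galois_group_def ring_iso_def Let_def by simp
qed

lemma total_aut:
  assumes K: "k \<subseteq> K" "K \<subseteq> carrier R" and \<Gamma>: "partial_aut K \<Gamma>" "fst ` \<Gamma> = carrier R"
  obtains \<sigma> where "\<sigma> \<in> carrier (galois_group R K)" "\<And>x y. (x, y) \<in> \<Gamma> \<Longrightarrow> \<sigma> x = y"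
proof -
  interpret RR: cring RR by (rule RR_cring)
  have sub: "subring \<Gamma> RR" and diag: "\<And>a. a \<in> K \<Longrightarrow> (a, a) \<in> \<Gamma>"
    and graph: "\<And>b. (\<zero>, b) \<in> \<Gamma> \<Longrightarrow> b = \<zero>"
    using \<Gamma> unfolding partial_aut_def by auto
  note \<Gamma>c = subringE(1)[OF sub]
  have uniq: "y = z" if "(x, y) \<in> \<Gamma>" "(x, z) \<in> \<Gamma>" for x y z
  proof -
    have c: "x \<in> carrier R" "y \<in> carrier R" "z \<in> carrier R" using that \<Gamma>c by auto
    have "(x, y) \<oplus>\<^bsub>RR\<^esub> \<ominus>\<^bsub>RR\<^esub> (x, z) \<in> \<Gamma>" using that subringE(5,7)[OF sub] by blast
    then have "(\<zero>, y \<ominus> z) \<in> \<Gamma>" using c by (simp add: RR_uminus r_neg a_minus_def)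
    then have "y \<ominus> z = \<zero>" using graph by blast
    then show ?thesis using c by simp
  qed
  define \<sigma> where "\<sigma> = (\<lambda>x\<in>carrier R. THE y. (x, y) \<in> \<Gamma>)"
  have \<sigma>I: "\<sigma> x = y" if "(x, y) \<in> \<Gamma>" for x y
    using that uniq \<Gamma>c unfolding \<sigma>_def by (auto intro: the_equality)
  have \<sigma>: "(x, \<sigma> x) \<in> \<Gamma>" if "x \<in> carrier R" for x
    using that \<Gamma>(2) \<sigma>I by (metis imageE prod.collapse)
  have hom: "\<sigma> \<in> ring_hom R R"
  proof (rule ring_hom_memI)
    fix x y assume x: "x \<in> carrier R" and y: "y \<in> carrier R"
    show "\<sigma> x \<in> carrier R" using \<sigma>[OF x] \<Gamma>c by auto
    show "\<sigma> (x \<otimes> y) = \<sigma> x \<otimes> \<sigma> y" using subringE(6)[OF sub \<sigma>[OF x] \<sigma>[OF y]] by (intro \<sigma>I) simp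
    show "\<sigma> (x \<oplus> y) = \<sigma> x \<oplus> \<sigma> y" using subringE(7)[OF sub \<sigma>[OF x] \<sigma>[OF y]] by (intro \<sigma>I) simp
  next
    show "\<sigma> \<one> = \<one>" using subringE(3)[OF sub] by (intro \<sigma>I) simp
  qed
  have fix_K: "\<sigma> x = x" if "x \<in> K" for x using diag[OF that] \<sigma>I by blast
  have "\<sigma> \<in> carrier (galois_group R K)"
    by (rule endomorphism_in_galois_group[OF hom _ K fix_K]) (unfold \<sigma>_def, rule restrict_extensional)
  then show ?thesis using that \<sigma>I by blast
qed

text \<open>The form of the Galois correspondence behind all later membership arguments. Starting
  from the diagonal of \<open>K\<close>, a minimal equation of \<open>x\<close> over
  \<open>K\<close> has a root other than \<open>x\<close>; otherwise its second coefficient,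
  \<open>x\<close> times a nonzero integer up to sign, would put \<open>x\<close> into
  \<open>K\<close>. The map sending \<open>x\<close> to the other root extends to an
  automorphism.\<close>

theorem galois_moves:
  assumes K: "subring K R" "k \<subseteq> K" and x: "x \<in> carrier R" "x \<notin> K"
  shows "\<exists>\<sigma>\<in>carrier (galois_group R K). \<sigma> x \<noteq> x"
proof -
  interpret RR: cring RR by (rule RR_cring)
  let ?D = "(\<lambda>a. (a, a)) ` K"
  note Kc = subringE(1)[OF K(1)]
  have "subring ?D RR"
  proof (rule RR.subringI)
    show "?D \<subseteq> carrier RR" using Kc by auto
    show "\<one>\<^bsub>RR\<^esub> \<in> ?D" using subringE(3)[OF K(1)] by auto
    show "\<ominus>\<^bsub>RR\<^esub> h \<in> ?D" if "h \<in> ?D" for h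
      using that subringE(5)[OF K(1)] Kc by (auto simp: RR_uminus subset_iff)
    show "h1 \<otimes>\<^bsub>RR\<^esub> h2 \<in> ?D" if "h1 \<in> ?D" "h2 \<in> ?D" for h1 h2
      using that subringE(6)[OF K(1)] by auto
    show "h1 \<oplus>\<^bsub>RR\<^esub> h2 \<in> ?D" if "h1 \<in> ?D" "h2 \<in> ?D" for h1 h2
      using that subringE(7)[OF K(1)] by auto
  qed
  then have D: "partial_aut K ?D" unfolding partial_aut_def by blast
  from partial_aut_extend[OF K(2) D x(1)] obtain cs where
    cs: "set cs \<subseteq> ?D \<and> cs \<noteq> [] \<and> (\<forall>w'\<in>carrier R. eval (\<one> # map snd cs) w' = \<zero> \<longrightarrow>
       (\<exists>\<Gamma>'. partial_aut K \<Gamma>' \<and> ?D \<subseteq> \<Gamma>' \<and> (x, w') \<in> \<Gamma>'))" ..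
  let ?es = "map snd cs"
  have es: "set ?es \<subseteq> K" "?es \<noteq> []" using cs by auto
  have "\<exists>y\<in>carrier R. eval (\<one> # ?es) y = \<zero> \<and> y \<noteq> x"
  proof (rule ccontr)
    assume *: "\<not> ?thesis"
    have "?es ! 0 = \<ominus> (\<guillemotleft>int (length ?es)\<guillemotright> \<otimes> x)"
    proof (rule single_root_coeff)
      show "set ?es \<subseteq> carrier R" using es(1) Kc by blast
      show "y = x" if "y \<in> carrier R" "eval (\<one> # ?es) y = \<zero>" for y using * that by blast
    qed (use es x in auto)
    moreover have "?es ! 0 \<in> K" using es by (metis length_greater_0_conv nth_mem subsetD)
    ultimately have "\<ominus> (\<guillemotleft>int (length ?es)\<guillemotright> \<otimes> x) \<in> K" by simp
    then have nx: "\<guillemotleft>int (length ?es)\<guillemotright> \<otimes> x \<in> K"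
      using subringE(5)[OF K(1)] x(1) by (metis minus_minus m_closed of_int_closed)
    have "\<guillemotleft>int n\<guillemotright> \<in> K" for n
      using subringE(2,3,7)[OF K(1)] by (induction n) auto
    moreover have n0: "\<guillemotleft>int (length ?es)\<guillemotright> \<noteq> \<zero>" using char_zero es(2) by fastforce
    ultimately have "inv \<guillemotleft>int (length ?es)\<guillemotright> \<in> K" using subring_inverse[OF K] by blast
    then have "inv \<guillemotleft>int (length ?es)\<guillemotright> \<otimes> (\<guillemotleft>int (length ?es)\<guillemotright> \<otimes> x) \<in> K"
      using nx subringE(6)[OF K(1)] by blast
    then have "x \<in> K" using x(1) n0 by (simp add: m_assoc[symmetric])
    then show False using x(2) by simp
  qed
  then obtain y where y: "y \<in> carrier R" "eval (\<one> # ?es) y = \<zero>" "y \<noteq> x" by blast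
  then obtain \<Gamma>' where \<Gamma>': "partial_aut K \<Gamma>'" "(x, y) \<in> \<Gamma>'" using cs by blast
  obtain \<Gamma> where "partial_aut K \<Gamma>" "\<Gamma>' \<subseteq> \<Gamma>" "fst ` \<Gamma> = carrier R"
    using partial_aut_total[OF K(2) \<Gamma>'(1)] by blast
  then obtain \<sigma> where "\<sigma> \<in> carrier (galois_group R K)" "\<sigma> x = y"
    using total_aut[OF K(2) Kc] \<Gamma>'(2) by (metis subsetD)
  then show ?thesis using y(3) by blast
qed

end

section \<open>Integers in an algebraic closure of a local field\<close>

text \<open>The binomial theorem with \<open>l\<close> taken out of the inner coefficients. The
  error term \<open>w\<close> is kept in the subring \<open>M\<close>, so that the congruence can be
  used among the integers.\<close>

lemma (in cring) add_pow_prime: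
  assumes M: "subring M R" and a: "a \<in> M" and b: "b \<in> M" and l: "prime (l::nat)"
  shows "\<exists>w\<in>M. (a \<oplus> b) [^] l = a [^] l \<oplus> b [^] l \<oplus> \<guillemotleft>int l\<guillemotright> \<otimes> w"
proof -
  have ac: "a \<in> carrier R" and bc: "b \<in> carrier R" using M a b subringE(1) by blast+
  define f where "f n i = \<guillemotleft>int (n choose i)\<guillemotright> \<otimes> (a [^] i \<otimes> b [^] (n - i))" for n i :: nat
  have fc: "f n i \<in> carrier R" for n i using ac bc unfolding f_def by simp
  have binomial: "(a \<oplus> b) [^] n = finsum R (f n) {..n}" for n
  proof (induction n)
    case 0
    then show ?case unfolding f_def by simp
  next
    case (Suc n)
    define g where "g i = \<guillemotleft>int (n choose i)\<guillemotright> \<otimes> (a [^] i \<otimes> b [^] (Suc n - i))" for i :: nat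
    have gc: "g i \<in> carrier R" for i using ac bc unfolding g_def by simp
    have step: "f (Suc n) (Suc i) = a \<otimes> f n i \<oplus> g (Suc i)" for i
    proof -
      define C D u v where "C = \<guillemotleft>int (n choose i)\<guillemotright>" "D = \<guillemotleft>int (n choose Suc i)\<guillemotright>"
        "u = a [^] i" "v = b [^] (n - i)"
      have c: "C \<in> carrier R" "D \<in> carrier R" "u \<in> carrier R" "v \<in> carrier R"
        using ac bc unfolding C_D_u_v_def by auto
      have "(C \<oplus> D) \<otimes> (u \<otimes> a \<otimes> v) = a \<otimes> (C \<otimes> (u \<otimes> v)) \<oplus> D \<otimes> (u \<otimes> a \<otimes> v)"
        using c ac by algebra
      then show ?thesis unfolding f_def g_def C_D_u_v_def using ac by simp
    qed
    have bg: "g i = b \<otimes> f n i" if "i \<le> n" for i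
      using that ac bc unfolding f_def g_def by (simp add: Suc_diff_le m_ac)
    have "g (Suc n) = \<zero>" using ac bc unfolding g_def by (simp add: binomial_eq_0)
    then have gS: "finsum R g {..Suc n} = finsum R g {..n}" using gc by simp
    have "finsum R (f (Suc n)) {..Suc n} = finsum R (\<lambda>i. f (Suc n) (Suc i)) {..n} \<oplus> f (Suc n) 0"
      using fc by (intro finsum_Suc2) auto
    also have "f (Suc n) 0 = g 0" using ac bc unfolding f_def g_def by simp
    also have "finsum R (\<lambda>i. f (Suc n) (Suc i)) {..n} =
        finsum R (\<lambda>i. a \<otimes> f n i) {..n} \<oplus> finsum R (\<lambda>i. g (Suc i)) {..n}"
      unfolding step using ac fc gc by (intro finsum_addf) auto
    also have "finsum R (\<lambda>i. a \<otimes> f n i) {..n} = a \<otimes> finsum R (f n) {..n}"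
      using fc ac by (intro finsum_rdistr[symmetric]) auto
    also have "a \<otimes> finsum R (f n) {..n} \<oplus> finsum R (\<lambda>i. g (Suc i)) {..n} \<oplus> g 0 =
        a \<otimes> finsum R (f n) {..n} \<oplus> (finsum R (\<lambda>i. g (Suc i)) {..n} \<oplus> g 0)"
      using fc gc ac by (intro a_assoc) auto
    also have "finsum R (\<lambda>i. g (Suc i)) {..n} \<oplus> g 0 = finsum R g {..Suc n}"
      using gc by (intro finsum_Suc2[symmetric]) auto
    also note gS
    also have "finsum R g {..n} = finsum R (\<lambda>i. b \<otimes> f n i) {..n}"
      using bg bc fc by (intro finsum_cong') auto
    also have "\<dots> = b \<otimes> finsum R (f n) {..n}"
      using fc bc by (intro finsum_rdistr[symmetric]) auto
    finally show ?case using Suc.IH ac bc fc by (simp add: l_distr m_comm)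
  qed
  have Mpow: "x [^] (n::nat) \<in> M" if "x \<in> M" for x n
    using that by (induction n) (auto intro: subringE(3,6)[OF M])
  have intM: "\<guillemotleft>int n\<guillemotright> \<in> M" for n by (induction n) (use subringE(2,3,7)[OF M] in auto)
  define T where "T = {\<guillemotleft>int l\<guillemotright> \<otimes> w | w. w \<in> M}"
  have Tadd: "x \<oplus> y \<in> T" if xy: "x \<in> T" "y \<in> T" for x y
  proof -
    obtain u v where uv: "u \<in> M" "v \<in> M" "x = \<guillemotleft>int l\<guillemotright> \<otimes> u" "y = \<guillemotleft>int l\<guillemotright> \<otimes> v"
      using xy unfolding T_def by blast
    then have "x \<oplus> y = \<guillemotleft>int l\<guillemotright> \<otimes> (u \<oplus> v)"
      using subringE(1)[OF M] by (simp add: r_distr subset_iff)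
    then show ?thesis using uv subringE(7)[OF M] unfolding T_def by blast
  qed
  have T0: "\<zero> \<in> T" unfolding T_def using subringE(2)[OF M] by force
  have Tsum: "finsum R (f l) S \<in> T" if "finite S" "\<And>i. i \<in> S \<Longrightarrow> f l i \<in> T" for S
    using that by (induction S rule: finite_induct) (auto simp: T0 Tadd fc)
  have mid: "f l i \<in> T" if "0 < i" "i < l" for i
  proof -
    have "l dvd (l choose i)" using that l by (intro dvd_choose_prime) auto
    then obtain q where q: "l choose i = l * q" by blast
    have c: "a [^] i \<otimes> b [^] (l - i) \<in> M" using Mpow a b subringE(6)[OF M] by blast
    then have "f l i = \<guillemotleft>int l\<guillemotright> \<otimes> (\<guillemotleft>int q\<guillemotright> \<otimes> (a [^] i \<otimes> b [^] (l - i)))"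
      unfolding f_def q using ac bc by (simp add: m_assoc)
    then show ?thesis unfolding T_def using c intM subringE(6)[OF M] by blast
  qed
  obtain n where n: "l = Suc (Suc n)"
    using prime_ge_2_nat[OF l] by (metis add_2_eq_Suc le_Suc_ex)
  have "finsum R (f l) {0<..<l} \<in> T" by (intro Tsum mid) auto
  then obtain w where w: "w \<in> M" "finsum R (f l) {0<..<l} = \<guillemotleft>int l\<guillemotright> \<otimes> w" unfolding T_def by blast
  have "{..l} = insert 0 (insert l {0<..<l})" using n by auto
  then have "finsum R (f l) {..l} = f l 0 \<oplus> (f l l \<oplus> finsum R (f l) {0<..<l})"
    using n fc by (simp del: finsum_Suc)
  also have "f l 0 = b [^] l" using bc unfolding f_def by simp
  also have "f l l = a [^] l" using ac unfolding f_def by simp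
  finally have "(a \<oplus> b) [^] l = b [^] l \<oplus> (a [^] l \<oplus> \<guillemotleft>int l\<guillemotright> \<otimes> w)"
    using binomial[of l] w(2) by simp
  moreover have "w \<in> carrier R" using w(1) subringE(1)[OF M] by blast
  ultimately have "(a \<oplus> b) [^] l = a [^] l \<oplus> b [^] l \<oplus> \<guillemotleft>int l\<guillemotright> \<otimes> w"
    using ac bc by (simp add: a_ac)
  then show ?thesis using w(1) by blast
qed

text \<open>What the arguments use about Z_l (here \<open>A\<close>) in Q_l (here \<open>k\<close>):
  residues represented by the integers below \<open>l\<close>, every nonzero element a power of
  \<open>l\<close> times a unit, denominators that are powers of \<open>l\<close>, \<open>l\<close>
  itself not a unit, and limits for sequences whose successive terms agree modulo
  \<open>l [^] n\<close>. Neither a topology nor a valuation appears.\<close>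

locale padic_closure = closed_field R k for R :: "'a ring" (structure) and k +
  fixes A :: "'a set" and l :: nat
  assumes prime_l: "prime l"
    and A_subring: "subring A R" and A_k: "A \<subseteq> k"
    and residue: "a \<in> A \<Longrightarrow> \<exists>i\<in>{0..<int l}. \<exists>b\<in>A. a = \<guillemotleft>i\<guillemotright> \<oplus> \<guillemotleft>int l\<guillemotright> \<otimes> b"
    and uniformizer: "a \<in> A \<Longrightarrow> a \<noteq> \<zero> \<Longrightarrow>
      \<exists>n::nat. \<exists>u\<in>A. u \<noteq> \<zero> \<and> inv u \<in> A \<and> a = \<guillemotleft>int l\<guillemotright> [^] n \<otimes> u"
    and fraction: "a \<in> k \<Longrightarrow> \<exists>n::nat. \<guillemotleft>int l\<guillemotright> [^] n \<otimes> a \<in> A"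
    and inv_l: "inv \<guillemotleft>int l\<guillemotright> \<notin> A"
    and complete: "(\<And>n. s n \<in> A) \<Longrightarrow> (\<And>n. \<exists>b\<in>A. s (Suc n) = s n \<oplus> \<guillemotleft>int l\<guillemotright> [^] n \<otimes> b) \<Longrightarrow>
      \<exists>t\<in>A. \<forall>n. \<exists>b\<in>A. t = s n \<oplus> \<guillemotleft>int l\<guillemotright> [^] (n::nat) \<otimes> b"
begin

abbreviation pi ("\<varpi>") where "\<varpi> \<equiv> \<guillemotleft>int l\<guillemotright>"

definition ints :: "'a set" where "ints = {x. integral_over R A x}"

text \<open>That this set is an ideal, so that the integral closure is local, is only shown in
  \<open>nonunits_add\<close>.\<close>

definition nonunits :: "'a set" where
  "nonunits = {x \<in> ints. \<forall>y\<in>ints. x \<otimes> y \<noteq> \<one>}"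

lemma A_carrier: "A \<subseteq> carrier R"
  using A_subring by (rule subringE)

lemma A_c [simp]: "a \<in> A \<Longrightarrow> a \<in> carrier R"
  using A_carrier by auto

lemma pi_nonzero: "\<varpi> \<noteq> \<zero>"
  using char_zero[of "int l"] prime_gt_0_nat[OF prime_l] by auto

lemma pi_pow_nonzero: "\<varpi> [^] (n::nat) \<noteq> \<zero>"
  using pi_nonzero by simp

lemma nat_in_subring: assumes "subring B R" shows "\<guillemotleft>int n\<guillemotright> \<in> B"
  by (induction n) (use subringE(2,3,7)[OF assms] in auto)

lemma int_in_subring: assumes "subring B R" shows "\<guillemotleft>i\<guillemotright> \<in> B"
  by (cases i rule: int_cases2)
    (use nat_in_subring[OF assms] subringE(5)[OF assms] in auto)

lemma pow_in_subring: "subring B R \<Longrightarrow> x \<in> B \<Longrightarrow> x [^] (n::nat) \<in> B"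
  by (induction n) (use subringE(3,6) in auto)

text \<open>A term with the least exponent of \<open>l\<close> divides all others; zero is a
  multiple of anything.\<close>

lemma A_dvr_like: "dvr_like R A"
  unfolding dvr_like_def
proof (intro allI impI)
  fix c :: "nat \<Rightarrow> 'a" assume c: "\<forall>n. c n \<in> A"
  then have cc: "c n \<in> carrier R" for n by auto
  show "\<exists>m. \<forall>n. \<exists>q\<in>A. c n = q \<otimes> c m"
  proof (cases "\<exists>m. c m \<noteq> \<zero>")
    case True
    define P where "P e \<longleftrightarrow> (\<exists>m. \<exists>u\<in>A. u \<noteq> \<zero> \<and> inv u \<in> A \<and> c m = \<varpi> [^] (e::nat) \<otimes> u)" for e
    have "\<exists>e. P e" using True uniformizer c unfolding P_def by blast
    then have P: "P (LEAST e. P e)" "\<And>e. P e \<Longrightarrow> (LEAST e. P e) \<le> e"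
      by (auto intro: LeastI_ex Least_le)
    define e where "e = (LEAST e. P e)"
    obtain m u where m: "u \<in> A" "u \<noteq> \<zero>" "inv u \<in> A" "c m = \<varpi> [^] e \<otimes> u"
      using P(1) unfolding P_def e_def by blast
    have "\<exists>q\<in>A. c n = q \<otimes> c m" for n
    proof (cases "c n = \<zero>")
      case True
      then show ?thesis using cc subringE(2)[OF A_subring] by (intro bexI[of _ \<zero>]) auto
    next
      case False
      then obtain e' u' where n: "u' \<in> A" "u' \<noteq> \<zero>" "inv u' \<in> A" "c n = \<varpi> [^] (e'::nat) \<otimes> u'"
        using uniformizer c by blast
      then have "e \<le> e'" using P(2) unfolding P_def e_def by blast
      then have e': "\<varpi> [^] e' = \<varpi> [^] (e' - e) \<otimes> \<varpi> [^] e" by (simp add: nat_pow_mult)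
      define q where "q = \<varpi> [^] (e' - e) \<otimes> (u' \<otimes> inv u)"
      have "q \<in> A" unfolding q_def using m n A_subring
        by (intro subringE(6)[OF A_subring] pow_in_subring nat_in_subring) auto
      moreover have "c n = q \<otimes> c m"
      proof -
        have "q \<otimes> c m = \<varpi> [^] (e' - e) \<otimes> \<varpi> [^] e \<otimes> (u' \<otimes> (inv u \<otimes> u))"
          unfolding q_def m(4) using A_c[OF m(1)] A_c[OF m(3)] A_c[OF n(1)] by (simp add: m_ac)
        then show ?thesis unfolding n(4) e' using m n by simp
      qed
      ultimately show ?thesis by blast
    qed
    then show ?thesis by blast
  next
    case False
    then have "c n = \<zero> \<otimes> c 0" for n using cc by auto
    then show ?thesis using subringE(2)[OF A_subring] by blast
  qed
qed

lemma ints_subring: "subring ints R"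
proof (rule subringI)
  show "ints \<subseteq> carrier R" unfolding ints_def integral_over_def by blast
  show "\<one> \<in> ints" unfolding ints_def using integral_over_base[OF A_subring] subringE(3)[OF A_subring] by blast
qed (use integral_over_ring[OF A_subring A_dvr_like] ints_def in auto)

lemma ints_c [simp]: "x \<in> ints \<Longrightarrow> x \<in> carrier R"
  using subringE(1)[OF ints_subring] by auto

lemmas ints_zero = subringE(2)[OF ints_subring]
  and ints_one = subringE(3)[OF ints_subring]
  and ints_uminus = subringE(5)[OF ints_subring]
  and ints_mult = subringE(6)[OF ints_subring]
  and ints_add = subringE(7)[OF ints_subring]

lemma ints_minus: "x \<in> ints \<Longrightarrow> y \<in> ints \<Longrightarrow> x \<ominus> y \<in> ints"
  unfolding a_minus_def by (intro ints_add ints_uminus)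

lemma ints_pow: "x \<in> ints \<Longrightarrow> x [^] (n::nat) \<in> ints"
  by (rule pow_in_subring[OF ints_subring])

lemma A_ints: "A \<subseteq> ints"
  unfolding ints_def using integral_over_base[OF A_subring] by blast

lemma int_ints: "\<guillemotleft>i\<guillemotright> \<in> ints"
  by (rule int_in_subring[OF ints_subring])

lemma ints_monic_root:
  assumes "x \<in> carrier R" "set cs \<subseteq> ints" "eval (\<one> # cs) x = \<zero>"
  shows "x \<in> ints"
  using integral_over_trans[OF A_subring A_dvr_like assms(1) _ assms(3)] assms(2)
  unfolding ints_def by blast

text \<open>Clearing denominators in a monic equation for \<open>inv \<varpi>\<close> gives
  \<open>\<one> \<oplus> \<varpi> \<otimes> a = \<zero>\<close> with \<open>a\<close> in
  \<open>A\<close>, so that \<open>inv \<varpi>\<close> would already lie in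
  \<open>A\<close>.\<close>

lemma inv_pi_notin_ints: "inv \<varpi> \<notin> ints"
proof
  let ?w = "inv \<varpi>"
  have w: "?w \<in> carrier R" "\<varpi> \<otimes> ?w = \<one>" using pi_nonzero by auto
  assume "inv \<varpi> \<in> ints"
  then obtain cs where cs: "set cs \<subseteq> A" "eval (\<one> # cs) ?w = \<zero>"
    unfolding ints_def using integral_over_iff[OF A_subring w(1)] by blast
  have *: "\<exists>a\<in>A. \<varpi> [^] length cs \<otimes> eval cs ?w = \<varpi> \<otimes> a" if "set cs \<subseteq> A" for cs
    using that
  proof (induction cs)
    case Nil
    then show ?case using subringE(2)[OF A_subring] by (intro bexI[of _ \<zero>]) auto
  next
    case (Cons c cs)
    then obtain a where a: "a \<in> A" "\<varpi> [^] length cs \<otimes> eval cs ?w = \<varpi> \<otimes> a" by auto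
    define e P W where "e = eval cs ?w" "P = \<varpi> [^] length cs" "W = ?w [^] length cs"
    have m: "e \<in> carrier R" "P \<in> carrier R" "W \<in> carrier R" "c \<in> carrier R" "a \<in> carrier R"
      using Cons.prems a w unfolding e_P_W_def by (auto intro!: eval_in_carrier)
    have PW: "P \<otimes> W = \<one>" unfolding e_P_W_def using w by (simp add: nat_pow_distrib[symmetric])
    have "\<varpi> [^] length (c # cs) \<otimes> eval (c # cs) ?w = \<varpi> \<otimes> P \<otimes> (c \<otimes> W \<oplus> e)"
      unfolding e_P_W_def by (simp add: m_comm)
    also have "\<dots> = \<varpi> \<otimes> (c \<otimes> (P \<otimes> W) \<oplus> P \<otimes> e)"
      using m by (simp add: r_distr m_ac)
    also have "P \<otimes> e = \<varpi> \<otimes> a" using a unfolding e_P_W_def by simp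
    finally show ?case using PW m(4) a(1) Cons.prems
      subringE(6,7)[OF A_subring] nat_in_subring[OF A_subring, of l] by auto
  qed
  obtain a where a: "a \<in> A" "\<varpi> [^] length cs \<otimes> eval cs ?w = \<varpi> \<otimes> a" using *[OF cs(1)] by blast
  have ec: "eval cs ?w \<in> carrier R" using cs(1) w(1) by (intro eval_in_carrier) auto
  have "\<varpi> [^] length cs \<otimes> eval (\<one> # cs) ?w = \<one> \<oplus> \<varpi> \<otimes> a"
    using w ec a(2) by (simp add: r_distr nat_pow_distrib[symmetric])
  then have "\<one> \<oplus> \<varpi> \<otimes> a = \<zero>" using cs(2) by simp
  then have "\<varpi> \<otimes> (\<ominus> a) = \<one>" using a(1)
    by (metis A_c m_closed minus_equality of_int_closed one_closed r_minus)
  then have "?w = \<ominus> a" using a(1) pi_nonzero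
    by (metis A_c a_inv_closed comm_inv_char of_int_closed)
  then show False using inv_l a(1) subringE(5)[OF A_subring] by metis
qed

lemma pi_not_unit: "y \<in> ints \<Longrightarrow> \<varpi> \<otimes> y \<noteq> \<one>"
  using inv_pi_notin_ints by (metis comm_inv_char ints_c of_int_closed)

text \<open>\<open>A\<close> is integrally closed in \<open>k\<close>: writing \<open>x\<close> as a
  unit times a power of \<open>l\<close>, a negative exponent would make \<open>l\<close> invertible
  among the integers.\<close>

lemma k_ints: assumes "x \<in> k" "x \<in> ints" shows "x \<in> A"
proof (rule ccontr)
  assume "x \<notin> A"
  then have x0: "x \<noteq> \<zero>" using subringE(2)[OF A_subring] by blast
  have xc: "x \<in> carrier R" using assms by simp
  obtain n :: nat where n: "\<varpi> [^] n \<otimes> x \<in> A" using fraction assms by blast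
  have "\<varpi> [^] n \<otimes> x \<noteq> \<zero>" using x0 xc pi_pow_nonzero integral[of "\<varpi> [^] n" x] by auto
  then obtain e u where u: "u \<in> A" "u \<noteq> \<zero>" "inv u \<in> A" "\<varpi> [^] n \<otimes> x = \<varpi> [^] (e::nat) \<otimes> u"
    using uniformizer n by blast
  have uc: "u \<in> carrier R" "inv u \<in> carrier R" using u by auto
  show False
  proof (cases "n \<le> e")
    case True
    then have "\<varpi> [^] n \<otimes> x = \<varpi> [^] n \<otimes> (\<varpi> [^] (e - n) \<otimes> u)"
      using u(4) uc by (simp add: m_assoc[symmetric] nat_pow_mult)
    then have "x = \<varpi> [^] (e - n) \<otimes> u"
      using m_lcancel[of "\<varpi> [^] n" x "\<varpi> [^] (e - n) \<otimes> u"] xc uc pi_pow_nonzero by auto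
    then have "x \<in> A" using u(1) pow_in_subring[OF A_subring nat_in_subring[OF A_subring]]
        subringE(6)[OF A_subring] by simp
    then show False using \<open>x \<notin> A\<close> by simp
  next
    case False
    then obtain d where d: "n = e + Suc d" by (metis add_Suc_right less_imp_Suc_add not_le)
    have "\<varpi> [^] e \<otimes> (\<varpi> [^] Suc d \<otimes> x) = \<varpi> [^] e \<otimes> u"
      using u(4) xc unfolding d by (simp only: nat_pow_mult[symmetric] m_assoc nat_pow_closed of_int_closed)
    then have "\<varpi> [^] Suc d \<otimes> x = u"
      using m_lcancel[of "\<varpi> [^] e" "\<varpi> [^] Suc d \<otimes> x" u] xc uc pi_pow_nonzero by auto
    moreover have "\<varpi> \<otimes> (\<varpi> [^] d \<otimes> x \<otimes> inv u) = \<varpi> [^] Suc d \<otimes> x \<otimes> inv u"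
      using xc uc by (simp add: m_ac)
    ultimately have "\<varpi> \<otimes> (\<varpi> [^] d \<otimes> x \<otimes> inv u) = \<one>" using u by simp
    moreover have "\<varpi> [^] d \<otimes> x \<otimes> inv u \<in> ints"
      using assms u(3) A_ints ints_mult ints_pow int_ints by (meson subsetD)
    ultimately show False using pi_not_unit by blast
  qed
qed

text \<open>Scaling a root by \<open>\<varpi> [^] s\<close> multiplies the \<open>i\<close>-th
  coefficient after the leading one by the \<open>i\<close>-th power of that factor; for large
  \<open>s\<close> all coefficients become integral while the equation stays monic.\<close>

lemma clear_denominator:
  assumes x: "x \<in> carrier R"
  shows "\<exists>s::nat. \<varpi> [^] s \<otimes> x \<in> ints"
proof -
  obtain cs where cs: "set cs \<subseteq> k" "eval (\<one> # cs) x = \<zero>"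
    using k_algebraic[OF x] unfolding integral_over_iff[OF k_subring x] by blast
  have mono: "\<varpi> [^] (s + t) \<otimes> c \<in> A" if "\<varpi> [^] s \<otimes> c \<in> A" "c \<in> carrier R" for s t :: nat and c
  proof -
    have "\<varpi> [^] t \<otimes> (\<varpi> [^] s \<otimes> c) \<in> A"
      using that pow_in_subring[OF A_subring nat_in_subring[OF A_subring]] subringE(6)[OF A_subring] by blast
    then show ?thesis using that(2) by (simp add: m_assoc[symmetric] nat_pow_mult add.commute)
  qed
  have "\<exists>s::nat. \<forall>c\<in>set cs. \<varpi> [^] s \<otimes> c \<in> A" using cs(1)
  proof (induction cs)
    case (Cons c cs)
    then obtain s t :: nat where "\<forall>c\<in>set cs. \<varpi> [^] s \<otimes> c \<in> A" "\<varpi> [^] t \<otimes> c \<in> A"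
      using fraction by (metis insert_subset list.simps(15))
    then have "\<forall>c\<in>set (c # cs). \<varpi> [^] (s + t) \<otimes> c \<in> A"
      using mono Cons.prems k_carrier by (auto simp: add.commute[of s t] subset_iff) (metis add.commute)
    then show ?case by blast
  qed simp
  then obtain s :: nat where s: "\<And>c. c \<in> set cs \<Longrightarrow> \<varpi> [^] s \<otimes> c \<in> A" by blast
  let ?y = "\<varpi> [^] s \<otimes> x"
  \<comment> \<open>\<open>N\<close> stays fixed while the list loses its leading entries, since a
    tail must be scaled by the same factor as the whole polynomial; the spare powers of
    \<open>\<varpi>\<close> go into the coefficients.\<close>
  have scale: "\<exists>es. set es \<subseteq> A \<and> length es = length ds \<and>
      \<varpi> [^] (s * N) \<otimes> eval ds x = eval es ?y"
    if "set ds \<subseteq> set cs" "length ds \<le> N" for ds N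
    using that
  proof (induction ds)
    case Nil
    then show ?case by (intro exI[of _ "[]"]) auto
  next
    case (Cons c ds)
    then obtain es where es: "set es \<subseteq> A" "length es = length ds"
      "\<varpi> [^] (s * N) \<otimes> eval ds x = eval es ?y" by auto
    have cc: "c \<in> carrier R" "set ds \<subseteq> carrier R" "\<varpi> [^] s \<otimes> c \<in> A"
      using Cons.prems cs k_carrier s by auto
    then have ec: "eval ds x \<in> carrier R" using x by (intro eval_in_carrier)
    obtain d where d: "N = Suc d + length ds" using Cons.prems(2)
      by (metis add.commute add_Suc_right le_Suc_ex length_Cons add_Suc)
    define e where "e = \<varpi> [^] (s * d) \<otimes> (\<varpi> [^] s \<otimes> c)"
    have "e \<in> A" unfolding e_def
      using cc pow_in_subring[OF A_subring nat_in_subring[OF A_subring]] subringE(6)[OF A_subring] by blast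
    have "\<varpi> [^] (s * N) \<otimes> (c \<otimes> x [^] length ds) = e \<otimes> ?y [^] length ds"
    proof -
      define Q1 Q2 Q3 where "Q1 = \<varpi> [^] (s * d)" "Q2 = \<varpi> [^] s" "Q3 = \<varpi> [^] (s * length ds)"
      have q: "Q1 \<in> carrier R" "Q2 \<in> carrier R" "Q3 \<in> carrier R" "x [^] length ds \<in> carrier R"
        using x unfolding Q1_Q2_Q3_def by auto
      have "\<varpi> [^] (s * N) = Q1 \<otimes> Q2 \<otimes> Q3" unfolding Q1_Q2_Q3_def d
        by (simp add: nat_pow_mult algebra_simps)
      moreover have "?y [^] length ds = Q3 \<otimes> x [^] length ds" unfolding Q1_Q2_Q3_def
        using x by (simp add: nat_pow_distrib nat_pow_pow)
      ultimately show ?thesis unfolding e_def Q1_Q2_Q3_def(1,2)[symmetric]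
        using q cc(1) by (simp add: m_ac)
    qed
    then have "\<varpi> [^] (s * N) \<otimes> eval (c # ds) x = eval (e # es) ?y"
      using es(2,3) cc ec x by (simp add: r_distr)
    then show ?case using es(1,2) \<open>e \<in> A\<close> by (intro exI[of _ "e # es"]) auto
  qed
  obtain es where es: "set es \<subseteq> A" "length es = length cs"
      "\<varpi> [^] (s * length cs) \<otimes> eval cs x = eval es ?y" using scale[of cs "length cs"] by auto
  have ec: "eval cs x \<in> carrier R" using cs k_carrier x by (intro eval_in_carrier) auto
  have "eval (\<one> # es) ?y = \<varpi> [^] (s * length cs) \<otimes> eval (\<one> # cs) x"
    using es(2,3) ec x by (simp add: r_distr nat_pow_distrib nat_pow_pow)
  then have "eval (\<one> # es) ?y = \<zero>" using cs(2) by simp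
  then have "integral_over R A ?y" using integral_over_iff[OF A_subring, of ?y] es(1) x by auto
  then show ?thesis unfolding ints_def by blast
qed

text \<open>If \<open>y\<close> were nonzero, some \<open>\<varpi> [^] s\<close> times its inverse
  would be integral, and divisibility of \<open>y\<close> by \<open>\<varpi> [^] Suc s\<close> would
  make \<open>\<varpi>\<close> a unit.\<close>

lemma separated:
  assumes y: "y \<in> carrier R" and "\<And>n::nat. \<exists>z\<in>ints. y = \<varpi> [^] n \<otimes> z"
  shows "y = \<zero>"
proof (rule ccontr)
  assume y0: "y \<noteq> \<zero>"
  then have yi: "inv y \<in> carrier R" "y \<otimes> inv y = \<one>" using y by auto
  obtain s :: nat where s: "\<varpi> [^] s \<otimes> inv y \<in> ints" using clear_denominator[OF yi(1)] by blast
  obtain z where z: "z \<in> ints" "y = \<varpi> [^] Suc s \<otimes> z" using assms(2) by blast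
  define W where "W = \<varpi> [^] s \<otimes> inv y"
  have c: "W \<in> carrier R" "z \<in> carrier R" using s z unfolding W_def by auto
  have "\<varpi> [^] s \<otimes> (\<varpi> \<otimes> (z \<otimes> W)) = y \<otimes> W" unfolding z(2) using c by (simp add: m_ac)
  also have "\<dots> = \<varpi> [^] s \<otimes> (y \<otimes> inv y)" unfolding W_def using y yi(1) by (intro m_lcomm) auto
  also have "\<dots> = \<varpi> [^] s \<otimes> \<one>" using yi(2) by simp
  finally have "\<varpi> \<otimes> (z \<otimes> W) = \<one>"
    using m_lcancel[of "\<varpi> [^] s" "\<varpi> \<otimes> (z \<otimes> W)" \<one>] c pi_pow_nonzero by auto
  moreover have "z \<otimes> W \<in> ints" using s z ints_mult unfolding W_def by blast
  ultimately show False using pi_not_unit by blast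
qed

end

section \<open>Finite algebras of integers: residues, completeness and idempotents\<close>

context padic_closure
begin

text \<open>Unlike in \<open>finite_alg\<close>, \<open>M\<close> equals the span: residues and
  limits are constructed coordinate by coordinate and have to land in \<open>M\<close>
  again.\<close>

definition intalg :: "'a set \<Rightarrow> bool" where
  "intalg M \<longleftrightarrow> subring M R \<and> A \<subseteq> M \<and> M \<subseteq> ints \<and>
     (\<exists>B\<subseteq>carrier R. finite B \<and> M = lin_span R A B)"

text \<open>Congruence modulo \<open>\<varpi> [^] n\<close> within one finite algebra rather than
  among all integers, because completeness is available there.\<close>

definition pi_cong :: "'a set \<Rightarrow> nat \<Rightarrow> 'a \<Rightarrow> 'a \<Rightarrow> bool" where
  "pi_cong M n a b \<longleftrightarrow> (\<exists>z\<in>M. a = b \<oplus> \<varpi> [^] n \<otimes> z)"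

lemma intalg_adjoin:
  assumes "x \<in> ints" obtains M where "intalg M" "x \<in> M"
proof -
  obtain n :: nat where x: "x \<in> carrier R" and n: "x [^] n \<in> lin_span R A ((\<lambda>i. x [^] i) ` {..<n})"
    using assms unfolding ints_def integral_over_def by blast
  let ?M = "lin_span R A ((\<lambda>i. x [^] i) ` {..<n})"
  note * = lin_span_powers_subring[OF A_subring x n]
  have B: "(\<lambda>i. x [^] i) ` {..<n} \<subseteq> carrier R" using x by auto
  have fa: "finite_alg R A ?M"
    unfolding finite_alg_def using *(2,3) B by blast
  have "?M \<subseteq> ints"
    using finite_alg_integral[OF A_subring A_dvr_like fa] unfolding ints_def by blast
  then have "intalg ?M" unfolding intalg_def using *(2,3) B by blast
  moreover have "x \<in> ?M" using *(1)[of 1] x by simp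
  ultimately show ?thesis using that by blast
qed

text \<open>The span is finite modulo \<open>l\<close> because \<open>A\<close> is: each coordinate
  is reduced to a representative below \<open>l\<close>. Representatives may coincide; only their
  finite number matters.\<close>

lemma span_residues:
  assumes "finite B" "B \<subseteq> carrier R"
  shows "\<exists>F. finite F \<and> (\<forall>y\<in>lin_span R A B. \<exists>f\<in>F. f \<in> carrier R \<and> (\<exists>z\<in>lin_span R A B. y = f \<oplus> \<varpi> \<otimes> z))"
  using assms
proof (induction B rule: finite_induct)
  case empty
  have "\<forall>y\<in>lin_span R A {}. \<exists>f\<in>{\<zero>}. f \<in> carrier R \<and> (\<exists>z\<in>lin_span R A {}. y = f \<oplus> \<varpi> \<otimes> z)"
    using lin_span_empty[of _ A] lin_span.zero[of R A "{}"] by (metis (no_types, lifting) insertI1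
        m_closed of_int_closed r_null r_zero zero_closed)
  then show ?case by blast
next
  case (insert b B)
  then obtain F where F: "finite F" "\<forall>y\<in>lin_span R A B. \<exists>f\<in>F. f \<in> carrier R \<and> (\<exists>z\<in>lin_span R A B. y = f \<oplus> \<varpi> \<otimes> z)"
    by blast
  have b: "b \<in> carrier R" "B \<subseteq> carrier R" using insert by auto
  let ?F = "(\<lambda>(i, f). \<guillemotleft>i\<guillemotright> \<otimes> b \<oplus> f) ` ({0..<int l} \<times> F)"
  have "\<exists>f\<in>?F. f \<in> carrier R \<and> (\<exists>z\<in>lin_span R A (insert b B). y = f \<oplus> \<varpi> \<otimes> z)"
    if y: "y \<in> lin_span R A (insert b B)" for y
  proof -
    obtain a w where aw: "a \<in> A" "w \<in> lin_span R A B" "y = a \<otimes> b \<oplus> w"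
      using lin_span_insert[OF A_subring b(2,1) y] by blast
    obtain i c where ic: "i \<in> {0..<int l}" "c \<in> A" "a = \<guillemotleft>i\<guillemotright> \<oplus> \<varpi> \<otimes> c" using residue aw by blast
    obtain f z where fz: "f \<in> F" "f \<in> carrier R" "z \<in> lin_span R A B" "w = f \<oplus> \<varpi> \<otimes> z" using F aw by blast
    have zc: "z \<in> carrier R" "c \<in> carrier R" using lin_span_closed[OF A_carrier b(2) fz(3)] ic by auto
    define I P where "I = \<guillemotleft>i\<guillemotright>" "P = \<varpi>"
    have IP: "I \<in> carrier R" "P \<in> carrier R" unfolding I_P_def by auto
    have "y = (I \<oplus> P \<otimes> c) \<otimes> b \<oplus> (f \<oplus> P \<otimes> z)" unfolding aw(3) ic(3) fz(4) I_P_def ..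
    also have "\<dots> = (I \<otimes> b \<oplus> f) \<oplus> P \<otimes> (c \<otimes> b \<oplus> z)"
      using IP zc b(1) fz(2) by algebra
    finally have "y = (\<guillemotleft>i\<guillemotright> \<otimes> b \<oplus> f) \<oplus> \<varpi> \<otimes> (c \<otimes> b \<oplus> z)" unfolding I_P_def .
    moreover have "c \<otimes> b \<oplus> z \<in> lin_span R A (insert b B)"
      using ic fz(3) lin_span_mono[of A A B "insert b B"] by (auto intro: lin_span.intros)
    moreover have "\<guillemotleft>i\<guillemotright> \<otimes> b \<oplus> f \<in> ?F" using ic fz by auto
    moreover have "\<guillemotleft>i\<guillemotright> \<otimes> b \<oplus> f \<in> carrier R" using b fz by auto
    ultimately show ?thesis by blast
  qed
  moreover have "finite ?F" using F(1) by auto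
  ultimately show ?case by blast
qed

text \<open>Limits are taken coordinate by coordinate. Coordinates are not unique, so they are
  chosen for the increments from \<open>s n\<close> to \<open>s (Suc n)\<close> and summed up, which
  makes each coordinate sequence converge in \<open>A\<close>.\<close>

lemma span_complete:
  assumes "finite B" "B \<subseteq> carrier R" "\<And>n. s n \<in> lin_span R A B"
    and "\<And>n. \<exists>z\<in>lin_span R A B. s (Suc n) = s n \<oplus> \<varpi> [^] n \<otimes> z"
  shows "\<exists>t\<in>lin_span R A B. \<forall>n. \<exists>z\<in>lin_span R A B. t = s n \<oplus> \<varpi> [^] (n::nat) \<otimes> z"
  using assms
proof (induction B arbitrary: s rule: finite_induct)
  case empty
  then have "s n = \<zero>" for n using lin_span_empty by blast
  then show ?case by (intro bexI[of _ \<zero>] allI bexI[of _ \<zero>]) (auto intro: lin_span.intros)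
next
  case (insert b B)
  have b: "b \<in> carrier R" "B \<subseteq> carrier R" using insert by auto
  obtain a0 w0 where s0: "a0 \<in> A" "w0 \<in> lin_span R A B" "s 0 = a0 \<otimes> b \<oplus> w0"
    using lin_span_insert[OF A_subring b(2,1) insert.prems(2)[of 0]] by blast
  have "\<exists>a w. a \<in> A \<and> w \<in> lin_span R A B \<and> s (Suc n) = s n \<oplus> \<varpi> [^] n \<otimes> (a \<otimes> b \<oplus> w)" for n
    using insert.prems(3)[of n] lin_span_insert[OF A_subring b(2,1)] by metis
  then obtain a w where aw: "\<And>n. a n \<in> A" "\<And>n. w n \<in> lin_span R A B"
    "\<And>n. s (Suc n) = s n \<oplus> \<varpi> [^] n \<otimes> (a n \<otimes> b \<oplus> w n)" by metis
  define p where "p = rec_nat a0 (\<lambda>n r. r \<oplus> \<varpi> [^] n \<otimes> a n)"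
  define q where "q = rec_nat w0 (\<lambda>n r. r \<oplus> \<varpi> [^] n \<otimes> w n)"
  have p: "p 0 = a0" "p (Suc n) = p n \<oplus> \<varpi> [^] n \<otimes> a n" for n unfolding p_def by auto
  have q: "q 0 = w0" "q (Suc n) = q n \<oplus> \<varpi> [^] n \<otimes> w n" for n unfolding q_def by auto
  have powA: "\<varpi> [^] n \<in> A" for n :: nat
    by (rule pow_in_subring[OF A_subring nat_in_subring[OF A_subring]])
  have pA: "p n \<in> A" for n
    by (induction n) (use p s0 aw(1) powA subringE(6,7)[OF A_subring] in auto)
  have qB: "q n \<in> lin_span R A B" for n
    by (induction n) (use q s0 aw(2) powA lin_span_smult[OF A_subring b(2)]
        lin_span_plus[OF A_carrier b(2)] in auto)
  have cl: "p n \<in> carrier R" "q n \<in> carrier R" "a n \<in> carrier R" "w n \<in> carrier R" for n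
    using pA qB aw(1,2) lin_span_closed[OF A_carrier b(2)] by auto
  have s: "s n = p n \<otimes> b \<oplus> q n" for n
  proof (induction n)
    case 0 show ?case using p q s0 by simp
  next
    case (Suc n)
    define p' q' a' w' P where "p' = p n" "q' = q n" "a' = a n" "w' = w n" "P = \<varpi> [^] n"
    have m: "p' \<in> carrier R" "q' \<in> carrier R" "a' \<in> carrier R" "w' \<in> carrier R" "P \<in> carrier R"
      unfolding p'_q'_a'_w'_P_def using cl by auto
    have "(p' \<otimes> b \<oplus> q') \<oplus> P \<otimes> (a' \<otimes> b \<oplus> w') = (p' \<oplus> P \<otimes> a') \<otimes> b \<oplus> (q' \<oplus> P \<otimes> w')"
      using m b(1) by algebra
    then show ?case unfolding aw(3) Suc.IH p(2) q(2) p'_q'_a'_w'_P_def .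
  qed
  obtain t1 where t1: "t1 \<in> A" "\<And>n. \<exists>b\<in>A. t1 = p n \<oplus> \<varpi> [^] n \<otimes> b"
    using complete[of p] pA p(2) aw(1) by blast
  obtain t2 where t2: "t2 \<in> lin_span R A B" "\<And>n. \<exists>z\<in>lin_span R A B. t2 = q n \<oplus> \<varpi> [^] n \<otimes> z"
    using insert.IH[OF b(2), of q] qB q(2) aw(2) by blast
  have mono: "lin_span R A B \<subseteq> lin_span R A (insert b B)" by (intro lin_span_mono) auto
  have "\<exists>z\<in>lin_span R A (insert b B). t1 \<otimes> b \<oplus> t2 = s n \<oplus> \<varpi> [^] n \<otimes> z" for n
  proof -
    obtain c z where cz: "c \<in> A" "t1 = p n \<oplus> \<varpi> [^] n \<otimes> c" "z \<in> lin_span R A B" "t2 = q n \<oplus> \<varpi> [^] n \<otimes> z"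
      using t1(2) t2(2) by meson
    define p' q' P where "p' = p n" "q' = q n" "P = \<varpi> [^] n"
    have m: "p' \<in> carrier R" "q' \<in> carrier R" "c \<in> carrier R" "z \<in> carrier R" "P \<in> carrier R"
      unfolding p'_q'_P_def using cl cz lin_span_closed[OF A_carrier b(2)] by auto
    have "(p' \<oplus> P \<otimes> c) \<otimes> b \<oplus> (q' \<oplus> P \<otimes> z) = (p' \<otimes> b \<oplus> q') \<oplus> P \<otimes> (c \<otimes> b \<oplus> z)"
      using m b(1) by algebra
    then have "t1 \<otimes> b \<oplus> t2 = s n \<oplus> \<varpi> [^] n \<otimes> (c \<otimes> b \<oplus> z)"
      unfolding cz(2,4) s p'_q'_P_def .
    moreover have "c \<otimes> b \<oplus> z \<in> lin_span R A (insert b B)"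
      using cz mono by (auto intro: lin_span.intros)
    ultimately show ?thesis by blast
  qed
  moreover have "t1 \<otimes> b \<oplus> t2 \<in> lin_span R A (insert b B)"
    using t1(1) t2(1) mono by (auto intro: lin_span.intros)
  ultimately show ?case by blast
qed

context
  fixes M assumes M: "intalg M"
begin

lemma M_subring: "subring M R"
  using M unfolding intalg_def by blast

lemma M_ints: "M \<subseteq> ints"
  using M unfolding intalg_def by blast

lemma M_c [simp]: "x \<in> M \<Longrightarrow> x \<in> carrier R"
  using M_subring subringE(1) by blast

lemmas M_zero = subringE(2)[OF M_subring]
  and M_one = subringE(3)[OF M_subring]
  and M_uminus = subringE(5)[OF M_subring]
  and M_mult = subringE(6)[OF M_subring]
  and M_add = subringE(7)[OF M_subring]
  and M_pow = pow_in_subring[OF M_subring]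
  and M_int = int_in_subring[OF M_subring]

lemma M_minus: "x \<in> M \<Longrightarrow> y \<in> M \<Longrightarrow> x \<ominus> y \<in> M"
  unfolding a_minus_def by (intro M_add M_uminus)

lemma pi_cong_refl: "x \<in> M \<Longrightarrow> pi_cong M n x x"
  unfolding pi_cong_def using M_zero by (intro bexI[of _ \<zero>]) auto

lemma pi_cong_trans:
  assumes "pi_cong M n x y" "pi_cong M n y w" "w \<in> M" shows "pi_cong M n x w"
proof -
  obtain z z' where z: "z \<in> M" "z' \<in> M" "x = (w \<oplus> \<varpi> [^] n \<otimes> z') \<oplus> \<varpi> [^] n \<otimes> z"
    using assms(1,2) unfolding pi_cong_def by blast
  then have "x = w \<oplus> \<varpi> [^] n \<otimes> (z' \<oplus> z)" using assms(3) by (simp add: r_distr a_assoc)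
  then show ?thesis unfolding pi_cong_def using z M_add by blast
qed

lemma pi_cong_mult:
  assumes "pi_cong M n x y" "y \<in> M" "c \<in> M" shows "pi_cong M n (c \<otimes> x) (c \<otimes> y)"
proof -
  obtain z where z: "z \<in> M" "x = y \<oplus> \<varpi> [^] n \<otimes> z"
    using assms(1) unfolding pi_cong_def by blast
  then have "c \<otimes> x = c \<otimes> y \<oplus> \<varpi> [^] n \<otimes> (c \<otimes> z)" using assms(2,3) by (simp add: r_distr m_lcomm)
  then show ?thesis unfolding pi_cong_def using z assms M_mult by blast
qed

lemma pi_cong_pigeonhole:
  assumes "\<And>i::nat. f i \<in> M"
  shows "\<exists>i j. i < j \<and> pi_cong M 1 (f j) (f i)"
proof -
  obtain B where B: "B \<subseteq> carrier R" "finite B" "M = lin_span R A B" using M unfolding intalg_def by blast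
  obtain F where F: "finite F" "\<forall>y\<in>M. \<exists>f\<in>F. f \<in> carrier R \<and> (\<exists>z\<in>M. y = f \<oplus> \<varpi> \<otimes> z)"
    using span_residues[OF B(2,1)] unfolding B(3) by blast
  have "\<exists>r z. r \<in> F \<and> r \<in> carrier R \<and> z \<in> M \<and> f i = r \<oplus> \<varpi> \<otimes> z" for i using F(2) assms by blast
  then obtain r z where rz: "\<And>i. r i \<in> F" "\<And>i. r i \<in> carrier R" "\<And>i. z i \<in> M"
    "\<And>i. f i = r i \<oplus> \<varpi> \<otimes> z i" by metis
  have "\<not> inj r" using F(1) rz(1) by (metis finite_subset image_subsetI infinite_UNIV_nat finite_imageD)
  then obtain i j where "i \<noteq> j" "r i = r j" unfolding inj_def by blast
  then obtain i j where ij: "i < j" "r i = r j" by (metis linorder_neqE_nat)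
  have "f j = f i \<oplus> \<varpi> \<otimes> (z j \<ominus> z i)"
  proof -
    define a b e P where "a = z j" "b = z i" "e = r i" "P = \<varpi>"
    have m: "a \<in> carrier R" "b \<in> carrier R" "e \<in> carrier R" "P \<in> carrier R"
      unfolding a_b_e_P_def using rz by auto
    have "(e \<oplus> P \<otimes> b) \<oplus> P \<otimes> (a \<ominus> b) = e \<oplus> P \<otimes> a" using m by algebra
    then show ?thesis unfolding rz(4)[of i] rz(4)[of j] ij(2)[symmetric] a_b_e_P_def by simp
  qed
  then have "pi_cong M 1 (f j) (f i)" unfolding pi_cong_def using rz M_minus by (intro bexI[of _ "z j \<ominus> z i"]) auto
  then show ?thesis using ij by blast
qed

lemma M_complete:
  assumes "\<And>n. s n \<in> M" "\<And>n. pi_cong M n (s (Suc n)) (s n)"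
  shows "\<exists>t\<in>M. \<forall>n. pi_cong M n t (s n)"
proof -
  obtain B where B: "B \<subseteq> carrier R" "finite B" "M = lin_span R A B" using M unfolding intalg_def by blast
  show ?thesis unfolding pi_cong_def
    using span_complete[OF B(2,1), of s] assms unfolding pi_cong_def B(3) by blast
qed

lemma M_separated:
  assumes "y \<in> M" "\<And>n. pi_cong M n y \<zero>" shows "y = \<zero>"
proof (rule separated)
  show "\<exists>z\<in>ints. y = \<varpi> [^] n \<otimes> z" for n :: nat
    using assms(2)[of n] M_ints unfolding pi_cong_def by (metis M_c l_zero m_closed nat_pow_closed of_int_closed subsetD)
qed (use assms in simp)

text \<open>Geometric series: the partial sums of the powers of \<open>\<varpi> \<otimes> z\<close>
  converge in \<open>M\<close>, and the error of the limit is divisible by every power of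
  \<open>\<varpi>\<close>.\<close>

lemma one_minus_pi_unit:
  assumes z: "z \<in> M" shows "\<exists>y\<in>M. (\<one> \<ominus> \<varpi> \<otimes> z) \<otimes> y = \<one>"
proof -
  define w where "w = \<varpi> \<otimes> z"
  have wM: "w \<in> M" unfolding w_def using z M_mult M_int by blast
  have wc: "w \<in> carrier R" using wM by simp
  define s where "s = rec_nat \<zero> (\<lambda>_ r. \<one> \<oplus> w \<otimes> r)"
  have s: "s 0 = \<zero>" "s (Suc n) = \<one> \<oplus> w \<otimes> s n" for n unfolding s_def by auto
  have sM: "s n \<in> M" for n by (induction n) (use s wM M_zero M_one M_mult M_add in auto)
  have sc: "s n \<in> carrier R" for n using sM by simp
  have diff: "s (Suc n) = s n \<oplus> w [^] n" for n
  proof (induction n)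
    case 0 show ?case using s wc by simp
  next
    case (Suc n)
    have "s (Suc (Suc n)) = \<one> \<oplus> w \<otimes> (s n \<oplus> w [^] n)" using s(2)[of "Suc n"] Suc by simp
    also have "\<dots> = (\<one> \<oplus> w \<otimes> s n) \<oplus> w [^] Suc n"
      using sc wc by (simp add: r_distr a_assoc m_comm)
    finally show ?case using s(2)[of n] by simp
  qed
  have wpow: "w [^] n = \<varpi> [^] n \<otimes> z [^] n" for n :: nat unfolding w_def using z by (simp add: nat_pow_distrib)
  have "pi_cong M n (s (Suc n)) (s n)" for n
    unfolding pi_cong_def diff wpow using M_pow[OF z] by blast
  then obtain t where t: "t \<in> M" "\<And>n. pi_cong M n t (s n)" using M_complete[of s] sM by blast
  have "(\<one> \<ominus> w) \<otimes> t \<ominus> \<one> = \<zero>"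
  proof (rule M_separated)
    show "(\<one> \<ominus> w) \<otimes> t \<ominus> \<one> \<in> M" using t wM M_one M_minus M_mult by blast
    fix n
    obtain v where v: "v \<in> M" "t = s n \<oplus> \<varpi> [^] n \<otimes> v" using t(2) unfolding pi_cong_def by blast
    define S P u where "S = s n" "P = \<varpi> [^] n" "u = z [^] n"
    have m: "S \<in> carrier R" "P \<in> carrier R" "u \<in> carrier R" "v \<in> carrier R"
      unfolding S_P_u_def using sc z v by auto
    have geom: "(\<one> \<ominus> w) \<otimes> S = \<one> \<ominus> P \<otimes> u"
    proof -
      have "S \<oplus> P \<otimes> u = \<one> \<oplus> w \<otimes> S" using diff[of n] s(2)[of n] wpow[of n] unfolding S_P_u_def by simp
      then have "(S \<oplus> P \<otimes> u) \<ominus> (P \<otimes> u \<oplus> w \<otimes> S) = (\<one> \<oplus> w \<otimes> S) \<ominus> (P \<otimes> u \<oplus> w \<otimes> S)" by simp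
      moreover have "(S \<oplus> P \<otimes> u) \<ominus> (P \<otimes> u \<oplus> w \<otimes> S) = (\<one> \<ominus> w) \<otimes> S" using m wc by algebra
      moreover have "(\<one> \<oplus> w \<otimes> S) \<ominus> (P \<otimes> u \<oplus> w \<otimes> S) = \<one> \<ominus> P \<otimes> u" using m wc by algebra
      ultimately show ?thesis by simp
    qed
    have "(\<one> \<ominus> w) \<otimes> (S \<oplus> P \<otimes> v) \<ominus> \<one> = ((\<one> \<ominus> w) \<otimes> S) \<oplus> (\<one> \<ominus> w) \<otimes> (P \<otimes> v) \<ominus> \<one>"
      using m wc by algebra
    also have "\<dots> = (\<one> \<ominus> P \<otimes> u) \<oplus> (\<one> \<ominus> w) \<otimes> (P \<otimes> v) \<ominus> \<one>" unfolding geom ..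
    also have "\<dots> = \<zero> \<oplus> P \<otimes> ((\<one> \<ominus> w) \<otimes> v \<ominus> u)" using m wc by algebra
    finally have "(\<one> \<ominus> w) \<otimes> t \<ominus> \<one> = \<zero> \<oplus> \<varpi> [^] n \<otimes> ((\<one> \<ominus> w) \<otimes> v \<ominus> z [^] n)"
      unfolding v(2) S_P_u_def .
    moreover have "(\<one> \<ominus> w) \<otimes> v \<ominus> z [^] n \<in> M"
      by (intro M_minus M_mult M_pow M_one v(1) wM z)
    ultimately show "pi_cong M n ((\<one> \<ominus> w) \<otimes> t \<ominus> \<one>) \<zero>" unfolding pi_cong_def by blast
  qed
  then have "(\<one> \<ominus> w) \<otimes> t = \<one>" using t(1) wc r_right_minus_eq[of "(\<one> \<ominus> w) \<otimes> t" \<one>] by auto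
  then show ?thesis unfolding w_def using t(1) by blast
qed

text \<open>One Newton step for the equation \<open>e \<otimes> e = e\<close>. The derivative
  \<open>2e - 1\<close> has square \<open>1 + 4h\<close>, so modulo \<open>h\<close> it is its own
  inverse, and the error drops from \<open>h\<close> to \<open>h^2 (4h - 3)\<close>.\<close>

lemma newton_idempotent:
  assumes e: "e \<in> carrier R" and h: "h = e \<otimes> e \<ominus> e"
  defines "f \<equiv> e \<oplus> h \<otimes> (\<one> \<ominus> e \<ominus> e)"
  shows "f \<otimes> f \<ominus> f = (h \<otimes> h) \<otimes> (h \<oplus> h \<oplus> h \<oplus> h \<ominus> \<one> \<ominus> \<one> \<ominus> \<one>)"
proof -
  define d q where "d = \<one> \<ominus> e \<ominus> e" "q = h \<oplus> h \<oplus> h \<oplus> h"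
  have c: "h \<in> carrier R" "d \<in> carrier R" "q \<in> carrier R" unfolding h d_q_def using e by auto
  have ee: "e \<otimes> e = h \<oplus> e" unfolding h using e by algebra
  have e2: "e \<oplus> e = \<one> \<ominus> d" unfolding d_q_def using e by algebra
  have "d \<otimes> d = (\<one> \<ominus> (e \<oplus> e)) \<ominus> (e \<oplus> e) \<oplus> ((e \<otimes> e \<oplus> e \<otimes> e) \<oplus> (e \<otimes> e \<oplus> e \<otimes> e))"
    unfolding d_q_def using e by algebra
  also have "\<dots> = \<one> \<oplus> q" unfolding ee d_q_def using e c(1) by algebra
  finally have dd: "d \<otimes> d = \<one> \<oplus> q" .
  have f: "f = e \<oplus> h \<otimes> d" "f \<in> carrier R" unfolding f_def d_q_def using e c by auto
  have "f \<otimes> f = e \<otimes> e \<oplus> (e \<oplus> e) \<otimes> (h \<otimes> d) \<oplus> (h \<otimes> h) \<otimes> (d \<otimes> d)"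
    unfolding f(1) using e c by algebra
  also have "\<dots> = f \<oplus> (h \<ominus> h \<otimes> (d \<otimes> d) \<oplus> (h \<otimes> h) \<otimes> (d \<otimes> d))"
    unfolding ee e2 f(1) using e c by algebra
  also have "\<dots> = f \<oplus> (h \<otimes> h) \<otimes> (q \<oplus> \<one>) \<ominus> h \<otimes> q"
    unfolding dd using f(2) c by algebra
  finally have "f \<otimes> f \<ominus> f = (h \<otimes> h) \<otimes> (q \<oplus> \<one>) \<ominus> h \<otimes> q" using f(2) c by algebra
  also have "\<dots> = (h \<otimes> h) \<otimes> (q \<ominus> \<one> \<ominus> \<one> \<ominus> \<one>)"
    unfolding d_q_def using c(1) by algebra
  finally show ?thesis unfolding d_q_def .
qed

text \<open>A power of \<open>x\<close> is idempotent modulo \<open>l\<close>. Newton iteration lifts it to an idempotent of the domain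
  \<open>R\<close>, that is, to zero or one.\<close>

lemma unit_or_nilpotent:
  assumes x: "x \<in> M"
  shows "(\<exists>y\<in>M. x \<otimes> y = \<one>) \<or> (\<exists>n. \<exists>y\<in>M. x [^] (n::nat) = \<varpi> \<otimes> y)"
proof -
  obtain i j :: nat where ij: "i < j" "pi_cong M 1 (x [^] j) (x [^] i)"
    using pi_cong_pigeonhole[of "\<lambda>i::nat. x [^] i"] M_pow[OF x] by blast
  define t where "t = j - i"
  have per: "pi_cong M 1 (x [^] (n + r * t)) (x [^] n)" if "i \<le> n" for n r
  proof (induction r)
    case 0 show ?case using pi_cong_refl M_pow[OF x] by simp
  next
    case (Suc r)
    have "t + i = j" using ij(1) unfolding t_def by simp
    then have exps: "n + Suc r * t = (n - i + r * t) + j" "n + r * t = (n - i + r * t) + i"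
      using that unfolding mult_Suc by linarith+
    have "x [^] (n + Suc r * t) = x [^] (n - i + r * t) \<otimes> x [^] j"
      unfolding exps(1) using x by (simp add: nat_pow_mult)
    moreover have "x [^] (n + r * t) = x [^] (n - i + r * t) \<otimes> x [^] i"
      unfolding exps(2) using x by (simp add: nat_pow_mult)
    ultimately have "pi_cong M 1 (x [^] (n + Suc r * t)) (x [^] (n + r * t))"
      using pi_cong_mult[OF ij(2)] M_pow[OF x] by simp
    then show ?case using Suc pi_cong_trans M_pow[OF x] by blast
  qed
  \<comment> \<open>A multiple of the period \<open>t\<close> that is at least the preperiod
    \<open>i\<close>, so that doubling the exponent does not change the residue.\<close>
  define N where "N = Suc i * t"
  have "1 \<le> t" using ij(1) unfolding t_def by simp
  then have N: "i \<le> N" "0 < N" using mult_le_mono[of i "Suc i" 1 t] unfolding N_def by auto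
  have e1: "pi_cong M 1 (x [^] N \<otimes> x [^] N) (x [^] N)"
    using per[OF N(1), of "Suc i"] x by (simp add: N_def nat_pow_mult)
  define e where "e = rec_nat (x [^] N) (\<lambda>_ e. e \<oplus> (e \<otimes> e \<ominus> e) \<otimes> (\<one> \<ominus> e \<ominus> e))"
  have e: "e 0 = x [^] N" "e (Suc n) = e n \<oplus> (e n \<otimes> e n \<ominus> e n) \<otimes> (\<one> \<ominus> e n \<ominus> e n)" for n
    unfolding e_def by auto
  have eM: "e n \<in> M" for n
    by (induction n) (use e x M_pow M_add M_mult M_minus M_one in auto)
  have ec: "e n \<in> carrier R" for n using eM by simp
  have idem: "\<exists>z\<in>M. e n \<otimes> e n \<ominus> e n = \<varpi> [^] Suc n \<otimes> z" for n
  proof (induction n)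
    case 0
    obtain z where z: "z \<in> M" "x [^] N \<otimes> x [^] N = x [^] N \<oplus> \<varpi> [^] (1::nat) \<otimes> z"
      using e1 unfolding pi_cong_def by blast
    define P Y where "P = \<varpi> [^] (1::nat)" "Y = x [^] N"
    have m: "P \<in> carrier R" "Y \<in> carrier R" "z \<in> carrier R" unfolding P_Y_def using x z by auto
    have "(Y \<oplus> P \<otimes> z) \<ominus> Y = P \<otimes> z" using m by algebra
    then show ?case using z unfolding e(1) z(2) P_Y_def by auto
  next
    case (Suc n)
    then obtain z where z: "z \<in> M" "e n \<otimes> e n \<ominus> e n = \<varpi> [^] Suc n \<otimes> z" by blast
    define h P where "h = e n \<otimes> e n \<ominus> e n" "P = \<varpi> [^] n"
    define c where "c = h \<oplus> h \<oplus> h \<oplus> h \<ominus> \<one> \<ominus> \<one> \<ominus> \<one>"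
    have hM: "h \<in> M" unfolding h_P_def using eM M_mult M_minus by blast
    have cM: "c \<in> M" unfolding c_def by (intro M_add M_minus M_one hM)
    have m: "P \<in> carrier R" "c \<in> carrier R" "h \<in> carrier R" "z \<in> carrier R"
      unfolding h_P_def(2) using hM cM z by auto
    have "e (Suc n) \<otimes> e (Suc n) \<ominus> e (Suc n) = (h \<otimes> h) \<otimes> c"
      unfolding e(2) c_def h_P_def using newton_idempotent[OF ec refl] .
    also have "\<dots> = (\<varpi> [^] Suc n \<otimes> z) \<otimes> (\<varpi> [^] Suc n \<otimes> z) \<otimes> c"
      using z(2) unfolding h_P_def by simp
    also have "\<dots> = \<varpi> [^] Suc (Suc n) \<otimes> (P \<otimes> z \<otimes> z \<otimes> c)"
      unfolding h_P_def(2) using m by (simp add: m_ac)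
    finally show ?case using z(1) cM M_mult M_pow[OF M_int] unfolding h_P_def(2) by blast
  qed
  have step: "\<exists>z\<in>M. e (Suc n) = e n \<oplus> \<varpi> [^] Suc n \<otimes> z" for n
  proof -
    obtain z where z: "z \<in> M" "e n \<otimes> e n \<ominus> e n = \<varpi> [^] Suc n \<otimes> z" using idem by blast
    define c where "c = \<one> \<ominus> e n \<ominus> e n"
    have cM: "c \<in> M" unfolding c_def using eM M_one M_minus by blast
    have "e (Suc n) = e n \<oplus> \<varpi> [^] Suc n \<otimes> (z \<otimes> c)"
      unfolding e(2) z(2) c_def[symmetric] using z(1) cM by (simp add: m_assoc)
    then show ?thesis using z(1) cM M_mult by blast
  qed
  have "pi_cong M n (e (Suc n)) (e n)" for n
  proof -
    obtain z where z: "z \<in> M" "e (Suc n) = e n \<oplus> \<varpi> [^] Suc n \<otimes> z" using step by blast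
    then have "e (Suc n) = e n \<oplus> \<varpi> [^] n \<otimes> (\<varpi> \<otimes> z)" by (simp add: m_assoc)
    then show ?thesis unfolding pi_cong_def using z(1) M_int M_mult by blast
  qed
  then obtain u where u: "u \<in> M" "\<And>n. pi_cong M n u (e n)" using M_complete[of e] eM by blast
  have uc: "u \<in> carrier R" using u by simp
  have "u \<otimes> u \<ominus> u = \<zero>"
  proof (rule M_separated)
    show "u \<otimes> u \<ominus> u \<in> M" using u M_mult M_minus by blast
    fix n
    obtain v where v: "v \<in> M" "u = e n \<oplus> \<varpi> [^] n \<otimes> v" using u(2) unfolding pi_cong_def by blast
    obtain z where z: "z \<in> M" "e n \<otimes> e n \<ominus> e n = \<varpi> [^] Suc n \<otimes> z" using idem by blast
    define E P where "E = e n" "P = \<varpi> [^] n"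
    have m: "E \<in> carrier R" "P \<in> carrier R" "v \<in> carrier R" "z \<in> carrier R"
      unfolding E_P_def using ec v z by auto
    have "(E \<oplus> P \<otimes> v) \<otimes> (E \<oplus> P \<otimes> v) \<ominus> (E \<oplus> P \<otimes> v) = (E \<otimes> E \<ominus> E) \<oplus> P \<otimes> (E \<otimes> v \<oplus> E \<otimes> v \<oplus> P \<otimes> v \<otimes> v \<ominus> v)"
      using m by algebra
    also have "E \<otimes> E \<ominus> E = P \<otimes> (\<varpi> \<otimes> z)" using z unfolding E_P_def by (simp add: m_assoc)
    also have "P \<otimes> (\<varpi> \<otimes> z) \<oplus> P \<otimes> (E \<otimes> v \<oplus> E \<otimes> v \<oplus> P \<otimes> v \<otimes> v \<ominus> v) =
        \<zero> \<oplus> P \<otimes> (\<varpi> \<otimes> z \<oplus> (E \<otimes> v \<oplus> E \<otimes> v \<oplus> P \<otimes> v \<otimes> v \<ominus> v))"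
      using m by (simp add: r_distr)
    finally have "u \<otimes> u \<ominus> u = \<zero> \<oplus> \<varpi> [^] n \<otimes> (\<varpi> \<otimes> z \<oplus> (E \<otimes> v \<oplus> E \<otimes> v \<oplus> P \<otimes> v \<otimes> v \<ominus> v))"
      unfolding v(2) E_P_def .
    moreover have "\<varpi> \<otimes> z \<oplus> (E \<otimes> v \<oplus> E \<otimes> v \<oplus> P \<otimes> v \<otimes> v \<ominus> v) \<in> M"
      unfolding E_P_def using z(1) v(1) eM M_int by (intro M_add M_mult M_minus M_pow) auto
    ultimately show "pi_cong M n (u \<otimes> u \<ominus> u) \<zero>" unfolding pi_cong_def by blast
  qed
  then have "u \<otimes> (u \<ominus> \<one>) = \<zero>" using uc by (simp add: a_minus_def r_distr r_minus)
  then have u01: "u = \<zero> \<or> u = \<one>" using uc integral[of u "u \<ominus> \<one>"] by auto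
  obtain v where v: "v \<in> M" "u = e 1 \<oplus> \<varpi> [^] (1::nat) \<otimes> v" using u(2) unfolding pi_cong_def by blast
  obtain z where z: "z \<in> M" "e 1 = e 0 \<oplus> \<varpi> [^] Suc 0 \<otimes> z" using step[of 0] by auto
  define Y P where "Y = x [^] N" "P = \<varpi>"
  have m: "Y \<in> carrier R" "P \<in> carrier R" "v \<in> carrier R" "z \<in> carrier R"
    unfolding Y_P_def using x v z by auto
  have uY: "u = Y \<oplus> P \<otimes> (z \<oplus> v)" unfolding v(2) z(2) e(1) Y_P_def using x v z by (simp add: r_distr a_assoc)
  \<comment> \<open>\<open>x [^] N\<close> differs from \<open>u\<close> by a multiple of
    \<open>\<varpi>\<close>: for \<open>u = \<zero>\<close> it is divisible by
    \<open>\<varpi>\<close>, for \<open>u = \<one>\<close> it is a unit by the geometric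
    series.\<close>
  have Yu: "Y = u \<ominus> P \<otimes> (z \<oplus> v)" unfolding uY using m by algebra
  show ?thesis
  proof (cases "u = \<zero>")
    case True
    then have "Y = P \<otimes> (\<ominus> (z \<oplus> v))" unfolding Yu using m by (simp add: r_minus)
    then show ?thesis unfolding Y_P_def using z v M_add M_uminus by blast
  next
    case False
    then have "Y = \<one> \<ominus> \<varpi> \<otimes> (z \<oplus> v)" using u01 Yu unfolding Y_P_def by simp
    then obtain y where y: "y \<in> M" "Y \<otimes> y = \<one>" using one_minus_pi_unit[of "z \<oplus> v"] z v M_add by metis
    obtain N' where N': "N = Suc N'" using N(2) gr0_conv_Suc by blast
    have "x \<otimes> (x [^] N' \<otimes> y) = Y \<otimes> y" unfolding Y_P_def N' using x y by (simp add: m_ac)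
    then show ?thesis using y x M_mult M_pow by metis
  qed
qed

end

end

section \<open>Inertia and roots of unity of order prime to the residue characteristic\<close>

context padic_closure
begin

lemma unit_or_nonunit: "x \<in> ints \<Longrightarrow> x \<in> nonunits \<or> (\<exists>y\<in>ints. x \<otimes> y = \<one>)"
  unfolding nonunits_def by blast

lemma nonunits_ints: "x \<in> nonunits \<Longrightarrow> x \<in> ints"
  unfolding nonunits_def by blast

lemma nonunits_c [simp]: "x \<in> nonunits \<Longrightarrow> x \<in> carrier R"
  using nonunits_ints ints_c by blast

text \<open>Together with \<open>nilpotent_nonunits\<close> this describes nonunits by an algebraic
  equation, which automorphisms preserve.\<close>

lemma nonunits_nilpotent:
  assumes "x \<in> nonunits" shows "\<exists>n::nat. \<exists>y\<in>ints. x [^] n = \<varpi> \<otimes> y"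
proof -
  obtain M where M: "intalg M" "x \<in> M" using intalg_adjoin nonunits_ints[OF assms] by blast
  have "M \<subseteq> ints" using M(1) unfolding intalg_def by blast
  then show ?thesis using unit_or_nilpotent[OF M] assms unfolding nonunits_def by blast
qed

lemma nilpotent_nonunits:
  assumes x: "x \<in> ints" and y: "y \<in> ints" and n: "x [^] (n::nat) = \<varpi> \<otimes> y"
  shows "x \<in> nonunits"
proof (rule ccontr)
  assume "x \<notin> nonunits"
  then obtain w where w: "w \<in> ints" "x \<otimes> w = \<one>" using x unfolding nonunits_def by blast
  have "\<one> = (x \<otimes> w) [^] n" unfolding w(2) by simp
  also have "\<dots> = \<varpi> \<otimes> (y \<otimes> w [^] n)" using x w(1) y by (simp add: nat_pow_distrib n m_assoc)
  finally show False using pi_not_unit y w(1) ints_mult ints_pow by metis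
qed

lemma one_notin_nonunits: "\<one> \<notin> nonunits"
  unfolding nonunits_def using ints_one by auto

lemma nonunits_zero: "\<zero> \<in> nonunits"
  unfolding nonunits_def using ints_zero by auto

lemma nonunits_mult:
  assumes x: "x \<in> ints" and y: "y \<in> nonunits" shows "x \<otimes> y \<in> nonunits"
proof -
  have "y \<otimes> (x \<otimes> w) \<noteq> \<one>" if "w \<in> ints" for w
    using y that x ints_mult unfolding nonunits_def by blast
  then have "(x \<otimes> y) \<otimes> w \<noteq> \<one>" if "w \<in> ints" for w
    using that x y by (simp add: m_ac)
  then show ?thesis using x y ints_mult nonunits_ints unfolding nonunits_def by blast
qed

lemma pi_mult_nonunits: "y \<in> ints \<Longrightarrow> \<varpi> \<otimes> y \<in> nonunits"
  by (rule nilpotent_nonunits[of _ y 1]) (auto intro: ints_mult int_ints)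

text \<open>\<open>\<one> \<ominus> x\<close> divides \<open>\<one> \<ominus> x [^] n\<close>, which
  for a suitable \<open>n\<close> has the form \<open>\<one> \<ominus> \<varpi> \<otimes> z\<close>
  and is a unit.\<close>

lemma one_minus_nonunit:
  assumes x: "x \<in> nonunits" shows "\<exists>y\<in>ints. (\<one> \<ominus> x) \<otimes> y = \<one>"
proof -
  have xi: "x \<in> ints" using x nonunits_ints by blast
  obtain n :: nat and z where z: "z \<in> ints" "x [^] n = \<varpi> \<otimes> z" using nonunits_nilpotent[OF x] by blast
  have "\<exists>g\<in>ints. (\<one> \<ominus> x) \<otimes> g = \<one> \<ominus> x [^] n" for n :: nat
  proof (induction n)
    case 0
    then show ?case using ints_zero xi by (intro bexI[of _ \<zero>]) (auto simp: a_minus_def r_neg)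
  next
    case (Suc n)
    then obtain g where g: "g \<in> ints" "(\<one> \<ominus> x) \<otimes> g = \<one> \<ominus> x [^] n" by blast
    have c: "g \<in> carrier R" "x \<in> carrier R" using g xi by auto
    have "(\<one> \<ominus> x) \<otimes> (\<one> \<oplus> x \<otimes> g) = (\<one> \<ominus> x) \<oplus> x \<otimes> ((\<one> \<ominus> x) \<otimes> g)" using c by algebra
    also have "\<dots> = \<one> \<ominus> x [^] Suc n"
    proof -
      have p: "x [^] n \<in> carrier R" using c by simp
      have "(\<one> \<ominus> x) \<oplus> x \<otimes> (\<one> \<ominus> x [^] n) = \<one> \<ominus> x [^] n \<otimes> x" using c p by algebra
      then show ?thesis unfolding g(2) by simp
    qed
    finally show ?case using g(1) xi ints_one ints_add ints_mult by blast
  qed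
  then obtain g where g: "g \<in> ints" "(\<one> \<ominus> x) \<otimes> g = \<one> \<ominus> \<varpi> \<otimes> z" unfolding z(2)[symmetric] by blast
  obtain M where M: "intalg M" "z \<in> M" using intalg_adjoin z(1) by blast
  then obtain y where y: "y \<in> ints" "(\<one> \<ominus> \<varpi> \<otimes> z) \<otimes> y = \<one>"
    using one_minus_pi_unit[OF M] unfolding intalg_def by blast
  have "(\<one> \<ominus> x) \<otimes> (g \<otimes> y) = \<one>" using g y x by (simp add: m_assoc[symmetric])
  then show ?thesis using g y ints_mult by blast
qed

text \<open>If \<open>(x \<oplus> y) \<otimes> w = \<one>\<close>, then
  \<open>y \<otimes> w = \<one> \<ominus> w \<otimes> x\<close> is a unit by
  \<open>one_minus_nonunit\<close>, hence \<open>y\<close> is one too.\<close>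

lemma nonunits_add:
  assumes x: "x \<in> nonunits" and y: "y \<in> nonunits" shows "x \<oplus> y \<in> nonunits"
proof (rule ccontr)
  assume "x \<oplus> y \<notin> nonunits"
  moreover have "x \<oplus> y \<in> ints" using x y nonunits_ints ints_add by blast
  ultimately obtain w where w: "w \<in> ints" "(x \<oplus> y) \<otimes> w = \<one>" using unit_or_nonunit by blast
  have "w \<otimes> x \<in> nonunits" using nonunits_mult[OF w(1) x] .
  then obtain v where v: "v \<in> ints" "(\<one> \<ominus> w \<otimes> x) \<otimes> v = \<one>" using one_minus_nonunit by blast
  have c: "x \<in> carrier R" "y \<in> carrier R" "w \<in> carrier R" "v \<in> carrier R" using x y w v by auto
  have "(x \<oplus> y) \<otimes> w \<ominus> w \<otimes> x = y \<otimes> w" using c by algebra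
  then have "y \<otimes> (w \<otimes> v) = \<one>" using v(2) c unfolding w(2) by (simp add: m_assoc)
  then show False using y v(1) w(1) ints_mult unfolding nonunits_def by blast
qed

lemma nonunits_uminus: "x \<in> nonunits \<Longrightarrow> \<ominus> x \<in> nonunits"
  using nonunits_mult[of "\<ominus> \<one>" x] ints_one ints_uminus by (simp add: l_minus)

lemma nonunits_minus: "x \<in> nonunits \<Longrightarrow> y \<in> nonunits \<Longrightarrow> x \<ominus> y \<in> nonunits"
  unfolding a_minus_def by (intro nonunits_add nonunits_uminus)

lemma nonunits_prime:
  assumes "x \<in> ints" "y \<in> ints" "x \<otimes> y \<in> nonunits"
  shows "x \<in> nonunits \<or> y \<in> nonunits"
proof (rule ccontr)
  assume "\<not> ?thesis"
  then obtain v w where v: "v \<in> ints" "x \<otimes> v = \<one>" "w \<in> ints" "y \<otimes> w = \<one>"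
    using assms unit_or_nonunit by blast
  have "(x \<otimes> y) \<otimes> (v \<otimes> w) = (x \<otimes> v) \<otimes> (y \<otimes> w)" using assms v by (simp add: m_ac)
  then have "(x \<otimes> y) \<otimes> (v \<otimes> w) = \<one>" using v by simp
  then show False using assms(3) v ints_mult unfolding nonunits_def by blast
qed

lemma nonunits_pow:
  assumes "x \<in> ints" "x [^] (n::nat) \<in> nonunits" shows "x \<in> nonunits"
  using assms(2)
proof (induction n)
  case 0
  then show ?case using one_notin_nonunits by simp
next
  case (Suc n)
  then show ?case using nonunits_prime[of "x [^] n" x] assms(1) ints_pow by auto
qed

text \<open>Over the closed field the polynomial splits into linear factors with integral roots; as
  the nonunits form a prime ideal, one of the factors is a nonunit at \<open>x\<close>.\<close>

lemma nonunits_root_approx: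
  assumes "set cs \<subseteq> ints" "x \<in> ints" "eval (\<one> # cs) x \<in> nonunits"
  shows "\<exists>\<eta>\<in>ints. eval (\<one> # cs) \<eta> = \<zero> \<and> x \<ominus> \<eta> \<in> nonunits"
  using assms(1,3)
proof (induction "length cs" arbitrary: cs)
  case 0
  then show ?case using one_notin_nonunits assms(2) by simp
next
  case (Suc n)
  have csc: "set cs \<subseteq> carrier R" "cs \<noteq> []" using Suc.prems Suc.hyps(2) by auto
  obtain \<eta> where \<eta>: "\<eta> \<in> carrier R" "eval (\<one> # cs) \<eta> = \<zero>" using monic_root[OF csc] by blast
  then have \<eta>i: "\<eta> \<in> ints" using ints_monic_root Suc.prems by blast
  obtain ds where ds: "set ds \<subseteq> ints" "length cs = Suc (length ds)"
    "\<And>y. y \<in> carrier R \<Longrightarrow> eval (\<one> # cs) y = (y \<ominus> \<eta>) \<otimes> eval (\<one> # ds) y"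
    using monic_root_divide[OF ints_subring Suc.prems(1) \<eta>i csc(2) \<eta>(2)] by metis
  have evi: "eval es x \<in> ints" if "set es \<subseteq> ints" for es
    using that by (induction es) (use assms(2) in \<open>auto intro!: ints_add ints_mult ints_pow ints_zero\<close>)
  have "(x \<ominus> \<eta>) \<otimes> eval (\<one> # ds) x \<in> nonunits" using ds(3)[of x] assms(2) Suc.prems(2) by simp
  moreover have "eval (\<one> # ds) x \<in> ints" using evi[of "\<one> # ds"] ds(1) ints_one by (simp del: eval.simps)
  ultimately consider "x \<ominus> \<eta> \<in> nonunits" | "eval (\<one> # ds) x \<in> nonunits"
    using nonunits_prime ints_minus[OF assms(2) \<eta>i] by blast
  then show ?case
  proof cases
    case 1
    then show ?thesis using \<eta>i \<eta> by blast
  next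
    case 2
    then obtain \<theta> where \<theta>: "\<theta> \<in> ints" "eval (\<one> # ds) \<theta> = \<zero>" "x \<ominus> \<theta> \<in> nonunits"
      using Suc.hyps(1)[of ds] Suc.hyps(2) ds by auto
    have "eval (\<one> # cs) \<theta> = \<zero>" using ds(3)[of \<theta>] \<theta> \<eta>(1) by (simp del: eval.simps)
    then show ?thesis using \<theta> by blast
  qed
qed

text \<open>With \<open>h = a \<ominus> b\<close>, the power \<open>h [^] l\<close> differs from
  \<open>a [^] l \<ominus> b [^] l\<close> by a multiple of \<open>\<varpi>\<close>, and an integer
  with a nonunit power is a nonunit.\<close>

lemma frobenius_nonunits:
  assumes a: "a \<in> ints" and b: "b \<in> ints" and "a [^] l \<ominus> b [^] l \<in> nonunits"
  shows "a \<ominus> b \<in> nonunits"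
proof -
  define h where "h = a \<ominus> b"
  have hi: "h \<in> ints" unfolding h_def using a b ints_minus by blast
  have c: "a \<in> carrier R" "b \<in> carrier R" "h \<in> carrier R" using a b hi by auto
  have a_eq: "a = b \<oplus> h" unfolding h_def using c by algebra
  obtain w where w: "w \<in> ints" "(b \<oplus> h) [^] l = b [^] l \<oplus> h [^] l \<oplus> \<varpi> \<otimes> w"
    using add_pow_prime[OF ints_subring b hi prime_l] by blast
  define p q r where "p = b [^] l" "q = h [^] l" "r = \<varpi> \<otimes> w"
  have m: "p \<in> carrier R" "q \<in> carrier R" "r \<in> carrier R" unfolding p_q_r_def using c w by auto
  have "(p \<oplus> q \<oplus> r) \<ominus> p \<ominus> r = q" using m by algebra
  then have "h [^] l = a [^] l \<ominus> b [^] l \<ominus> \<varpi> \<otimes> w" unfolding a_eq w(2) p_q_r_def by simp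
  then have "h [^] l \<in> nonunits" using assms(3) nonunits_minus pi_mult_nonunits[OF w(1)] by simp
  then show ?thesis using nonunits_pow[OF hi] unfolding h_def by blast
qed

lemma frobenius_iter_nonunits:
  assumes "a \<in> ints" "b \<in> ints" "a [^] (l ^ i) \<ominus> b [^] (l ^ i) \<in> nonunits"
  shows "a \<ominus> b \<in> nonunits"
  using assms(3)
proof (induction i)
  case 0
  then show ?case using assms by simp
next
  case (Suc i)
  then have "(a [^] (l ^ i)) [^] l \<ominus> (b [^] (l ^ i)) [^] l \<in> nonunits"
    using assms by (simp add: nat_pow_pow mult.commute)
  then show ?case using Suc.IH frobenius_nonunits assms ints_pow by blast
qed

section \<open>Automorphisms acting on integers and nonunits\<close>

definition roots_of_unity :: "'a set" where
  "roots_of_unity = {\<eta> \<in> carrier R. \<exists>n>0. coprime n l \<and> \<eta> [^] (n::nat) = \<one>}"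

text \<open>The coefficients of \<open>X^n - c\<close> without the leading one, which the statements
  about monic polynomials supply.\<close>

definition pure_poly :: "nat \<Rightarrow> 'a \<Rightarrow> 'a list" where
  "pure_poly n c = replicate (n - 1) \<zero> @ [\<ominus> c]"

lemma eval_pure_poly:
  assumes "0 < n" "c \<in> carrier R" "x \<in> carrier R"
  shows "eval (\<one> # pure_poly n c) x = x [^] n \<ominus> c"
proof -
  obtain m where n: "n = Suc m" using assms(1) gr0_conv_Suc by blast
  have "eval (\<one> # pure_poly n c) x = eval (monom \<one> m @ [\<ominus> c]) x"
    unfolding pure_poly_def monom_def n by simp
  also have "\<dots> = eval (monom \<one> m) x \<otimes> x \<oplus> \<ominus> c"
    using assms by (intro eval_append_aux monom_in_carrier) auto
  finally show ?thesis using assms eval_monom[of \<one> x m] unfolding n by (simp add: a_minus_def)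
qed

lemma set_pure_poly: "set (pure_poly n c) \<subseteq> {\<zero>, \<ominus> c}"
  unfolding pure_poly_def by auto

lemma finite_power_eq:
  assumes "0 < n" "c \<in> carrier R" shows "finite {x \<in> carrier R. x [^] (n::nat) = c}"
proof -
  have "{x \<in> carrier R. x [^] n = c} \<subseteq> {x \<in> carrier R. eval (\<one> # pure_poly n c) x = \<zero>}"
    using eval_pure_poly[OF assms] assms(2) by auto
  moreover have "set (pure_poly n c) \<subseteq> carrier R" using set_pure_poly[of n c] assms(2) by auto
  ultimately show ?thesis using finite_monic_roots finite_subset by blast
qed

lemma ints_root:
  assumes "0 < n" "c \<in> ints" "x \<in> carrier R" "x [^] (n::nat) = c" shows "x \<in> ints"
  using assms set_pure_poly[of n c] eval_pure_poly[of n c x] ints_zero ints_uminus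
  by (intro ints_monic_root[of x "pure_poly n c"]) auto

lemma galoisD:
  assumes "\<phi> \<in> carrier (galois_group R K)"
  shows "ring_hom_cring R R \<phi>" "\<And>x. x \<in> K \<Longrightarrow> \<phi> x = x" "inj_on \<phi> (carrier R)"
    "\<And>x. x \<in> carrier R \<Longrightarrow> \<phi> x \<in> carrier R"
proof -
  have h: "\<phi> \<in> ring_hom R R" and b: "bij_betw \<phi> (carrier R) (carrier R)"
    and f: "\<forall>x\<in>K. \<phi> x = x"
    using assms unfolding galois_group_def Let_def ring_iso_def by auto
  show "ring_hom_cring R R \<phi>" using h is_cring unfolding ring_hom_cring_def ring_hom_cring_axioms_def by blast
  show "\<phi> x = x" if "x \<in> K" for x using f that by blast
  show "inj_on \<phi> (carrier R)" using b by (rule bij_betw_imp_inj_on)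
  show "\<phi> x \<in> carrier R" if "x \<in> carrier R" for x using b that by (rule bij_betwE[rule_format])
qed

lemma galois_compose:
  assumes "\<phi> \<in> carrier (galois_group R K)" "\<tau> \<in> carrier (galois_group R K)" "K \<subseteq> carrier R"
  shows "compose (carrier R) \<phi> \<tau> \<in> carrier (galois_group R K)"
proof -
  have h: "\<phi> \<in> ring_hom R R" "\<tau> \<in> ring_hom R R"
    and b: "bij_betw \<phi> (carrier R) (carrier R)" "bij_betw \<tau> (carrier R) (carrier R)"
    and f: "\<forall>x\<in>K. \<phi> x = x" "\<forall>x\<in>K. \<tau> x = x"
    using assms unfolding galois_group_def Let_def ring_iso_def by auto
  have c: "\<tau> x \<in> carrier R" if "x \<in> carrier R" for x using h(2) that by (rule ring_hom_closed)
  have "compose (carrier R) \<phi> \<tau> \<in> ring_hom R R"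
    using h c by (intro ring_hom_memI) (auto simp: compose_def ring_hom_mult ring_hom_add ring_hom_one ring_hom_closed)
  moreover have "bij_betw (compose (carrier R) \<phi> \<tau>) (carrier R) (carrier R)"
    using b by (rule bij_betw_compose[rotated])
  ultimately show ?thesis using f assms(3)
    unfolding galois_group_def Let_def ring_iso_def by (auto simp: compose_def subset_iff)
qed

lemma galois_mono: "K \<subseteq> K' \<Longrightarrow> carrier (galois_group R K') \<subseteq> carrier (galois_group R K)"
  unfolding galois_group_def Let_def by auto

lemma galois_ints:
  assumes \<phi>: "\<phi> \<in> carrier (galois_group R K)" and K: "A \<subseteq> K" and x: "x \<in> ints"
  shows "\<phi> x \<in> ints"
proof -
  interpret \<phi>: ring_hom_cring R R \<phi> using galoisD[OF \<phi>] by blast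
  have xc: "x \<in> carrier R" using x by simp
  obtain cs where cs: "set cs \<subseteq> A" "eval (\<one> # cs) x = \<zero>"
    using x integral_over_iff[OF A_subring xc] unfolding ints_def by blast
  have "map \<phi> (\<one> # cs) = \<one> # cs" using cs(1) K galoisD(2)[OF \<phi>] by (auto intro!: map_idI)
  moreover have "eval (map \<phi> (\<one> # cs)) (\<phi> x) = \<phi> (eval (\<one> # cs) x)"
    using cs(1) xc by (intro \<phi>.ring.eval_hom'[symmetric]) auto
  ultimately have "eval (\<one> # cs) (\<phi> x) = \<zero>" using cs(2) by simp
  then show ?thesis using integral_over_iff[OF A_subring, of "\<phi> x"] cs(1) galoisD(4)[OF \<phi> xc]
    unfolding ints_def by blast
qed

lemma galois_nonunits:
  assumes \<phi>: "\<phi> \<in> carrier (galois_group R K)" and K: "A \<subseteq> K" and x: "x \<in> nonunits"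
  shows "\<phi> x \<in> nonunits"
proof -
  interpret \<phi>: ring_hom_cring R R \<phi> using galoisD[OF \<phi>] by blast
  obtain n :: nat and y where y: "y \<in> ints" "x [^] n = \<varpi> \<otimes> y" using nonunits_nilpotent[OF x] by blast
  have pi: "\<phi> \<varpi> = \<varpi>" using galoisD(2)[OF \<phi>] K nat_in_subring[OF A_subring] by blast
  have "\<phi> x [^] n = \<phi> (x [^] n)" using x by (simp add: \<phi>.ring.hom_nat_pow)
  also have "\<dots> = \<varpi> \<otimes> \<phi> y" unfolding y(2) using y(1) pi by simp
  finally show ?thesis
    using nilpotent_nonunits galois_ints[OF \<phi> K] y(1) nonunits_ints[OF x] by blast
qed

text \<open>For some \<open>i\<close>, the power \<open>x\<close> to the \<open>l\<^sup>i\<close> is a nonunit or is congruent, modulo nonunits, to a root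
  of unity of order prime to \<open>l\<close>; and raising to the \<open>l\<close>-th power is injective modulo nonunits.\<close>

theorem galois_inertia:
  assumes \<phi>: "\<phi> \<in> carrier (galois_group R K)" and K: "A \<subseteq> K" "roots_of_unity \<subseteq> K" and x: "x \<in> ints"
  shows "\<phi> x \<ominus> x \<in> nonunits"
proof -
  interpret \<phi>: ring_hom_cring R R \<phi> using galoisD[OF \<phi>] by blast
  obtain M where M: "intalg M" "x \<in> M" using intalg_adjoin[OF x] by blast
  have Mi: "M \<subseteq> ints" using M(1) unfolding intalg_def by blast
  \<comment> \<open>Modulo \<open>\<varpi>\<close> the algebra \<open>M\<close> is finite, so the
    iterated \<open>l\<close>-th powers of \<open>x\<close> must repeat.\<close>
  obtain i j :: nat where ij: "i < j" "pi_cong M 1 (x [^] (l ^ j)) (x [^] (l ^ i))"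
    using pi_cong_pigeonhole[OF M(1), of "\<lambda>i. x [^] (l ^ i)"] M_pow[OF M] by blast
  define y where "y = x [^] (l ^ i)"
  have yi: "y \<in> ints" unfolding y_def using x ints_pow by blast
  then have yc: "y \<in> carrier R" by simp
  define n where "n = l ^ (j - i) - 1"
  have l2: "2 \<le> l" using prime_l prime_ge_2_nat by blast
  have lj: "2 \<le> l ^ (j - i)" using l2 ij(1) self_le_power[of l "j - i"] by linarith
  have n: "0 < n" "l ^ (j - i) = Suc n" using lj unfolding n_def by auto
  have "coprime n l"
  proof -
    have "coprime n (Suc n)" by simp
    then have "coprime n (l ^ (j - i))" unfolding n(2) .
    then show ?thesis using ij(1) by simp
  qed
  have "l ^ j = l ^ i * Suc n" using ij(1) unfolding n(2)[symmetric] by (simp add: power_add[symmetric])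
  then have "x [^] (l ^ j) = y [^] Suc n" unfolding y_def using x by (simp only: nat_pow_pow ints_c)
  then obtain z where z: "z \<in> M" "y [^] Suc n = y \<oplus> \<varpi> [^] (1::nat) \<otimes> z"
    using ij(2) unfolding pi_cong_def y_def by auto
  have zi: "z \<in> ints" using z Mi by blast
  then have zc: "z \<in> carrier R" by simp
  have "y \<otimes> (y [^] n \<ominus> \<one>) = y [^] Suc n \<ominus> y"
  proof -
    have "y [^] n \<in> carrier R" using yc by simp
    then show ?thesis using yc by (simp add: a_minus_def r_distr r_minus m_comm)
  qed
  also have "\<dots> = \<varpi> \<otimes> z"
  proof -
    define w where "w = \<varpi> \<otimes> z"
    have "w \<in> carrier R" unfolding w_def using zc by simp
    then have "y \<oplus> w \<ominus> y = w" using yc by algebra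
    then show ?thesis unfolding z(2) w_def by simp
  qed
  finally have "y \<otimes> (y [^] n \<ominus> \<one>) \<in> nonunits" using pi_mult_nonunits[OF zi] by simp
  \<comment> \<open>\<open>y [^] Suc n\<close> is congruent to \<open>y\<close>, so \<open>y\<close>
    is a nonunit or its \<open>n\<close>-th power is congruent to one; being one less than a power
    of \<open>l\<close>, \<open>n\<close> is prime to \<open>l\<close>.\<close>
  then consider "y \<in> nonunits" | "y [^] n \<ominus> \<one> \<in> nonunits"
    using nonunits_prime[OF yi ints_minus[OF ints_pow[OF yi, of n] ints_one]] by blast
  then have "\<phi> y \<ominus> y \<in> nonunits"
  proof cases
    case 1
    then show ?thesis using galois_nonunits[OF \<phi> K(1)] nonunits_minus by blast
  next
    case 2
    have "set (pure_poly n \<one>) \<subseteq> ints" using set_pure_poly[of n \<one>] ints_zero ints_one ints_uminus by auto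
    then obtain \<eta> where \<eta>: "\<eta> \<in> ints" "eval (\<one> # pure_poly n \<one>) \<eta> = \<zero>" "y \<ominus> \<eta> \<in> nonunits"
      using nonunits_root_approx[of "pure_poly n \<one>" y] yi 2 eval_pure_poly[OF n(1) _ yc, of \<one>] by auto
    have \<eta>c: "\<eta> \<in> carrier R" using \<eta> by simp
    have "\<eta> [^] n \<ominus> \<one> = \<zero>" using \<eta>(2) eval_pure_poly[OF n(1) _ \<eta>c, of \<one>] by simp
    then have "\<eta> [^] n = \<one>" using \<eta>c by simp
    then have "\<eta> \<in> roots_of_unity" unfolding roots_of_unity_def using n(1) \<open>coprime n l\<close> \<eta>c by blast
    then have fix_\<eta>: "\<phi> \<eta> = \<eta>" using galoisD(2)[OF \<phi>] K(2) by blast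
    have "\<phi> (y \<ominus> \<eta>) = \<phi> y \<ominus> \<phi> \<eta>" using yc \<eta>c by (simp add: a_minus_def)
    then have "\<phi> (y \<ominus> \<eta>) \<ominus> (y \<ominus> \<eta>) = (\<phi> y \<ominus> \<eta>) \<ominus> (y \<ominus> \<eta>)" using fix_\<eta> by simp
    moreover have "(\<phi> y \<ominus> \<eta>) \<ominus> (y \<ominus> \<eta>) = \<phi> y \<ominus> y"
    proof -
      define s where "s = \<phi> y"
      have "s \<in> carrier R" unfolding s_def using galoisD(4)[OF \<phi> yc] .
      then have "(s \<ominus> \<eta>) \<ominus> (y \<ominus> \<eta>) = s \<ominus> y" using yc \<eta>c by algebra
      then show ?thesis unfolding s_def .
    qed
    moreover have "\<phi> (y \<ominus> \<eta>) \<ominus> (y \<ominus> \<eta>) \<in> nonunits"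
      using galois_nonunits[OF \<phi> K(1) \<eta>(3)] \<eta>(3) nonunits_minus by blast
    ultimately show ?thesis by simp
  qed
  moreover have "\<phi> y = \<phi> x [^] (l ^ i)" unfolding y_def using x by (simp add: \<phi>.ring.hom_nat_pow)
  ultimately show ?thesis
    using frobenius_iter_nonunits[of "\<phi> x" x i] galois_ints[OF \<phi> K(1) x] x unfolding y_def by simp
qed

end

section \<open>The maximal unramified extension\<close>

lemma (in comm_monoid) finprod_bij:
  assumes "finite I" "inj_on h I" "h ` I \<subseteq> I" "\<And>i. i \<in> I \<Longrightarrow> f i \<in> carrier G"
  shows "finprod G (\<lambda>i. f (h i)) I = finprod G f I"
proof -
  have "h ` I = I" using assms(1-3) by (simp add: endo_inj_surj)
  then show ?thesis using finprod_reindex[of f h I] assms by (simp add: Pi_def)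
qed

text \<open>Orthogonality, by telescoping the product of the sum with
  \<open>w \<ominus> \<one>\<close>.\<close>

lemma (in domain) finsum_powers_of_unity:
  assumes w: "w \<in> carrier R" "w [^] (n::nat) = \<one>"
  shows "finsum R (\<lambda>j. w [^] j) {..<n} = (if w = \<one> then \<guillemotleft>int n\<guillemotright> else \<zero>)"
proof (cases "w = \<one>")
  case True
  have "finsum R (\<lambda>j. \<one> [^] j) {..<m} = \<guillemotleft>int m\<guillemotright>" for m :: nat
    by (induction m) (simp_all add: lessThan_Suc)
  then show ?thesis using True by simp
next
  case False
  have "(w \<ominus> \<one>) \<otimes> finsum R (\<lambda>j. w [^] j) {..<m} = w [^] m \<ominus> \<one>" for m :: nat
  proof (induction m)
    case 0
    then show ?case using w by (simp add: a_minus_def r_neg)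
  next
    case (Suc m)
    define s v where "s = finsum R (\<lambda>j. w [^] j) {..<m}" "v = w [^] m"
    have c: "s \<in> carrier R" "v \<in> carrier R" unfolding s_v_def using w by auto
    have "finsum R (\<lambda>j. w [^] j) {..<Suc m} = v \<oplus> s" unfolding s_v_def using w by (simp add: lessThan_Suc)
    moreover have "(w \<ominus> \<one>) \<otimes> (v \<oplus> s) = (w \<ominus> \<one>) \<otimes> v \<oplus> (w \<ominus> \<one>) \<otimes> s" using c w by (simp add: r_distr)
    moreover have "(w \<ominus> \<one>) \<otimes> s = v \<ominus> \<one>" using Suc unfolding s_v_def .
    moreover have "(w \<ominus> \<one>) \<otimes> v \<oplus> (v \<ominus> \<one>) = v \<otimes> w \<ominus> \<one>" using c w(1) by algebra
    ultimately show ?case unfolding s_v_def by simp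
  qed
  then have "(w \<ominus> \<one>) \<otimes> finsum R (\<lambda>j. w [^] j) {..<n} = \<zero>" using w(2) by (simp add: a_minus_def r_neg)
  moreover have "finsum R (\<lambda>j. w [^] j) {..<n} \<in> carrier R" using w by simp
  ultimately have "finsum R (\<lambda>j. w [^] j) {..<n} = \<zero>"
    using integral[of "w \<ominus> \<one>" "finsum R (\<lambda>j. w [^] j) {..<n}"] False w(1)
    by (metis minus_closed one_closed r_right_minus_eq)
  then show ?thesis using False by simp
qed

lemma (in ring) generate_ring_mono: "H \<subseteq> H' \<Longrightarrow> generate_ring R H \<subseteq> generate_ring R H'"
proof
  fix x assume H: "H \<subseteq> H'" "x \<in> generate_ring R H"
  from H(2) show "x \<in> generate_ring R H'"
    by induction (use H(1) in \<open>auto intro: generate_ring.intros\<close>)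
qed

text \<open>Reduces statements on \<open>k_unr\<close> to finitely many roots of unity, which can be
  adjoined one at a time.\<close>

lemma (in ring) generate_ring_finite_support:
  assumes "x \<in> generate_ring R (K \<union> U)"
  shows "\<exists>S\<subseteq>U. finite S \<and> x \<in> generate_ring R (K \<union> S)"
  using assms
proof induction
  case one
  show ?case by (intro exI[of _ "{}"]) (auto intro: generate_ring.intros)
next
  case (incl h)
  then show ?case by (intro exI[of _ "{h} \<inter> U"]) (auto intro: generate_ring.intros)
next
  case (a_inv h)
  then show ?case by (blast intro: generate_ring.intros)
next
  case (eng_add h1 h2)
  then obtain S1 S2 where S: "S1 \<subseteq> U" "finite S1" "h1 \<in> generate_ring R (K \<union> S1)"
    "S2 \<subseteq> U" "finite S2" "h2 \<in> generate_ring R (K \<union> S2)" by blast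
  have "h1 \<in> generate_ring R (K \<union> (S1 \<union> S2))" "h2 \<in> generate_ring R (K \<union> (S1 \<union> S2))"
    using S generate_ring_mono[of "K \<union> S1" "K \<union> (S1 \<union> S2)"] generate_ring_mono[of "K \<union> S2" "K \<union> (S1 \<union> S2)"] by auto
  then show ?case using S by (intro exI[of _ "S1 \<union> S2"]) (auto intro: generate_ring.intros)
next
  case (eng_mult h1 h2)
  then obtain S1 S2 where S: "S1 \<subseteq> U" "finite S1" "h1 \<in> generate_ring R (K \<union> S1)"
    "S2 \<subseteq> U" "finite S2" "h2 \<in> generate_ring R (K \<union> S2)" by blast
  have "h1 \<in> generate_ring R (K \<union> (S1 \<union> S2))" "h2 \<in> generate_ring R (K \<union> (S1 \<union> S2))"
    using S generate_ring_mono[of "K \<union> S1" "K \<union> (S1 \<union> S2)"] generate_ring_mono[of "K \<union> S2" "K \<union> (S1 \<union> S2)"] by auto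
  then show ?case using S by (intro exI[of _ "S1 \<union> S2"]) (auto intro: generate_ring.intros)
qed

context padic_closure
begin

lemma galois_agree:
  assumes \<phi>: "\<phi> \<in> carrier (galois_group R K)" and \<psi>: "\<psi> \<in> carrier (galois_group R K)"
    and "S \<subseteq> carrier R" "K \<subseteq> carrier R" "\<And>y. y \<in> S \<Longrightarrow> \<phi> y = \<psi> y" and x: "x \<in> generate_ring R (K \<union> S)"
  shows "\<phi> x = \<psi> x"
proof -
  interpret \<phi>: ring_hom_cring R R \<phi> using galoisD[OF \<phi>] by blast
  interpret \<psi>: ring_hom_cring R R \<psi> using galoisD[OF \<psi>] by blast
  have KS: "K \<union> S \<subseteq> carrier R" using assms by auto
  note c = generate_ring_in_carrier[OF KS]
  from x show ?thesis
  proof induction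
    case (incl h)
    then show ?case using assms(5) galoisD(2)[OF \<phi>] galoisD(2)[OF \<psi>] by auto
  next
    case (eng_add h1 h2)
    then show ?case using c[of h1] c[of h2] by simp
  next
    case (eng_mult h1 h2)
    then show ?case using c[of h1] c[of h2] by simp
  qed (auto dest: c)
qed

lemma galois_fixed:
  assumes "subring K R" "k \<subseteq> K" "x \<in> carrier R" "\<And>\<phi>. \<phi> \<in> carrier (galois_group R K) \<Longrightarrow> \<phi> x = x"
  shows "x \<in> K"
  using galois_moves[OF assms(1-3)] assms(4) by blast

text \<open>Write \<open>n\<close> as \<open>\<varpi> [^] e\<close> times a unit; for positive
  \<open>e\<close> a Bezout relation between \<open>n\<close> and \<open>l\<close> would exhibit
  \<open>\<varpi>\<close> as invertible.\<close>

lemma coprime_unit: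
  assumes "coprime n l" shows "\<guillemotleft>int n\<guillemotright> \<noteq> \<zero>" "inv \<guillemotleft>int n\<guillemotright> \<in> A"
proof -
  have l1: "l \<noteq> 1" using prime_l prime_gt_1_nat by auto
  have "n \<noteq> 0" using assms l1 by (metis coprime_0_left_iff nat_dvd_1_iff_1)
  then show n0: "\<guillemotleft>int n\<guillemotright> \<noteq> \<zero>" using char_zero[of "int n"] by auto
  obtain e u where u: "u \<in> A" "u \<noteq> \<zero>" "inv u \<in> A" "\<guillemotleft>int n\<guillemotright> = \<varpi> [^] (e::nat) \<otimes> u"
    using uniformizer[OF nat_in_subring[OF A_subring] n0] by blast
  show "inv \<guillemotleft>int n\<guillemotright> \<in> A"
  proof (cases e)
    case 0
    then show ?thesis using u by simp
  next
    case (Suc d)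
    have "coprime (int n) (int l)" using assms by simp
    then obtain s t where st: "s * int n + t * int l = 1" using bezout_int[of "int n" "int l"] by auto
    define z where "z = \<guillemotleft>s\<guillemotright> \<otimes> (\<varpi> [^] d \<otimes> u) \<oplus> \<guillemotleft>t\<guillemotright>"
    have uc: "u \<in> carrier R" using u by simp
    have "\<one> = \<guillemotleft>s * int n + t * int l\<guillemotright>" unfolding st by simp
    also have "\<dots> = \<guillemotleft>s\<guillemotright> \<otimes> (\<varpi> [^] e \<otimes> u) \<oplus> \<guillemotleft>t\<guillemotright> \<otimes> \<varpi>" unfolding u(4)[symmetric] by simp
    also have "\<dots> = \<varpi> \<otimes> z" unfolding z_def Suc using uc by (simp add: r_distr m_ac)
    finally have "\<varpi> \<otimes> z = \<one>" by simp
    moreover have "z \<in> ints" unfolding z_def using u A_ints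
      by (intro ints_add ints_mult ints_pow int_ints) auto
    ultimately show ?thesis using pi_not_unit by blast
  qed
qed

text \<open>\<open>l\<close> is a uniformiser of \<open>K\<close>. The quotient is only asked to be
  integral; for a field \<open>K\<close> it lies in \<open>K\<close> anyway.\<close>

definition unram :: "'a set \<Rightarrow> bool" where
  "unram K \<longleftrightarrow> (\<forall>x\<in>K \<inter> nonunits. \<exists>z\<in>ints. x = \<varpi> \<otimes> z)"

lemma unram_k: "unram k"
  unfolding unram_def
proof clarify
  fix x assume x: "x \<in> k" "x \<in> nonunits"
  have xA: "x \<in> A" using k_ints x nonunits_ints by blast
  show "\<exists>z\<in>ints. x = \<varpi> \<otimes> z"
  proof (cases "x = \<zero>")
    case True
    then show ?thesis using ints_zero by (intro bexI[of _ \<zero>]) auto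
  next
    case False
    then obtain e u where u: "u \<in> A" "u \<noteq> \<zero>" "inv u \<in> A" "x = \<varpi> [^] (e::nat) \<otimes> u"
      using uniformizer xA by blast
    show ?thesis
    proof (cases e)
      case 0
      then have "x \<otimes> inv u = \<one>" using u by simp
      then show ?thesis using x(2) u(3) A_ints unfolding nonunits_def by blast
    next
      case (Suc d)
      then have "x = \<varpi> \<otimes> (\<varpi> [^] d \<otimes> u)" using u by (simp add: m_ac)
      moreover have "\<varpi> [^] d \<otimes> u \<in> ints" using u(1) A_ints by (intro ints_mult ints_pow int_ints) auto
      ultimately show ?thesis by blast
    qed
  qed
qed

lemma nonunits_finsum:
  assumes "finite I" "\<And>i. i \<in> I \<Longrightarrow> f i \<in> nonunits"
  shows "finsum R f I \<in> nonunits"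
  using assms
  by (induction I rule: finite_induct) (auto simp: nonunits_zero nonunits_add Pi_def)

lemma ints_finsum:
  assumes "finite I" "\<And>i. i \<in> I \<Longrightarrow> f i \<in> ints"
  shows "finsum R f I \<in> ints"
  using assms
  by (induction I rule: finite_induct) (auto simp: ints_zero ints_add Pi_def)

text \<open>The discrete Fourier transform over the conjugates of \<open>\<eta>\<close> writes a nonunit of \<open>K[\<eta>]\<close> as a
  combination of powers of \<open>\<eta>\<close> with nonunit coefficients in \<open>K\<close>; this needs no knowledge of the
  minimal polynomial of \<open>\<eta>\<close>.\<close>

lemma unram_adjoin:
  assumes K: "subring K R" "k \<subseteq> K" "unram K" and \<eta>: "\<eta> \<in> roots_of_unity"
  shows "\<exists>K'. subring K' R \<and> K \<subseteq> K' \<and> \<eta> \<in> K' \<and> unram K'"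
proof -
  obtain n :: nat where n: "0 < n" "coprime n l" "\<eta> [^] n = \<one>" and \<eta>c: "\<eta> \<in> carrier R"
    using \<eta> unfolding roots_of_unity_def by blast
  note Kc = subringE(1)[OF K(1)]
  have AK: "A \<subseteq> K" using A_k K(2) by blast
  let ?K' = "generate_ring R (K \<union> {\<eta>})"
  let ?G = "carrier (galois_group R K)"
  have K\<eta>: "K \<union> {\<eta>} \<subseteq> carrier R" using Kc \<eta>c by auto
  note gc = generate_ring_in_carrier[OF K\<eta>]
  \<comment> \<open>The conjugates of \<open>\<eta>\<close> over \<open>K\<close>. They are roots of
    \<open>X^n - 1\<close>, hence finitely many, and they index the automorphisms up to their action
    on \<open>?K'\<close>.\<close>
  define J where "J = (\<lambda>\<phi>. \<phi> \<eta>) ` ?G"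
  have J_root: "\<theta> \<in> carrier R" "\<theta> [^] n = \<one>" if "\<theta> \<in> J" for \<theta>
  proof -
    obtain \<phi> where \<phi>: "\<phi> \<in> ?G" "\<theta> = \<phi> \<eta>" using \<open>\<theta> \<in> J\<close> unfolding J_def by blast
    interpret \<phi>: ring_hom_cring R R \<phi> using galoisD[OF \<phi>(1)] by blast
    show "\<theta> \<in> carrier R" unfolding \<phi>(2) using \<eta>c by simp
    have "\<theta> [^] n = \<phi> (\<eta> [^] n)" unfolding \<phi>(2) using \<eta>c by (simp add: \<phi>.ring.hom_nat_pow)
    then show "\<theta> [^] n = \<one>" unfolding n(3) by simp
  qed
  have finJ: "finite J"
    using finite_power_eq[OF n(1) one_closed] by (rule finite_subset[rotated]) (use J_root in auto)
  have "\<exists>\<phi>. \<phi> \<in> ?G \<and> \<phi> \<eta> = \<theta>" if "\<theta> \<in> J" for \<theta> using that unfolding J_def by blast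
  then obtain s where s: "\<And>\<theta>. \<theta> \<in> J \<Longrightarrow> s \<theta> \<in> ?G" "\<And>\<theta>. \<theta> \<in> J \<Longrightarrow> s \<theta> \<eta> = \<theta>" by metis
  have id: "(\<lambda>x\<in>carrier R. x) \<in> ?G"
    unfolding galois_group_def Let_def ring_iso_def using Kc
    by (auto simp: ring_hom_def bij_betw_def inj_on_def image_iff)
  then have \<eta>J: "\<eta> \<in> J" unfolding J_def using \<eta>c by (intro image_eqI[OF _ id]) simp
  have agree: "\<phi> x = \<psi> x" if "\<phi> \<in> ?G" "\<psi> \<in> ?G" "\<phi> \<eta> = \<psi> \<eta>" "x \<in> ?K'" for \<phi> \<psi> x
    using galois_agree[OF that(1,2), of "{\<eta>}"] that \<eta>c Kc by auto
  have "\<exists>z\<in>ints. x = \<varpi> \<otimes> z" if x: "x \<in> ?K'" "x \<in> nonunits" for x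
  proof -
    have xc: "x \<in> carrier R" using x by simp
    \<comment> \<open>\<open>(n - 1) * j\<close> stands for the exponent \<open>- j\<close>, as
      \<open>\<theta> [^] n = \<one>\<close>. Thus \<open>a j\<close> is a Fourier coefficient of
      the function sending the conjugate \<open>\<theta>\<close> to the corresponding conjugate of
      \<open>x\<close>; \<open>n\<close> is invertible in \<open>A\<close> because it is prime to
      \<open>l\<close>.\<close>
    define F where "F j \<theta> = s \<theta> x \<otimes> \<theta> [^] ((n - 1) * j)" for j \<theta>
    define c where "c = inv \<guillemotleft>int n\<guillemotright>"
    define a where "a j = c \<otimes> finsum R (F j) J" for j
    have cA: "c \<in> A" unfolding c_def by (rule coprime_unit(2)[OF n(2)])
    then have cc: "c \<in> carrier R" by simp
    have sx: "s \<theta> x \<in> nonunits" if "\<theta> \<in> J" for \<theta> using galois_nonunits[OF s(1)[OF that] AK x(2)] .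
    have \<theta>i: "\<theta> \<in> ints" if "\<theta> \<in> J" for \<theta> using ints_root[OF n(1) ints_one] J_root[OF that] by blast
    have FN: "F j \<theta> \<in> nonunits" if "\<theta> \<in> J" for j \<theta>
      unfolding F_def using nonunits_mult[OF ints_pow[OF \<theta>i[OF that]] sx[OF that]]
        sx[OF that] J_root[OF that] by (simp add: m_comm)
    have Fc: "F j \<theta> \<in> carrier R" if "\<theta> \<in> J" for j \<theta> using FN[OF that] by simp
    have aN: "a j \<in> nonunits" for j unfolding a_def
      by (intro nonunits_mult[OF subsetD[OF A_ints cA]] nonunits_finsum[OF finJ] FN)
    \<comment> \<open>An automorphism over \<open>K\<close> permutes \<open>J\<close> and carries
      \<open>s \<theta> x\<close> to \<open>s (\<tau> \<theta>) x\<close>, so it only permutes the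
      summands of \<open>a j\<close>.\<close>
    have "a j \<in> K" for j
    proof (rule galois_fixed[OF K(1,2)])
      show "a j \<in> carrier R" using aN by simp
      fix \<tau> assume \<tau>: "\<tau> \<in> ?G"
      interpret \<tau>: ring_hom_cring R R \<tau> using galoisD[OF \<tau>] by blast
      have \<tau>J: "\<tau> \<theta> \<in> J" if "\<theta> \<in> J" for \<theta>
      proof -
        have "compose (carrier R) \<tau> (s \<theta>) \<in> ?G" using galois_compose[OF \<tau> s(1)[OF that] Kc] .
        moreover have "compose (carrier R) \<tau> (s \<theta>) \<eta> = \<tau> \<theta>" using s(2)[OF that] \<eta>c by (simp add: compose_def)
        ultimately show ?thesis unfolding J_def by (intro image_eqI) auto
      qed
      have "\<tau> (F j \<theta>) = F j (\<tau> \<theta>)" if "\<theta> \<in> J" for \<theta>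
      proof -
        have "compose (carrier R) \<tau> (s \<theta>) x = s (\<tau> \<theta>) x"
        proof (rule agree[OF galois_compose[OF \<tau> s(1)[OF that] Kc] s(1)[OF \<tau>J[OF that]] _ x(1)])
          show "compose (carrier R) \<tau> (s \<theta>) \<eta> = s (\<tau> \<theta>) \<eta>"
            unfolding s(2)[OF \<tau>J[OF that]] using s(2)[OF that] \<eta>c by (simp add: compose_def)
        qed
        then have "\<tau> (s \<theta> x) = s (\<tau> \<theta>) x" using xc by (simp add: compose_def)
        then show ?thesis unfolding F_def using sx[OF that] J_root[OF that] by (simp add: \<tau>.ring.hom_nat_pow)
      qed
      then have "finsum R (\<lambda>\<theta>. \<tau> (F j \<theta>)) J = finsum R (\<lambda>\<theta>. F j (\<tau> \<theta>)) J"
        using Fc \<tau>J by (intro finsum_cong') auto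
      also have "\<dots> = finsum R (F j) J"
        using add.finprod_bij[OF finJ, of \<tau> "F j"] Fc \<tau>J galoisD(3)[OF \<tau>] J_root(1)
        by (simp add: finsum_def) (meson image_subsetI inj_on_subset subsetI)
      finally have "finsum R (\<lambda>\<theta>. \<tau> (F j \<theta>)) J = finsum R (F j) J" .
      moreover have "\<tau> (finsum R (F j) J) = finsum R (\<lambda>\<theta>. \<tau> (F j \<theta>)) J"
        using \<tau>.hom_finsum[of "F j" J] Fc by (simp add: comp_def Pi_def)
      moreover have "\<tau> c = c" using galoisD(2)[OF \<tau>] cA AK by blast
      moreover have "finsum R (F j) J \<in> carrier R" using Fc by auto
      ultimately show "\<tau> (a j) = a j" unfolding a_def using cc by simp
    qed
    \<comment> \<open>Each coefficient is a nonunit of \<open>K\<close> and thus divisible by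
      \<open>\<varpi>\<close>; inverting the transform carries this over to
      \<open>x\<close>.\<close>
    then have "\<exists>z\<in>ints. a j = \<varpi> \<otimes> z" for j using K(3) aN unfolding unram_def by blast
    then obtain z where z: "\<And>j. z j \<in> ints" "\<And>j. a j = \<varpi> \<otimes> z j" by metis
    define Z where "Z = finsum R (\<lambda>j. z j \<otimes> \<eta> [^] j) {..<n}"
    have \<eta>i: "\<eta> \<in> ints" using \<theta>i \<eta>J by blast
    have zc: "z j \<in> carrier R" for j using z(1) by simp
    have "Z \<in> ints" unfolding Z_def using z(1) \<eta>i by (intro ints_finsum ints_mult ints_pow) auto
    have w: "\<theta> [^] (n - 1) \<otimes> \<eta> \<in> carrier R" "(\<theta> [^] (n - 1) \<otimes> \<eta>) [^] n = \<one>"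
      "\<theta> [^] (n - 1) \<otimes> \<eta> = \<one> \<longleftrightarrow> \<theta> = \<eta>" if "\<theta> \<in> J" for \<theta>
    proof -
      note \<theta> = J_root[OF that]
      show "\<theta> [^] (n - 1) \<otimes> \<eta> \<in> carrier R" using \<theta> \<eta>c by simp
      have "(\<theta> [^] (n - 1)) [^] n = (\<theta> [^] n) [^] (n - 1)" using \<theta>(1) by (simp add: nat_pow_pow mult.commute)
      then show "(\<theta> [^] (n - 1) \<otimes> \<eta>) [^] n = \<one>" using \<theta> \<eta>c n(3) by (simp add: nat_pow_distrib)
      have nn: "n = Suc (n - 1)" using n(1) by simp
      have 1: "\<theta> \<otimes> \<theta> [^] (n - 1) = \<one>" using \<theta> nn by (metis nat_pow_Suc2)
      show "\<theta> [^] (n - 1) \<otimes> \<eta> = \<one> \<longleftrightarrow> \<theta> = \<eta>"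
      proof
        assume "\<theta> [^] (n - 1) \<otimes> \<eta> = \<one>"
        then have "\<theta> \<otimes> (\<theta> [^] (n - 1) \<otimes> \<eta>) = \<theta>" using \<theta>(1) by simp
        then show "\<theta> = \<eta>" using 1 \<theta>(1) \<eta>c by (simp add: m_assoc[symmetric])
      next
        assume "\<theta> = \<eta>"
        then show "\<theta> [^] (n - 1) \<otimes> \<eta> = \<one>" using 1 \<eta>c by (simp add: m_comm)
      qed
    qed
    have sxc: "s \<theta> x \<in> carrier R" if "\<theta> \<in> J" for \<theta> using sx[OF that] by simp
    have "\<varpi> \<otimes> Z = finsum R (\<lambda>j. \<varpi> \<otimes> (z j \<otimes> \<eta> [^] j)) {..<n}"
      unfolding Z_def using zc \<eta>c by (intro finsum_rdistr) auto
    also have "\<dots> = finsum R (\<lambda>j. c \<otimes> finsum R (\<lambda>\<theta>. s \<theta> x \<otimes> (\<theta> [^] (n - 1) \<otimes> \<eta>) [^] j) J) {..<n}"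
    proof (intro finsum_cong')
      fix j assume "j \<in> {..<n}"
      have "\<varpi> \<otimes> (z j \<otimes> \<eta> [^] j) = a j \<otimes> \<eta> [^] j" unfolding z(2) using zc \<eta>c by (simp add: m_assoc)
      also have "\<dots> = c \<otimes> (finsum R (F j) J \<otimes> \<eta> [^] j)" unfolding a_def using cc Fc \<eta>c by (simp add: m_assoc Pi_def)
      also have "finsum R (F j) J \<otimes> \<eta> [^] j = finsum R (\<lambda>\<theta>. F j \<theta> \<otimes> \<eta> [^] j) J"
        using finsum_ldistr[OF finJ, of "\<eta> [^] j" "F j"] Fc \<eta>c by (simp add: Pi_def)
      also have "\<dots> = finsum R (\<lambda>\<theta>. s \<theta> x \<otimes> (\<theta> [^] (n - 1) \<otimes> \<eta>) [^] j) J"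
        unfolding F_def using sxc J_root \<eta>c
        by (intro finsum_cong') (auto simp: nat_pow_distrib nat_pow_pow m_assoc)
      finally show "\<varpi> \<otimes> (z j \<otimes> \<eta> [^] j) = c \<otimes> finsum R (\<lambda>\<theta>. s \<theta> x \<otimes> (\<theta> [^] (n - 1) \<otimes> \<eta>) [^] j) J" .
    qed (use cc sxc w in auto)
    also have "\<dots> = c \<otimes> finsum R (\<lambda>j. finsum R (\<lambda>\<theta>. s \<theta> x \<otimes> (\<theta> [^] (n - 1) \<otimes> \<eta>) [^] j) J) {..<n}"
      using cc sxc w by (intro finsum_rdistr[symmetric]) auto
    also have "finsum R (\<lambda>j. finsum R (\<lambda>\<theta>. s \<theta> x \<otimes> (\<theta> [^] (n - 1) \<otimes> \<eta>) [^] j) J) {..<n} =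
        finsum R (\<lambda>\<theta>. finsum R (\<lambda>j. s \<theta> x \<otimes> (\<theta> [^] (n - 1) \<otimes> \<eta>) [^] j) {..<n}) J"
      using add.finprod_finprod_swap[of "{..<n}" J "\<lambda>j \<theta>. s \<theta> x \<otimes> (\<theta> [^] (n - 1) \<otimes> \<eta>) [^] j"] finJ sxc w(1)
      by (simp add: finsum_def)
    \<comment> \<open>Orthogonality: after exchanging the sums only the conjugate
      \<open>\<theta> = \<eta>\<close> survives, where \<open>s \<theta>\<close> fixes
      \<open>x\<close>.\<close>
    also have "\<dots> = finsum R (\<lambda>\<theta>. if \<eta> = \<theta> then \<guillemotleft>int n\<guillemotright> \<otimes> x else \<zero>) J"
    proof (intro finsum_cong')
      fix \<theta> assume \<theta>: "\<theta> \<in> J"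
      have "finsum R (\<lambda>j. s \<theta> x \<otimes> (\<theta> [^] (n - 1) \<otimes> \<eta>) [^] j) {..<n} =
          s \<theta> x \<otimes> finsum R (\<lambda>j. (\<theta> [^] (n - 1) \<otimes> \<eta>) [^] j) {..<n}"
        using sxc[OF \<theta>] w(1)[OF \<theta>] by (intro finsum_rdistr[symmetric]) auto
      also have "\<dots> = s \<theta> x \<otimes> (if \<theta> = \<eta> then \<guillemotleft>int n\<guillemotright> else \<zero>)"
        unfolding finsum_powers_of_unity[OF w(1,2)[OF \<theta>]] w(3)[OF \<theta>] ..
      also have "\<dots> = (if \<eta> = \<theta> then \<guillemotleft>int n\<guillemotright> \<otimes> x else \<zero>)"
      proof (cases "\<theta> = \<eta>")
        case True
        have "s \<theta> x = (\<lambda>x\<in>carrier R. x) x"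
          using agree[OF s(1)[OF \<theta>] id _ x(1)] s(2)[OF \<theta>] True \<eta>c by simp
        then show ?thesis using True xc by (simp add: m_comm)
      next
        case False
        then show ?thesis using sxc[OF \<theta>] by auto
      qed
      finally show "finsum R (\<lambda>j. s \<theta> x \<otimes> (\<theta> [^] (n - 1) \<otimes> \<eta>) [^] j) {..<n} =
        (if \<eta> = \<theta> then \<guillemotleft>int n\<guillemotright> \<otimes> x else \<zero>)" .
    qed (use xc in auto)
    also have "\<dots> = \<guillemotleft>int n\<guillemotright> \<otimes> x"
      using finsum_singleton[OF \<eta>J finJ, of "\<lambda>_. \<guillemotleft>int n\<guillemotright> \<otimes> x"] xc by simp
    also have "c \<otimes> (\<guillemotleft>int n\<guillemotright> \<otimes> x) = x"
      unfolding c_def using coprime_unit(1)[OF n(2)] xc by (simp add: m_assoc[symmetric])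
    finally have "x = \<varpi> \<otimes> Z" by simp
    then show ?thesis using \<open>Z \<in> ints\<close> by blast
  qed
  then have "unram ?K'" unfolding unram_def by blast
  moreover have "subring ?K' R" by (rule generate_ring_is_subring[OF K\<eta>])
  ultimately show ?thesis by (intro exI[of _ ?K']) (auto intro: generate_ring.incl)
qed

lemma unram_tower:
  assumes "finite S" "S \<subseteq> roots_of_unity"
  shows "\<exists>K. subring K R \<and> k \<subseteq> K \<and> S \<subseteq> K \<and> unram K"
  using assms
proof (induction S rule: finite_induct)
  case empty
  then show ?case using k_subring unram_k by blast
next
  case (insert \<eta> S)
  then obtain K where K: "subring K R" "k \<subseteq> K" "S \<subseteq> K" "unram K" by auto
  then obtain K' where "subring K' R" "K \<subseteq> K'" "\<eta> \<in> K'" "unram K'"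
    using unram_adjoin[OF K(1,2,4), of \<eta>] insert.prems by auto
  then show ?case using K by (intro exI[of _ K']) auto
qed

text \<open>The maximal unramified extension. The generated ring is already a field by
  \<open>subring_inverse\<close>.\<close>

definition k_unr :: "'a set" where
  "k_unr = generate_ring R (k \<union> roots_of_unity)"

lemma roots_of_unity_carrier: "roots_of_unity \<subseteq> carrier R"
  unfolding roots_of_unity_def by blast

lemma k_unr_subring: "subring k_unr R"
  unfolding k_unr_def using k_carrier roots_of_unity_carrier by (intro generate_ring_is_subring) auto

lemma k_k_unr: "k \<subseteq> k_unr"
  unfolding k_unr_def by (auto intro: generate_ring.incl)

lemma k_unr_c: "x \<in> k_unr \<Longrightarrow> x \<in> carrier R"
  using subringE(1)[OF k_unr_subring] by blast

text \<open>If \<open>p\<close> did not divide \<open>v\<close>, a product of powers of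
  \<open>x\<close> and \<open>inv \<varpi>\<close> would have a \<open>p\<close>-th power equal to
  \<open>\<varpi>\<close> times a unit. It would be a nonunit, hence divisible by
  \<open>\<varpi>\<close>, and its \<open>p\<close>-th power at least twice.\<close>

theorem k_unr_power_valuation:
  assumes x: "x \<in> k_unr" and p: "prime (p::nat)"
    and u: "u \<in> A" "u \<noteq> \<zero>" "inv u \<in> A" and eq: "x [^] p = \<varpi> [^] (v::nat) \<otimes> u"
  shows "p dvd v"
proof (rule ccontr)
  assume "\<not> p dvd v"
  then have "coprime v p" using p by (metis coprime_commute prime_imp_coprime)
  then obtain s where s: "[v * s = Suc 0] (mod p)" using cong_solve_coprime_nat by blast
  \<comment> \<open>\<open>s\<close> inverts \<open>v\<close> modulo \<open>p\<close>, with
    \<open>v * s = t * p + 1\<close>; then \<open>x [^] s\<close> divided by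
    \<open>\<varpi> [^] t\<close> has valuation \<open>1 / p\<close>.\<close>
  define t where "t = v * s div p"
  have p1: "1 < p" using p prime_gt_1_nat by blast
  have "v * s mod p = 1" using s p1 by (simp add: cong_def)
  then have vs: "v * s = Suc (t * p)" unfolding t_def by (metis Suc_eq_plus1 div_mult_mod_eq)
  obtain S where S: "S \<subseteq> roots_of_unity" "finite S" "x \<in> generate_ring R (k \<union> S)"
    using x generate_ring_finite_support unfolding k_unr_def by blast
  obtain K where K: "subring K R" "k \<subseteq> K" "S \<subseteq> K" "unram K" using unram_tower[OF S(2,1)] by blast
  have xK: "x \<in> K"
    using S(3) K generate_ring_min_subring1[of "k \<union> S" K] subringE(1)[OF K(1)] by blast
  define w where "w = inv \<varpi>"
  have w: "w \<in> carrier R" "\<varpi> \<otimes> w = \<one>" unfolding w_def using pi_nonzero by auto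
  have wK: "w \<in> K" unfolding w_def using k_inv[OF _ pi_nonzero] nat_in_subring[OF k_subring] K(2) by blast
  define y where "y = x [^] s \<otimes> w [^] t"
  have xc: "x \<in> carrier R" and uc: "u \<in> carrier R" using x k_unr_c u by auto
  have yK: "y \<in> K" unfolding y_def using xK wK pow_in_subring[OF K(1)] subringE(6)[OF K(1)] by blast
  have yc: "y \<in> carrier R" unfolding y_def using xc w by simp
  have yp: "y [^] p = \<varpi> \<otimes> u [^] s"
  proof -
    have "y [^] p = (x [^] p) [^] s \<otimes> w [^] (t * p)"
      unfolding y_def using xc w by (simp add: nat_pow_distrib nat_pow_pow mult.commute)
    also have "(x [^] p) [^] s = \<varpi> [^] (v * s) \<otimes> u [^] s"
      unfolding eq using uc by (simp add: nat_pow_distrib nat_pow_pow)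
    also have "\<varpi> [^] (v * s) = \<varpi> \<otimes> \<varpi> [^] (t * p)" unfolding vs by (simp add: m_comm)
    finally have "y [^] p = \<varpi> \<otimes> \<varpi> [^] (t * p) \<otimes> u [^] s \<otimes> w [^] (t * p)" .
    also have "\<dots> = \<varpi> \<otimes> u [^] s \<otimes> (\<varpi> \<otimes> w) [^] (t * p)"
      using uc w(1) by (simp add: nat_pow_distrib m_ac)
    finally show ?thesis unfolding w(2) using uc by simp
  qed
  have ui: "u [^] s \<in> ints" "inv u [^] s \<in> ints" using u A_ints ints_pow by auto
  have "y \<in> ints"
    using p1 ui int_ints ints_mult yp yc by (intro ints_root[of p "\<varpi> \<otimes> u [^] s" y]) auto
  then have "y \<in> nonunits" using nilpotent_nonunits yp ui by blast
  then obtain z where z: "z \<in> ints" "y = \<varpi> \<otimes> z" using K(4) yK unfolding unram_def by blast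
  have zc: "z \<in> carrier R" using z by simp
  \<comment> \<open>As \<open>p \<ge> 2\<close>, two factors \<open>\<varpi>\<close> can be taken
    out of \<open>y [^] p\<close>; only one of them cancels.\<close>
  define q where "q = p - 2"
  have q: "p = Suc (Suc q)" using p1 unfolding q_def by simp
  define W where "W = \<varpi> [^] q \<otimes> z [^] p"
  have Wc: "W \<in> carrier R" unfolding W_def using zc by simp
  have "y [^] p = \<varpi> \<otimes> (\<varpi> \<otimes> W)"
    unfolding W_def z(2) using zc by (simp add: nat_pow_distrib q m_ac)
  then have "\<varpi> \<otimes> (\<varpi> \<otimes> W) = \<varpi> \<otimes> u [^] s" using yp by simp
  then have "\<varpi> \<otimes> W = u [^] s"
    using m_lcancel[of \<varpi> "\<varpi> \<otimes> W" "u [^] s"] Wc uc pi_nonzero by auto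
  then have "\<varpi> \<otimes> (W \<otimes> inv u [^] s) = u [^] s \<otimes> inv u [^] s"
    using Wc u by (simp add: m_assoc[symmetric])
  also have "\<dots> = (u \<otimes> inv u) [^] s" using u(1,3) by (simp only: nat_pow_distrib A_c)
  also have "\<dots> = \<one>" using u(1,2) by (simp only: r_inv A_c nat_pow_one not_False_eq_True)
  finally have "\<varpi> \<otimes> (W \<otimes> inv u [^] s) = \<one>" .
  moreover have "W \<otimes> inv u [^] s \<in> ints"
    unfolding W_def by (rule ints_mult[OF ints_mult[OF ints_pow[OF int_ints] ints_pow[OF z(1)]] ui(2)])
  ultimately show False using pi_not_unit by blast
qed

end

section \<open>The Kummer argument over the unramified extension\<close>

lemma (in cring) finprod_nat_pow:
  assumes "finite I" "\<And>i. i \<in> I \<Longrightarrow> f i \<in> carrier R"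
  shows "finprod R f I [^] (n::nat) = finprod R (\<lambda>i. f i [^] n) I"
  using assms
proof (induction I rule: finite_induct)
  case (insert i I)
  have "finprod R f I \<in> carrier R" using insert.prems by (intro finprod_closed) auto
  then show ?case using insert by (simp add: nat_pow_distrib Pi_def)
qed simp

context padic_closure
begin

text \<open>If \<open>\<alpha>\<close> lies in the compositum of the unramified extension with \<open>k(\<zeta>, \<nu>)\<close>, then Kummer theory
  over \<open>k(\<zeta>)\<close> turns \<open>\<alpha>\<close>, up to a power of \<open>\<nu>\<close>, into an element of the compositum with \<open>k(\<zeta>)\<close>. Its
  norm down to the unramified extension has a valuation that is multiplied by a degree prime to
  \<open>p\<close>.\<close>

theorem kummer_radical_valuation:
  assumes p: "prime (p::nat)" and c: "\<zeta> \<in> carrier R" "\<nu> \<in> carrier R" "\<alpha> \<in> carrier R" "\<nu> \<noteq> \<zero>" "\<alpha> \<noteq> \<zero>"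
    and \<zeta>p: "\<zeta> [^] p = \<one>" "\<zeta> \<noteq> \<one>"
    and conj\<zeta>: "\<And>\<phi>. \<phi> \<in> carrier (galois_group R k) \<Longrightarrow> \<exists>i\<in>{0<..<p}. \<phi> \<zeta> = \<zeta> [^] i"
    and conj\<nu>: "\<And>\<phi>. \<phi> \<in> carrier (galois_group R k) \<Longrightarrow> \<exists>i::nat. \<phi> \<nu> = \<zeta> [^] i \<otimes> \<nu>"
    and conj\<alpha>: "\<And>\<phi>. \<phi> \<in> carrier (galois_group R k) \<Longrightarrow> \<exists>i::nat. \<phi> \<alpha> = \<zeta> [^] i \<otimes> \<alpha>"
    and fixed: "\<And>\<phi>. \<phi> \<in> carrier (galois_group R (k \<union> roots_of_unity \<union> {\<zeta>, \<nu>})) \<Longrightarrow> \<phi> \<alpha> = \<alpha>"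
    and \<nu>p: "\<nu> [^] p = n" "n \<in> A" "n \<noteq> \<zero>" "inv n \<in> A"
    and \<alpha>p: "\<alpha> [^] p = \<varpi> [^] (v::nat) \<otimes> u" "u \<in> A" "u \<noteq> \<zero>" "inv u \<in> A"
  shows "p dvd v"
proof -
  let ?G = "carrier (galois_group R k_unr)"
  have kc: "k_unr \<subseteq> carrier R" using subringE(1)[OF k_unr_subring] .
  have Gk: "\<phi> \<in> carrier (galois_group R k)" if "\<phi> \<in> ?G" for \<phi>
    using galois_mono[OF k_k_unr] that by blast
  have \<zeta>0: "\<zeta> [^] i \<noteq> \<zero>" for i :: nat
  proof -
    have "\<zeta> \<noteq> \<zero>" using \<zeta>p(1) p c(1) prime_gt_0_nat[OF p] by (metis nat_pow_zero neq0_conv one_not_zero)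
    then show ?thesis using c(1) by simp
  qed
  have \<zeta>cong: "\<zeta> [^] i = \<zeta> [^] j" if "[i = j] (mod p)" for i j :: nat
  proof -
    have red: "\<zeta> [^] i = \<zeta> [^] (i mod p)" for i :: nat
    proof -
      have "\<zeta> [^] i = \<zeta> [^] (p * (i div p) + i mod p)" by simp
      also have "\<dots> = (\<zeta> [^] p) [^] (i div p) \<otimes> \<zeta> [^] (i mod p)"
        using c(1) by (simp only: nat_pow_pow nat_pow_mult[symmetric])
      finally show ?thesis using \<zeta>p(1) c(1) by simp
    qed
    show ?thesis using red[of i] red[of j] that unfolding cong_def by simp
  qed
  have gen_galois: "carrier (galois_group R (generate_ring R (k_unr \<union> S))) \<subseteq>
      carrier (galois_group R (k \<union> roots_of_unity \<union> S))" for S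
    by (rule galois_mono) (auto simp: k_unr_def intro!: generate_ring.incl)
  have gen_sub: "subring (generate_ring R (k_unr \<union> S)) R" "k \<subseteq> generate_ring R (k_unr \<union> S)"
    if "S \<subseteq> carrier R" for S
    using that kc k_k_unr by (auto intro!: generate_ring_is_subring generate_ring.incl)
  have agree: "\<phi> x = \<psi> x" if "\<phi> \<in> ?G" "\<psi> \<in> ?G" "x \<in> generate_ring R (k_unr \<union> S)" "S \<subseteq> carrier R"
    "\<And>y. y \<in> S \<Longrightarrow> \<phi> y = \<psi> y" for \<phi> \<psi> x S
    using galois_agree[OF that(1,2,4) kc that(5,3)] .
  have gen_G: "carrier (galois_group R (generate_ring R (k_unr \<union> S))) \<subseteq> ?G" for S
    by (rule galois_mono) (auto intro: generate_ring.incl)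
  have id: "(\<lambda>x\<in>carrier R. x) \<in> ?G"
    unfolding galois_group_def Let_def ring_iso_def using kc
    by (auto simp: ring_hom_def bij_betw_def inj_on_def image_iff)
  have \<alpha>E: "\<alpha> \<in> generate_ring R (k_unr \<union> {\<zeta>, \<nu>})"
    using c gen_galois[of "{\<zeta>, \<nu>}"] fixed by (intro galois_fixed[OF gen_sub]) auto
  let ?H = "{\<phi> \<in> ?G. \<phi> \<zeta> = \<zeta>}"
  \<comment> \<open>On \<open>?H\<close> the conjugates of \<open>\<nu>\<close> and
    \<open>\<alpha>\<close> define characters into the \<open>p\<close>-th roots of unity; the claim
    is that the second is the \<open>i\<close>-th power of the first.\<close>
  have "\<exists>i::nat. \<forall>\<phi>\<in>?H. \<exists>a::nat. \<phi> \<nu> = \<zeta> [^] a \<otimes> \<nu> \<and> \<phi> \<alpha> = \<zeta> [^] (a * i) \<otimes> \<alpha>"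
  proof (cases "\<forall>\<phi>\<in>?H. \<phi> \<nu> = \<nu>")
    \<comment> \<open>By \<open>\<alpha>E\<close>, an automorphism over \<open>k_unr\<close> that
      fixes \<open>\<zeta>\<close> and \<open>\<nu>\<close> fixes \<open>\<alpha>\<close>, so
      \<open>i = 0\<close> serves.\<close>
    case True
    have "\<phi> \<alpha> = \<alpha>" if \<phi>: "\<phi> \<in> ?H" for \<phi>
    proof -
      have "\<phi> \<alpha> = (\<lambda>x\<in>carrier R. x) \<alpha>"
        using \<phi> True c by (intro agree[OF _ id \<alpha>E]) auto
      then show ?thesis using c by simp
    qed
    then show ?thesis using True c by (intro exI[of _ 0] ballI exI[of _ 0]) auto
  next
    case False
    then obtain \<phi>0 where \<phi>0: "\<phi>0 \<in> ?G" "\<phi>0 \<zeta> = \<zeta>" "\<phi>0 \<nu> \<noteq> \<nu>" by blast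
    obtain a0 t0 :: nat where at: "\<phi>0 \<nu> = \<zeta> [^] a0 \<otimes> \<nu>" "\<phi>0 \<alpha> = \<zeta> [^] t0 \<otimes> \<alpha>"
      using conj\<nu> conj\<alpha> Gk[OF \<phi>0(1)] by blast
    have "\<not> p dvd a0"
    proof
      assume "p dvd a0"
      then have "\<zeta> [^] a0 = \<zeta> [^] (0::nat)" by (intro \<zeta>cong) (simp add: cong_0_iff)
      then show False using at(1) \<phi>0(3) c by simp
    qed
    then have "coprime a0 p" using p by (metis coprime_commute prime_imp_coprime)
    \<comment> \<open>\<open>b\<close> inverts \<open>a0\<close> modulo \<open>p\<close>. The
      iterate of \<open>\<phi>0\<close> of order \<open>a * b\<close> then acts on
      \<open>\<nu>\<close> by \<open>\<zeta> [^] a\<close>, like any given automorphism in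
      \<open>?H\<close> with this exponent, and on \<open>\<alpha>\<close> by
      \<open>\<zeta> [^] (a * b * t0)\<close>; so \<open>i\<close> is \<open>b * t0\<close>.\<close>
    then obtain b where b: "[a0 * b = Suc 0] (mod p)" using cong_solve_coprime_nat by blast
    have pow: "\<exists>\<psi>\<in>?H. \<psi> \<nu> = \<zeta> [^] (r * a0) \<otimes> \<nu> \<and> \<psi> \<alpha> = \<zeta> [^] (r * t0) \<otimes> \<alpha>" for r :: nat
    proof (induction r)
      case 0
      show ?case using id c by (intro bexI[of _ "\<lambda>x\<in>carrier R. x"]) auto
    next
      case (Suc r)
      then obtain \<psi> where \<psi>: "\<psi> \<in> ?G" "\<psi> \<zeta> = \<zeta>" "\<psi> \<nu> = \<zeta> [^] (r * a0) \<otimes> \<nu>" "\<psi> \<alpha> = \<zeta> [^] (r * t0) \<otimes> \<alpha>"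
        by blast
      interpret \<psi>: ring_hom_cring R R \<psi> using galoisD[OF \<psi>(1)] by blast
      let ?\<chi> = "compose (carrier R) \<psi> \<phi>0"
      have "?\<chi> \<in> ?G" using galois_compose[OF \<psi>(1) \<phi>0(1) kc] .
      moreover have "?\<chi> \<zeta> = \<zeta>" using \<phi>0 \<psi> c by (simp add: compose_def)
      moreover have "?\<chi> \<nu> = \<zeta> [^] (Suc r * a0) \<otimes> \<nu>" "?\<chi> \<alpha> = \<zeta> [^] (Suc r * t0) \<otimes> \<alpha>"
        using at \<psi> c by (simp_all add: compose_def \<psi>.ring.hom_nat_pow m_assoc[symmetric] nat_pow_mult)
      ultimately show ?case by blast
    qed
    have "\<exists>a::nat. \<phi> \<nu> = \<zeta> [^] a \<otimes> \<nu> \<and> \<phi> \<alpha> = \<zeta> [^] (a * (b * t0)) \<otimes> \<alpha>" if \<phi>: "\<phi> \<in> ?H" for \<phi>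
    proof -
      obtain a :: nat where a: "\<phi> \<nu> = \<zeta> [^] a \<otimes> \<nu>" using conj\<nu> Gk \<phi> by blast
      obtain \<psi> where \<psi>: "\<psi> \<in> ?H" "\<psi> \<nu> = \<zeta> [^] (a * b * a0) \<otimes> \<nu>" "\<psi> \<alpha> = \<zeta> [^] (a * b * t0) \<otimes> \<alpha>"
        using pow[of "a * b"] by blast
      have "[a * (a0 * b) = a * Suc 0] (mod p)" using b by (rule cong_scalar_left)
      then have "\<zeta> [^] (a * b * a0) = \<zeta> [^] a" by (intro \<zeta>cong) (simp add: ac_simps)
      then have "\<phi> \<nu> = \<psi> \<nu>" using a \<psi>(2) by simp
      have "\<phi> \<alpha> = \<psi> \<alpha>"
      proof (rule agree[OF _ _ \<alpha>E])
        show "\<phi> y = \<psi> y" if "y \<in> {\<zeta>, \<nu>}" for y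
          using that \<phi> \<psi>(1) \<open>\<phi> \<nu> = \<psi> \<nu>\<close> by auto
        show "\<phi> \<in> ?G" "\<psi> \<in> ?G" using \<phi> \<psi>(1) by blast+
        show "{\<zeta>, \<nu>} \<subseteq> carrier R" using c(1,2) by simp
      qed
      then show ?thesis using a \<psi>(3) by (intro exI[of _ a]) (simp add: mult.assoc)
    qed
    then show ?thesis by blast
  qed
  then obtain i :: nat where i: "\<And>\<phi>. \<phi> \<in> ?H \<Longrightarrow> \<exists>a::nat. \<phi> \<nu> = \<zeta> [^] a \<otimes> \<nu> \<and> \<phi> \<alpha> = \<zeta> [^] (a * i) \<otimes> \<alpha>" by blast
  define w where "w = inv \<nu>"
  have w: "w \<in> carrier R" "w \<otimes> \<nu> = \<one>" unfolding w_def using c by auto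
  \<comment> \<open>Dividing by the \<open>i\<close>-th power of \<open>\<nu>\<close> removes the
    character: \<open>\<gamma>\<close> is invariant under \<open>?H\<close>.\<close>
  define \<gamma> where "\<gamma> = \<alpha> \<otimes> w [^] i"
  have \<gamma>c: "\<gamma> \<in> carrier R" unfolding \<gamma>_def using c w by simp
  have \<gamma>\<nu>: "\<gamma> \<otimes> \<nu> [^] i = \<alpha>"
  proof -
    have "\<gamma> \<otimes> \<nu> [^] i = \<alpha> \<otimes> (w \<otimes> \<nu>) [^] i" unfolding \<gamma>_def using c w(1) by (simp add: nat_pow_distrib m_assoc)
    then show ?thesis unfolding w(2) using c by simp
  qed
  have "\<phi> \<gamma> = \<gamma>" if \<phi>: "\<phi> \<in> ?H" for \<phi>
  proof -
    interpret \<phi>: ring_hom_cring R R \<phi> using galoisD \<phi> by blast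
    obtain a :: nat where a: "\<phi> \<nu> = \<zeta> [^] a \<otimes> \<nu>" "\<phi> \<alpha> = \<zeta> [^] (a * i) \<otimes> \<alpha>" using i[OF \<phi>] by blast
    define Z V where "Z = \<zeta> [^] (a * i)" "V = \<nu> [^] i"
    have ZV: "Z \<in> carrier R" "V \<in> carrier R" "Z \<otimes> V \<noteq> \<zero>"
      unfolding Z_V_def using c \<zeta>0[of "a * i"] integral[of "\<zeta> [^] (a * i)" "\<nu> [^] i"] by auto
    have "\<phi> (\<gamma> \<otimes> \<nu> [^] i) = \<phi> \<gamma> \<otimes> (\<zeta> [^] a \<otimes> \<nu>) [^] i"
      using \<gamma>c c a(1) by (simp add: \<phi>.ring.hom_nat_pow)
    also have "(\<zeta> [^] a \<otimes> \<nu>) [^] i = Z \<otimes> V" unfolding Z_V_def using c by (simp add: nat_pow_distrib nat_pow_pow)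
    finally have "\<phi> \<gamma> \<otimes> (Z \<otimes> V) = \<phi> \<alpha>" unfolding \<gamma>\<nu> by simp
    also have "\<dots> = Z \<otimes> (\<gamma> \<otimes> V)" unfolding a(2) Z_V_def \<gamma>\<nu> ..
    also have "\<dots> = \<gamma> \<otimes> (Z \<otimes> V)" using ZV \<gamma>c by (simp add: m_lcomm)
    finally show ?thesis using m_rcancel[of "Z \<otimes> V" "\<phi> \<gamma>" \<gamma>] ZV \<gamma>c by auto
  qed
  then have \<gamma>E: "\<gamma> \<in> generate_ring R (k_unr \<union> {\<zeta>})"
  proof (intro galois_fixed[OF gen_sub])
    fix \<phi> assume \<phi>: "\<phi> \<in> carrier (galois_group R (generate_ring R (k_unr \<union> {\<zeta>})))"
    have "\<phi> \<zeta> = \<zeta>" using galoisD(2)[OF \<phi>] by (auto intro: generate_ring.incl)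
    then show "\<phi> \<gamma> = \<gamma>" if "\<And>\<phi>. \<phi> \<in> ?H \<Longrightarrow> \<phi> \<gamma> = \<gamma>" using that gen_G \<phi> by blast
  qed (use c \<gamma>c in auto)
  have nc: "n \<in> carrier R" "inv n \<in> carrier R" "u \<in> carrier R" "inv u \<in> carrier R" using \<nu>p \<alpha>p by auto
  \<comment> \<open>Passing from \<open>\<alpha>\<close> to \<open>\<gamma>\<close> changes the
    radicand only by the unit \<open>inv n [^] i\<close>, so the valuation \<open>v\<close> is
    preserved.\<close>
  define u' where "u' = u \<otimes> inv n [^] i"
  define d where "d = \<varpi> [^] v \<otimes> u'"
  have u'A: "u' \<in> A" unfolding u'_def using \<nu>p \<alpha>p subringE(6)[OF A_subring] pow_in_subring[OF A_subring] by blast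
  then have u'c: "u' \<in> carrier R" by simp
  have u'inv: "u' \<otimes> (inv u \<otimes> n [^] i) = \<one>"
  proof -
    have "u' \<otimes> (inv u \<otimes> n [^] i) = (u \<otimes> inv u) \<otimes> (inv n \<otimes> n) [^] i"
      unfolding u'_def using nc by (simp add: nat_pow_distrib m_ac)
    then show ?thesis using nc \<nu>p(3) \<alpha>p(3) by simp
  qed
  have \<gamma>p: "\<gamma> [^] p = d"
  proof -
    have "w [^] p \<otimes> n = \<one>" unfolding \<nu>p(1)[symmetric] using w c by (simp add: nat_pow_distrib[symmetric])
    then have "inv n = w [^] p" using nc(1) w(1) comm_inv_char[of n "w [^] p"] by (simp add: m_comm)
    moreover have "\<gamma> [^] p = \<alpha> [^] p \<otimes> (w [^] p) [^] i"
      unfolding \<gamma>_def using c w by (simp add: nat_pow_distrib nat_pow_pow mult.commute)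
    ultimately show ?thesis unfolding d_def u'_def \<alpha>p(1) using nc by (simp add: m_assoc)
  qed
  have dk: "d \<in> k_unr"
    unfolding d_def using u'A A_k k_k_unr pow_in_subring[OF k_unr_subring nat_in_subring[OF k_unr_subring]]
      subringE(6)[OF k_unr_subring] by blast
  have dc: "d \<in> carrier R" unfolding d_def using u'c by simp
  \<comment> \<open>The conjugates of \<open>\<zeta>\<close> over \<open>k_unr\<close>, the index
    set of the norm. They are powers of \<open>\<zeta>\<close> with exponent in
    \<open>{0<..<p}\<close>, so their number is positive and below \<open>p\<close>.\<close>
  define J where "J = (\<lambda>\<phi>. \<phi> \<zeta>) ` ?G"
  have Jsub: "J \<subseteq> (\<lambda>i. \<zeta> [^] i) ` {0<..<p}" unfolding J_def using conj\<zeta> Gk by blast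
  then have finJ: "finite J" by (rule finite_subset) simp
  have \<zeta>J: "\<zeta> \<in> J" unfolding J_def using c by (intro image_eqI[OF _ id]) simp
  have "card J \<le> card {0<..<p}"
    using Jsub by (rule surj_card_le[rotated]) simp
  then have cardJ: "0 < card J" "card J < p" using finJ \<zeta>J prime_gt_0_nat[OF p] card_gt_0_iff by fastforce+
  have Jc: "\<theta> \<in> carrier R" if "\<theta> \<in> J" for \<theta> using Jsub that c by auto
  have "\<exists>\<phi>. \<phi> \<in> ?G \<and> \<phi> \<zeta> = \<theta>" if "\<theta> \<in> J" for \<theta> using that unfolding J_def by blast
  then obtain s where s: "\<And>\<theta>. \<theta> \<in> J \<Longrightarrow> s \<theta> \<in> ?G" "\<And>\<theta>. \<theta> \<in> J \<Longrightarrow> s \<theta> \<zeta> = \<theta>" by metis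
  have sc: "s \<theta> \<gamma> \<in> carrier R" if "\<theta> \<in> J" for \<theta> using galoisD(4)[OF s(1)[OF that] \<gamma>c] .
  \<comment> \<open>The norm of \<open>\<gamma>\<close> down to \<open>k_unr\<close>. All factors
    have the same \<open>p\<close>-th power \<open>d\<close>, so \<open>nm [^] p\<close> has
    valuation \<open>v * card J\<close>.\<close>
  define nm where "nm = finprod R (\<lambda>\<theta>. s \<theta> \<gamma>) J"
  have "nm \<in> k_unr"
  proof (rule galois_fixed[OF k_unr_subring k_k_unr])
    show "nm \<in> carrier R" unfolding nm_def using sc by (intro finprod_closed) auto
    fix \<tau> assume \<tau>: "\<tau> \<in> ?G"
    interpret \<tau>: ring_hom_cring R R \<tau> using galoisD[OF \<tau>] by blast
    have \<tau>\<zeta>: "compose (carrier R) \<tau> (s \<theta>) \<zeta> = \<tau> \<theta>" if "\<theta> \<in> J" for \<theta>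
      using s(2)[OF that] c by (simp add: compose_def)
    have \<tau>J: "\<tau> \<theta> \<in> J" if "\<theta> \<in> J" for \<theta>
      unfolding J_def using galois_compose[OF \<tau> s(1)[OF that] kc] \<tau>\<zeta>[OF that] by (intro image_eqI) auto
    have eq: "\<tau> (s \<theta> \<gamma>) = s (\<tau> \<theta>) \<gamma>" if "\<theta> \<in> J" for \<theta>
    proof -
      have "compose (carrier R) \<tau> (s \<theta>) \<gamma> = s (\<tau> \<theta>) \<gamma>"
      proof (rule agree[OF galois_compose[OF \<tau> s(1)[OF that] kc] s(1)[OF \<tau>J[OF that]] \<gamma>E])
        fix y assume "y \<in> {\<zeta>}"
        then show "compose (carrier R) \<tau> (s \<theta>) y = s (\<tau> \<theta>) y"
          using \<tau>\<zeta>[OF that] s(2)[OF \<tau>J[OF that]] by simp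
      qed (use c in simp)
      then show ?thesis using \<gamma>c by (simp add: compose_def)
    qed
    have "\<tau> nm = finprod R (\<lambda>\<theta>. \<tau> (s \<theta> \<gamma>)) J"
      unfolding nm_def using \<tau>.hom_finprod[of "\<lambda>\<theta>. s \<theta> \<gamma>" J] sc by (simp add: comp_def Pi_def)
    also have "\<dots> = finprod R (\<lambda>\<theta>. s (\<tau> \<theta>) \<gamma>) J"
      using eq sc \<tau>J by (intro finprod_cong') auto
    also have "\<dots> = nm" unfolding nm_def
    proof (rule finprod_bij[OF finJ])
      show "inj_on \<tau> J" using inj_on_subset[OF galoisD(3)[OF \<tau>]] Jc by blast
    qed (use \<tau>J sc in auto)
    finally show "\<tau> nm = nm" .
  qed
  moreover have "nm [^] p = \<varpi> [^] (v * card J) \<otimes> u' [^] card J"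
  proof -
    have "s \<theta> \<gamma> [^] p = d" if "\<theta> \<in> J" for \<theta>
    proof -
      interpret s: ring_hom_cring R R "s \<theta>" using galoisD s(1)[OF that] by blast
      have "s \<theta> \<gamma> [^] p = s \<theta> d" using \<gamma>c \<gamma>p s.ring.hom_nat_pow[OF \<gamma>c, of p] by simp
      then show ?thesis using galoisD(2)[OF s(1)[OF that] dk] by simp
    qed
    then have "finprod R (\<lambda>\<theta>. s \<theta> \<gamma> [^] p) J = finprod R (\<lambda>\<theta>. d) J"
      using dc by (intro finprod_cong') auto
    then have "nm [^] p = finprod R (\<lambda>\<theta>. d) J"
      unfolding nm_def using finprod_nat_pow[of J "\<lambda>\<theta>. s \<theta> \<gamma>" p] finJ sc by simp
    also have "\<dots> = d [^] card J" using dc by (simp add: finprod_const)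
    finally show ?thesis unfolding d_def using u'c by (simp add: nat_pow_distrib nat_pow_pow)
  qed
  moreover have "u' [^] card J \<in> A" using u'A pow_in_subring[OF A_subring] by blast
  moreover have u'0: "u' \<noteq> \<zero>" using u'inv nc by auto
  moreover have "inv (u' [^] card J) \<in> A"
  proof -
    define u'' where "u'' = inv u \<otimes> n [^] i"
    have u'': "u'' \<in> A" unfolding u''_def
      using \<nu>p \<alpha>p subringE(6)[OF A_subring] pow_in_subring[OF A_subring] by blast
    then have "u' [^] card J \<otimes> u'' [^] card J = \<one>"
      using u'inv u'c unfolding u''_def[symmetric] by (simp add: nat_pow_distrib[symmetric])
    then have "inv (u' [^] card J) = u'' [^] card J" using u'' u'c by (intro comm_inv_char) auto
    then show ?thesis using u'' pow_in_subring[OF A_subring] by simp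
  qed
  ultimately have "p dvd v * card J"
    using k_unr_power_valuation[OF _ p, of nm "u' [^] card J" "v * card J"] u'c by simp
  then show ?thesis using p cardJ by (metis nat_dvd_not_less prime_dvd_mult_iff)
qed

end

section \<open>The l-adic numbers\<close>

locale padic_prime =
  fixes l :: nat
  assumes prime_l: "prime l"
begin

abbreviation v :: "rat \<Rightarrow> real" where "v \<equiv> padic_abs l"

lemma l_gt1: "1 < l"
  using prime_l prime_gt_1_nat by blast

text \<open>Any representation as a fraction may be used, not only the reduced one given by
  \<open>quotient_of\<close>: the two sides of the cross multiplied equation have the same
  multiplicity.\<close>

lemma v_fraction:
  fixes a b :: int
  assumes "a \<noteq> 0" "b \<noteq> 0"
  shows "v (of_int a / of_int b) = real l powi (int (multiplicity (int l) b) - int (multiplicity (int l) a))"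
proof -
  let ?x = "of_int a / of_int b :: rat"
  obtain c d where cd: "quotient_of ?x = (c, d)" by (cases "quotient_of ?x")
  have x: "?x = of_int c / of_int d" and d: "d > 0"
    using quotient_of_div[OF cd] quotient_of_denom_pos[OF cd] by auto
  have x0: "?x \<noteq> 0" using assms by simp
  then have c: "c \<noteq> 0" using x by auto
  have "of_int (a * d) = (of_int (c * b) :: rat)" using x assms d by (simp add: field_simps)
  then have eq: "a * d = c * b" by (simp only: of_int_eq_iff)
  have pe: "prime_elem (int l)" using prime_l by simp
  have "multiplicity (int l) a + multiplicity (int l) d = multiplicity (int l) c + multiplicity (int l) b"
    using arg_cong[OF eq, of "multiplicity (int l)"] pe assms c d
    by (simp add: prime_elem_multiplicity_mult_distrib)
  then have "int (multiplicity (int l) d) - int (multiplicity (int l) c) =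
      int (multiplicity (int l) b) - int (multiplicity (int l) a)" by linarith
  then show ?thesis unfolding padic_abs_def cd using x0 by simp
qed

lemma fraction_cases: obtains a b :: int where "(x::rat) = of_int a / of_int b" "b \<noteq> 0"
  by (metis quotient_of_div quotient_of_denom_pos less_irrefl surj_pair)

lemma v_0 [simp]: "v 0 = 0"
  by (simp add: padic_abs_def)

lemma v_pos: "x \<noteq> 0 \<Longrightarrow> 0 < v x"
  using l_gt1 by (simp add: padic_abs_def)

lemma v_eq_0_iff [simp]: "v x = 0 \<longleftrightarrow> x = 0"
  using v_pos[of x] by (cases "x = 0") auto

lemma v_nonneg [simp]: "0 \<le> v x"
  using v_pos[of x] by (cases "x = 0") auto

lemma v_mult: "v (x * y) = v x * v y"
proof (cases "x = 0 \<or> y = 0")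
  case False
  obtain a b where ab: "x = of_int a / of_int b" "b \<noteq> 0" by (rule fraction_cases)
  obtain c d where cd: "y = of_int c / of_int d" "d \<noteq> 0" by (rule fraction_cases)
  have nz: "a \<noteq> 0" "c \<noteq> 0" using False ab cd by auto
  have pe: "prime_elem (int l)" using prime_l by simp
  have "x * y = of_int (a * c) / of_int (b * d)" using ab cd by simp
  then have "v (x * y) = real l powi (int (multiplicity (int l) (b * d)) - int (multiplicity (int l) (a * c)))"
    using v_fraction[of "a * c" "b * d"] nz ab cd by simp
  also have "\<dots> = real l powi ((int (multiplicity (int l) b) - int (multiplicity (int l) a)) +
      (int (multiplicity (int l) d) - int (multiplicity (int l) c)))"
    using pe nz ab cd by (simp add: prime_elem_multiplicity_mult_distrib algebra_simps)
  also have "\<dots> = v x * v y" using ab cd nz v_fraction l_gt1 by (simp add: power_int_add)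
  finally show ?thesis .
qed auto

lemma v_1 [simp]: "v 1 = 1"
  using v_mult[of 1 1] v_pos[of 1] by simp

lemma v_minus [simp]: "v (- x) = v x"
proof -
  have "v (-1) * v (-1) = 1" using v_mult[of "-1" "-1"] by simp
  then have "(v (-1))\<^sup>2 = 1" by (simp add: power2_eq_square)
  then have "v (-1) = 1" using v_nonneg[of "-1"] unfolding power2_eq_1_iff by linarith
  then show ?thesis using v_mult[of "-1" x] by simp
qed

lemma v_inverse: "v (inverse x) = inverse (v x)"
proof (cases "x = 0")
  case False
  then have "v x * v (inverse x) = 1" using v_mult[of x "inverse x"] by simp
  then show ?thesis by (simp add: inverse_unique)
qed simp

lemma v_divide: "v (x / y) = v x / v y"
  by (simp add: divide_inverse v_mult v_inverse)

lemma v_power: "v (x ^ n) = v x ^ n"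
  by (induction n) (auto simp: v_mult)

lemma v_ultra: "v (x + y) \<le> max (v x) (v y)"
proof (cases "x = 0 \<or> y = 0 \<or> x + y = 0")
  case True
  then show ?thesis by (auto simp: max_def)
next
  case False
  obtain a b where ab: "x = of_int a / of_int b" "b \<noteq> 0" by (rule fraction_cases)
  obtain c d where cd: "y = of_int c / of_int d" "d \<noteq> 0" by (rule fraction_cases)
  define e f g where "e = a * d" "f = c * b" "g = b * d"
  have g: "g \<noteq> 0" unfolding e_f_g_def using ab cd by simp
  have x: "x = of_int e / of_int g" and y: "y = of_int f / of_int g"
    and xy: "x + y = of_int (e + f) / of_int g"
    using ab cd unfolding e_f_g_def by (auto simp: field_simps)
  have nz: "e \<noteq> 0" "f \<noteq> 0" "e + f \<noteq> 0" using False x y xy by auto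
  define m where "m = min (multiplicity (int l) e) (multiplicity (int l) f)"
  have "int l ^ m dvd e + f"
    by (intro dvd_add) (auto simp: m_def intro!: multiplicity_dvd')
  moreover have "\<not> is_unit (int l)" using l_gt1 by simp
  ultimately have "m \<le> multiplicity (int l) (e + f)" using nz by (intro multiplicity_geI) auto
  then have "v (x + y) \<le> real l powi (int (multiplicity (int l) g) - int m)"
    unfolding xy using v_fraction[of "e + f" g] nz g l_gt1 by (auto intro!: power_int_increasing)
  also have "\<dots> \<le> max (v x) (v y)"
    unfolding x y using v_fraction nz g by (auto simp: m_def min_def max_def)
  finally show ?thesis .
qed

lemma v_add_le: "v x \<le> c \<Longrightarrow> v y \<le> c \<Longrightarrow> v (x + y) \<le> c"
  using v_ultra[of x y] by linarith

lemma v_diff_le: "v x \<le> c \<Longrightarrow> v y \<le> c \<Longrightarrow> v (x - y) \<le> c"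
  using v_add_le[of x c "- y"] by simp

lemma v_diff_less: "v x < c \<Longrightarrow> v y < c \<Longrightarrow> v (x - y) < c"
  using v_ultra[of x "- y"] by simp

lemma v_add_less: "v x < c \<Longrightarrow> v y < c \<Longrightarrow> v (x + y) < c"
  using v_ultra[of x y] by linarith

lemma v_commute: "v (x - y) = v (y - x)"
  using v_minus[of "x - y"] by simp

text \<open>The isosceles property: of three ultrametric distances the two largest agree.\<close>

lemma v_eqI: "v (x - y) < v y \<Longrightarrow> v x = v y"
  using v_add_less[of "x - y" "v y" y] v_ultra[of "x - y" y] v_ultra[of "y - x" x] v_commute[of x y]
  by (auto simp: max_def split: if_splits)

lemma v_int_le: "v (of_int n) \<le> 1"
proof (cases "n = 0")
  case False
  then have "v (of_int n / of_int 1) = real l powi (- int (multiplicity (int l) n))"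
    using v_fraction[of n 1] by simp
  also have "\<dots> \<le> real l powi 0" using l_gt1 by (intro power_int_increasing) auto
  finally show ?thesis by simp
qed simp

lemma v_l: "v (of_nat l) = 1 / real l"
proof -
  have "v (of_int (int l) / of_int 1) = real l powi (- 1)"
    using v_fraction[of "int l" 1] l_gt1 multiplicity_self[of "int l"] by simp
  then show ?thesis by (simp add: power_int_minus field_simps)
qed

lemma v_l_power: "v (of_nat l ^ n) = (1 / real l) ^ n"
  by (simp add: v_power v_l)

lemma v_powi: "x \<noteq> 0 \<Longrightarrow> \<exists>e. v x = real l powi e"
  unfolding padic_abs_def by auto

lemma v_le_1E:
  assumes "v x \<le> 1"
  obtains a b :: int where "x = of_int a / of_int b" "\<not> int l dvd b"
proof -
  obtain a b where ab: "quotient_of x = (a, b)" by (cases "quotient_of x")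
  have x: "x = of_int a / of_int b" and b: "b > 0" and co: "coprime a b"
    using quotient_of_div[OF ab] quotient_of_denom_pos[OF ab] quotient_of_coprime[OF ab] by auto
  have "\<not> int l dvd b"
  proof
    assume d: "int l dvd b"
    then have na: "\<not> int l dvd a" using co l_gt1
      by (metis coprime_common_divisor int_one_le_iff_zero_less int_dvd_int_iff nat_dvd_1_iff_1
          of_nat_1 less_irrefl)
    then have a0: "a \<noteq> 0" by auto
    have "multiplicity (int l) a = 0" using na by (simp add: not_dvd_imp_multiplicity_0)
    moreover have "0 < multiplicity (int l) b" using d b l_gt1 by (simp add: multiplicity_gt_zero_iff)
    ultimately have "v x = real l powi int (multiplicity (int l) b)" "1 < real l ^ multiplicity (int l) b"
      using v_fraction[of a b] a0 b l_gt1 unfolding x by auto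
    then show False using assms by simp
  qed
  then show ?thesis using that x by blast
qed

lemma small_power: "0 < e \<Longrightarrow> \<exists>n. (1 / real l) ^ n < e"
  using real_arch_pow_inv[of e "1 / real l"] l_gt1 by simp

section \<open>Cauchy sequences, null sequences and the quotient field\<close>

abbreviation C :: "(nat \<Rightarrow> rat) ring" where "C \<equiv> padic_cauchy_ring l"

lemma C_simps [simp]:
  "f \<otimes>\<^bsub>C\<^esub> g = (\<lambda>n. f n * g n)" "f \<oplus>\<^bsub>C\<^esub> g = (\<lambda>n. f n + g n)"
  "\<one>\<^bsub>C\<^esub> = (\<lambda>_. 1)" "\<zero>\<^bsub>C\<^esub> = (\<lambda>_. 0)"
  by (auto simp: padic_cauchy_ring_def)

lemma C_iff: "f \<in> carrier C \<longleftrightarrow> (\<forall>e>0. \<exists>M. \<forall>m\<ge>M. \<forall>n\<ge>M. v (f m - f n) < e)"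
  by (simp add: padic_cauchy_ring_def)

lemma C_const: "(\<lambda>_. r) \<in> carrier C"
  by (simp add: C_iff)

lemma C_bounded:
  assumes "f \<in> carrier C" shows "\<exists>B>0. \<forall>n. v (f n) \<le> B"
proof -
  obtain M where M: "\<forall>m\<ge>M. \<forall>n\<ge>M. v (f m - f n) < 1"
    using spec[OF assms[unfolded C_iff], of 1] by auto
  define B where "B = Max (insert 1 ((\<lambda>i. v (f i)) ` {..M}))"
  have B: "1 \<le> B" "\<And>i. i \<le> M \<Longrightarrow> v (f i) \<le> B" unfolding B_def by (rule Max_ge; simp)+
  have "v (f n) \<le> B" for n
  proof (cases "n \<le> M")
    case False
    then have "v (f n - f M) \<le> B" using M B(1) by (meson le_refl less_imp_le nat_le_linear order_trans)
    then show ?thesis using v_add_le[of "f n - f M" B "f M"] B(2)[of M] by simp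
  qed (use B in simp)
  then show ?thesis using B(1) by (intro exI[of _ B]) auto
qed

lemma C_add: "f \<in> carrier C \<Longrightarrow> g \<in> carrier C \<Longrightarrow> (\<lambda>n. f n + g n) \<in> carrier C"
  unfolding C_iff
proof (intro allI impI)
  fix e :: real assume f: "\<forall>e>0. \<exists>M. \<forall>m\<ge>M. \<forall>n\<ge>M. v (f m - f n) < e"
    and g: "\<forall>e>0. \<exists>M. \<forall>m\<ge>M. \<forall>n\<ge>M. v (g m - g n) < e" and "0 < e"
  then obtain M1 M2 where M: "\<forall>m\<ge>M1. \<forall>n\<ge>M1. v (f m - f n) < e" "\<forall>m\<ge>M2. \<forall>n\<ge>M2. v (g m - g n) < e" by meson
  have "v (f m + g m - (f n + g n)) < e" if "m \<ge> max M1 M2" "n \<ge> max M1 M2" for m n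
    using v_add_less[of "f m - f n" e "g m - g n"] M that by (simp add: algebra_simps)
  then show "\<exists>M. \<forall>m\<ge>M. \<forall>n\<ge>M. v (f m + g m - (f n + g n)) < e" by blast
qed

lemma C_uminus: "f \<in> carrier C \<Longrightarrow> (\<lambda>n. - f n) \<in> carrier C"
  unfolding C_iff by (simp add: v_commute)

lemma C_mult: assumes f: "f \<in> carrier C" and g: "g \<in> carrier C" shows "(\<lambda>n. f n * g n) \<in> carrier C"
  unfolding C_iff
proof (intro allI impI)
  fix e :: real assume e: "0 < e"
  obtain B1 B2 where B: "B1 > 0" "\<And>n. v (f n) \<le> B1" "B2 > 0" "\<And>n. v (g n) \<le> B2"
    using C_bounded[OF f] C_bounded[OF g] by blast
  have "0 < e / B2" "0 < e / B1" using e B by auto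
  then obtain M1 M2 where M: "\<forall>m\<ge>M1. \<forall>n\<ge>M1. v (f m - f n) < e / B2" "\<forall>m\<ge>M2. \<forall>n\<ge>M2. v (g m - g n) < e / B1"
    using f g unfolding C_iff by meson
  have "v (f m * g m - f n * g n) < e" if "m \<ge> max M1 M2" "n \<ge> max M1 M2" for m n
  proof -
    have "v (f m * (g m - g n)) < e"
    proof -
      have "v (f m) * v (g m - g n) \<le> B1 * v (g m - g n)" using B by (intro mult_right_mono) auto
      also have "\<dots> < B1 * (e / B1)" using M that B by (intro mult_strict_left_mono) auto
      finally show ?thesis using B by (simp add: v_mult)
    qed
    moreover have "v (g n * (f m - f n)) < e"
    proof -
      have "v (g n) * v (f m - f n) \<le> B2 * v (f m - f n)" using B by (intro mult_right_mono) auto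
      also have "\<dots> < B2 * (e / B2)" using M that B by (intro mult_strict_left_mono) auto
      finally show ?thesis using B by (simp add: v_mult)
    qed
    ultimately show ?thesis using v_add_less[of "f m * (g m - g n)" e "g n * (f m - f n)"]
      by (simp add: algebra_simps)
  qed
  then show "\<exists>M. \<forall>m\<ge>M. \<forall>n\<ge>M. v (f m * g m - f n * g n) < e" by blast
qed

lemma C_cring: "cring C"
proof (rule cringI)
  show "abelian_group C"
  proof (rule abelian_groupI)
    fix f assume "f \<in> carrier C"
    then show "\<exists>g\<in>carrier C. g \<oplus>\<^bsub>C\<^esub> f = \<zero>\<^bsub>C\<^esub>"
      using C_uminus[of f] by (intro bexI[of _ "\<lambda>n. - f n"]) auto
  qed (auto simp: C_add C_const algebra_simps)
  show "Group.comm_monoid C"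
    by (rule comm_monoidI) (auto simp: C_mult C_const algebra_simps)
qed (auto simp: algebra_simps)

lemma C_a_inv: "f \<in> carrier C \<Longrightarrow> \<ominus>\<^bsub>C\<^esub> f = (\<lambda>n. - f n)"
proof -
  interpret C: cring C by (rule C_cring)
  assume "f \<in> carrier C"
  then show ?thesis using C_uminus by (intro C.minus_equality) auto
qed

abbreviation N :: "(nat \<Rightarrow> rat) set" where "N \<equiv> padic_null l"

lemma N_iff: "f \<in> N \<longleftrightarrow> (\<forall>e>0. \<exists>M. \<forall>n\<ge>M. v (f n) < e)"
  unfolding padic_null_def by (simp add: LIMSEQ_iff)

lemma N_C: "f \<in> N \<Longrightarrow> f \<in> carrier C"
  unfolding N_iff C_iff using v_diff_less by meson

lemma N_eventually_0: "(\<And>n. n \<ge> M \<Longrightarrow> f n = 0) \<Longrightarrow> f \<in> N"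
  unfolding N_iff by (metis v_0)

lemma N_ideal: "ideal N C"
proof -
  interpret C: cring C by (rule C_cring)
  show ?thesis
  proof (rule C.ring_axioms[THEN idealI])
    show "subgroup N (add_monoid C)"
    proof
      show "N \<subseteq> carrier (add_monoid C)" using N_C by auto
      fix f g assume f: "f \<in> N" and g: "g \<in> N"
      show "f \<otimes>\<^bsub>add_monoid C\<^esub> g \<in> N" unfolding N_iff
      proof (intro allI impI)
        fix e :: real assume "0 < e"
        then obtain M1 M2 where "\<forall>n\<ge>M1. v (f n) < e" "\<forall>n\<ge>M2. v (g n) < e" using f g unfolding N_iff by meson
        then show "\<exists>M. \<forall>n\<ge>M. v ((f \<otimes>\<^bsub>add_monoid C\<^esub> g) n) < e"
          by (intro exI[of _ "max M1 M2"]) (auto intro: v_add_less)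
      qed
    next
      show "\<one>\<^bsub>add_monoid C\<^esub> \<in> N" by (simp add: N_iff)
    next
      fix f assume f: "f \<in> N"
      then have "inv\<^bsub>add_monoid C\<^esub> f = (\<lambda>n. - f n)"
        using C_a_inv[OF N_C[OF f]] by (simp add: a_inv_def)
      then show "inv\<^bsub>add_monoid C\<^esub> f \<in> N" using f by (simp add: N_iff)
    qed
    have *: "(\<lambda>n. g n * f n) \<in> N" if f: "f \<in> N" and g: "g \<in> carrier C" for f g
      unfolding N_iff
    proof (intro allI impI)
      fix e :: real assume "0 < e"
      obtain B where B: "B > 0" "\<And>n. v (g n) \<le> B" using C_bounded[OF g] by blast
      then have "0 < e / B" using \<open>0 < e\<close> by simp
      then obtain M where M: "\<forall>n\<ge>M. v (f n) < e / B" using f unfolding N_iff by meson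
      have "v (g n * f n) < e" if "n \<ge> M" for n
      proof -
        have "v (g n) * v (f n) \<le> B * v (f n)" using B by (intro mult_right_mono) auto
        also have "\<dots> < B * (e / B)" using M that B by (intro mult_strict_left_mono) auto
        finally show ?thesis using B by (simp add: v_mult)
      qed
      then show "\<exists>M. \<forall>n\<ge>M. v (g n * f n) < e" by blast
    qed
    then show "g \<otimes>\<^bsub>C\<^esub> f \<in> N" if "f \<in> N" "g \<in> carrier C" for f g using that by simp
    show "f \<otimes>\<^bsub>C\<^esub> g \<in> N" if "f \<in> N" "g \<in> carrier C" for f g using *[OF that] by (simp add: mult.commute)
  qed
qed

text \<open>The sequence is Cauchy and infinitely often bounded away from zero, so the isosceles
  property makes its absolute value eventually constant; nonzero rationals take only powers of
  \<open>l\<close> as values.\<close>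

lemma C_eventually_constant_abs:
  assumes f: "f \<in> carrier C" "f \<notin> N"
  shows "\<exists>M. \<exists>e::int. \<forall>n\<ge>M. v (f n) = real l powi e"
proof -
  obtain e where e: "0 < e" "\<And>M. \<exists>n\<ge>M. e \<le> v (f n)" using f(2) unfolding N_iff by (meson not_less)
  obtain M where M: "\<forall>m\<ge>M. \<forall>n\<ge>M. v (f m - f n) < e" using f(1) e(1) unfolding C_iff by meson
  obtain m where m: "m \<ge> M" "e \<le> v (f m)" using e(2) by blast
  have "v (f n) = v (f m)" if "n \<ge> M" for n
    using M m that by (intro v_eqI) force
  moreover have "f m \<noteq> 0" using m e by auto
  ultimately show ?thesis using v_powi by metis
qed

text \<open>Only finitely many terms vanish, where \<open>inverse 0 = 0\<close> does no harm; beyond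
  them the constant absolute value bounds the differences of the inverses.\<close>

lemma C_inverse:
  assumes f: "f \<in> carrier C" "f \<notin> N"
  shows "(\<lambda>n. inverse (f n)) \<in> carrier C" "(\<lambda>n. f n * inverse (f n) - 1) \<in> N"
proof -
  obtain M and i :: int where Mi: "\<And>n. n \<ge> M \<Longrightarrow> v (f n) = real l powi i"
    using C_eventually_constant_abs[OF f] by blast
  define r where "r = real l powi i"
  have r: "0 < r" unfolding r_def using l_gt1 by simp
  have nz: "f n \<noteq> 0" if "n \<ge> M" for n using Mi[OF that] r unfolding r_def by auto
  show "(\<lambda>n. f n * inverse (f n) - 1) \<in> N" using nz by (intro N_eventually_0[of M]) auto
  show "(\<lambda>n. inverse (f n)) \<in> carrier C" unfolding C_iff
  proof (intro allI impI)
    fix e :: real assume "0 < e"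
    then have "0 < e * (r * r)" using r by simp
    then obtain M' where M': "\<forall>m\<ge>M'. \<forall>n\<ge>M'. v (f m - f n) < e * (r * r)" using f(1) unfolding C_iff by meson
    have "v (inverse (f m) - inverse (f n)) < e" if "m \<ge> max M M'" "n \<ge> max M M'" for m n
    proof -
      have "inverse (f m) - inverse (f n) = (f n - f m) / (f m * f n)"
        using nz[of m] nz[of n] that by (simp add: field_simps)
      then have "v (inverse (f m) - inverse (f n)) = v (f n - f m) / (r * r)"
        using Mi[of m] Mi[of n] that by (simp add: v_divide v_mult r_def)
      also have "\<dots> < e" using M' that r by (simp add: field_simps)
      finally show ?thesis .
    qed
    then show "\<exists>M. \<forall>m\<ge>M. \<forall>n\<ge>M. v (inverse (f m) - inverse (f n)) < e" by blast
  qed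
qed

definition cls :: "(nat \<Rightarrow> rat) \<Rightarrow> padic" where "cls f = N +>\<^bsub>C\<^esub> f"

lemma cls_hom: "cls \<in> ring_hom C (padic_field l)"
  unfolding padic_field_def cls_def[abs_def] by (rule ideal.rcos_ring_hom[OF N_ideal])

lemma cls_surj: "carrier (padic_field l) = cls ` carrier C"
  unfolding padic_field_def FactRing_def A_RCOSETS_def' cls_def by auto

lemma cls_eq_iff:
  assumes "f \<in> carrier C" "g \<in> carrier C" shows "cls f = cls g \<longleftrightarrow> (\<lambda>n. f n - g n) \<in> N"
proof -
  interpret C: cring C by (rule C_cring)
  have "f \<ominus>\<^bsub>C\<^esub> g = (\<lambda>n. f n - g n)" using C_a_inv[OF assms(2)] by (simp add: a_minus_def)
  then show ?thesis unfolding cls_def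
    using C.quotient_eq_iff_same_a_r_cos[OF N_ideal assms] by simp
qed

lemma cls_mem: assumes "g \<in> cls f" "f \<in> carrier C" shows "g \<in> carrier C" "cls g = cls f"
proof -
  obtain h where h: "h \<in> N" "g = (\<lambda>n. h n + f n)"
    using assms(1) unfolding cls_def a_r_coset_def' by auto
  show gC: "g \<in> carrier C" unfolding h(2) using C_add[OF N_C[OF h(1)] assms(2)] .
  show "cls g = cls f" unfolding cls_eq_iff[OF gC assms(2)] using h by simp
qed

lemma cls_self: "f \<in> carrier C \<Longrightarrow> f \<in> cls f"
  unfolding cls_def a_r_coset_def' by (auto intro!: bexI[of _ "\<lambda>_. 0"] simp: N_iff)

lemma padic_field_cring: "cring (padic_field l)"
  unfolding padic_field_def using ideal.quotient_is_cring[OF N_ideal C_cring] .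

lemma padic_field_field: "field (padic_field l)"
proof -
  interpret Q: cring "padic_field l" by (rule padic_field_cring)
  interpret h: ring_hom_cring C "padic_field l" cls
    using C_cring padic_field_cring cls_hom unfolding ring_hom_cring_def ring_hom_cring_axioms_def by blast
  have zero: "cls f = \<zero>\<^bsub>padic_field l\<^esub> \<longleftrightarrow> f \<in> N" if "f \<in> carrier C" for f
    using cls_eq_iff[OF that C_const[of 0]] h.hom_zero by simp
  show ?thesis
  proof (rule Q.cring_fieldI2)
    have "(\<lambda>_. 1) \<notin> N" unfolding N_iff not_all not_imp by (intro exI[of _ 1]) auto
    then show "\<zero>\<^bsub>padic_field l\<^esub> \<noteq> \<one>\<^bsub>padic_field l\<^esub>" using zero[OF C_const[of 1]] h.hom_one by simp
    fix a assume a: "a \<in> carrier (padic_field l)" "a \<noteq> \<zero>\<^bsub>padic_field l\<^esub>"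
    then obtain f where f: "f \<in> carrier C" "a = cls f" using cls_surj by auto
    then have "f \<notin> N" using zero a by auto
    note inv = C_inverse[OF f(1) this]
    have "a \<otimes>\<^bsub>padic_field l\<^esub> cls (\<lambda>n. inverse (f n)) = cls (\<lambda>n. f n * inverse (f n))"
      using f inv h.hom_mult[of f "\<lambda>n. inverse (f n)"] by simp
    also have "\<dots> = cls (\<lambda>_. 1)" using inv C_mult[OF f(1) inv(1)] C_const by (simp add: cls_eq_iff)
    finally show "\<exists>b\<in>carrier (padic_field l). a \<otimes>\<^bsub>padic_field l\<^esub> b = \<one>\<^bsub>padic_field l\<^esub>"
      using h.hom_closed[OF inv(1)] h.hom_one by auto
  qed
qed

end

text \<open>Algebraicity supplies an arbitrary nonzero polynomial; dividing by its leading
  coefficient, which is invertible in \<open>K\<close>, makes it monic.\<close>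

lemma closed_field_of_algebraic_closure:
  fixes L :: "'a ring"
  assumes ac: "algebraic_closure L K" and char: "\<And>i. \<guillemotleft>i\<guillemotright>\<^bsub>L\<^esub> = \<zero>\<^bsub>L\<^esub> \<Longrightarrow> i = 0"
  shows "closed_field L K"
proof -
  interpret algebraic_closure L K by fact
  have K: "subfield K L" by (rule subfield_axioms)
  have Ks: "subring K L" using K by (rule subfieldE)
  show ?thesis
  proof
    fix x assume x: "x \<in> carrier L"
    obtain p where p: "p \<in> carrier (univ_poly L K)" "p \<noteq> []" "eval p x = \<zero>\<^bsub>L\<^esub>"
      using algebraicE[OF Ks x algebraic_extension[OF x]] by blast
    obtain a cs where acs: "p = a # cs" using p(2) by (cases p) auto
    have ac: "a \<in> K" "a \<noteq> \<zero>\<^bsub>L\<^esub>" "set cs \<subseteq> K"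
      using p(1) unfolding acs univ_poly_carrier[symmetric] polynomial_def by auto
    have i: "inv\<^bsub>L\<^esub> a \<in> K" using subfield_m_inv(1)[OF K] ac by auto
    have Kc: "K \<subseteq> carrier L" using Ks by (rule subringE)
    have c: "a \<in> carrier L" "inv\<^bsub>L\<^esub> a \<in> carrier L" "set cs \<subseteq> carrier L" using ac i Kc by auto
    let ?ds = "map ((\<otimes>\<^bsub>L\<^esub>) (inv\<^bsub>L\<^esub> a)) cs"
    have ec: "eval cs x \<in> carrier L" by (rule eval_in_carrier[OF c(3) x])
    have "eval (\<one>\<^bsub>L\<^esub> # ?ds) x = inv\<^bsub>L\<^esub> a \<otimes>\<^bsub>L\<^esub> eval p x"
      unfolding acs using eval_map_mult[OF c(3,2) x] c ac(2) x ec
      by (simp add: r_distr m_assoc[symmetric])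
    then have "eval (\<one>\<^bsub>L\<^esub> # ?ds) x = \<zero>\<^bsub>L\<^esub>" using p(3) c by simp
    moreover have "set ?ds \<subseteq> K" using ac i subringE(6)[OF Ks] by auto
    ultimately show "integral_over L K x" using integral_over_iff[OF Ks x] by blast
  next
    fix cs assume cs: "set cs \<subseteq> carrier L" "cs \<noteq> []"
    let ?p = "\<one>\<^bsub>L\<^esub> # cs"
    have p: "?p \<in> carrier (poly_ring L)"
      using cs unfolding univ_poly_carrier[symmetric] polynomial_def by auto
    have "length cs = size (roots ?p)" using roots_over_carrier[OF p] unfolding splitted_def by simp
    then have "roots ?p \<noteq> {#}" using cs(2) by auto
    then obtain x where "x \<in># roots ?p" by (meson multiset_nonemptyE)
    then have "is_root ?p x" using roots_mem_iff_is_root[OF p] by blast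
    then show "\<exists>x\<in>carrier L. eval ?p x = \<zero>\<^bsub>L\<^esub>" unfolding is_root_def by blast
  qed (use char K in auto)
qed

section \<open>The closure of Q_l as a model of the axioms\<close>

context padic_prime
begin

text \<open>Sequences are mapped straight into the closure, so that identities in Z_l and Q_l become
  identities of rational sequences up to null sequences.\<close>

definition emb :: "(nat \<Rightarrow> rat) \<Rightarrow> padic_bar" where
  "emb f = ring.indexed_const (padic_field l) (cls f)"

lemma Qlbar_algebraic_closure: "algebraic_closure (Qlbar l) (Ql l)"
  and indexed_const_hom: "ring.indexed_const (padic_field l) \<in> ring_hom (padic_field l) (Qlbar l)"
  unfolding Qlbar_def Ql_def using field.alg_closureE[OF padic_field_field] by auto

lemma Qlbar_field: "field (Qlbar l)"
  using Qlbar_algebraic_closure unfolding algebraic_closure_def by blast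

lemma emb_hom: "emb \<in> ring_hom C (Qlbar l)"
proof -
  have "emb = ring.indexed_const (padic_field l) \<circ> cls" by (auto simp: emb_def)
  then show ?thesis using ring_hom_trans[OF cls_hom indexed_const_hom] by simp
qed

lemma emb_eq_iff:
  assumes "f \<in> carrier C" "g \<in> carrier C" shows "emb f = emb g \<longleftrightarrow> (\<lambda>n. f n - g n) \<in> N"
proof -
  have "ring (padic_field l)" using padic_field_field field.is_ring by blast
  then have "inj (ring.indexed_const (padic_field l) :: padic \<Rightarrow> padic_bar)" by (rule ring.indexed_const_is_inj)
  then show ?thesis unfolding emb_def cls_eq_iff[OF assms, symmetric] by (simp add: inj_eq)
qed

lemma Ql_emb: "Ql l = emb ` carrier C"
  unfolding Ql_def cls_surj emb_def by auto

lemma Zl_emb: "Zl l = emb ` {f \<in> carrier C. \<forall>n. v (f n) \<le> 1}"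
proof
  show "Zl l \<subseteq> emb ` {f \<in> carrier C. \<forall>n. v (f n) \<le> 1}"
  proof
    fix x assume "x \<in> Zl l"
    then obtain f g where fg: "x = ring.indexed_const (padic_field l) (cls f)" "f \<in> carrier C" "g \<in> cls f" "\<forall>n. v (g n) \<le> 1"
      unfolding Zl_def padic_integers_def cls_surj by auto
    then show "x \<in> emb ` {f \<in> carrier C. \<forall>n. v (f n) \<le> 1}"
      using cls_mem[OF fg(3,2)] unfolding emb_def by (intro image_eqI[of _ _ g]) auto
  qed
next
  show "emb ` {f \<in> carrier C. \<forall>n. v (f n) \<le> 1} \<subseteq> Zl l"
    unfolding Zl_def padic_integers_def cls_surj emb_def using cls_self by auto
qed

interpretation Q: field "Qlbar l" by (rule Qlbar_field)

interpretation h: ring_hom_cring C "Qlbar l" emb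
  using C_cring Q.is_cring emb_hom unfolding ring_hom_cring_def ring_hom_cring_axioms_def by blast

lemma emb_one: "emb (\<lambda>_. 1) = \<one>\<^bsub>Qlbar l\<^esub>"
  using h.hom_one by simp

lemma emb_zero: "emb (\<lambda>_. 0) = \<zero>\<^bsub>Qlbar l\<^esub>"
  using h.hom_zero by simp

lemma emb_add: "f \<in> carrier C \<Longrightarrow> g \<in> carrier C \<Longrightarrow> emb f \<oplus>\<^bsub>Qlbar l\<^esub> emb g = emb (\<lambda>n. f n + g n)"
  using h.hom_add[of f g] by simp

lemma emb_mult: "f \<in> carrier C \<Longrightarrow> g \<in> carrier C \<Longrightarrow> emb f \<otimes>\<^bsub>Qlbar l\<^esub> emb g = emb (\<lambda>n. f n * g n)"
  using h.hom_mult[of f g] by simp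

lemma emb_uminus: "f \<in> carrier C \<Longrightarrow> \<ominus>\<^bsub>Qlbar l\<^esub> emb f = emb (\<lambda>n. - f n)"
  using h.hom_a_inv[of f] C_a_inv by simp

lemma emb_int: "\<guillemotleft>i\<guillemotright>\<^bsub>Qlbar l\<^esub> = emb (\<lambda>_. of_int i)"
proof -
  have nat: "\<guillemotleft>int n\<guillemotright>\<^bsub>Qlbar l\<^esub> = emb (\<lambda>_. of_nat n)" for n
    by (induction n) (simp_all add: emb_zero emb_one[symmetric] emb_add C_const add.commute)
  show ?thesis
    by (cases i rule: int_cases2) (simp_all add: nat emb_uminus C_const)
qed

lemma emb_pow: "f \<in> carrier C \<Longrightarrow> emb f [^]\<^bsub>Qlbar l\<^esub> (n::nat) = emb (\<lambda>i. f i ^ n)"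
proof (induction n)
  case (Suc n)
  have "(\<lambda>i. f i ^ n) \<in> carrier C" using Suc.prems
    by (induction n) (auto simp: C_const intro: C_mult)
  then show ?case using Suc by (simp add: emb_mult mult.commute)
qed (simp add: emb_one)

lemma emb_l_pow: "\<guillemotleft>int l\<guillemotright>\<^bsub>Qlbar l\<^esub> [^]\<^bsub>Qlbar l\<^esub> (n::nat) = emb (\<lambda>_. of_nat l ^ n)"
  unfolding emb_int using emb_pow[OF C_const, of "of_int (int l)" n] by simp

lemma emb_eqI: "f \<in> carrier C \<Longrightarrow> g \<in> carrier C \<Longrightarrow> (\<And>n. n \<ge> M \<Longrightarrow> f n = g n) \<Longrightarrow> emb f = emb g"
  unfolding emb_eq_iff by (rule N_eventually_0[of M]) auto

lemma C_eventually:
  assumes "f \<in> carrier C" "\<And>n. n \<ge> M \<Longrightarrow> f n = g n" shows "g \<in> carrier C"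
  unfolding C_iff
proof (intro allI impI)
  fix e :: real assume "0 < e"
  then obtain M' where "\<forall>m\<ge>M'. \<forall>n\<ge>M'. v (f m - f n) < e" using assms(1) unfolding C_iff by meson
  then have "v (g m - g n) < e" if "m \<ge> max M M'" "n \<ge> max M M'" for m n
    using that assms(2)[of m, symmetric] assms(2)[of n, symmetric] by simp
  then show "\<exists>M. \<forall>m\<ge>M. \<forall>n\<ge>M. v (g m - g n) < e" by blast
qed

lemma C_cmult: "f \<in> carrier C \<Longrightarrow> (\<lambda>n. r * f n) \<in> carrier C"
  using C_mult[OF C_const[of r]] by simp

text \<open>Sequences all of whose terms are \<open>l\<close>-integral, matching the representatives
  asked for in \<open>padic_integers\<close>.\<close>

definition C1 :: "(nat \<Rightarrow> rat) set" where "C1 = {f \<in> carrier C. \<forall>n. v (f n) \<le> 1}"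

lemma Zl_C1: "Zl l = emb ` C1"
  unfolding Zl_emb C1_def ..

lemma C1_C: "f \<in> C1 \<Longrightarrow> f \<in> carrier C"
  unfolding C1_def by blast

text \<open>A far term of the sequence serves as rational approximation; the remainder divided by
  \<open>l ^ n\<close> is again integral once the terms before it are reset to zero.\<close>

lemma Zl_approx:
  assumes f: "f \<in> C1"
  shows "\<exists>r g. v r \<le> 1 \<and> g \<in> C1 \<and>
    emb f = emb (\<lambda>_. r) \<oplus>\<^bsub>Qlbar l\<^esub> \<guillemotleft>int l\<guillemotright>\<^bsub>Qlbar l\<^esub> [^]\<^bsub>Qlbar l\<^esub> (n::nat) \<otimes>\<^bsub>Qlbar l\<^esub> emb g"
proof -
  define q where "q = (1 / real l) ^ n"
  have q: "0 < q" unfolding q_def using l_gt1 by simp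
  obtain M where M: "\<forall>m\<ge>M. \<forall>n\<ge>M. v (f m - f n) < q"
    using f q unfolding C1_def C_iff by blast
  define L :: rat where "L = of_nat l ^ n"
  have L: "v L = q" "L \<noteq> 0" unfolding L_def q_def using v_l_power l_gt1 by auto
  define r where "r = f M"
  define g where "g m = (if m \<ge> M then (f m - r) / L else 0)" for m
  have g1: "v (g m) \<le> 1" for m
    using M L q unfolding g_def r_def by (auto simp: v_divide less_imp_le)
  have "(\<lambda>m. inverse L * (f m + - r)) \<in> carrier C"
    using f by (intro C_cmult C_add C_const C1_C)
  then have gC: "g \<in> carrier C" by (rule C_eventually[of _ M]) (auto simp: g_def divide_inverse mult.commute)
  have "emb f = emb (\<lambda>m. r + L * g m)"
    using L(2) by (intro emb_eqI[OF C1_C[OF f] C_add[OF C_const C_cmult[OF gC]], of M]) (simp add: g_def)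
  also have "\<dots> = emb (\<lambda>_. r) \<oplus>\<^bsub>Qlbar l\<^esub> \<guillemotleft>int l\<guillemotright>\<^bsub>Qlbar l\<^esub> [^]\<^bsub>Qlbar l\<^esub> n \<otimes>\<^bsub>Qlbar l\<^esub> emb g"
    using gC unfolding emb_l_pow by (simp add: emb_mult emb_add C_const C_cmult L_def)
  finally show ?thesis using g1 gC f unfolding C1_def r_def by blast
qed

text \<open>The way back from divisibility in the closure to an estimate for a rational number: up
  to a null sequence, \<open>r\<close> equals \<open>l ^ n\<close> times a sequence of integral
  terms.\<close>

lemma Zl_const_bound:
  assumes "g \<in> C1" "emb (\<lambda>_. r) = \<guillemotleft>int l\<guillemotright>\<^bsub>Qlbar l\<^esub> [^]\<^bsub>Qlbar l\<^esub> (n::nat) \<otimes>\<^bsub>Qlbar l\<^esub> emb g"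
  shows "v r \<le> (1 / real l) ^ n"
proof -
  define q where "q = (1 / real l) ^ n"
  have q: "0 < q" unfolding q_def using l_gt1 by simp
  have gC: "g \<in> carrier C" and g1: "\<And>m. v (g m) \<le> 1" using assms(1) unfolding C1_def by auto
  have "emb (\<lambda>_. r) = emb (\<lambda>m. of_nat l ^ n * g m)"
    using assms(2) gC unfolding emb_l_pow by (simp add: emb_mult C_const)
  then have "(\<lambda>m. r - of_nat l ^ n * g m) \<in> N"
    using gC by (simp add: emb_eq_iff C_const C_cmult)
  then obtain M where "v (r - of_nat l ^ n * g M) < q" using q unfolding N_iff by blast
  moreover have "v (of_nat l ^ n * g M) \<le> q"
    using g1[of M] q unfolding q_def by (simp add: v_mult v_l_power mult_left_le)
  ultimately have "v (r - of_nat l ^ n * g M + of_nat l ^ n * g M) \<le> q" by (intro v_add_le) auto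
  then show ?thesis unfolding q_def by simp
qed

lemma Qlbar_char_zero: "\<guillemotleft>i\<guillemotright>\<^bsub>Qlbar l\<^esub> = \<zero>\<^bsub>Qlbar l\<^esub> \<Longrightarrow> i = 0"
proof (rule ccontr)
  assume "\<guillemotleft>i\<guillemotright>\<^bsub>Qlbar l\<^esub> = \<zero>\<^bsub>Qlbar l\<^esub>" and i: "i \<noteq> 0"
  then have "(\<lambda>_. of_int i :: rat) \<in> N"
    unfolding emb_int emb_zero[symmetric] emb_eq_iff[OF C_const C_const] by simp
  moreover have "0 < v (of_int i)" using v_pos i by simp
  ultimately show False unfolding N_iff by (meson le_refl less_irrefl)
qed

lemma Zl_subring: "subring (Zl l) (Qlbar l)"
proof (rule Q.subringI)
  show "Zl l \<subseteq> carrier (Qlbar l)" unfolding Zl_C1 using C1_C by auto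
  show "\<one>\<^bsub>Qlbar l\<^esub> \<in> Zl l" unfolding Zl_C1 emb_one[symmetric] C1_def by (auto simp: C_const)
  show "\<ominus>\<^bsub>Qlbar l\<^esub> x \<in> Zl l" if "x \<in> Zl l" for x
    using that C_uminus unfolding Zl_C1 C1_def by (auto simp: emb_uminus)
  show "x \<otimes>\<^bsub>Qlbar l\<^esub> y \<in> Zl l" if "x \<in> Zl l" "y \<in> Zl l" for x y
    using that C_mult unfolding Zl_C1 C1_def by (auto simp: emb_mult v_mult intro!: imageI mult_le_one)
  show "x \<oplus>\<^bsub>Qlbar l\<^esub> y \<in> Zl l" if "x \<in> Zl l" "y \<in> Zl l" for x y
    using that C_add unfolding Zl_C1 C1_def by (auto simp: emb_add intro!: imageI v_add_le)
qed

lemma Zl_uniformizer: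
  assumes "f \<in> C1" "emb f \<noteq> \<zero>\<^bsub>Qlbar l\<^esub>"
  shows "\<exists>n::nat. \<exists>u\<in>Zl l. u \<noteq> \<zero>\<^bsub>Qlbar l\<^esub> \<and> inv\<^bsub>Qlbar l\<^esub> u \<in> Zl l \<and>
    emb f = \<guillemotleft>int l\<guillemotright>\<^bsub>Qlbar l\<^esub> [^]\<^bsub>Qlbar l\<^esub> n \<otimes>\<^bsub>Qlbar l\<^esub> u"
proof -
  have fC: "f \<in> carrier C" and f1: "\<And>m. v (f m) \<le> 1" using assms(1) unfolding C1_def by auto
  have "f \<notin> N" using assms(2) emb_eq_iff[OF fC C_const[of 0]] emb_zero by simp
  then obtain M and i :: int where Mi: "\<And>n. n \<ge> M \<Longrightarrow> v (f n) = real l powi i"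
    using C_eventually_constant_abs[OF fC] by blast
  have "i \<le> 0"
  proof (rule ccontr)
    assume "\<not> i \<le> 0"
    then have "1 < real l powi i" using l_gt1 power_int_strict_increasing[of 0 i "real l"] by simp
    then show False using Mi[of M] f1[of M] by simp
  qed
  define n where "n = nat (- i)"
  have i: "i = - int n" using \<open>i \<le> 0\<close> unfolding n_def by simp
  define L :: rat where "L = of_nat l ^ n"
  have L: "v L = real l powi i" "L \<noteq> 0"
    unfolding L_def using v_l_power[of n] l_gt1 by (auto simp: i power_int_minus power_one_over inverse_eq_divide)
  \<comment> \<open>Early terms are set to 1 rather than 0, so that every term of \<open>g\<close>
    has absolute value one and the termwise inverse is integral as well.\<close>
  define g where "g m = (if m \<ge> M then f m / L else 1)" for m
  have g1: "v (g m) = 1" for m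
    using Mi[of m] L v_pos[OF L(2)] unfolding g_def by (auto simp: v_divide)
  then have g0: "g m \<noteq> 0" for m using v_0 by (metis zero_neq_one)
  have "(\<lambda>m. inverse L * f m) \<in> carrier C" using fC by (rule C_cmult)
  then have gC: "g \<in> carrier C" by (rule C_eventually[of _ M]) (auto simp: g_def divide_inverse mult.commute)
  have gN: "g \<notin> N" using g1 unfolding N_iff not_all not_imp by (intro exI[of _ 1]) auto
  note inv = C_inverse[OF gC gN]
  have eqf: "emb f = \<guillemotleft>int l\<guillemotright>\<^bsub>Qlbar l\<^esub> [^]\<^bsub>Qlbar l\<^esub> n \<otimes>\<^bsub>Qlbar l\<^esub> emb g"
  proof -
    have "emb f = emb (\<lambda>m. L * g m)"
      using L(2) by (intro emb_eqI[OF fC C_cmult[OF gC], of M]) (simp add: g_def)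
    then show ?thesis using gC unfolding emb_l_pow by (simp add: emb_mult C_const L_def)
  qed
  have "emb g \<otimes>\<^bsub>Qlbar l\<^esub> emb (\<lambda>m. inverse (g m)) = \<one>\<^bsub>Qlbar l\<^esub>"
    using gC inv(1) g0 by (simp add: emb_mult emb_one)
  then have "inv\<^bsub>Qlbar l\<^esub> (emb g) = emb (\<lambda>m. inverse (g m))"
    using Q.comm_inv_char[of "emb g"] gC inv(1) by auto
  moreover have "emb (\<lambda>m. inverse (g m)) \<in> Zl l"
    unfolding Zl_C1 C1_def using inv(1) g1 by (auto simp: v_inverse)
  moreover have "emb g \<in> Zl l" unfolding Zl_C1 C1_def using gC g1 by auto
  moreover have "emb g \<noteq> \<zero>\<^bsub>Qlbar l\<^esub>" using assms(2) unfolding eqf by auto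
  ultimately show ?thesis using eqf by metis
qed

theorem padic_closure_Qlbar: "padic_closure (Qlbar l) (Ql l) (Zl l) l"
proof -
  have cf: "closed_field (Qlbar l) (Ql l)"
    using closed_field_of_algebraic_closure[OF Qlbar_algebraic_closure Qlbar_char_zero] .
  show ?thesis
  proof (intro padic_closure.intro padic_closure_axioms.intro cf)
    show "prime l" by (rule prime_l)
    show "subring (Zl l) (Qlbar l)" by (rule Zl_subring)
    show "Zl l \<subseteq> Ql l" unfolding Zl_C1 Ql_emb using C1_C by blast
  next
    fix a assume "a \<in> Zl l"
    then obtain f where f: "f \<in> C1" "a = emb f" unfolding Zl_C1 by blast
    obtain r g where rg: "v r \<le> 1" "g \<in> C1"
      "emb f = emb (\<lambda>_. r) \<oplus>\<^bsub>Qlbar l\<^esub> \<guillemotleft>int l\<guillemotright>\<^bsub>Qlbar l\<^esub> [^]\<^bsub>Qlbar l\<^esub> (1::nat) \<otimes>\<^bsub>Qlbar l\<^esub> emb g"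
      using Zl_approx[OF f(1), of 1] by blast
    have gC: "g \<in> carrier C" using rg(2) by (rule C1_C)
    obtain c d :: int where cd: "r = of_int c / of_int d" "\<not> int l dvd d" using v_le_1E[OF rg(1)] .
    have "coprime d (int l)" using cd(2) prime_l
      by (metis coprime_commute prime_imp_coprime prime_nat_int_transfer)
    then obtain e where e: "[d * e = 1] (mod int l)" using cong_solve_coprime_int by blast
    \<comment> \<open>\<open>e\<close> inverts \<open>d\<close> modulo \<open>l\<close>, so
      \<open>i\<close> is the residue of \<open>c / d\<close> and \<open>c - d * i\<close> is
      divisible by \<open>l\<close>.\<close>
    define i where "i = (c * e) mod int l"
    have i: "i \<in> {0..<int l}" unfolding i_def using l_gt1 by auto
    have "[d * i = d * (c * e)] (mod int l)" unfolding i_def by (simp add: cong_def mod_mult_right_eq)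
    also have "[d * (c * e) = c * 1] (mod int l)" using cong_scalar_left[OF e, of c] by (simp add: ac_simps)
    finally have "int l dvd c - d * i" by (simp add: cong_iff_dvd_diff dvd_diff_commute)
    then obtain t where t: "c - d * i = int l * t" by blast
    have d0: "d \<noteq> 0" using cd(2) by auto
    define s :: rat where "s = of_int t / of_int d"
    have rs: "r = of_int i + of_nat l * s"
    proof -
      have "c = d * i + int l * t" using t by linarith
      then have "(of_int c :: rat) = of_int (d * i + int l * t)" by simp
      then show ?thesis unfolding s_def cd(1) using d0 by (simp add: field_simps)
    qed
    have "v s \<le> 1"
    proof -
      have "v (of_int d) = 1"
        using v_fraction[of d 1] d0 cd(2) by (simp add: not_dvd_imp_multiplicity_0)
      then show ?thesis unfolding s_def using v_int_le[of t] by (simp add: v_divide)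
    qed
    then have "(\<lambda>n. s + g n) \<in> C1" using rg(2) unfolding C1_def
      by (auto intro: C_add C_const v_add_le)
    moreover have "a = \<guillemotleft>i\<guillemotright>\<^bsub>Qlbar l\<^esub> \<oplus>\<^bsub>Qlbar l\<^esub> \<guillemotleft>int l\<guillemotright>\<^bsub>Qlbar l\<^esub> \<otimes>\<^bsub>Qlbar l\<^esub> emb (\<lambda>n. s + g n)"
      unfolding f(2) rg(3) rs emb_int using gC
      by (simp add: emb_pow emb_add emb_mult C_const C_add C_cmult algebra_simps)
    ultimately show "\<exists>i\<in>{0..<int l}. \<exists>b\<in>Zl l. a = \<guillemotleft>i\<guillemotright>\<^bsub>Qlbar l\<^esub> \<oplus>\<^bsub>Qlbar l\<^esub> \<guillemotleft>int l\<guillemotright>\<^bsub>Qlbar l\<^esub> \<otimes>\<^bsub>Qlbar l\<^esub> b"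
      using i unfolding Zl_C1 by blast
  next
    fix a assume "a \<in> Zl l" "a \<noteq> \<zero>\<^bsub>Qlbar l\<^esub>"
    then show "\<exists>n::nat. \<exists>u\<in>Zl l. u \<noteq> \<zero>\<^bsub>Qlbar l\<^esub> \<and> inv\<^bsub>Qlbar l\<^esub> u \<in> Zl l \<and>
      a = \<guillemotleft>int l\<guillemotright>\<^bsub>Qlbar l\<^esub> [^]\<^bsub>Qlbar l\<^esub> n \<otimes>\<^bsub>Qlbar l\<^esub> u"
      using Zl_uniformizer unfolding Zl_C1 by blast
  next
    fix a assume "a \<in> Ql l"
    then obtain f where f: "f \<in> carrier C" "a = emb f" unfolding Ql_emb by blast
    obtain B where B: "B > 0" "\<And>n. v (f n) \<le> B" using C_bounded[OF f(1)] by blast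
    obtain n where n: "(1 / real l) ^ n < inverse B" using small_power[of "inverse B"] B by auto
    have "v (of_nat l ^ n * f m) \<le> 1" for m
    proof -
      have "(1 / real l) ^ n * v (f m) \<le> inverse B * B" using n B by (intro mult_mono) auto
      then show ?thesis using B(1) by (simp add: v_mult v_l_power)
    qed
    then have "(\<lambda>m. of_nat l ^ n * f m) \<in> C1" unfolding C1_def using C_cmult f(1) by blast
    moreover have "\<guillemotleft>int l\<guillemotright>\<^bsub>Qlbar l\<^esub> [^]\<^bsub>Qlbar l\<^esub> n \<otimes>\<^bsub>Qlbar l\<^esub> a = emb (\<lambda>m. of_nat l ^ n * f m)"
      unfolding emb_l_pow f(2) using f(1) by (simp add: emb_mult C_const)
    ultimately show "\<exists>n::nat. \<guillemotleft>int l\<guillemotright>\<^bsub>Qlbar l\<^esub> [^]\<^bsub>Qlbar l\<^esub> n \<otimes>\<^bsub>Qlbar l\<^esub> a \<in> Zl l"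
      unfolding Zl_C1 by blast
  next
    show "inv\<^bsub>Qlbar l\<^esub> \<guillemotleft>int l\<guillemotright>\<^bsub>Qlbar l\<^esub> \<notin> Zl l"
    proof
      assume "inv\<^bsub>Qlbar l\<^esub> \<guillemotleft>int l\<guillemotright>\<^bsub>Qlbar l\<^esub> \<in> Zl l"
      then obtain g where g: "g \<in> C1" "inv\<^bsub>Qlbar l\<^esub> \<guillemotleft>int l\<guillemotright>\<^bsub>Qlbar l\<^esub> = emb g" unfolding Zl_C1 by blast
      have "\<guillemotleft>int l\<guillemotright>\<^bsub>Qlbar l\<^esub> \<noteq> \<zero>\<^bsub>Qlbar l\<^esub>" using Qlbar_char_zero[of "int l"] l_gt1 by auto
      then have "emb (\<lambda>_. 1) = \<guillemotleft>int l\<guillemotright>\<^bsub>Qlbar l\<^esub> [^]\<^bsub>Qlbar l\<^esub> (1::nat) \<otimes>\<^bsub>Qlbar l\<^esub> emb g"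
        unfolding g(2)[symmetric] emb_one by simp
      then have "v 1 \<le> (1 / real l) ^ 1" by (rule Zl_const_bound[OF g(1)])
      then show False using l_gt1 by simp
    qed
  next
    fix s :: "nat \<Rightarrow> padic_bar" assume s: "\<And>n. s n \<in> Zl l"
      and step: "\<And>n. \<exists>b\<in>Zl l. s (Suc n) = s n \<oplus>\<^bsub>Qlbar l\<^esub> \<guillemotleft>int l\<guillemotright>\<^bsub>Qlbar l\<^esub> [^]\<^bsub>Qlbar l\<^esub> n \<otimes>\<^bsub>Qlbar l\<^esub> b"
    let ?q = "\<lambda>n::nat. \<guillemotleft>int l\<guillemotright>\<^bsub>Qlbar l\<^esub> [^]\<^bsub>Qlbar l\<^esub> n"
    \<comment> \<open>Each \<open>s n\<close> is replaced by a rational \<open>r n\<close> that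
      agrees with it modulo \<open>l ^ n\<close>; the sequence \<open>r\<close> itself then
      represents the limit.\<close>
    have "\<exists>r g. v r \<le> 1 \<and> g \<in> C1 \<and> s n = emb (\<lambda>_. r) \<oplus>\<^bsub>Qlbar l\<^esub> ?q n \<otimes>\<^bsub>Qlbar l\<^esub> emb g" for n
    proof -
      obtain f where f: "f \<in> C1" "s n = emb f" using s[of n] unfolding Zl_C1 by blast
      show ?thesis unfolding f(2) by (rule Zl_approx[OF f(1)])
    qed
    then obtain r g where rg: "\<And>n. v (r n) \<le> 1" "\<And>n. g n \<in> C1"
      "\<And>n. s n = emb (\<lambda>_. r n) \<oplus>\<^bsub>Qlbar l\<^esub> ?q n \<otimes>\<^bsub>Qlbar l\<^esub> emb (g n)" by metis
    have gC: "g n \<in> carrier C" for n using rg(2) by (rule C1_C)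
    have r_step: "v (r (Suc n) - r n) \<le> (1 / real l) ^ n" for n
    proof -
      obtain h where h: "h \<in> C1" "s (Suc n) = s n \<oplus>\<^bsub>Qlbar l\<^esub> ?q n \<otimes>\<^bsub>Qlbar l\<^esub> emb h"
        using step[of n] unfolding Zl_C1 by blast
      have hC: "h \<in> carrier C" using h(1) by (rule C1_C)
      \<comment> \<open>The two approximation errors and the increment combined: up to a null
        sequence, \<open>r (Suc n) - r n\<close> is \<open>l ^ n\<close> times
        \<open>w\<close>.\<close>
      define w where "w m = g n m + h m - of_nat l * g (Suc n) m" for m
      have "of_nat l = (of_int (int l) :: rat)" by simp
      then have "v (of_nat l) \<le> 1" using v_int_le by metis
      then have w1: "w \<in> C1" using h(1) rg(2)[of n] rg(2)[of "Suc n"] unfolding C1_def w_def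
        using C_add[OF C_add[of "g n" h] C_uminus[OF C_cmult[of "g (Suc n)" "of_nat l"]]]
        by (auto intro!: v_add_le v_diff_le mult_le_one simp: v_mult)
      define Q1 :: rat where "Q1 = of_nat l ^ n"
      have "emb (\<lambda>m. r (Suc n) + of_nat l * Q1 * g (Suc n) m) = emb (\<lambda>m. r n + Q1 * g n m + Q1 * h m)"
        using h(2) gC[of n] gC[of "Suc n"] hC unfolding rg(3) emb_l_pow Q1_def
        by (simp add: emb_add emb_mult C_const C_add C_cmult C_mult)
      then have *: "(\<lambda>m. (r (Suc n) + of_nat l * Q1 * g (Suc n) m) - (r n + Q1 * g n m + Q1 * h m)) \<in> N"
        using gC hC by (simp add: emb_eq_iff C_add C_const C_cmult)
      have wC: "w \<in> carrier C" using w1 by (rule C1_C)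
      have "(\<lambda>m. (r (Suc n) - r n) - Q1 * w m) \<in> N" using * unfolding w_def by (simp add: algebra_simps)
      then have "emb (\<lambda>_. r (Suc n) - r n) = emb (\<lambda>m. Q1 * w m)"
        using emb_eq_iff[OF C_const C_cmult[OF wC], of "r (Suc n) - r n" Q1] by simp
      then have "emb (\<lambda>_. r (Suc n) - r n) = ?q n \<otimes>\<^bsub>Qlbar l\<^esub> emb w"
        using wC unfolding emb_l_pow Q1_def by (simp add: emb_mult C_const)
      then show ?thesis by (rule Zl_const_bound[OF w1])
    qed
    have r_diff: "v (r m - r n) \<le> (1 / real l) ^ n" if "n \<le> m" for m n
      using that
    proof (induction m rule: dec_induct)
      case base
      then show ?case by simp
    next
      case (step m)
      have "(1 / real l) ^ m \<le> (1 / real l) ^ n" using step.hyps l_gt1 by (intro power_decreasing) auto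
      then have "v (r (Suc m) - r m) \<le> (1 / real l) ^ n" using r_step[of m] by linarith
      then have "v ((r (Suc m) - r m) + (r m - r n)) \<le> (1 / real l) ^ n" using step.IH by (rule v_add_le)
      then show ?case by simp
    qed
    have rC: "r \<in> carrier C" unfolding C_iff
    proof (intro allI impI)
      fix e :: real assume "0 < e"
      then obtain n where n: "(1 / real l) ^ n < e" using small_power by blast
      have "v (r m - r k) < e" if "m \<ge> n" "k \<ge> n" for m k
      proof -
        have "v (r m - r n) < e" "v (r k - r n) < e" using r_diff that n by (meson le_less_trans)+
        then have "v ((r m - r n) - (r k - r n)) < e" by (rule v_diff_less)
        then show ?thesis by simp
      qed
      then show "\<exists>M. \<forall>m\<ge>M. \<forall>n\<ge>M. v (r m - r n) < e" by blast
    qed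
    have "emb r \<in> Zl l" unfolding Zl_C1 C1_def using rC rg(1) by blast
    moreover have "\<exists>b\<in>Zl l. emb r = s n \<oplus>\<^bsub>Qlbar l\<^esub> ?q n \<otimes>\<^bsub>Qlbar l\<^esub> b" for n
    proof -
      define Q1 :: rat where "Q1 = of_nat l ^ n"
      have Q1: "Q1 \<noteq> 0" "v Q1 = (1 / real l) ^ n" unfolding Q1_def using l_gt1 v_l_power by auto
      \<comment> \<open>The bound \<open>r_diff\<close> is available only from index
        \<open>n\<close> on, so the quotient is replaced by zero before that; subtracting
        \<open>g n\<close> accounts for the error in \<open>r n\<close>.\<close>
      define w where "w m = (if n \<le> m then (r m - r n) / Q1 else 0) - g n m" for m
      have "(\<lambda>m. inverse Q1 * (r m + - r n) + - g n m) \<in> carrier C"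
        using rC gC by (intro C_add C_cmult C_const C_uminus)
      then have wC: "w \<in> carrier C"
        by (rule C_eventually[of _ n]) (auto simp: w_def divide_inverse mult.commute)
      have "v (w m) \<le> 1" for m unfolding w_def
      proof (rule v_diff_le)
        show "v (if n \<le> m then (r m - r n) / Q1 else 0) \<le> 1"
          using r_diff[of n m] Q1 l_gt1 by (auto simp: v_divide)
        show "v (g n m) \<le> 1" using rg(2)[of n] unfolding C1_def by blast
      qed
      then have w1: "w \<in> C1" unfolding C1_def using wC by blast
      have "emb r = emb (\<lambda>m. r n + Q1 * g n m + Q1 * w m)"
      proof (rule emb_eqI[OF rC C_add[OF C_add[OF C_const C_cmult[OF gC]] C_cmult[OF wC]], of n])
        fix m assume "n \<le> m"
        then show "r m = r n + Q1 * g n m + Q1 * w m" using Q1(1) unfolding w_def by (simp add: field_simps)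
      qed
      then have "emb r = s n \<oplus>\<^bsub>Qlbar l\<^esub> ?q n \<otimes>\<^bsub>Qlbar l\<^esub> emb w"
        using gC[of n] wC unfolding rg(3) emb_l_pow Q1_def
        by (simp add: emb_add emb_mult C_const C_add C_cmult)
      then show ?thesis using w1 unfolding Zl_C1 by blast
    qed
    ultimately show "\<exists>t\<in>Zl l. \<forall>n. \<exists>b\<in>Zl l. t = s n \<oplus>\<^bsub>Qlbar l\<^esub> ?q n \<otimes>\<^bsub>Qlbar l\<^esub> b" by blast
  qed
qed

end

section \<open>Algebraic numbers and the absolute Galois group of the rationals\<close>

lemma cring_class_eval:
  "ring.eval cring_class_ops cs x = poly (Poly (rev cs)) (x::'a::comm_ring_1)"
proof -
  have r: "ring (cring_class_ops :: 'a ring)" using cring_class by (rule cring.axioms)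
  show ?thesis
    by (induction cs) (simp_all add: ring.eval.simps[OF r] class_simps Poly_snoc poly_monom add.commute)
qed

lemma Rats_subring: "subring \<rat> (cring_class_ops :: complex ring)"
proof -
  have r: "ring (cring_class_ops :: complex ring)" using cring_class by (rule cring.axioms)
  show ?thesis by (rule ring.subringI[OF r]) (auto simp: class_simps)
qed

lemma Rats_dvr_like: "dvr_like (cring_class_ops :: complex ring) \<rat>"
  unfolding dvr_like_def class_simps
proof (intro allI impI)
  fix c :: "nat \<Rightarrow> complex" assume c: "\<forall>n. c n \<in> \<rat>"
  show "\<exists>m. \<forall>n. \<exists>q\<in>\<rat>. c n = q * c m"
  proof (cases "\<exists>m. c m \<noteq> 0")
    case True
    then obtain m where m: "c m \<noteq> 0" by blast
    have "c n / c m \<in> \<rat>" "c n = (c n / c m) * c m" for n using c m by (auto intro: Rats_divide)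
    then show ?thesis by blast
  next
    case False
    then show ?thesis by auto
  qed
qed

text \<open>Brings the theory of \<open>integral_over\<close> to bear on complex algebraic numbers;
  \<open>Rats_dvr_like\<close> holds because \<open>\<rat>\<close> is a field. Closure under sums
  and products follows.\<close>

lemma algebraic_iff_integral:
  "algebraic x \<longleftrightarrow> integral_over (cring_class_ops :: complex ring) \<rat> x"
proof -
  have "integral_over cring_class_ops \<rat> x \<longleftrightarrow> (\<exists>cs. set cs \<subseteq> \<rat> \<and> poly (Poly (rev (1 # cs))) x = 0)"
    using cring.integral_over_iff[OF cring_class Rats_subring carrier_class, of x] unfolding cring_class_eval class_simps by simp
  also have "\<dots> \<longleftrightarrow> algebraic x"
  proof
    assume "\<exists>cs. set cs \<subseteq> \<rat> \<and> poly (Poly (rev (1 # cs))) x = 0"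
    then obtain cs where cs: "set cs \<subseteq> \<rat>" "poly (Poly (rev (1 # cs))) x = 0" by blast
    have "Polynomial.coeff (Poly (rev (1 # cs))) i \<in> \<rat>" for i
      using cs(1) nth_mem[of i "rev (1 # cs)"] by (auto simp: nth_default_def simp del: nth_mem)
    moreover have "Polynomial.coeff (Poly (rev (1 # cs))) (length cs) = 1"
      by (simp add: nth_default_def nth_append)
    then have "Poly (rev (1 # cs)) \<noteq> 0" by (metis coeff_0 zero_neq_one)
    ultimately show "algebraic x" using cs(2) by (rule algebraicI')
  next
    assume "algebraic x"
    then obtain p where p: "\<And>i. Polynomial.coeff p i \<in> \<rat>" "p \<noteq> 0" "poly p x = 0" unfolding algebraic_altdef by blast
    define q where "q = Polynomial.smult (inverse (Polynomial.coeff p (Polynomial.degree p))) p"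
    have q: "\<And>i. Polynomial.coeff q i \<in> \<rat>" "Polynomial.coeff q (Polynomial.degree q) = 1" "poly q x = 0" "q \<noteq> 0"
      unfolding q_def using p by (auto intro: Rats_mult Rats_inverse)
    have ne: "rev (coeffs q) \<noteq> []" using q(4) by simp
    have "hd (rev (coeffs q)) = 1" using q(2,4) by (simp add: hd_rev last_coeffs_eq_coeff_degree)
    then obtain cs where cs: "rev (coeffs q) = 1 # cs" using ne by (cases "rev (coeffs q)") auto
    have "set (coeffs q) \<subseteq> \<rat>" using q(1) by (auto simp: coeffs_def)
    then have "set cs \<subseteq> \<rat>" using cs by (metis set_rev set_subset_Cons subset_trans)
    moreover have "Poly (rev (1 # cs)) = q" unfolding cs[symmetric] by simp
    ultimately show "\<exists>cs. set cs \<subseteq> \<rat> \<and> poly (Poly (rev (1 # cs))) x = 0" using q(3) by metis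
  qed
  finally show ?thesis by blast
qed

lemma algebraic_plus_complex: "algebraic x \<Longrightarrow> algebraic y \<Longrightarrow> algebraic (x + y :: complex)"
  and algebraic_times_complex: "algebraic x \<Longrightarrow> algebraic y \<Longrightarrow> algebraic (x * y :: complex)"
  using cring.integral_over_ring[OF cring_class Rats_subring Rats_dvr_like]
  unfolding algebraic_iff_integral class_simps by blast+

lemma algebraic_diff_complex: "algebraic x \<Longrightarrow> algebraic y \<Longrightarrow> algebraic (x - y :: complex)"
  using algebraic_plus_complex[of x "- y"] by simp

lemma algebraic_divide_complex: "algebraic x \<Longrightarrow> algebraic y \<Longrightarrow> algebraic (x / y :: complex)"
  unfolding divide_inverse by (intro algebraic_times_complex algebraic_inverse)

lemma algebraic_power_complex: "algebraic x \<Longrightarrow> algebraic (x ^ n :: complex)"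
  by (induction n) (auto intro: algebraic_times_complex)

text \<open>\<open>X^n - x^n\<close> is monic in \<open>X\<close> with algebraic coefficients, and
  integrality is transitive.\<close>

lemma algebraic_root_complex: "algebraic (x ^ n) \<Longrightarrow> 0 < n \<Longrightarrow> algebraic (x :: complex)"
proof -
  assume x: "algebraic (x ^ n)" and n: "0 < n"
  then obtain m where m: "n = Suc m" using gr0_conv_Suc by blast
  let ?cs = "replicate m 0 @ [- (x ^ n)]"
  have "ring.eval cring_class_ops (\<one>\<^bsub>cring_class_ops\<^esub> # ?cs) x = \<zero>\<^bsub>cring_class_ops\<^esub>"
    unfolding cring_class_eval class_simps m
    by (simp add: Poly_snoc poly_monom monom_eq_iff' Poly_append algebra_simps)
  moreover have "integral_over cring_class_ops \<rat> c" if "c \<in> set ?cs" for c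
    using that x unfolding algebraic_iff_integral[symmetric] by (auto split: if_splits)
  ultimately show ?thesis
    unfolding algebraic_iff_integral
    by (intro cring.integral_over_trans[OF cring_class Rats_subring Rats_dvr_like, of x ?cs]) (auto simp: class_simps)
qed

lemma Qbar_simps [simp]:
  "carrier Qbar = {x. algebraic x}" "x \<otimes>\<^bsub>Qbar\<^esub> y = x * y" "\<one>\<^bsub>Qbar\<^esub> = 1" "\<zero>\<^bsub>Qbar\<^esub> = 0" "x \<oplus>\<^bsub>Qbar\<^esub> y = x + y"
  by (auto simp: Qbar_def)

lemma Qbar_cring: "cring Qbar"
proof (rule cringI)
  show "abelian_group Qbar"
  proof (rule abelian_groupI)
    fix x assume "x \<in> carrier Qbar"
    then show "\<exists>y\<in>carrier Qbar. y \<oplus>\<^bsub>Qbar\<^esub> x = \<zero>\<^bsub>Qbar\<^esub>" by (intro bexI[of _ "- x"]) auto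
  qed (auto intro: algebraic_plus_complex)
  show "Group.comm_monoid Qbar"
    by (rule comm_monoidI) (auto intro: algebraic_times_complex)
qed (auto simp: algebra_simps)

lemma Qbar_field: "field Qbar"
proof -
  interpret Qb: cring Qbar by (rule Qbar_cring)
  show ?thesis
  proof (rule Qb.cring_fieldI2)
    fix a assume "a \<in> carrier Qbar" "a \<noteq> \<zero>\<^bsub>Qbar\<^esub>"
    then show "\<exists>b\<in>carrier Qbar. a \<otimes>\<^bsub>Qbar\<^esub> b = \<one>\<^bsub>Qbar\<^esub>"
      by (intro bexI[of _ "inverse a"]) auto
  qed simp
qed

lemma Qbar_pow [simp]: "x [^]\<^bsub>Qbar\<^esub> (n::nat) = x ^ n"
  by (induction n) (simp_all add: nat_pow_def mult.commute)

lemma Qbar_eval: "ring.eval Qbar cs x = ring.eval cring_class_ops cs x"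
proof -
  interpret Qb: cring Qbar by (rule Qbar_cring)
  have r: "ring (cring_class_ops :: complex ring)" using cring_class by (rule cring.axioms)
  show ?thesis by (induction cs) (simp_all add: ring.eval.simps[OF r] class_simps)
qed

lemma Qbar_uminus: "algebraic x \<Longrightarrow> \<ominus>\<^bsub>Qbar\<^esub> x = - x"
proof -
  interpret Qb: cring Qbar by (rule Qbar_cring)
  assume "algebraic x"
  then show ?thesis by (intro Qb.minus_equality) auto
qed

lemma Qbar_int: "\<guillemotleft>i\<guillemotright>\<^bsub>Qbar\<^esub> = of_int i"
proof -
  interpret Qb: cring Qbar by (rule Qbar_cring)
  have nat: "\<guillemotleft>int n\<guillemotright>\<^bsub>Qbar\<^esub> = of_nat n" for n by (induction n) simp_all
  show ?thesis by (cases i rule: int_cases2) (simp_all add: nat Qbar_uminus)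
qed

lemma Qbar_inv: "algebraic x \<Longrightarrow> x \<noteq> 0 \<Longrightarrow> inv\<^bsub>Qbar\<^esub> x = inverse x"
proof -
  interpret Qb: field Qbar by (rule Qbar_field)
  assume "algebraic x" "x \<noteq> 0"
  then show ?thesis by (intro Qb.comm_inv_char) auto
qed

text \<open>Roots exist among the complex numbers by the fundamental theorem of algebra and are
  algebraic by transitivity of integrality.\<close>

theorem Qbar_closed_field: "closed_field Qbar \<rat>"
proof -
  interpret Qb: field Qbar by (rule Qbar_field)
  have sub: "subring \<rat> Qbar"
    by (rule Qb.subringI) (auto simp: Qbar_uminus rat_imp_algebraic)
  show ?thesis
  proof (intro closed_field.intro closed_field_axioms.intro Qbar_field)
    show "subfield \<rat> Qbar"
    proof (rule Qb.subfieldI')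
      show "subring \<rat> Qbar" by (rule sub)
      show "inv\<^bsub>Qbar\<^esub> q \<in> \<rat>" if "q \<in> \<rat> - {\<zero>\<^bsub>Qbar\<^esub>}" for q
        using that by (simp add: Qbar_inv rat_imp_algebraic)
    qed
    fix x assume "x \<in> carrier Qbar"
    then have x: "algebraic x" by simp
    then obtain cs where "set cs \<subseteq> \<rat>" "ring.eval cring_class_ops (\<one>\<^bsub>cring_class_ops\<^esub> # cs) x = \<zero>\<^bsub>cring_class_ops\<^esub>"
      unfolding algebraic_iff_integral using cring.integral_over_iff[OF cring_class Rats_subring carrier_class, of x] by (auto simp: class_simps)
    then show "integral_over Qbar \<rat> x"
      using Qb.integral_over_iff[OF sub, of x] x unfolding Qbar_eval by (auto simp: class_simps)
  next
    fix cs assume cs: "set cs \<subseteq> carrier Qbar" "cs \<noteq> []"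
    let ?p = "Poly (rev (1 # cs))"
    have "Polynomial.coeff ?p (length cs) = 1" by (simp add: nth_default_def nth_append)
    then have "length cs \<le> Polynomial.degree ?p" by (intro le_degree) simp
    then have "Polynomial.degree ?p > 0" using cs(2) by (cases cs) auto
    then obtain x where x: "poly ?p x = 0" using alg_closed_imp_poly_has_root by blast
    have "integral_over cring_class_ops \<rat> x"
    proof (rule cring.integral_over_trans[OF cring_class Rats_subring Rats_dvr_like])
      show "ring.eval cring_class_ops (\<one>\<^bsub>cring_class_ops\<^esub> # cs) x = \<zero>\<^bsub>cring_class_ops\<^esub>"
        using x unfolding cring_class_eval class_simps .
      show "integral_over cring_class_ops \<rat> c" if "c \<in> set cs" for c
        using that cs unfolding algebraic_iff_integral[symmetric] by auto
    qed (simp add: class_simps)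
    then have "algebraic x" unfolding algebraic_iff_integral .
    then show "\<exists>x\<in>carrier Qbar. Qb.eval (\<one>\<^bsub>Qbar\<^esub> # cs) x = \<zero>\<^bsub>Qbar\<^esub>"
      using x unfolding Qbar_eval cring_class_eval by auto
  next
    fix i assume "\<guillemotleft>i\<guillemotright>\<^bsub>Qbar\<^esub> = \<zero>\<^bsub>Qbar\<^esub>"
    then show "i = 0" unfolding Qbar_int by simp
  qed
qed

section \<open>The action of the absolute Galois group on algebraic numbers\<close>

context
  fixes s assumes s: "s \<in> carrier G_Q"
begin

lemma GQ_hom: "s \<in> ring_hom Qbar Qbar"
  and GQ_bij: "bij_betw s {x. algebraic x} {x. algebraic x}"
  and GQ_rat: "x \<in> \<rat> \<Longrightarrow> s x = x"
  using s unfolding G_Q_def galois_group_def Let_def ring_iso_def by auto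

lemma GQ_algebraic: "algebraic x \<Longrightarrow> algebraic (s x)"
  using ring_hom_closed[OF GQ_hom] by simp

lemma GQ_add: "algebraic x \<Longrightarrow> algebraic y \<Longrightarrow> s (x + y) = s x + s y"
  using ring_hom_add[OF GQ_hom] by simp

lemma GQ_mult: "algebraic x \<Longrightarrow> algebraic y \<Longrightarrow> s (x * y) = s x * s y"
  using ring_hom_mult[OF GQ_hom] by simp

lemma GQ_one: "s 1 = 1"
  using GQ_rat[of 1] by simp

lemma GQ_zero: "s 0 = 0"
  using GQ_rat[of 0] by simp

lemma GQ_power: "algebraic x \<Longrightarrow> s (x ^ n) = s x ^ n"
  by (induction n) (simp_all add: GQ_one GQ_mult algebraic_power_complex)

lemma GQ_inj: "algebraic x \<Longrightarrow> algebraic y \<Longrightarrow> s x = s y \<Longrightarrow> x = y"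
  using GQ_bij unfolding bij_betw_def inj_on_def by simp

lemma GQ_eq_0: "algebraic x \<Longrightarrow> s x = 0 \<longleftrightarrow> x = 0"
  using GQ_inj[of x 0] GQ_zero by auto

lemma GQ_inverse: "algebraic x \<Longrightarrow> s (inverse x) = inverse (s x)"
proof (cases "x = 0")
  case False
  assume x: "algebraic x"
  then have "s x * s (inverse x) = 1" using False GQ_mult[of x "inverse x"] by (simp add: GQ_one algebraic_inverse)
  then show ?thesis by (metis inverse_unique)
qed (simp add: GQ_zero)

lemma GQ_sum: "finite I \<Longrightarrow> (\<And>i. i \<in> I \<Longrightarrow> algebraic (f i)) \<Longrightarrow>
    algebraic (sum f I) \<and> s (sum f I) = (\<Sum>i\<in>I. s (f i))"
  by (induction I rule: finite_induct) (auto simp: GQ_zero GQ_add algebraic_plus_complex)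

end

lemma GQ_mult_simp: "s \<otimes>\<^bsub>G_Q\<^esub> t = compose {x. algebraic x} s t"
  unfolding G_Q_def galois_group_def Let_def by simp

lemma GQ_mult_apply: "algebraic x \<Longrightarrow> (s \<otimes>\<^bsub>G_Q\<^esub> t) x = s (t x)"
  unfolding GQ_mult_simp by (simp add: compose_def)

lemma GQ_mult_closed: "s \<in> carrier G_Q \<Longrightarrow> t \<in> carrier G_Q \<Longrightarrow> s \<otimes>\<^bsub>G_Q\<^esub> t \<in> carrier G_Q"
proof -
  assume st: "s \<in> carrier G_Q" "t \<in> carrier G_Q"
  have "compose {x. algebraic x} s t \<in> ring_hom Qbar Qbar"
    using GQ_algebraic[OF st(1)] GQ_algebraic[OF st(2)]
    by (intro ring_hom_memI)
      (auto simp: compose_def GQ_add[OF st(2)] GQ_add[OF st(1)] GQ_mult[OF st(2)] GQ_mult[OF st(1)]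
        algebraic_plus_complex algebraic_times_complex GQ_one[OF st(1)] GQ_one[OF st(2)])
  moreover have "bij_betw (compose {x. algebraic x} s t) {x. algebraic x} {x. algebraic x}"
    using GQ_bij[OF st(2)] GQ_bij[OF st(1)] by (rule bij_betw_compose)
  ultimately show ?thesis using GQ_rat[OF st(1)] GQ_rat[OF st(2)] unfolding GQ_mult_simp
    unfolding G_Q_def galois_group_def Let_def ring_iso_def
    by (auto simp: compose_def rat_imp_algebraic)
qed

lemma GQ_extI: "s \<in> carrier G_Q \<Longrightarrow> t \<in> carrier G_Q \<Longrightarrow> (\<And>x. algebraic x \<Longrightarrow> s x = t x) \<Longrightarrow> s = t"
  unfolding G_Q_def galois_group_def Let_def by (auto intro: extensionalityI)

lemma GQ_id: "(\<lambda>x\<in>{x. algebraic x}. x) \<in> carrier G_Q"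
  unfolding G_Q_def galois_group_def Let_def ring_iso_def
  by (auto intro!: ring_hom_memI simp: bij_betw_def inj_on_def image_iff rat_imp_algebraic
      algebraic_plus_complex algebraic_times_complex)

lemma GQ_inverse_exists:
  assumes s: "s \<in> carrier G_Q"
  obtains t where "t \<in> carrier G_Q" "\<And>x. algebraic x \<Longrightarrow> s (t x) = x"
proof -
  let ?A = "{x. algebraic x}"
  define t where "t = restrict (inv_into ?A s) ?A"
  have b: "bij_betw s ?A ?A" by (rule GQ_bij[OF s])
  have ta: "algebraic (t x)" and st: "s (t x) = x" if "algebraic x" for x
    using b that inv_into_into[of x s ?A] f_inv_into_f[of x s ?A] unfolding t_def bij_betw_def by auto
  have ts: "t y = x" if "algebraic x" "s x = y" for x y
  proof -
    have y: "algebraic y" using that GQ_algebraic[OF s] by blast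
    show ?thesis using GQ_inj[OF s ta[OF y] that(1)] st[OF y] that(2) by simp
  qed
  have "t \<in> ring_hom Qbar Qbar"
  proof (rule ring_hom_memI)
    fix x y assume "x \<in> carrier Qbar" "y \<in> carrier Qbar"
    then have xy: "algebraic x" "algebraic y" by auto
    show "t x \<in> carrier Qbar" using ta xy by simp
    have "t (x * y) = t x * t y"
      by (rule ts) (simp_all add: xy ta st GQ_mult[OF s] algebraic_times_complex)
    then show "t (x \<otimes>\<^bsub>Qbar\<^esub> y) = t x \<otimes>\<^bsub>Qbar\<^esub> t y" by simp
    have "t (x + y) = t x + t y"
      by (rule ts) (simp_all add: xy ta st GQ_add[OF s] algebraic_plus_complex)
    then show "t (x \<oplus>\<^bsub>Qbar\<^esub> y) = t x \<oplus>\<^bsub>Qbar\<^esub> t y" by simp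
  next
    have "t 1 = 1" by (rule ts) (simp_all add: GQ_one[OF s])
    then show "t \<one>\<^bsub>Qbar\<^esub> = \<one>\<^bsub>Qbar\<^esub>" by simp
  qed
  moreover have "bij_betw t ?A ?A"
    by (rule bij_betw_byWitness[of _ s]) (use ta st ts GQ_algebraic[OF s] in auto)
  moreover have "t x = x" if "x \<in> \<rat>" for x using GQ_rat[OF s that] that by (intro ts) (auto simp: rat_imp_algebraic)
  ultimately have "t \<in> carrier G_Q" unfolding G_Q_def galois_group_def Let_def ring_iso_def
    by (simp add: t_def)
  then show ?thesis using that st by blast
qed

lemma GQ_fixed_rational: "algebraic x \<Longrightarrow> (\<And>s. s \<in> carrier G_Q \<Longrightarrow> s x = x) \<Longrightarrow> x \<in> \<rat>"
  using closed_field.galois_moves[OF Qbar_closed_field closed_field.k_subring[OF Qbar_closed_field], of x]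
  unfolding G_Q_def by auto

section \<open>Hilbert 90 for cocycles of finite level\<close>

lemma GQ_orbit_finite:
  assumes "algebraic x" shows "finite ((\<lambda>s. s x) ` carrier G_Q)"
proof -
  obtain p where p: "\<And>i. Polynomial.coeff p i \<in> \<rat>" "p \<noteq> 0" "poly p x = 0" using assms unfolding algebraic_altdef by blast
  have "poly p (s x) = 0" if s: "s \<in> carrier G_Q" for s
  proof -
    have "poly p (s x) = (\<Sum>i\<le>Polynomial.degree p. s (Polynomial.coeff p i * x ^ i))"
      unfolding poly_altdef using GQ_rat[OF s p(1)] assms p(1)
      by (intro sum.cong refl) (simp add: GQ_mult[OF s] GQ_power[OF s] rat_imp_algebraic algebraic_power_complex)
    also have "\<dots> = s (poly p x)" unfolding poly_altdef
      using GQ_sum[OF s, of "{..Polynomial.degree p}" "\<lambda>i. Polynomial.coeff p i * x ^ i"] assms p(1)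
      by (simp add: algebraic_times_complex algebraic_power_complex rat_imp_algebraic)
    finally show ?thesis unfolding p(3) GQ_zero[OF s] .
  qed
  then have "(\<lambda>s. s x) ` carrier G_Q \<subseteq> {y. poly p y = 0}" by auto
  then show ?thesis using poly_roots_finite[OF p(2)] by (rule finite_subset)
qed

text \<open>Artin's argument on a multiplicatively closed set \<open>M\<close> that separates the
  given automorphisms, in place of a whole field. Evaluating a relation at \<open>u * y\<close> and
  subtracting \<open>t u\<close> times the relation at \<open>y\<close> removes the term of
  \<open>t\<close>.\<close>

lemma dedekind_independence:
  assumes "finite S" "S \<subseteq> carrier G_Q" "M \<subseteq> {x. algebraic x}" "1 \<in> M"
    and "\<And>x y. x \<in> M \<Longrightarrow> y \<in> M \<Longrightarrow> x * y \<in> M"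
    and "\<And>s t. s \<in> S \<Longrightarrow> t \<in> S \<Longrightarrow> s \<noteq> t \<Longrightarrow> \<exists>x\<in>M. s x \<noteq> t x"
    and "\<And>y. y \<in> M \<Longrightarrow> (\<Sum>s\<in>S. a s * s y) = 0"
  shows "\<forall>s\<in>S. a s = (0::complex)"
  using assms(1,2,6,7)
proof (induction S arbitrary: a rule: finite_induct)
  case (insert t S)
  have G: "t \<in> carrier G_Q" "\<And>s. s \<in> S \<Longrightarrow> s \<in> carrier G_Q" using insert.prems by auto
  have *: "a s * (s u - t u) = 0" if u: "u \<in> M" and s: "s \<in> S" for u s
  proof -
    have "(\<Sum>s\<in>S. (a s * (s u - t u)) * s y) = 0" if y: "y \<in> M" for y
    proof -
      have "(\<Sum>s\<in>S. (a s * (s u - t u)) * s y) = (\<Sum>s\<in>S. a s * s (u * y)) - t u * (\<Sum>s\<in>S. a s * s y)"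
        unfolding sum_distrib_left sum_subtractf[symmetric]
        using assms(3) u y by (intro sum.cong refl) (auto simp: GQ_mult[OF G(2)] algebra_simps subset_iff)
      moreover have "a t * t y + (\<Sum>s\<in>S. a s * s y) = 0" "a t * t (u * y) + (\<Sum>s\<in>S. a s * s (u * y)) = 0"
        using insert.prems(3)[OF y] insert.prems(3)[OF assms(5)[OF u y]] insert.hyps by simp_all
      moreover have "t (u * y) = t u * t y" using assms(3) u y by (auto simp: GQ_mult[OF G(1)] subset_iff)
      ultimately show ?thesis by (simp add: add_eq_0_iff algebra_simps)
    qed
    then show ?thesis using insert.IH[of "\<lambda>s. a s * (s u - t u)"] insert.prems s by simp
  qed
  have S0: "a s = 0" if s: "s \<in> S" for s
  proof -
    have "s \<noteq> t" using s insert.hyps by blast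
    then obtain u where "u \<in> M" "s u \<noteq> t u" using insert.prems(2)[of s t] s by blast
    then show ?thesis using *[of u s] s by simp
  qed
  moreover have "a t = 0" using insert.prems(3)[OF assms(4)] insert.hyps S0 GQ_one[OF G(1)] by simp
  ultimately show ?case by simp
qed simp

text \<open>The usual averaging proof. The finite level is given by a finite set \<open>Y\<close>
  whose pointwise stabiliser kills the cocycle, which avoids forming a finite Galois extension; sums
  run over one automorphism for each restriction to \<open>Y\<close>.\<close>

theorem hilbert90:
  fixes e :: "(complex \<Rightarrow> complex) \<Rightarrow> complex"
  assumes e: "\<And>s. s \<in> carrier G_Q \<Longrightarrow> algebraic (e s) \<and> e s \<noteq> 0"
    and cocycle: "\<And>s t. s \<in> carrier G_Q \<Longrightarrow> t \<in> carrier G_Q \<Longrightarrow> e (s \<otimes>\<^bsub>G_Q\<^esub> t) = e s * s (e t)"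
    and Y: "finite Y" "Y \<subseteq> {x. algebraic x}"
    and loc: "\<And>s. s \<in> carrier G_Q \<Longrightarrow> (\<And>x. x \<in> Y \<Longrightarrow> s x = x) \<Longrightarrow> e s = 1"
  obtains \<alpha> where "algebraic \<alpha>" "\<alpha> \<noteq> 0" "\<And>s. s \<in> carrier G_Q \<Longrightarrow> s \<alpha> = e s * \<alpha>"
proof -
  let ?G = "carrier G_Q"
  define res where "res s = restrict s Y" for s :: "complex \<Rightarrow> complex"
  have "res ` ?G \<subseteq> PiE Y (\<lambda>x. (\<lambda>s. s x) ` ?G)" unfolding res_def by auto
  moreover have "finite (PiE Y (\<lambda>x. (\<lambda>s. s x) ` ?G))"
    using Y GQ_orbit_finite by (intro finite_PiE) auto
  ultimately have fin: "finite (res ` ?G)" by (rule finite_subset)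
  define rep where "rep r = (SOME s. s \<in> ?G \<and> res s = r)" for r
  have rep: "rep (res s) \<in> ?G" "res (rep (res s)) = res s" if "s \<in> ?G" for s
    unfolding rep_def using someI[of "\<lambda>t. t \<in> ?G \<and> res t = res s" s] that by auto
  have res_eq: "s x = t x" if "res s = res t" "x \<in> Y" for s t x
    using that unfolding res_def by (metis restrict_apply)
  \<comment> \<open>One representative for each restriction to \<open>Y\<close>; there are finitely
    many since the elements of \<open>Y\<close> have finite orbits.\<close>
  define S where "S = rep ` res ` ?G"
  have S: "finite S" "S \<subseteq> ?G" "\<And>s t. s \<in> S \<Longrightarrow> t \<in> S \<Longrightarrow> res s = res t \<Longrightarrow> s = t"
    unfolding S_def using fin rep by auto
  \<comment> \<open>Two automorphisms with equal restriction differ by one that fixes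
    \<open>Y\<close>, on which the cocycle is trivial.\<close>
  have e_res: "e s = e t" if st: "s \<in> ?G" "t \<in> ?G" "res s = res t" for s t
  proof -
    obtain s' where s': "s' \<in> ?G" "\<And>x. algebraic x \<Longrightarrow> s (s' x) = x" using GQ_inverse_exists[OF st(1)] by blast
    have u: "s' \<otimes>\<^bsub>G_Q\<^esub> t \<in> ?G" using GQ_mult_closed s' st by blast
    have "(s' \<otimes>\<^bsub>G_Q\<^esub> t) x = x" if "x \<in> Y" for x
    proof -
      have x: "algebraic x" using that Y by auto
      have "s ((s' \<otimes>\<^bsub>G_Q\<^esub> t) x) = s x"
        using x s' res_eq[OF st(3) that] GQ_algebraic[OF st(2) x] by (simp add: GQ_mult_apply)
      then show ?thesis using GQ_inj[OF st(1) GQ_algebraic[OF u x] x] by blast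
    qed
    then have "e (s' \<otimes>\<^bsub>G_Q\<^esub> t) = 1" using loc u by blast
    moreover have "s \<otimes>\<^bsub>G_Q\<^esub> (s' \<otimes>\<^bsub>G_Q\<^esub> t) = t"
      using s' GQ_algebraic[OF st(2)] by (intro GQ_extI GQ_mult_closed st u) (simp add: GQ_mult_apply)
    ultimately show ?thesis using cocycle[OF st(1) u] GQ_one[OF st(1)] by simp
  qed
  \<comment> \<open>The elements whose image depends only on the restriction to \<open>Y\<close>,
    that is, the field generated by \<open>Y\<close>. It is multiplicatively closed and contains
    \<open>Y\<close>, which separates the representatives.\<close>
  define M where "M = {y. algebraic y \<and> (\<forall>s\<in>?G. \<forall>t\<in>?G. res s = res t \<longrightarrow> s y = t y)}"
  have "\<exists>\<theta>\<in>M. (\<Sum>s\<in>S. e s * s \<theta>) \<noteq> 0"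
  proof (rule ccontr)
    assume "\<not> ?thesis"
    then have zero: "\<And>y. y \<in> M \<Longrightarrow> (\<Sum>s\<in>S. e s * s y) = 0" by blast
    have "\<forall>s\<in>S. e s = 0"
    proof (rule dedekind_independence[OF S(1,2) _ _ _ _ zero])
      show "M \<subseteq> {x. algebraic x}" "1 \<in> M" unfolding M_def by (auto simp: GQ_one)
      show "x * y \<in> M" if "x \<in> M" "y \<in> M" for x y
      proof -
        have a: "algebraic x" "algebraic y" using that unfolding M_def by blast+
        have "s (x * y) = t (x * y)" if "s \<in> ?G" "t \<in> ?G" "res s = res t" for s t
        proof -
          have "s x = t x" using \<open>x \<in> M\<close> that unfolding M_def by blast
          moreover have "s y = t y" using \<open>y \<in> M\<close> that unfolding M_def by blast
          ultimately show ?thesis unfolding GQ_mult[OF that(1) a] GQ_mult[OF that(2) a] by simp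
        qed
        then show ?thesis unfolding M_def using a algebraic_times_complex by blast
      qed
      show "\<exists>x\<in>M. s x \<noteq> t x" if "s \<in> S" "t \<in> S" "s \<noteq> t" for s t
      proof -
        have "res s \<noteq> res t" using S(3) that by blast
        then obtain x where "x \<in> Y" "s x \<noteq> t x" unfolding res_def by (metis restrict_ext)
        moreover have "x \<in> M" unfolding M_def using Y res_eq \<open>x \<in> Y\<close> by auto
        ultimately show ?thesis by blast
      qed
    qed
    moreover have "rep (res (\<lambda>x\<in>{x. algebraic x}. x)) \<in> S" unfolding S_def using GQ_id by blast
    ultimately show False using e S(2) by blast
  qed
  then obtain \<theta> where \<theta>: "\<theta> \<in> M" "(\<Sum>s\<in>S. e s * s \<theta>) \<noteq> 0" by blast
  have \<theta>a: "algebraic \<theta>" using \<theta> unfolding M_def by blast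
  define \<alpha> where "\<alpha> = (\<Sum>s\<in>S. e s * s \<theta>)"
  have term_alg: "algebraic (e s * s \<theta>)" if "s \<in> S" for s
    using e S(2) GQ_algebraic \<theta>a that by (blast intro: algebraic_times_complex)
  have \<alpha>a: "algebraic \<alpha>" using GQ_sum[OF GQ_id S(1), of "\<lambda>s. e s * s \<theta>"] term_alg unfolding \<alpha>_def by blast
  \<comment> \<open>Left translation by \<open>t\<close> permutes the representatives up to
    automorphisms fixing \<open>Y\<close>, and such a change affects neither the cocycle nor the
    image of \<open>\<theta>\<close>.\<close>
  have main: "e t * t \<alpha> = \<alpha>" if t: "t \<in> ?G" for t
  proof -
    define h where "h s = rep (res (t \<otimes>\<^bsub>G_Q\<^esub> s))" for s
    have ts: "t \<otimes>\<^bsub>G_Q\<^esub> s \<in> ?G" if "s \<in> S" for s using GQ_mult_closed t S(2) that by blast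
    have h: "h s \<in> S" "res (h s) = res (t \<otimes>\<^bsub>G_Q\<^esub> s)" "h s \<in> ?G" if "s \<in> S" for s
      using rep[OF ts[OF that]] ts[OF that] unfolding h_def S_def by auto
    have "inj_on h S"
    proof (rule inj_onI)
      fix s s' assume s: "s \<in> S" "s' \<in> S" "h s = h s'"
      then have r: "res (t \<otimes>\<^bsub>G_Q\<^esub> s) = res (t \<otimes>\<^bsub>G_Q\<^esub> s')" using h(2) by metis
      have "s x = s' x" if "x \<in> Y" for x
      proof -
        have x: "algebraic x" using that Y by auto
        have "t (s x) = t (s' x)" using res_eq[OF r that] x by (simp add: GQ_mult_apply)
        then show ?thesis using GQ_inj[OF t] GQ_algebraic x s S(2) by blast
      qed
      then have "res s = res s'" unfolding res_def by (intro restrict_ext) auto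
      then show "s = s'" using S(3) s by blast
    qed
    then have hS: "h ` S = S" using S(1) h(1) by (simp add: endo_inj_surj image_subsetI)
    have "e t * t \<alpha> = (\<Sum>s\<in>S. e t * t (e s * s \<theta>))"
      unfolding \<alpha>_def using GQ_sum[OF t S(1), of "\<lambda>s. e s * s \<theta>"] term_alg by (simp add: sum_distrib_left)
    also have "\<dots> = (\<Sum>s\<in>S. e (h s) * h s \<theta>)"
    proof (rule sum.cong[OF refl])
      fix s assume s: "s \<in> S"
      then have sG: "s \<in> ?G" using S(2) by blast
      have "e t * t (e s * s \<theta>) = (e t * t (e s)) * t (s \<theta>)"
        using e[OF sG] GQ_algebraic[OF sG \<theta>a] by (simp add: GQ_mult[OF t])
      also have "\<dots> = e (t \<otimes>\<^bsub>G_Q\<^esub> s) * (t \<otimes>\<^bsub>G_Q\<^esub> s) \<theta>" using cocycle[OF t sG] \<theta>a by (simp add: GQ_mult_apply)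
      also have "e (t \<otimes>\<^bsub>G_Q\<^esub> s) = e (h s)" using e_res h[OF s] ts[OF s] by metis
      also have "(t \<otimes>\<^bsub>G_Q\<^esub> s) \<theta> = h s \<theta>" using \<theta>(1) h[OF s] ts[OF s] unfolding M_def by auto
      finally show "e t * t (e s * s \<theta>) = e (h s) * h s \<theta>" .
    qed
    also have "\<dots> = \<alpha>" unfolding \<alpha>_def using sum.reindex[OF \<open>inj_on h S\<close>, of "\<lambda>s. e s * s \<theta>"] hS by simp
    finally show ?thesis .
  qed
  show ?thesis
  proof (rule that)
    \<comment> \<open>The average satisfies \<open>e t * t \<alpha> = \<alpha>\<close>, so its
      inverse has the required behaviour.\<close>
    show "algebraic (inverse \<alpha>)" using \<alpha>a by (rule algebraic_inverse)
    show "inverse \<alpha> \<noteq> 0" using \<theta>(2) unfolding \<alpha>_def by simp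
    show "t (inverse \<alpha>) = e t * inverse \<alpha>" if t: "t \<in> ?G" for t
    proof -
      have "t \<alpha> \<noteq> 0" using \<theta>(2) GQ_eq_0[OF t \<alpha>a] unfolding \<alpha>_def by simp
      then show ?thesis using main[OF t] \<theta>(2) unfolding \<alpha>_def[symmetric] GQ_inverse[OF t \<alpha>a]
        by (simp add: field_simps)
    qed
  qed
qed

section \<open>Localisation at a prime\<close>

text \<open>A monic polynomial over the image splits there into linear factors, and a root in the
  field \<open>\<Omega>\<close> must annihilate one of them.\<close>

lemma image_root_closed:
  assumes "closed_field L K" "field \<Omega>" and j: "j \<in> ring_hom L \<Omega>"
    and es: "set es \<subseteq> j ` carrier L" and y: "y \<in> carrier \<Omega>" "ring.eval \<Omega> (\<one>\<^bsub>\<Omega>\<^esub> # es) y = \<zero>\<^bsub>\<Omega>\<^esub>"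
  shows "y \<in> j ` carrier L"
proof -
  interpret L: closed_field L K by fact
  interpret O: field \<Omega> by fact
  interpret j: ring_hom_ring L \<Omega> j using j by (intro ring_hom_ringI2 L.ring_axioms O.ring_axioms)
  have B: "subring (j ` carrier L) \<Omega>" by (rule j.img_is_subring[OF L.carrier_is_subring])
  show ?thesis using es y(2)
  proof (induction "length es" arbitrary: es)
    case 0
    then show ?case using y(1) by simp
  next
    case (Suc n)
    then have ne: "es \<noteq> []" by auto
    define cs where "cs = map (inv_into (carrier L) j) es"
    have "inv_into (carrier L) j x \<in> carrier L" "j (inv_into (carrier L) j x) = x" if "x \<in> set es" for x
      using that Suc.prems(1) by (blast intro: inv_into_into f_inv_into_f)+
    then have cs: "set cs \<subseteq> carrier L" "es = map j cs"
      unfolding cs_def by (auto simp: comp_def intro!: map_idI[symmetric])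
    obtain \<eta> where \<eta>: "\<eta> \<in> carrier L" "L.eval (\<one>\<^bsub>L\<^esub> # cs) \<eta> = \<zero>\<^bsub>L\<^esub>"
      using L.monic_root[OF cs(1)] cs(2) ne by auto
    have "O.eval (map j (\<one>\<^bsub>L\<^esub> # cs)) (j \<eta>) = j (L.eval (\<one>\<^bsub>L\<^esub> # cs) \<eta>)"
      using \<eta> cs by (intro j.eval_hom'[symmetric]) auto
    then have root: "O.eval (\<one>\<^bsub>\<Omega>\<^esub> # es) (j \<eta>) = \<zero>\<^bsub>\<Omega>\<^esub>" unfolding \<eta>(2) cs(2) by (simp del: O.eval.simps)
    obtain ds where ds: "set ds \<subseteq> j ` carrier L" "length es = Suc (length ds)"
      "\<And>x. x \<in> carrier \<Omega> \<Longrightarrow> O.eval (\<one>\<^bsub>\<Omega>\<^esub> # es) x = (x \<ominus>\<^bsub>\<Omega>\<^esub> j \<eta>) \<otimes>\<^bsub>\<Omega>\<^esub> O.eval (\<one>\<^bsub>\<Omega>\<^esub> # ds) x"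
      using O.monic_root_divide[OF B Suc.prems(1) imageI[OF \<eta>(1)] ne root] by metis
    have "set (\<one>\<^bsub>\<Omega>\<^esub> # ds) \<subseteq> carrier \<Omega>" using ds(1) by auto
    then have ec: "O.eval (\<one>\<^bsub>\<Omega>\<^esub> # ds) y \<in> carrier \<Omega>" using y(1) by (rule O.eval_in_carrier)
    have "(y \<ominus>\<^bsub>\<Omega>\<^esub> j \<eta>) \<otimes>\<^bsub>\<Omega>\<^esub> O.eval (\<one>\<^bsub>\<Omega>\<^esub> # ds) y = \<zero>\<^bsub>\<Omega>\<^esub>" using ds(3)[OF y(1)] Suc.prems(2) by simp
    then consider "y \<ominus>\<^bsub>\<Omega>\<^esub> j \<eta> = \<zero>\<^bsub>\<Omega>\<^esub>" | "O.eval (\<one>\<^bsub>\<Omega>\<^esub> # ds) y = \<zero>\<^bsub>\<Omega>\<^esub>"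
      using O.integral[OF _ O.minus_closed[OF y(1) j.hom_closed[OF \<eta>(1)]] ec] by argo
    then show ?case
    proof cases
      case 1
      then show ?thesis using y(1) \<eta>(1) by simp
    next
      case 2
      then show ?thesis using Suc.hyps(1)[of ds] Suc.hyps(2) ds(1,2) by auto
    qed
  qed
qed

text \<open>For \<open>\<eta> \<noteq> \<one>\<close> the sum of the powers
  \<open>\<eta> [^] j\<close> over \<open>j < n\<close> vanishes. Each of them is congruent to one
  modulo nonunits, so \<open>n\<close> would be a nonunit, against
  \<open>coprime n l\<close>.\<close>

lemma (in padic_closure) unity_root_nonunit:
  assumes \<eta>: "\<eta> \<in> carrier R" "\<eta> [^] (n::nat) = \<one>" and n: "coprime n l" and "\<eta> \<ominus> \<one> \<in> nonunits"
  shows "\<eta> = \<one>"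
proof (rule ccontr)
  assume ne: "\<eta> \<noteq> \<one>"
  have "0 < n" using n prime_l prime_gt_1_nat[OF prime_l] by (cases n) auto
  then have \<eta>i: "\<eta> \<in> ints" using ints_root[of n \<one> \<eta>] ints_one \<eta> by blast
  have *: "\<eta> [^] j \<ominus> \<one> \<in> nonunits" for j :: nat
  proof (induction j)
    case 0
    then show ?case using nonunits_zero by (simp add: a_minus_def r_neg)
  next
    case (Suc j)
    define v where "v = \<eta> [^] j"
    have v: "v \<in> carrier R" unfolding v_def using \<eta> by simp
    have "v \<otimes> \<eta> \<ominus> \<one> = \<eta> \<otimes> (v \<ominus> \<one>) \<oplus> (\<eta> \<ominus> \<one>)" using v \<eta>(1) by algebra
    then show ?case using nonunits_add[OF nonunits_mult[OF \<eta>i Suc] assms(4)] unfolding v_def by simp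
  qed
  have "finsum R (\<lambda>j. \<eta> [^] j \<ominus> \<one>) {..<m} \<in> nonunits" for m :: nat
    using * by (intro nonunits_finsum) auto
  moreover have "finsum R (\<lambda>j. \<eta> [^] j \<ominus> \<one>) {..<m} = finsum R (\<lambda>j. \<eta> [^] j) {..<m} \<ominus> \<guillemotleft>int m\<guillemotright>" for m :: nat
  proof (induction m)
    case 0
    then show ?case by (simp add: a_minus_def r_neg)
  next
    case (Suc m)
    define s v c where "s = finsum R (\<lambda>j. \<eta> [^] j) {..<m}" "v = \<eta> [^] m" "c = \<guillemotleft>int m\<guillemotright>"
    have m: "s \<in> carrier R" "v \<in> carrier R" "c \<in> carrier R" unfolding s_v_c_def using \<eta> by auto
    have "(v \<ominus> \<one>) \<oplus> (s \<ominus> c) = (v \<oplus> s) \<ominus> (\<one> \<oplus> c)" using m by algebra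
    then show ?case using Suc \<eta>(1) unfolding s_v_c_def by (simp add: lessThan_Suc)
  qed
  ultimately have "finsum R (\<lambda>j. \<eta> [^] j) {..<n} \<ominus> \<guillemotleft>int n\<guillemotright> \<in> nonunits" by simp
  then have "\<ominus> \<guillemotleft>int n\<guillemotright> \<in> nonunits"
    unfolding finsum_powers_of_unity[OF \<eta>] using ne by simp
  then have "\<guillemotleft>int n\<guillemotright> \<in> nonunits" using nonunits_uminus by fastforce
  moreover have "\<guillemotleft>int n\<guillemotright> \<otimes> inv \<guillemotleft>int n\<guillemotright> = \<one>" using coprime_unit(1)[OF n] by simp
  ultimately show False using coprime_unit(2)[OF n] A_ints unfolding nonunits_def by blast
qed

locale padic_embedding = padic_prime +
  fixes j :: "complex \<Rightarrow> padic_bar"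
  assumes j_hom: "j \<in> ring_hom Qbar (Qlbar l)"
begin

abbreviation \<Omega> where "\<Omega> \<equiv> Qlbar l"

sublocale P: padic_closure "Qlbar l" "Ql l" "Zl l" l
  by (rule padic_closure_Qlbar)

lemma j_ring_hom_ring: "ring_hom_ring Qbar \<Omega> j"
  using j_hom Qbar_cring P.ring_axioms by (intro ring_hom_ringI2) (auto simp: cring.axioms(1))

lemma j_closed: "algebraic x \<Longrightarrow> j x \<in> carrier \<Omega>"
  using ring_hom_closed[OF j_hom] by simp

lemma j_add: "algebraic x \<Longrightarrow> algebraic y \<Longrightarrow> j (x + y) = j x \<oplus>\<^bsub>\<Omega>\<^esub> j y"
  using ring_hom_add[OF j_hom] by simp

lemma j_mult: "algebraic x \<Longrightarrow> algebraic y \<Longrightarrow> j (x * y) = j x \<otimes>\<^bsub>\<Omega>\<^esub> j y"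
  using ring_hom_mult[OF j_hom] by simp

lemma j_one: "j 1 = \<one>\<^bsub>\<Omega>\<^esub>"
  using ring_hom_one[OF j_hom] by simp

lemma j_power: "algebraic x \<Longrightarrow> j (x ^ n) = j x [^]\<^bsub>\<Omega>\<^esub> (n::nat)"
  by (induction n) (simp_all add: j_one j_mult algebraic_power_complex j_closed P.m_comm)

lemma j_int: "j (of_int i) = \<guillemotleft>i\<guillemotright>\<^bsub>\<Omega>\<^esub>"
proof -
  interpret j: ring_hom_ring Qbar \<Omega> j by (rule j_ring_hom_ring)
  have nat: "j (of_nat n) = \<guillemotleft>int n\<guillemotright>\<^bsub>\<Omega>\<^esub>" for n
    using j.hom_zero by (induction n) (simp_all add: j_add j_one)
  have "j (- of_nat n) = \<ominus>\<^bsub>\<Omega>\<^esub> \<guillemotleft>int n\<guillemotright>\<^bsub>\<Omega>\<^esub>" for n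
    using j.hom_a_inv[of "of_nat n"] by (simp add: Qbar_uminus nat)
  then show ?thesis using nat by (cases i rule: int_cases2) simp_all
qed

lemma j_inj: "algebraic x \<Longrightarrow> algebraic y \<Longrightarrow> j x = j y \<Longrightarrow> x = y"
proof (rule ccontr)
  assume xy: "algebraic x" "algebraic y" "j x = j y" "x \<noteq> y"
  then have d: "algebraic (x - y)" "x - y \<noteq> 0" by (auto intro: algebraic_diff_complex)
  have "j y \<oplus>\<^bsub>\<Omega>\<^esub> j (x - y) = j y" using j_add[OF xy(2) d(1)] xy(3) by simp
  then have "j (x - y) = \<zero>\<^bsub>\<Omega>\<^esub>" using P.add.r_cancel_one[of "j y" "j (x - y)"] j_closed xy(2) d(1) by simp
  then have "j ((x - y) * inverse (x - y)) = \<zero>\<^bsub>\<Omega>\<^esub>"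
    using d j_mult[OF d(1) algebraic_inverse[OF d(1)]] j_closed[OF algebraic_inverse[OF d(1)]] by simp
  then show False using d(2) j_one by simp
qed

lemma j_rat: assumes "x \<in> \<rat>" shows "j x \<in> Ql l"
proof -
  obtain a b :: int where ab: "b \<noteq> 0" "x = of_int a / of_int b"
    using assms by (metis Rats_cases' of_int_0_less_iff less_irrefl)
  have alg: "algebraic x" using assms by (rule rat_imp_algebraic)
  have b: "\<guillemotleft>b\<guillemotright>\<^bsub>\<Omega>\<^esub> \<noteq> \<zero>\<^bsub>\<Omega>\<^esub>" using P.char_zero ab(1) by blast
  have "x * of_int b = of_int a" using ab by simp
  then have "j x \<otimes>\<^bsub>\<Omega>\<^esub> \<guillemotleft>b\<guillemotright>\<^bsub>\<Omega>\<^esub> = \<guillemotleft>a\<guillemotright>\<^bsub>\<Omega>\<^esub>" using j_mult[OF alg, of "of_int b"] by (simp add: j_int)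
  then have "j x = \<guillemotleft>a\<guillemotright>\<^bsub>\<Omega>\<^esub> \<otimes>\<^bsub>\<Omega>\<^esub> inv\<^bsub>\<Omega>\<^esub> \<guillemotleft>b\<guillemotright>\<^bsub>\<Omega>\<^esub>"
    using b j_closed[OF alg] by (metis P.inv_closed P.m_assoc P.of_int_closed P.r_inv P.r_one)
  then show ?thesis using P.k_inv[OF P.int_in_subring[OF P.k_subring] b]
      P.int_in_subring[OF P.k_subring] subringE(6)[OF P.k_subring] by simp
qed

context
  fixes \<tau> K assumes \<tau>: "\<tau> \<in> carrier (galois_group \<Omega> K)" and K: "Ql l \<subseteq> K"
begin

lemma tau_hom: "ring_hom_cring \<Omega> \<Omega> \<tau>"
  using P.galoisD[OF \<tau>] by blast

text \<open>\<open>\<tau>\<close> fixes the image of \<open>\<rat>\<close>, so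
  \<open>\<tau> (j x)\<close> is a root of the same rational polynomial as \<open>j x\<close>, and
  all such roots lie in the image of \<open>j\<close>.\<close>

lemma restrict_ex: assumes x: "algebraic x" shows "\<exists>y. algebraic y \<and> j y = \<tau> (j x)"
proof -
  interpret \<tau>: ring_hom_cring \<Omega> \<Omega> \<tau> by (rule tau_hom)
  interpret j: ring_hom_ring Qbar \<Omega> j by (rule j_ring_hom_ring)
  interpret Qb: closed_field Qbar \<rat> by (rule Qbar_closed_field)
  obtain cs where cs: "set cs \<subseteq> \<rat>" "ring.eval Qbar (\<one>\<^bsub>Qbar\<^esub> # cs) x = \<zero>\<^bsub>Qbar\<^esub>"
    using Qb.k_algebraic[of x] x Qb.integral_over_iff[OF Qb.k_subring, of x] by auto
  have csc: "set (\<one>\<^bsub>Qbar\<^esub> # cs) \<subseteq> carrier Qbar" using cs(1) by (auto simp: rat_imp_algebraic)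
  have xc: "x \<in> carrier Qbar" using x by simp
  have 1: "P.eval (map j (\<one>\<^bsub>Qbar\<^esub> # cs)) (j x) = \<zero>\<^bsub>\<Omega>\<^esub>"
    using j.eval_hom'[OF xc csc] unfolding cs(2) using j.hom_zero by simp
  have "\<tau> (j c) = j c" if "c \<in> \<rat>" for c
    using P.galoisD(2)[OF \<tau>] K j_rat[OF that] by blast
  then have fix_cs: "map \<tau> (map j (\<one>\<^bsub>Qbar\<^esub> # cs)) = map j (\<one>\<^bsub>Qbar\<^esub> # cs)"
    using cs(1) Rats_1 by (intro map_idI) (auto simp del: Rats_1)
  have "set (map j (\<one>\<^bsub>Qbar\<^esub> # cs)) \<subseteq> carrier \<Omega>" using csc j.hom_closed by auto
  then have "P.eval (map \<tau> (map j (\<one>\<^bsub>Qbar\<^esub> # cs))) (\<tau> (j x)) = \<tau> (P.eval (map j (\<one>\<^bsub>Qbar\<^esub> # cs)) (j x))"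
    using j_closed[OF x] by (intro \<tau>.ring.eval_hom'[symmetric])
  then have "P.eval (\<one>\<^bsub>\<Omega>\<^esub> # map j cs) (\<tau> (j x)) = \<zero>\<^bsub>\<Omega>\<^esub>"
    unfolding fix_cs 1 using \<tau>.hom_zero j_one by simp
  then have "\<tau> (j x) \<in> j ` carrier Qbar"
    using csc j_closed[OF x] \<tau>.hom_closed
    by (intro image_root_closed[OF Qbar_closed_field Qlbar_field j_hom, of "map j cs"]) (auto simp del: P.eval.simps)
  then show ?thesis by auto
qed

lemma restrict_algebraic: "algebraic x \<Longrightarrow> algebraic (galois_restrict j \<tau> x)"
  and j_restrict: "algebraic x \<Longrightarrow> j (galois_restrict j \<tau> x) = \<tau> (j x)"
proof -
  assume x: "algebraic x"
  then have "\<tau> (j x) \<in> j ` carrier Qbar" using restrict_ex by force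
  then show "algebraic (galois_restrict j \<tau> x)" "j (galois_restrict j \<tau> x) = \<tau> (j x)"
    using x inv_into_into[of "\<tau> (j x)" j "carrier Qbar"] f_inv_into_f[of "\<tau> (j x)" j "carrier Qbar"]
    unfolding galois_restrict_def by auto
qed

lemma restrict_eqI: "algebraic x \<Longrightarrow> algebraic y \<Longrightarrow> \<tau> (j x) = j y \<Longrightarrow> galois_restrict j \<tau> x = y"
  using j_inj restrict_algebraic j_restrict by simp

lemma restrict_GQ: "galois_restrict j \<tau> \<in> carrier G_Q"
proof -
  interpret \<tau>: ring_hom_cring \<Omega> \<Omega> \<tau> by (rule tau_hom)
  show ?thesis unfolding G_Q_def
  proof (rule closed_field.endomorphism_in_galois_group[OF Qbar_closed_field])
    show "galois_restrict j \<tau> \<in> ring_hom Qbar Qbar"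
    proof (rule ring_hom_memI)
      fix x y assume "x \<in> carrier Qbar" "y \<in> carrier Qbar"
      then have xy: "algebraic x" "algebraic y" by auto
      show "galois_restrict j \<tau> x \<in> carrier Qbar" using restrict_algebraic xy by simp
      have "galois_restrict j \<tau> (x * y) = galois_restrict j \<tau> x * galois_restrict j \<tau> y"
        using xy by (intro restrict_eqI) (simp_all add: algebraic_times_complex restrict_algebraic j_mult j_restrict j_closed)
      then show "galois_restrict j \<tau> (x \<otimes>\<^bsub>Qbar\<^esub> y) = galois_restrict j \<tau> x \<otimes>\<^bsub>Qbar\<^esub> galois_restrict j \<tau> y" by simp
      have "galois_restrict j \<tau> (x + y) = galois_restrict j \<tau> x + galois_restrict j \<tau> y"
        using xy by (intro restrict_eqI) (simp_all add: algebraic_plus_complex restrict_algebraic j_add j_restrict j_closed)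
      then show "galois_restrict j \<tau> (x \<oplus>\<^bsub>Qbar\<^esub> y) = galois_restrict j \<tau> x \<oplus>\<^bsub>Qbar\<^esub> galois_restrict j \<tau> y" by simp
    next
      have "galois_restrict j \<tau> 1 = 1" by (rule restrict_eqI) (simp_all add: j_one)
      then show "galois_restrict j \<tau> \<one>\<^bsub>Qbar\<^esub> = \<one>\<^bsub>Qbar\<^esub>" by simp
    qed
    show "galois_restrict j \<tau> \<in> extensional (carrier Qbar)"
      unfolding galois_restrict_def by (rule restrict_extensional)
    show "\<rat> \<subseteq> carrier Qbar" by (auto simp: rat_imp_algebraic)
    show "galois_restrict j \<tau> x = x" if "x \<in> \<rat>" for x
      using that P.galoisD(2)[OF \<tau>] j_rat K by (intro restrict_eqI) (auto simp: rat_imp_algebraic)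
  qed simp
qed

end

text \<open>The bridge from the polynomial definition of the integral closure to
  \<open>ints\<close>; with \<open>Zlbar_nonunits\<close> it turns inertia into a congruence modulo
  nonunits.\<close>

lemma Zlbar_carrier: "carrier (Zlbar l) = P.ints"
proof -
  have "x \<in> integral_closure_in \<Omega> (Zl l) \<longleftrightarrow> integral_over \<Omega> (Zl l) x" if x: "x \<in> carrier \<Omega>" for x
  proof
    assume "x \<in> integral_closure_in \<Omega> (Zl l)"
    then obtain f where f: "f \<in> carrier (univ_poly \<Omega> (Zl l))" "f \<noteq> []" "hd f = \<one>\<^bsub>\<Omega>\<^esub>" "P.eval f x = \<zero>\<^bsub>\<Omega>\<^esub>"
      unfolding integral_closure_in_def by blast
    then obtain cs where "f = \<one>\<^bsub>\<Omega>\<^esub> # cs" by (cases f) auto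
    then show "integral_over \<Omega> (Zl l) x"
      using f unfolding P.integral_over_iff[OF P.A_subring x] univ_poly_carrier[symmetric] polynomial_def
      by (intro exI[of _ cs]) auto
  next
    assume "integral_over \<Omega> (Zl l) x"
    then obtain cs where cs: "set cs \<subseteq> Zl l" "P.eval (\<one>\<^bsub>\<Omega>\<^esub> # cs) x = \<zero>\<^bsub>\<Omega>\<^esub>"
      unfolding P.integral_over_iff[OF P.A_subring x] by blast
    then have "\<one>\<^bsub>\<Omega>\<^esub> # cs \<in> carrier (univ_poly \<Omega> (Zl l))"
      using subringE(3)[OF P.A_subring] unfolding univ_poly_carrier[symmetric] polynomial_def by auto
    then show "x \<in> integral_closure_in \<Omega> (Zl l)" unfolding integral_closure_in_def using cs x
      by (intro CollectI conjI bexI[of _ "\<one>\<^bsub>\<Omega>\<^esub> # cs"]) (simp_all del: P.eval.simps)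
  qed
  then show ?thesis unfolding Zlbar_def P.ints_def integral_closure_in_def integral_over_def by auto
qed

lemma Zlbar_nonunits: "carrier (Zlbar l) - Units (Zlbar l) = P.nonunits"
proof -
  have "x \<in> Units (Zlbar l) \<longleftrightarrow> (\<exists>y\<in>P.ints. x \<otimes>\<^bsub>\<Omega>\<^esub> y = \<one>\<^bsub>\<Omega>\<^esub>)" if "x \<in> P.ints" for x
    unfolding Units_def Zlbar_carrier using that P.m_comm[of x] by (auto simp: Zlbar_def)
  then show ?thesis unfolding Zlbar_carrier P.nonunits_def by blast
qed

lemma inertia_iff:
  "\<tau> \<in> inertia l K \<longleftrightarrow> \<tau> \<in> carrier (galois_group \<Omega> K) \<and> (\<forall>x\<in>P.ints. \<tau> x \<ominus>\<^bsub>\<Omega>\<^esub> x \<in> P.nonunits)"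
  unfolding inertia_def Zlbar_nonunits unfolding Zlbar_carrier by blast

text \<open>The set \<open>K'\<close> whose invariance forces trivial action on residues may differ
  from the field \<open>K\<close> over which inertia is formed; at \<open>p\<close> the latter is
  \<open>Lp\<close>.\<close>

lemma inertiaI:
  assumes "\<tau> \<in> carrier (galois_group \<Omega> K')" "Ql l \<subseteq> K'" "P.roots_of_unity \<subseteq> K'" "\<tau> \<in> carrier (galois_group \<Omega> K)"
  shows "\<tau> \<in> inertia l K"
  using P.galois_inertia[OF assms(1) _ assms(3)] P.A_k assms(2,4) unfolding inertia_iff by blast

lemma nat_valuation:
  fixes A :: nat assumes "0 < A"
  obtains B where "\<guillemotleft>int A\<guillemotright>\<^bsub>\<Omega>\<^esub> = \<guillemotleft>int l\<guillemotright>\<^bsub>\<Omega>\<^esub> [^]\<^bsub>\<Omega>\<^esub> multiplicity l A \<otimes>\<^bsub>\<Omega>\<^esub> \<guillemotleft>int B\<guillemotright>\<^bsub>\<Omega>\<^esub>" "coprime B l"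
proof -
  have "\<not> is_unit l" using l_gt1 by simp
  then obtain B where B: "A = l ^ multiplicity l A * B" "\<not> l dvd B"
    using multiplicity_decompose'[of A l] assms by blast
  have "coprime B l" using B(2) prime_l by (metis coprime_commute prime_imp_coprime)
  moreover have "\<guillemotleft>int A\<guillemotright>\<^bsub>\<Omega>\<^esub> = \<guillemotleft>int (l ^ multiplicity l A * B)\<guillemotright>\<^bsub>\<Omega>\<^esub>" using B(1) by simp
  ultimately show ?thesis using that by simp
qed

text \<open>An element fixed by inertia is fixed by all automorphisms over \<open>k_unr\<close>,
  hence lies in \<open>k_unr\<close>, where \<open>l\<close> is a uniformiser.\<close>

theorem unramified_valuation:
  assumes p: "prime p" and \<alpha>: "algebraic \<alpha>" "\<alpha> ^ p = of_nat A" "0 < A"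
    and fixed: "\<And>\<tau>. \<tau> \<in> inertia l (Ql l) \<Longrightarrow> galois_restrict j \<tau> \<alpha> = \<alpha>"
  shows "p dvd multiplicity l A"
proof -
  obtain B where B: "\<guillemotleft>int A\<guillemotright>\<^bsub>\<Omega>\<^esub> = \<guillemotleft>int l\<guillemotright>\<^bsub>\<Omega>\<^esub> [^]\<^bsub>\<Omega>\<^esub> multiplicity l A \<otimes>\<^bsub>\<Omega>\<^esub> \<guillemotleft>int B\<guillemotright>\<^bsub>\<Omega>\<^esub>" "coprime B l"
    using nat_valuation[OF \<alpha>(3)] by blast
  have sub: "Ql l \<subseteq> P.k_unr" "P.roots_of_unity \<subseteq> P.k_unr"
    unfolding P.k_unr_def by (auto intro: generate_ring.incl)
  have "j \<alpha> \<in> P.k_unr"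
  proof (rule P.galois_fixed[OF P.k_unr_subring P.k_k_unr j_closed[OF \<alpha>(1)]])
    fix \<tau> assume \<tau>: "\<tau> \<in> carrier (galois_group \<Omega> P.k_unr)"
    have \<tau>l: "\<tau> \<in> carrier (galois_group \<Omega> (Ql l))" using P.galois_mono[OF sub(1)] \<tau> by blast
    have "galois_restrict j \<tau> \<alpha> = \<alpha>" using fixed inertiaI[OF \<tau> sub \<tau>l] by blast
    then show "\<tau> (j \<alpha>) = j \<alpha>" using j_restrict[OF \<tau>l order_refl \<alpha>(1)] by simp
  qed
  moreover have "j \<alpha> [^]\<^bsub>\<Omega>\<^esub> p = \<guillemotleft>int l\<guillemotright>\<^bsub>\<Omega>\<^esub> [^]\<^bsub>\<Omega>\<^esub> multiplicity l A \<otimes>\<^bsub>\<Omega>\<^esub> \<guillemotleft>int B\<guillemotright>\<^bsub>\<Omega>\<^esub>"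
    unfolding B(1)[symmetric] j_power[OF \<alpha>(1), symmetric] \<alpha>(2) using j_int[of "int A"] by simp
  ultimately show ?thesis
    using P.k_unr_power_valuation[OF _ p _ _ _ ] P.coprime_unit[OF B(2)] P.nat_in_subring[OF P.A_subring] by blast
qed

text \<open>The quotient \<open>\<eta>\<close> of the image of \<open>\<nu>\<close> by
  \<open>\<nu>\<close> is a \<open>p\<close>-th root of unity. Since \<open>N\<close> is prime to
  \<open>l\<close>, \<open>\<nu>\<close> is a unit at \<open>l\<close>, so \<open>\<eta>\<close> is
  congruent to one and therefore equal to it, as \<open>p \<noteq> l\<close>.\<close>

lemma unramified_root:
  fixes N :: nat
  assumes p: "prime p" "p \<noteq> l" and N: "prime N" "N \<noteq> l" and \<nu>: "algebraic \<nu>" "\<nu> ^ p = of_nat N" "\<nu> \<noteq> 0"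
    and \<tau>: "\<tau> \<in> inertia l (Ql l)"
  shows "galois_restrict j \<tau> \<nu> = \<nu>"
proof -
  have \<tau>G: "\<tau> \<in> carrier (galois_group \<Omega> (Ql l))" and \<tau>I: "\<And>x. x \<in> P.ints \<Longrightarrow> \<tau> x \<ominus>\<^bsub>\<Omega>\<^esub> x \<in> P.nonunits"
    using \<tau> unfolding inertia_iff by blast+
  note r = restrict_GQ[OF \<tau>G order_refl] restrict_algebraic[OF \<tau>G order_refl] j_restrict[OF \<tau>G order_refl]
  have "coprime N l" "coprime p l" using p N prime_l primes_coprime by auto
  define \<eta> where "\<eta> = galois_restrict j \<tau> \<nu> / \<nu>"
  have \<eta>: "algebraic \<eta>" unfolding \<eta>_def using r(2) \<nu>(1) by (intro algebraic_divide_complex)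
  have "galois_restrict j \<tau> \<nu> ^ p = \<nu> ^ p"
    using GQ_power[OF r(1) \<nu>(1), of p] GQ_rat[OF r(1), of "\<nu> ^ p"] \<nu>(2) by simp
  then have \<eta>p: "\<eta> ^ p = 1" unfolding \<eta>_def using \<nu>(3) by (simp add: power_divide)
  have jNc: "j \<nu> \<in> carrier \<Omega>" "j \<eta> \<in> carrier \<Omega>" using j_closed \<nu>(1) \<eta> by auto
  have jN: "j \<nu> [^]\<^bsub>\<Omega>\<^esub> p = \<guillemotleft>int N\<guillemotright>\<^bsub>\<Omega>\<^esub>"
    unfolding j_power[OF \<nu>(1), symmetric] \<nu>(2) using j_int[of "int N"] by simp
  have \<nu>i: "j \<nu> \<in> P.ints"
    using P.ints_root[OF prime_gt_0_nat[OF p(1)] P.int_ints jNc(1) jN] .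
  have "\<tau> (j \<nu>) = j \<eta> \<otimes>\<^bsub>\<Omega>\<^esub> j \<nu>"
    using r(3)[OF \<nu>(1)] j_mult[OF \<eta> \<nu>(1)] \<nu>(3) unfolding \<eta>_def by simp
  then have "j \<eta> \<otimes>\<^bsub>\<Omega>\<^esub> j \<nu> \<ominus>\<^bsub>\<Omega>\<^esub> j \<nu> \<in> P.nonunits" using \<tau>I[OF \<nu>i] by simp
  moreover have "j \<eta> \<otimes>\<^bsub>\<Omega>\<^esub> j \<nu> \<ominus>\<^bsub>\<Omega>\<^esub> j \<nu> = (j \<eta> \<ominus>\<^bsub>\<Omega>\<^esub> \<one>\<^bsub>\<Omega>\<^esub>) \<otimes>\<^bsub>\<Omega>\<^esub> j \<nu>"
    using jNc by (simp add: a_minus_def P.l_distr P.l_minus)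
  ultimately have prod: "(j \<eta> \<ominus>\<^bsub>\<Omega>\<^esub> \<one>\<^bsub>\<Omega>\<^esub>) \<otimes>\<^bsub>\<Omega>\<^esub> j \<nu> \<in> P.nonunits" by simp
  have j\<eta>p: "j \<eta> [^]\<^bsub>\<Omega>\<^esub> p = \<one>\<^bsub>\<Omega>\<^esub>" unfolding j_power[OF \<eta>, symmetric] \<eta>p by (rule j_one)
  have \<eta>i: "j \<eta> \<in> P.ints" using P.ints_root[OF prime_gt_0_nat[OF p(1)] P.ints_one jNc(2) j\<eta>p] .
  have "j \<nu> \<notin> P.nonunits"
  proof
    assume "j \<nu> \<in> P.nonunits"
    then obtain m :: nat and y where y: "y \<in> P.ints" "j \<nu> [^]\<^bsub>\<Omega>\<^esub> m = \<guillemotleft>int l\<guillemotright>\<^bsub>\<Omega>\<^esub> \<otimes>\<^bsub>\<Omega>\<^esub> y"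
      using P.nonunits_nilpotent by blast
    have "\<guillemotleft>int N\<guillemotright>\<^bsub>\<Omega>\<^esub> [^]\<^bsub>\<Omega>\<^esub> m = (j \<nu> [^]\<^bsub>\<Omega>\<^esub> m) [^]\<^bsub>\<Omega>\<^esub> p"
      unfolding jN[symmetric] using jNc(1) by (simp add: P.nat_pow_pow mult.commute)
    then have "\<guillemotleft>int N\<guillemotright>\<^bsub>\<Omega>\<^esub> [^]\<^bsub>\<Omega>\<^esub> m \<in> P.nonunits"
      using P.pi_mult_nonunits[OF y(1)] P.nonunits_mult[OF P.ints_pow[of "\<guillemotleft>int l\<guillemotright>\<^bsub>\<Omega>\<^esub> \<otimes>\<^bsub>\<Omega>\<^esub> y" "p - 1"], of "\<guillemotleft>int l\<guillemotright>\<^bsub>\<Omega>\<^esub> \<otimes>\<^bsub>\<Omega>\<^esub> y"]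
        P.nonunits_ints prime_gt_0_nat[OF p(1)] unfolding y(2) by (metis P.nat_pow_Suc Suc_pred')
    then have "\<guillemotleft>int N\<guillemotright>\<^bsub>\<Omega>\<^esub> \<in> P.nonunits" using P.nonunits_pow P.int_ints by blast
    moreover have "\<guillemotleft>int N\<guillemotright>\<^bsub>\<Omega>\<^esub> \<otimes>\<^bsub>\<Omega>\<^esub> inv\<^bsub>\<Omega>\<^esub> \<guillemotleft>int N\<guillemotright>\<^bsub>\<Omega>\<^esub> = \<one>\<^bsub>\<Omega>\<^esub>"
      using P.coprime_unit(1)[OF \<open>coprime N l\<close>] by simp
    ultimately show False using P.coprime_unit(2)[OF \<open>coprime N l\<close>] P.A_ints unfolding P.nonunits_def by blast
  qed
  then have "j \<eta> \<ominus>\<^bsub>\<Omega>\<^esub> \<one>\<^bsub>\<Omega>\<^esub> \<in> P.nonunits"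
    using P.nonunits_prime[OF P.ints_minus[OF \<eta>i P.ints_one] \<nu>i prod] by blast
  then have "j \<eta> = j 1" using P.unity_root_nonunit[OF jNc(2) j\<eta>p \<open>coprime p l\<close>] j_one by simp
  then have "\<eta> = 1" using j_inj[OF \<eta>, of 1] by simp
  then show ?thesis unfolding \<eta>_def using \<nu>(3) by simp
qed

end

section \<open>Powers of a primitive \<open>p\<close>-th root of unity, and radicals\<close>

locale primitive_root =
  fixes p :: nat and \<zeta> :: complex
  assumes prime_p: "prime p" and \<zeta>_pow: "\<zeta> ^ p = 1" and \<zeta>_ne: "\<zeta> \<noteq> 1"
begin

lemma p_gt1: "1 < p"
  using prime_p prime_gt_1_nat by blast

lemma \<zeta>_algebraic: "algebraic \<zeta>"
  using algebraic_root_complex[of \<zeta> p] \<zeta>_pow p_gt1 by simp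

lemma \<zeta>_nonzero: "\<zeta> \<noteq> 0"
  using \<zeta>_pow p_gt1 by (auto simp: power_0_left)

text \<open>Integer exponents are used so that cocycle values and their negatives can be combined
  before any reduction modulo \<open>p\<close>.\<close>

lemma \<zeta>_powi_eq_1: "\<zeta> powi k = 1 \<longleftrightarrow> [k = 0] (mod int p)"
proof
  assume k: "\<zeta> powi k = 1"
  show "[k = 0] (mod int p)"
  proof (rule ccontr)
    assume "\<not> [k = 0] (mod int p)"
    then have "\<not> int p dvd k" by (simp add: cong_0_iff)
    then have "coprime k (int p)" using prime_p
      by (metis coprime_commute prime_imp_coprime prime_nat_int_transfer)
    then obtain s t where "s * k + t * int p = 1" using bezout_int[of k "int p"] by auto
    then have "\<zeta> powi 1 = \<zeta> powi (k * s + int p * t)" by (simp add: mult.commute)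
    also have "\<dots> = (\<zeta> powi k) powi s * (\<zeta> powi int p) powi t"
      using \<zeta>_nonzero by (simp add: power_int_add power_int_mult)
    also have "\<dots> = 1" using k \<zeta>_pow by simp
    finally show False using \<zeta>_ne by simp
  qed
next
  assume "[k = 0] (mod int p)"
  then obtain t where "k = int p * t" by (auto simp: cong_0_iff)
  then show "\<zeta> powi k = 1" using \<zeta>_pow by (simp add: power_int_mult)
qed

lemma \<zeta>_powi_eq_iff: "\<zeta> powi a = \<zeta> powi b \<longleftrightarrow> [a = b] (mod int p)"
proof -
  have "\<zeta> powi a = \<zeta> powi b \<longleftrightarrow> \<zeta> powi (a - b) = 1"
    using \<zeta>_nonzero by (simp add: power_int_diff)
  then show ?thesis unfolding \<zeta>_powi_eq_1 by (simp add: cong_iff_dvd_diff)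
qed

lemma \<zeta>_powi_mod [simp]: "\<zeta> powi (k mod int p) = \<zeta> powi k"
  unfolding \<zeta>_powi_eq_iff by simp

text \<open>The powers of \<open>\<zeta>\<close> already give \<open>p\<close> distinct solutions of
  \<open>z ^ p = 1\<close>, which are all there are.\<close>

lemma root_of_unity_powi: assumes "z ^ p = (1::complex)" shows "\<exists>k\<in>{0..<int p}. z = \<zeta> powi k"
proof -
  let ?R = "{z::complex. z ^ p = 1}" and ?f = "\<lambda>k. \<zeta> powi k"
  have sub: "?f ` {0..<int p} \<subseteq> ?R" using \<zeta>_pow
    by (auto simp: power_int_power[symmetric] power_int_mult[symmetric] mult.commute)
      (metis \<zeta>_powi_eq_1 cong_0_iff dvd_triv_left mult.commute power_int_mult power_int_of_nat)
  have "inj_on ?f {0..<int p}"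
    by (rule inj_onI) (auto simp: \<zeta>_powi_eq_iff cong_def)
  then have "card (?f ` {0..<int p}) = p" by (simp add: card_image)
  moreover have "card ?R = p" using p_gt1 by (intro card_roots_unity_eq) simp
  moreover have "finite ?R" using p_gt1 by (intro finite_roots_unity) simp
  ultimately have "?f ` {0..<int p} = ?R" using sub by (intro card_subset_eq) auto
  then show ?thesis using assms by auto
qed

lemma zeta_log_eqI: assumes "k \<in> {0..<int p}" "z = \<zeta> powi k" shows "zeta_log p \<zeta> z = k"
  unfolding zeta_log_def
proof (rule the_equality)
  have nat: "\<zeta> ^ nat k = \<zeta> powi k" if "0 \<le> k" for k using that by (simp add: power_int_def)
  show "k \<in> carrier (residue_ring (int p)) \<and> z = \<zeta> ^ nat k"
    using assms nat[of k] by (auto simp: residue_ring_def)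
  fix k' assume k': "k' \<in> carrier (residue_ring (int p)) \<and> z = \<zeta> ^ nat k'"
  then have "k' \<in> {0..<int p}" by (auto simp: residue_ring_def)
  moreover have "\<zeta> powi k' = \<zeta> powi k" using k' assms nat[of k'] calculation by simp
  ultimately show "k' = k" using assms(1) unfolding \<zeta>_powi_eq_iff by (auto simp: cong_def)
qed

lemma zeta_log: assumes "z ^ p = 1" shows "zeta_log p \<zeta> z \<in> {0..<int p}" "\<zeta> powi zeta_log p \<zeta> z = z"
  using root_of_unity_powi[OF assms] zeta_log_eqI by auto

abbreviation \<chi> where "\<chi> \<equiv> cyclotomic_char p \<zeta>"

context
  fixes s assumes s: "s \<in> carrier G_Q"
begin

lemma chi: "s \<zeta> = \<zeta> powi \<chi> s" "\<chi> s \<in> {0..<int p}"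
proof -
  have "s \<zeta> ^ p = 1" using GQ_power[OF s \<zeta>_algebraic, of p] \<zeta>_pow GQ_one[OF s] by simp
  then show "s \<zeta> = \<zeta> powi \<chi> s" "\<chi> s \<in> {0..<int p}"
    using zeta_log unfolding cyclotomic_char_def by auto
qed

lemma \<zeta>_powi_algebraic: "algebraic (\<zeta> powi k)"
  using \<zeta>_algebraic by (auto simp: power_int_def intro: algebraic_power_complex algebraic_inverse)

lemma chi_powi: "s (\<zeta> powi k) = \<zeta> powi (\<chi> s * k)"
proof -
  have "s (\<zeta> powi k) = s \<zeta> powi k"
    using \<zeta>_algebraic unfolding power_int_def
    by (auto simp: GQ_power[OF s] GQ_inverse[OF s] algebraic_power_complex algebraic_inverse)
  then show ?thesis unfolding chi(1) by (simp add: power_int_mult)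
qed

lemma radical_conjugate:
  assumes \<alpha>: "algebraic \<alpha>" "\<alpha> \<noteq> 0" "\<alpha> ^ p \<in> \<rat>"
  shows "(s \<alpha> / \<alpha>) ^ p = 1" "s \<alpha> = \<zeta> powi zeta_log p \<zeta> (s \<alpha> / \<alpha>) * \<alpha>"
proof -
  have "s \<alpha> ^ p = \<alpha> ^ p" using GQ_power[OF s \<alpha>(1), of p] GQ_rat[OF s \<alpha>(3)] by simp
  then show 1: "(s \<alpha> / \<alpha>) ^ p = 1" using \<alpha>(2) by (simp add: power_divide)
  show "s \<alpha> = \<zeta> powi zeta_log p \<zeta> (s \<alpha> / \<alpha>) * \<alpha>" using zeta_log(2)[OF 1] \<alpha>(2) by simp
qed

end

end

text \<open>Checks the hypotheses of \<open>kummer_radical_valuation\<close> for the images under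
  \<open>j\<close>, with \<open>l\<close> in the role of \<open>p\<close>. Coprimality of
  \<open>N\<close> and \<open>l\<close> makes the radicand of \<open>\<nu>\<close> a unit.\<close>

lemma (in padic_embedding) radical_valuation_over_Lp:
  fixes N :: nat
  assumes \<zeta>: "\<zeta> ^ l = 1" "\<zeta> \<noteq> 1" and \<nu>: "algebraic \<nu>" "\<nu> ^ l = of_nat N" "coprime N l"
    and \<alpha>: "algebraic \<alpha>" "\<alpha> ^ l = of_nat A" "0 < A"
    and fixed: "\<And>\<tau>. \<tau> \<in> inertia l (Lp l j \<zeta> \<nu>) \<Longrightarrow> galois_restrict j \<tau> \<alpha> = \<alpha>"
  shows "l dvd multiplicity l A"
proof -
  interpret primitive_root l \<zeta> using prime_l \<zeta> by unfold_locales
  have N0: "N \<noteq> 0" using \<nu>(3) l_gt1 by (metis coprime_0_left_iff is_unit_gcd nat_neq_iff nat_dvd_1_iff_1)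
  have l0: "0 < l" using l_gt1 by simp
  have nz: "\<nu> \<noteq> 0" "\<alpha> \<noteq> 0" using \<nu>(2) \<alpha>(2,3) N0 l0 by (auto simp: power_0_left)
  obtain B where B: "\<guillemotleft>int A\<guillemotright>\<^bsub>\<Omega>\<^esub> = \<guillemotleft>int l\<guillemotright>\<^bsub>\<Omega>\<^esub> [^]\<^bsub>\<Omega>\<^esub> multiplicity l A \<otimes>\<^bsub>\<Omega>\<^esub> \<guillemotleft>int B\<guillemotright>\<^bsub>\<Omega>\<^esub>" "coprime B l"
    using nat_valuation[OF \<alpha>(3)] by blast
  have jp: "j x [^]\<^bsub>\<Omega>\<^esub> l = \<guillemotleft>int n\<guillemotright>\<^bsub>\<Omega>\<^esub>" if "algebraic x" "x ^ l = of_nat n" for x n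
    unfolding j_power[OF that(1), symmetric] that(2) using j_int[of "int n"] by simp
  have j0: "j x \<noteq> \<zero>\<^bsub>\<Omega>\<^esub>" if "algebraic x" "x \<noteq> 0" for x
    using j_inj[OF that(1), of 0] that(2) j_int[of 0] by auto
  have conj: "\<exists>i::nat. \<phi> (j x) = j \<zeta> [^]\<^bsub>\<Omega>\<^esub> i \<otimes>\<^bsub>\<Omega>\<^esub> j x"
    if \<phi>: "\<phi> \<in> carrier (galois_group \<Omega> (Ql l))" and x: "algebraic x" "x \<noteq> 0" "x ^ l = of_nat n" for \<phi> x n
  proof -
    note r = restrict_GQ[OF \<phi> order_refl] j_restrict[OF \<phi> order_refl x(1)]
    have "x ^ l \<in> \<rat>" unfolding x(3) by simp
    note c = radical_conjugate[OF r(1) x(1,2) this]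
    define k where "k = zeta_log l \<zeta> (galois_restrict j \<phi> x / x)"
    have "\<zeta> powi k = \<zeta> ^ nat k" using zeta_log(1)[OF c(1)] unfolding k_def by (simp add: power_int_def)
    then have "galois_restrict j \<phi> x = \<zeta> ^ nat k * x" using c(2) unfolding k_def by simp
    then have "\<phi> (j x) = j (\<zeta> ^ nat k * x)" using r(2) by simp
    then show ?thesis using j_mult[of "\<zeta> ^ nat k" x] j_power[OF \<zeta>_algebraic] x(1)
        algebraic_power_complex[OF \<zeta>_algebraic] by auto
  qed
  show ?thesis
  proof (rule P.kummer_radical_valuation[OF prime_l, of "j \<zeta>" "j \<nu>" "j \<alpha>" "\<guillemotleft>int N\<guillemotright>\<^bsub>\<Omega>\<^esub>" "multiplicity l A" "\<guillemotleft>int B\<guillemotright>\<^bsub>\<Omega>\<^esub>"])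
    show "j \<zeta> \<in> carrier \<Omega>" "j \<nu> \<in> carrier \<Omega>" "j \<alpha> \<in> carrier \<Omega>"
      using j_closed \<zeta>_algebraic \<nu>(1) \<alpha>(1) by auto
    show "j \<nu> \<noteq> \<zero>\<^bsub>\<Omega>\<^esub>" "j \<alpha> \<noteq> \<zero>\<^bsub>\<Omega>\<^esub>" using j0 \<nu>(1) \<alpha>(1) nz by auto
    show "j \<zeta> [^]\<^bsub>\<Omega>\<^esub> l = \<one>\<^bsub>\<Omega>\<^esub>" using j_power[OF \<zeta>_algebraic, of l] \<zeta>(1) j_one by simp
    show "j \<zeta> \<noteq> \<one>\<^bsub>\<Omega>\<^esub>" using j_inj[OF \<zeta>_algebraic, of 1] \<zeta>(2) j_one by auto
    show "\<exists>i\<in>{0<..<l}. \<phi> (j \<zeta>) = j \<zeta> [^]\<^bsub>\<Omega>\<^esub> i" if \<phi>: "\<phi> \<in> carrier (galois_group \<Omega> (Ql l))" for \<phi>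
    proof -
      note r = restrict_GQ[OF \<phi> order_refl] j_restrict[OF \<phi> order_refl \<zeta>_algebraic]
      define i where "i = nat (\<chi> (galois_restrict j \<phi>))"
      have i: "galois_restrict j \<phi> \<zeta> = \<zeta> ^ i" "i < l"
        using chi[OF r(1)] unfolding i_def by (auto simp: power_int_def)
      moreover have "i \<noteq> 0"
      proof
        assume "i = 0"
        then have "galois_restrict j \<phi> \<zeta> = galois_restrict j \<phi> 1" using i GQ_one[OF r(1)] by simp
        then show False using GQ_inj[OF r(1) \<zeta>_algebraic, of 1] \<zeta>(2) by simp
      qed
      moreover have "\<phi> (j \<zeta>) = j \<zeta> [^]\<^bsub>\<Omega>\<^esub> i" using r(2) i(1) j_power[OF \<zeta>_algebraic] by simp
      ultimately show ?thesis by auto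
    qed
    show "\<exists>i::nat. \<phi> (j \<nu>) = j \<zeta> [^]\<^bsub>\<Omega>\<^esub> i \<otimes>\<^bsub>\<Omega>\<^esub> j \<nu>" if "\<phi> \<in> carrier (galois_group \<Omega> (Ql l))" for \<phi>
      using conj[OF that \<nu>(1) nz(1) \<nu>(2)] .
    show "\<exists>i::nat. \<phi> (j \<alpha>) = j \<zeta> [^]\<^bsub>\<Omega>\<^esub> i \<otimes>\<^bsub>\<Omega>\<^esub> j \<alpha>" if "\<phi> \<in> carrier (galois_group \<Omega> (Ql l))" for \<phi>
      using conj[OF that \<alpha>(1) nz(2) \<alpha>(2)] .
    show "\<phi> (j \<alpha>) = j \<alpha>"
      if \<phi>: "\<phi> \<in> carrier (galois_group \<Omega> (Ql l \<union> P.roots_of_unity \<union> {j \<zeta>, j \<nu>}))" for \<phi>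
    proof -
      interpret \<phi>: ring_hom_cring \<Omega> \<Omega> \<phi> using P.galoisD[OF \<phi>] by blast
      have c: "Ql l \<union> {j \<zeta>, j \<nu>} \<subseteq> carrier \<Omega>"
        using P.k_carrier j_closed \<zeta>_algebraic \<nu>(1) by auto
      have cL: "x \<in> carrier \<Omega>" if "x \<in> Lp l j \<zeta> \<nu>" for x
        using that P.generate_field_in_carrier[OF c] unfolding Lp_def by blast
      have "\<phi> x = x" if "x \<in> Lp l j \<zeta> \<nu>" for x
        using that unfolding Lp_def
      proof induction
        case (incl h)
        then show ?case using P.galoisD(2)[OF \<phi>] by blast
      next
        case (m_inv h)
        have h: "h \<in> carrier \<Omega>" using m_inv.hyps(1) P.generate_field_in_carrier[OF c] by blast
        have U: "h \<in> Units \<Omega>" using h m_inv.hyps(2) P.field_Units by blast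
        then have "h \<otimes>\<^bsub>\<Omega>\<^esub> \<phi> (inv\<^bsub>\<Omega>\<^esub> h) = \<phi> (h \<otimes>\<^bsub>\<Omega>\<^esub> inv\<^bsub>\<Omega>\<^esub> h)"
          using h m_inv.IH by (metis P.Units_inv_closed \<phi>.hom_mult)
        then have "h \<otimes>\<^bsub>\<Omega>\<^esub> \<phi> (inv\<^bsub>\<Omega>\<^esub> h) = \<one>\<^bsub>\<Omega>\<^esub>" using U P.Units_r_inv by simp
        then show ?case using h U P.comm_inv_char[of h "\<phi> (inv\<^bsub>\<Omega>\<^esub> h)"] by simp
      next
        case (a_inv h)
        then show ?case using P.generate_field_in_carrier[OF c a_inv.hyps(1)] by simp
      next
        case (eng_add h1 h2)
        then show ?case
          using P.generate_field_in_carrier[OF c eng_add.hyps(1)] P.generate_field_in_carrier[OF c eng_add.hyps(2)] by simp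
      next
        case (eng_mult h1 h2)
        then show ?case
          using P.generate_field_in_carrier[OF c eng_mult.hyps(1)] P.generate_field_in_carrier[OF c eng_mult.hyps(2)] by simp
      qed simp
      then have \<phi>L: "\<phi> \<in> carrier (galois_group \<Omega> (Lp l j \<zeta> \<nu>))"
        using \<phi> unfolding galois_group_def Let_def by auto
      \<comment> \<open>Fixing the roots of unity of order prime to \<open>l\<close> gives trivial
        action on residues, and \<open>\<phi>\<close> is an automorphism over \<open>Lp\<close> by
        \<open>\<phi>L\<close>.\<close>
      have "\<phi> \<in> inertia l (Lp l j \<zeta> \<nu>)" using inertiaI[OF \<phi> _ _ \<phi>L] by blast
      then have "galois_restrict j \<phi> \<alpha> = \<alpha>" by (rule fixed)
      moreover have "Ql l \<subseteq> Ql l \<union> P.roots_of_unity \<union> {j \<zeta>, j \<nu>}" by blast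
      ultimately show ?thesis using j_restrict[OF \<phi> _ \<alpha>(1)] by simp
    qed
    show "j \<nu> [^]\<^bsub>\<Omega>\<^esub> l = \<guillemotleft>int N\<guillemotright>\<^bsub>\<Omega>\<^esub>" using jp[OF \<nu>(1,2)] .
    show "j \<alpha> [^]\<^bsub>\<Omega>\<^esub> l = \<guillemotleft>int l\<guillemotright>\<^bsub>\<Omega>\<^esub> [^]\<^bsub>\<Omega>\<^esub> multiplicity l A \<otimes>\<^bsub>\<Omega>\<^esub> \<guillemotleft>int B\<guillemotright>\<^bsub>\<Omega>\<^esub>"
      using jp[OF \<alpha>(1,2)] B(1) by simp
  qed (use P.coprime_unit[OF \<nu>(3)] P.coprime_unit[OF B(2)] P.nat_in_subring[OF P.A_subring] in auto)
qed

text \<open>After the power of \<open>N\<close> is split off, the cofactor has multiplicity zero at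
  \<open>N\<close> and multiplicities divisible by \<open>p\<close> elsewhere, hence is a
  \<open>p\<close>-th power.\<close>

lemma prime_times_power_decomposition:
  fixes A N p :: nat
  assumes "0 < A" "0 < p" "prime N" "\<And>q. prime q \<Longrightarrow> q \<noteq> N \<Longrightarrow> p dvd multiplicity q A"
  shows "\<exists>k r. A = N ^ k * r ^ p"
proof -
  have "\<not> is_unit N" using assms(3) by (metis not_prime_unit)
  then obtain B where B: "A = N ^ multiplicity N A * B" "\<not> N dvd B"
    using multiplicity_decompose'[of A N] assms(1) by blast
  have B0: "B \<noteq> 0" using B(2) by (metis dvd_0_right)
  have "p dvd multiplicity q B" if q: "prime q" for q
  proof (cases "q = N")
    case True
    then show ?thesis using B(2) by (simp add: not_dvd_imp_multiplicity_0)
  next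
    case False
    have "multiplicity q A = multiplicity q (N ^ multiplicity N A) + multiplicity q B"
      by (subst B(1), rule prime_elem_multiplicity_mult_distrib) (use q B0 assms(3) in auto)
    moreover have "multiplicity q (N ^ multiplicity N A) = 0"
      using q False assms(3) by (simp add: multiplicity_distinct_prime_power)
    ultimately show ?thesis using assms(4)[OF q False] by simp
  qed
  then have "is_nth_power p B"
    using is_nth_power_conv_multiplicity_nat[of p B] B0 assms(2) by simp
  then obtain r where "B = r ^ p" by (auto simp: is_nth_power_def)
  then show ?thesis using B(1) by blast
qed

section \<open>Cohomology of \<open>\<int>/p\<close> with a character\<close>

text \<open>The vector space axioms for \<open>S\<close> are transported from \<open>F\<close> along
  the bijection \<open>\<Psi>\<close>, so that they need not be derived for the quotient of cocycles
  by coboundaries.\<close>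

lemma one_dimensional_vectorspace:
  fixes F :: "'k ring" and S :: "('k, 'v) module"
  assumes F: "field F" and img: "\<Psi> ` carrier F = carrier S" and inj: "inj_on \<Psi> (carrier F)"
    and add: "\<And>a b. a \<in> carrier F \<Longrightarrow> b \<in> carrier F \<Longrightarrow> \<Psi> a \<oplus>\<^bsub>S\<^esub> \<Psi> b = \<Psi> (a \<oplus>\<^bsub>F\<^esub> b)"
    and smult: "\<And>a b. a \<in> carrier F \<Longrightarrow> b \<in> carrier F \<Longrightarrow> a \<odot>\<^bsub>S\<^esub> \<Psi> b = \<Psi> (a \<otimes>\<^bsub>F\<^esub> b)"
    and zero: "\<zero>\<^bsub>S\<^esub> = \<Psi> \<zero>\<^bsub>F\<^esub>"
  shows "vectorspace F S" "vectorspace.dim F S = 1" "LinearCombinations.module.span F S {\<Psi> \<one>\<^bsub>F\<^esub>} = carrier S"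
proof -
  interpret F: field F by fact
  have closed: "\<Psi> a \<in> carrier S" if "a \<in> carrier F" for a using img that by blast
  have ex: "\<exists>a\<in>carrier F. x = \<Psi> a" if "x \<in> carrier S" for x using img that by blast
  have "abelian_group S"
  proof (rule abelian_groupI)
    show "\<zero>\<^bsub>S\<^esub> \<in> carrier S" using zero closed by simp
    show "x \<oplus>\<^bsub>S\<^esub> y \<in> carrier S" if "x \<in> carrier S" "y \<in> carrier S" for x y
      using ex[OF that(1)] ex[OF that(2)] add closed by auto
    show "x \<oplus>\<^bsub>S\<^esub> y \<oplus>\<^bsub>S\<^esub> z = x \<oplus>\<^bsub>S\<^esub> (y \<oplus>\<^bsub>S\<^esub> z)"
      if "x \<in> carrier S" "y \<in> carrier S" "z \<in> carrier S" for x y z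
      using ex[OF that(1)] ex[OF that(2)] ex[OF that(3)] add by (auto simp: F.a_assoc)
    show "x \<oplus>\<^bsub>S\<^esub> y = y \<oplus>\<^bsub>S\<^esub> x" if "x \<in> carrier S" "y \<in> carrier S" for x y
      using ex[OF that(1)] ex[OF that(2)] add by (auto simp: F.a_comm)
    show "\<zero>\<^bsub>S\<^esub> \<oplus>\<^bsub>S\<^esub> x = x" if "x \<in> carrier S" for x
      using ex[OF that] add zero by auto
    show "\<exists>y\<in>carrier S. y \<oplus>\<^bsub>S\<^esub> x = \<zero>\<^bsub>S\<^esub>" if x: "x \<in> carrier S" for x
    proof -
      obtain a where a: "a \<in> carrier F" "x = \<Psi> a" using ex[OF x] by blast
      then show ?thesis using add[of "\<ominus>\<^bsub>F\<^esub> a" a] closed zero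
        by (intro bexI[of _ "\<Psi> (\<ominus>\<^bsub>F\<^esub> a)"]) (simp_all add: F.l_neg)
    qed
  qed
  moreover have "module_axioms F S"
  proof
    fix a b x y assume a: "a \<in> carrier F" and b: "b \<in> carrier F" and x: "x \<in> carrier S" and y: "y \<in> carrier S"
    obtain u where "u \<in> carrier F" "x = \<Psi> u" using ex[OF x] by blast
    moreover obtain v where "v \<in> carrier F" "y = \<Psi> v" using ex[OF y] by blast
    ultimately have uv: "u \<in> carrier F" "v \<in> carrier F" "x = \<Psi> u" "y = \<Psi> v" by simp_all
    show "(a \<oplus>\<^bsub>F\<^esub> b) \<odot>\<^bsub>S\<^esub> x = a \<odot>\<^bsub>S\<^esub> x \<oplus>\<^bsub>S\<^esub> b \<odot>\<^bsub>S\<^esub> x"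
      using a b uv by (simp add: smult add F.l_distr)
    show "a \<odot>\<^bsub>S\<^esub> (x \<oplus>\<^bsub>S\<^esub> y) = a \<odot>\<^bsub>S\<^esub> x \<oplus>\<^bsub>S\<^esub> a \<odot>\<^bsub>S\<^esub> y"
      using a uv by (simp add: smult add F.r_distr)
    show "(a \<otimes>\<^bsub>F\<^esub> b) \<odot>\<^bsub>S\<^esub> x = a \<odot>\<^bsub>S\<^esub> (b \<odot>\<^bsub>S\<^esub> x)"
      using a b uv by (simp add: smult F.m_assoc)
  next
    fix a x assume "a \<in> carrier F" "x \<in> carrier S"
    then show "a \<odot>\<^bsub>S\<^esub> x \<in> carrier S" using ex smult closed by fastforce
  next
    fix x assume "x \<in> carrier S"
    then show "\<one>\<^bsub>F\<^esub> \<odot>\<^bsub>S\<^esub> x = x" using ex smult by fastforce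
  qed
  ultimately show vs: "vectorspace F S"
    unfolding vectorspace_def Module.module_def using F F.cring_axioms by blast
  interpret V: vectorspace F S by (rule vs)
  have one: "\<Psi> \<one>\<^bsub>F\<^esub> \<in> carrier S" "\<Psi> \<one>\<^bsub>F\<^esub> \<noteq> \<zero>\<^bsub>S\<^esub>"
    using closed zero inj_onD[OF inj, of "\<one>\<^bsub>F\<^esub>" "\<zero>\<^bsub>F\<^esub>"] by auto
  show span: "V.span {\<Psi> \<one>\<^bsub>F\<^esub>} = carrier S"
  proof
    show "V.span {\<Psi> \<one>\<^bsub>F\<^esub>} \<subseteq> carrier S" using one(1) by (intro V.span_is_subset2) simp
    show "carrier S \<subseteq> V.span {\<Psi> \<one>\<^bsub>F\<^esub>}"
    proof
      fix x assume "x \<in> carrier S"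
      then obtain a where a: "a \<in> carrier F" "x = \<Psi> a" using ex by blast
      then have "x = V.lincomb (\<lambda>_. a) {\<Psi> \<one>\<^bsub>F\<^esub>}"
        unfolding V.lincomb_def using one(1) smult[OF a(1), of "\<one>\<^bsub>F\<^esub>"] closed[OF a(1)]
        by (simp add: V.M.finsum_insert)
      then show "x \<in> V.span {\<Psi> \<one>\<^bsub>F\<^esub>}" unfolding V.span_def using a(1) by blast
    qed
  qed
  show "V.dim = 1" by (rule V.dim1I[OF span one(2,1)])
qed

text \<open>The action through an arbitrary integer valued function; it covers both
  \<open>Fp1_action\<close> and its pullbacks to local Galois groups.\<close>

definition twist :: "nat \<Rightarrow> ('g \<Rightarrow> int) \<Rightarrow> 'g \<Rightarrow> int \<Rightarrow> int" where
  "twist p \<chi> s a = (\<chi> s * a) mod int p"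

text \<open>The class, modulo coboundaries of the action through \<open>\<chi>\<close>, of an integer valued function
  which need be neither reduced nor extensional.\<close>

definition cochain_class :: "nat \<Rightarrow> 'g set \<Rightarrow> ('g \<Rightarrow> int) \<Rightarrow> ('g \<Rightarrow> int) \<Rightarrow> ('g \<Rightarrow> int) set" where
  "cochain_class p G \<chi> c = range (\<lambda>a. \<lambda>s\<in>G. ((\<chi> s - 1) * a + c s) mod int p)"

lemma cochain_class_eq_iff:
  "cochain_class p G \<chi> c = cochain_class p G \<chi> d \<longleftrightarrow>
    (\<exists>a. \<forall>s\<in>G. [c s = (\<chi> s - 1) * a + d s] (mod int p))" (is "?L \<longleftrightarrow> ?R")
proof
  assume ?L
  then have "(\<lambda>s\<in>G. ((\<chi> s - 1) * 0 + c s) mod int p) \<in> cochain_class p G \<chi> d"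
    unfolding cochain_class_def by blast
  then obtain a where a: "(\<lambda>s\<in>G. ((\<chi> s - 1) * 0 + c s) mod int p) = (\<lambda>s\<in>G. ((\<chi> s - 1) * a + d s) mod int p)"
    unfolding cochain_class_def by blast
  have "[c s = (\<chi> s - 1) * a + d s] (mod int p)" if "s \<in> G" for s
    using fun_cong[OF a, of s] that by (simp add: cong_def)
  then show ?R by blast
next
  have sub: "cochain_class p G \<chi> c \<subseteq> cochain_class p G \<chi> d"
    if "\<forall>s\<in>G. [c s = (\<chi> s - 1) * a + d s] (mod int p)" for a c d
  proof -
    have "(\<lambda>s\<in>G. ((\<chi> s - 1) * b + c s) mod int p) = (\<lambda>s\<in>G. ((\<chi> s - 1) * (a + b) + d s) mod int p)" for b
    proof (rule restrict_ext)
      fix s assume "s \<in> G"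
      then have "[(\<chi> s - 1) * b + c s = (\<chi> s - 1) * b + ((\<chi> s - 1) * a + d s)] (mod int p)"
        using that by (intro cong_add) auto
      then show "((\<chi> s - 1) * b + c s) mod int p = ((\<chi> s - 1) * (a + b) + d s) mod int p"
        by (simp add: cong_def algebra_simps)
    qed
    then show ?thesis unfolding cochain_class_def by blast
  qed
  assume ?R
  then obtain a where a: "\<forall>s\<in>G. [c s = (\<chi> s - 1) * a + d s] (mod int p)" by blast
  have "\<forall>s\<in>G. [d s = (\<chi> s - 1) * (- a) + c s] (mod int p)"
  proof
    fix s assume "s \<in> G"
    then have "[(\<chi> s - 1) * (- a) + c s = (\<chi> s - 1) * (- a) + ((\<chi> s - 1) * a + d s)] (mod int p)"
      using a by (intro cong_add) auto
    then show "[d s = (\<chi> s - 1) * (- a) + c s] (mod int p)" by (simp add: cong_sym_eq algebra_simps)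
  qed
  then show ?L using sub[OF a] sub[of d "- a" c] by blast
qed

lemma cochain_class_cong:
  "(\<And>s. s \<in> G \<Longrightarrow> [c s = d s] (mod int p)) \<Longrightarrow> cochain_class p G \<chi> c = cochain_class p G \<chi> d"
  unfolding cochain_class_eq_iff by (intro exI[of _ 0]) simp

lemma Fp_simps [simp]:
  "carrier (Fp_module p) = {0..<int p}" "x \<oplus>\<^bsub>Fp_module p\<^esub> y = (x + y) mod int p"
  "\<zero>\<^bsub>Fp_module p\<^esub> = 0" "x \<odot>\<^bsub>Fp_module p\<^esub> y = (x * y) mod int p"
  by (auto simp: Fp_module_def residue_ring_def Let_def)

lemma Fp_minus: assumes "1 < p" "y \<in> {0..<int p}" shows "x \<ominus>\<^bsub>Fp_module p\<^esub> y = (x - y) mod int p"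
proof -
  interpret residues "int p" "residue_ring (int p)" using assms(1) by unfold_locales auto
  have "\<ominus>\<^bsub>Fp_module p\<^esub> y = \<ominus>\<^bsub>residue_ring (int p)\<^esub> y"
    unfolding a_inv_def m_inv_def by (simp add: residue_ring_def atLeastLessThanPlusOne_atLeastAtMost_int[symmetric])
  then show ?thesis unfolding a_minus_def by (simp add: res_neg_eq mod_simps)
qed

section \<open>Degree one cohomology with twisted coefficients\<close>

context
  fixes p :: nat assumes p: "1 < p"
begin

lemma coboundaries_twist:
  "coboundaries G (Fp_module p) (twist p \<chi>) = cochain_class p (carrier G) \<chi> (\<lambda>_. 0)"
proof -
  have *: "(\<lambda>s\<in>carrier G. twist p \<chi> s a \<ominus>\<^bsub>Fp_module p\<^esub> a) =
      (\<lambda>s\<in>carrier G. ((\<chi> s - 1) * a + 0) mod int p)" if "a \<in> {0..<int p}" for a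
    using Fp_minus[OF p that] by (intro restrict_ext) (simp add: twist_def mod_simps algebra_simps)
  have "(\<lambda>s\<in>carrier G. ((\<chi> s - 1) * a + 0) mod int p) \<in> coboundaries G (Fp_module p) (twist p \<chi>)" for a
  proof -
    have m: "a mod int p \<in> {0..<int p}" using p by simp
    have "(\<lambda>s\<in>carrier G. ((\<chi> s - 1) * a + 0) mod int p) =
        (\<lambda>s\<in>carrier G. twist p \<chi> s (a mod int p) \<ominus>\<^bsub>Fp_module p\<^esub> (a mod int p))"
      unfolding *[OF m] by (intro restrict_ext) (simp add: mod_simps)
    then show ?thesis unfolding coboundaries_def Fp_simps using m by blast
  qed
  then show ?thesis using * unfolding cochain_class_def coboundaries_def by fastforce
qed

text \<open>Holds for every function \<open>c\<close>, not only for cocycles, so that unreduced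
  representatives such as integer multiples of the Kummer cocycle can be used.\<close>

lemma H1_class_twist:
  "H1_class G (Fp_module p) (twist p \<chi>) c = cochain_class p (carrier G) \<chi> c"
proof -
  have "H1_class G (Fp_module p) (twist p \<chi>) c =
      (\<lambda>h. \<lambda>s\<in>carrier G. (h s + c s) mod int p) ` cochain_class p (carrier G) \<chi> (\<lambda>_. 0)"
    unfolding H1_class_def a_r_coset_def' coboundaries_twist by (auto simp: Z1_def)
  also have "\<dots> = cochain_class p (carrier G) \<chi> c"
    unfolding cochain_class_def image_image by (intro image_cong refl restrict_ext) (simp add: mod_simps)
  finally show ?thesis .
qed

lemma H1_carrier_twist:
  "carrier (H1 G (Fp_module p) (twist p \<chi>)) =
    cochain_class p (carrier G) \<chi> ` cocycles G (Fp_module p) (twist p \<chi>)"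
proof -
  have "coboundaries G (Fp_module p) (twist p \<chi>) +>\<^bsub>Z1 G (Fp_module p) (twist p \<chi>)\<^esub> c =
      cochain_class p (carrier G) \<chi> c" for c
    using H1_class_twist[of G \<chi> c] unfolding H1_class_def .
  then show ?thesis unfolding H1_def A_RCOSETS_def' by (auto simp: Z1_def)
qed

lemma H1_add_twist:
  "cochain_class p (carrier G) \<chi> c \<oplus>\<^bsub>H1 G (Fp_module p) (twist p \<chi>)\<^esub> cochain_class p (carrier G) \<chi> d =
    cochain_class p (carrier G) \<chi> (\<lambda>s. c s + d s)" (is "?S = ?T")
proof -
  let ?h = "\<lambda>c a. \<lambda>s\<in>carrier G. ((\<chi> s - 1) * a + c s) mod int p"
  have S: "?S = (\<Union>a. \<Union>b. {\<lambda>s\<in>carrier G. (?h c a s + ?h d b s) mod int p})"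
    by (simp add: H1_def set_add_def' Z1_def cochain_class_def)
  have sum: "(\<lambda>s\<in>carrier G. (?h c a s + ?h d b s) mod int p) = ?h (\<lambda>s. c s + d s) (a + b)" for a b
    by (intro restrict_ext) (simp add: mod_add_eq, simp add: algebra_simps)
  show ?thesis
  proof
    show "?S \<subseteq> ?T" unfolding S sum unfolding cochain_class_def by blast
    have "?h (\<lambda>s. c s + d s) a \<in> ?S" for a unfolding S sum by (simp, rule exI[of _ a], rule exI[of _ 0], simp)
    then show "?T \<subseteq> ?S" unfolding cochain_class_def by blast
  qed
qed

text \<open>The union in the definition of scalar multiplication runs over all representatives of
  the class, and each of them gives the same result.\<close>

lemma H1_smult_twist:
  "k \<odot>\<^bsub>H1 G (Fp_module p) (twist p \<chi>)\<^esub> cochain_class p (carrier G) \<chi> c =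
    cochain_class p (carrier G) \<chi> (\<lambda>s. k * c s)"
proof -
  have "cochain_class p (carrier G) \<chi> (\<lambda>s\<in>carrier G. (k * (((\<chi> s - 1) * a + c s) mod int p)) mod int p) =
      cochain_class p (carrier G) \<chi> (\<lambda>s. k * c s)" for a
    unfolding cochain_class_eq_iff
    by (intro exI[of _ "k * a"]) (simp add: cong_def mod_simps algebra_simps)
  then show ?thesis
    by (simp add: H1_def H1_class_twist Z1_def cochain_class_def[of p "carrier G" \<chi> c] cong: restrict_cong)
qed

lemma H1_pullback_twist:
  assumes "\<And>t. t \<in> carrier H \<Longrightarrow> \<phi> t \<in> carrier G"
  shows "H1_pullback H \<phi> (Fp_module p) (twist p \<chi>) (cochain_class p (carrier G) \<chi> c) =
    cochain_class p (carrier H) (\<lambda>t. \<chi> (\<phi> t)) (\<lambda>t. c (\<phi> t))"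
proof -
  have tw: "(\<lambda>t. twist p \<chi> (\<phi> t)) = twist p (\<lambda>t. \<chi> (\<phi> t))" unfolding twist_def by (rule refl)
  have "cochain_class p (carrier H) (\<lambda>t. \<chi> (\<phi> t))
      (\<lambda>t\<in>carrier H. (\<lambda>s\<in>carrier G. ((\<chi> s - 1) * a + c s) mod int p) (\<phi> t)) =
      cochain_class p (carrier H) (\<lambda>t. \<chi> (\<phi> t)) (\<lambda>t. c (\<phi> t))" for a
    unfolding cochain_class_eq_iff using assms by (intro exI[of _ a]) (simp add: cong_def)
  then show ?thesis
    unfolding H1_pullback_def tw H1_class_twist cochain_class_def[of p "carrier G" \<chi> c] by simp
qed

end

text \<open>The two successive pullbacks, to the local Galois group and then to inertia, combine
  into one; the class vanishes when this restriction is a coboundary.\<close>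

lemma (in padic_embedding) unramified_over_twist_iff:
  assumes p: "1 < p" and K: "Ql l \<subseteq> K"
  shows "unramified_over l j K (Fp_module p) (twist p \<chi>) (cochain_class p (carrier G_Q) \<chi> c) \<longleftrightarrow>
    (\<exists>a. \<forall>\<tau>\<in>inertia l K. [c (galois_restrict j \<tau>) = (\<chi> (galois_restrict j \<tau>) - 1) * a] (mod int p))"
proof -
  have tw: "(\<lambda>t. twist p \<chi> (galois_restrict j t)) = twist p (\<lambda>t. \<chi> (galois_restrict j t))"
    unfolding twist_def by (rule refl)
  have sub: "carrier (top_subgroup (galois_group \<Omega> K) (inertia l K)) = inertia l K"
    by (simp add: top_subgroup_def)
  have id: "id \<tau> \<in> carrier (galois_group \<Omega> K)" if "\<tau> \<in> carrier (top_subgroup (galois_group \<Omega> K) (inertia l K))" for \<tau>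
    using that unfolding sub inertia_iff by simp
  have zero: "\<zero>\<^bsub>H1 I (Fp_module p) (twist p \<psi>)\<^esub> = cochain_class p (carrier I) \<psi> (\<lambda>_. 0)"
    for I :: "(padic_bar \<Rightarrow> padic_bar) top_group" and \<psi>
    using coboundaries_twist[OF p] by (simp add: H1_def)
  have "H1_pullback (galois_group \<Omega> K) (galois_restrict j) (Fp_module p) (twist p \<chi>)
      (cochain_class p (carrier G_Q) \<chi> c) = cochain_class p (carrier (galois_group \<Omega> K))
      (\<lambda>t. \<chi> (galois_restrict j t)) (\<lambda>t. c (galois_restrict j t))"
    by (rule H1_pullback_twist[OF p]) (rule restrict_GQ[OF _ K])
  moreover have "H1_pullback (top_subgroup (galois_group \<Omega> K) (inertia l K)) id (Fp_module p) (twist p \<psi>)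
      (cochain_class p (carrier (galois_group \<Omega> K)) \<psi> d) = cochain_class p (inertia l K) \<psi> d" for \<psi> d
  proof -
    have "H1_pullback (top_subgroup (galois_group \<Omega> K) (inertia l K)) id (Fp_module p) (twist p \<psi>)
      (cochain_class p (carrier (galois_group \<Omega> K)) \<psi> d) =
      cochain_class p (carrier (top_subgroup (galois_group \<Omega> K) (inertia l K))) (\<lambda>t. \<psi> (id t)) (\<lambda>t. d (id t))"
      by (rule H1_pullback_twist[OF p]) (rule id)
    then show ?thesis unfolding sub by simp
  qed
  ultimately show ?thesis
    unfolding unramified_over_def unramified_def Let_def tw zero sub by (simp add: cochain_class_eq_iff)
qed

section \<open>The Selmer group\<close>

lemma galois_group_topspace: "topspace (gtop (galois_group L K)) = carrier (galois_group L K)"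
  unfolding galois_group_def Let_def ring_iso_def ring_hom_def by (auto simp: PiE_def)

text \<open>Evaluation at \<open>x\<close> is a projection of the product topology to a discrete
  space, on which any \<open>f\<close> is continuous.\<close>

lemma evaluation_continuous:
  assumes "x \<in> carrier L" "\<And>s. s \<in> carrier (galois_group L K) \<Longrightarrow> f (s x) \<in> Y"
  shows "continuous_map (gtop (galois_group L K)) (discrete_topology Y) (\<lambda>s. f (s x))"
proof -
  let ?D = "{z \<in> carrier L. f z \<in> Y}"
  have "continuous_map (gtop (galois_group L K)) (discrete_topology (carrier L)) (\<lambda>s. s x)"
    unfolding galois_group_def Let_def top_group.simps
    by (intro continuous_map_from_subtopology continuous_map_product_projection assms(1))
  moreover have "(\<lambda>s. s x) ` topspace (gtop (galois_group L K)) \<subseteq> ?D"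
    using assms(1,2) unfolding galois_group_topspace
    by (auto simp: galois_group_def Let_def ring_iso_def ring_hom_def)
  ultimately have "continuous_map (gtop (galois_group L K)) (subtopology (discrete_topology (carrier L)) ?D) (\<lambda>s. s x)"
    by (intro continuous_map_into_subtopology) auto
  moreover have "subtopology (discrete_topology (carrier L)) ?D = discrete_topology ?D"
    by (simp add: Int_absorb1 Int_commute)
  moreover have "continuous_map (discrete_topology ?D) (discrete_topology Y) f" by auto
  ultimately show ?thesis using continuous_map_compose[of _ _ "\<lambda>s. s x" _ f] by (auto simp: comp_def)
qed

text \<open>A basic neighbourhood of the identity restricts only finitely many coordinates; these
  form \<open>T\<close>. This is the form of continuity that \<open>hilbert90\<close> asks
  for.\<close>

lemma locally_constant_at_one:
  assumes c: "continuous_map (gtop (galois_group L K)) (discrete_topology Y) c"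
    and one: "\<one>\<^bsub>galois_group L K\<^esub> \<in> carrier (galois_group L K)"
  obtains T where "finite T" "T \<subseteq> carrier L"
    "\<And>s. s \<in> carrier (galois_group L K) \<Longrightarrow> (\<And>x. x \<in> T \<Longrightarrow> s x = x) \<Longrightarrow> c s = c \<one>\<^bsub>galois_group L K\<^esub>"
proof -
  let ?G = "galois_group L K" and ?P = "product_topology (\<lambda>_. discrete_topology (carrier L)) (carrier L)"
  let ?y = "c \<one>\<^bsub>?G\<^esub>"
  have y: "?y \<in> Y" using c one continuous_map_image_subset_topspace[OF c] galois_group_topspace[of L K] by auto
  have "openin (gtop ?G) {s \<in> topspace (gtop ?G). c s \<in> {?y}}"
    using y by (intro openin_continuous_map_preimage[OF c]) simp
  then have "openin (subtopology ?P (carrier ?G)) {s \<in> carrier ?G. c s = ?y}"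
    unfolding galois_group_topspace by (simp add: galois_group_def Let_def)
  then obtain W where W: "openin ?P W" "{s \<in> carrier ?G. c s = ?y} = W \<inter> carrier ?G"
    unfolding openin_subtopology by blast
  then have oneW: "\<one>\<^bsub>?G\<^esub> \<in> W" using one by blast
  have "\<exists>U. finite {i \<in> carrier L. U i \<noteq> carrier L} \<and>
      (\<forall>i\<in>carrier L. openin (discrete_topology (carrier L)) (U i)) \<and>
      \<one>\<^bsub>?G\<^esub> \<in> Pi\<^sub>E (carrier L) U \<and> Pi\<^sub>E (carrier L) U \<subseteq> W"
    by (rule bspec[OF W(1)[unfolded openin_product_topology_alt topspace_discrete_topology] oneW])
  then obtain U where U: "finite {i \<in> carrier L. U i \<noteq> carrier L}" "\<one>\<^bsub>?G\<^esub> \<in> Pi\<^sub>E (carrier L) U"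
      "Pi\<^sub>E (carrier L) U \<subseteq> W"
    by (elim exE conjE) (rule that)
  show ?thesis
  proof (rule that[of "{i \<in> carrier L. U i \<noteq> carrier L}"])
    fix s assume s: "s \<in> carrier ?G" "\<And>x. x \<in> {i \<in> carrier L. U i \<noteq> carrier L} \<Longrightarrow> s x = x"
    have "s x \<in> U x" if x: "x \<in> carrier L" for x
    proof (cases "U x = carrier L")
      case True
      then show ?thesis using s(1) x by (auto simp: galois_group_def Let_def ring_iso_def ring_hom_def)
    next
      case False
      then have "s x = x" using s(2) x by blast
      moreover have "\<one>\<^bsub>?G\<^esub> x = x" using x by (simp add: galois_group_def Let_def)
      ultimately show ?thesis using U(2) x by (auto simp: PiE_def Pi_def)
    qed
    moreover have "s \<in> extensional (carrier L)" using s(1) by (simp add: galois_group_def Let_def)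
    ultimately have "s \<in> W" using U(3) by (auto simp: PiE_def)
    then show "c s = ?y" using W(2) s(1) by blast
  qed (use U(1) in auto)
qed

text \<open>In \<open>u ^ p = N * v ^ p\<close> the multiplicity of \<open>N\<close> is a multiple
  of \<open>p\<close> on the left and one more than a multiple of \<open>p\<close> on the
  right.\<close>

lemma prime_no_rational_root:
  fixes N p :: nat assumes "prime N" "1 < p" "x \<in> \<rat>" shows "x ^ p \<noteq> (of_nat N :: complex)"
proof
  assume x: "x ^ p = of_nat N"
  obtain u v :: int where uv: "v \<noteq> 0" "x = of_int u / of_int v"
    using assms(3) by (metis Rats_cases' of_int_0_less_iff less_irrefl)
  then have "of_int u ^ p = (x * of_int v) ^ p" by simp
  then have "of_int u ^ p = (of_int (int N) * of_int v ^ p :: complex)"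
    unfolding power_mult_distrib x by simp
  then have e: "u ^ p = int N * v ^ p" by (metis of_int_eq_iff of_int_mult of_int_power)
  have N: "prime (int N)" using assms(1) by simp
  have u: "u \<noteq> 0" using e uv(1) assms(1,2) by (auto simp: power_0_left)
  have "multiplicity (int N) (u ^ p) = p * multiplicity (int N) u"
    using N u by (intro prime_elem_multiplicity_power_distrib) auto
  moreover have "multiplicity (int N) (int N * v ^ p) = multiplicity (int N) (int N) + multiplicity (int N) (v ^ p)"
    using N uv(1) by (intro prime_elem_multiplicity_mult_distrib) auto
  moreover have "multiplicity (int N) (v ^ p) = p * multiplicity (int N) v"
    using N uv(1) by (intro prime_elem_multiplicity_power_distrib) auto
  moreover have "multiplicity (int N) (int N) = 1" using N by (intro multiplicity_self) auto
  ultimately have "p * multiplicity (int N) u = 1 + p * multiplicity (int N) v" using e by simp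
  then have "p dvd 1" by (metis dvd_add_left_iff dvd_triv_left)
  then show False using assms(2) by simp
qed

section \<open>Kummer theory over the rationals\<close>

locale kummer_setting = primitive_root p \<zeta> for p \<zeta> +
  fixes N :: nat and \<nu> :: complex and \<iota> :: "nat \<Rightarrow> complex \<Rightarrow> padic_bar"
  assumes odd_p: "odd p" and prime_N: "prime N" and N_cong: "[N = 1] (mod p)"
    and \<nu>_pow: "\<nu> ^ p = of_nat N"
    and \<iota>_hom: "\<And>l. prime l \<Longrightarrow> \<iota> l \<in> ring_hom Qbar (Qlbar l)"
begin

lemma padic_embedding_\<iota>: "prime l \<Longrightarrow> padic_embedding l (\<iota> l)"
  using \<iota>_hom by (simp add: padic_embedding_def padic_embedding_axioms_def padic_prime_def)

lemma N_coprime: "coprime N p"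
  using N_cong cong_imp_coprime[of 1 N p] cong_sym by auto

lemma \<nu>_algebraic: "algebraic \<nu>"
  using algebraic_root_complex[of \<nu> p] \<nu>_pow p_gt1 by simp

lemma \<nu>_nonzero: "\<nu> \<noteq> 0"
  using \<nu>_pow p_gt1 prime_N by (auto simp: power_0_left)

abbreviation \<kappa> where "\<kappa> \<equiv> kummer_cocycle p \<zeta> \<nu>"

lemma kummer_apply:
  assumes s: "s \<in> carrier G_Q"
  shows "s \<nu> = \<zeta> powi \<kappa> s * \<nu>" "\<kappa> s \<in> {0..<int p}"
proof -
  have "\<nu> ^ p \<in> \<rat>" unfolding \<nu>_pow by simp
  note r = radical_conjugate[OF s \<nu>_algebraic \<nu>_nonzero this]
  show "s \<nu> = \<zeta> powi \<kappa> s * \<nu>" "\<kappa> s \<in> {0..<int p}"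
    using r(2) zeta_log(1)[OF r(1)] s unfolding kummer_cocycle_def by auto
qed

lemma Fp1_action_twist: "Fp1_action p \<zeta> = twist p \<chi>"
  unfolding Fp1_action_def twist_def residue_ring_def by simp

lemma cocycle_iff:
  "c \<in> cocycles G_Q (Fp_module p) (twist p \<chi>) \<longleftrightarrow>
    c \<in> carrier G_Q \<rightarrow>\<^sub>E {0..<int p} \<and>
    continuous_map (gtop G_Q) (discrete_topology {0..<int p}) c \<and>
    (\<forall>s\<in>carrier G_Q. \<forall>t\<in>carrier G_Q. c (s \<otimes>\<^bsub>G_Q\<^esub> t) = (c s + \<chi> s * c t) mod int p)"
  unfolding cocycles_def by (simp add: twist_def mod_simps)

lemma kummer_product:
  assumes s: "s \<in> carrier G_Q" and t: "t \<in> carrier G_Q"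
  shows "[\<kappa> (s \<otimes>\<^bsub>G_Q\<^esub> t) = \<kappa> s + \<chi> s * \<kappa> t] (mod int p)"
proof -
  have "(s \<otimes>\<^bsub>G_Q\<^esub> t) \<nu> = s (\<zeta> powi \<kappa> t * \<nu>)"
    using GQ_mult_apply[OF \<nu>_algebraic] kummer_apply(1)[OF t] by simp
  also have "\<dots> = s (\<zeta> powi \<kappa> t) * s \<nu>" by (rule GQ_mult[OF s \<zeta>_powi_algebraic[OF s] \<nu>_algebraic])
  also have "\<dots> = \<zeta> powi (\<kappa> s + \<chi> s * \<kappa> t) * \<nu>"
    unfolding chi_powi[OF s] kummer_apply(1)[OF s] using \<zeta>_nonzero by (simp add: power_int_add)
  finally have "\<zeta> powi \<kappa> (s \<otimes>\<^bsub>G_Q\<^esub> t) = \<zeta> powi (\<kappa> s + \<chi> s * \<kappa> t)"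
    using kummer_apply(1)[OF GQ_mult_closed[OF s t]] \<nu>_nonzero by simp
  then show ?thesis unfolding \<zeta>_powi_eq_iff .
qed

text \<open>The multiple is restricted and reduced here because \<open>cocycles\<close> consists of
  extensional functions with values below \<open>p\<close>. Continuity holds since the value depends
  only on \<open>s \<nu>\<close>.\<close>

lemma kummer_multiple_cocycle:
  "(\<lambda>s\<in>carrier G_Q. k * \<kappa> s mod int p) \<in> cocycles G_Q (Fp_module p) (twist p \<chi>)"
  unfolding cocycle_iff
proof (intro conjI ballI)
  show "(\<lambda>s\<in>carrier G_Q. k * \<kappa> s mod int p) \<in> carrier G_Q \<rightarrow>\<^sub>E {0..<int p}"
    using p_gt1 by auto
  have "continuous_map (gtop G_Q) (discrete_topology {0..<int p})
      (\<lambda>s. (\<lambda>z. k * zeta_log p \<zeta> (z / \<nu>) mod int p) (s \<nu>))"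
    unfolding G_Q_def using p_gt1 \<nu>_algebraic by (intro evaluation_continuous) auto
  then show "continuous_map (gtop G_Q) (discrete_topology {0..<int p}) (\<lambda>s\<in>carrier G_Q. k * \<kappa> s mod int p)"
    by (rule continuous_map_eq) (simp add: G_Q_def galois_group_topspace kummer_cocycle_def)
  fix s t assume s: "s \<in> carrier G_Q" and t: "t \<in> carrier G_Q"
  have "[k * \<kappa> (s \<otimes>\<^bsub>G_Q\<^esub> t) = k * (\<kappa> s + \<chi> s * \<kappa> t)] (mod int p)"
    by (intro cong_mult cong_refl kummer_product s t)
  also have "[k * (\<kappa> s + \<chi> s * \<kappa> t) = k * \<kappa> s mod int p + \<chi> s * (k * \<kappa> t mod int p)] (mod int p)"
    unfolding distrib_left mult.left_commute[of k "\<chi> s"] by (intro cong_add cong_mult) simp_all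
  finally show "(\<lambda>s\<in>carrier G_Q. k * \<kappa> s mod int p) (s \<otimes>\<^bsub>G_Q\<^esub> t) =
      ((\<lambda>s\<in>carrier G_Q. k * \<kappa> s mod int p) s + \<chi> s * (\<lambda>s\<in>carrier G_Q. k * \<kappa> s mod int p) t) mod int p"
    using s t GQ_mult_closed[OF s t] by (simp add: cong_def)
qed

text \<open>The cocycle condition for \<open>c\<close> turns \<open>\<zeta> powi c s\<close> into a
  multiplicative cocycle, to which \<open>hilbert90\<close> applies.\<close>

lemma cocycle_radical:
  assumes c: "c \<in> cocycles G_Q (Fp_module p) (twist p \<chi>)"
  obtains \<alpha> where "algebraic \<alpha>" "\<alpha> \<noteq> 0" "\<And>s. s \<in> carrier G_Q \<Longrightarrow> s \<alpha> = \<zeta> powi c s * \<alpha>"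
proof -
  note cc = c[unfolded cocycle_iff]
  let ?id = "\<one>\<^bsub>G_Q\<^esub>"
  have id: "?id = (\<lambda>x\<in>{x. algebraic x}. x)" by (simp add: G_Q_def galois_group_def Let_def)
  have idG: "?id \<in> carrier G_Q" unfolding id by (rule GQ_id)
  obtain T where T: "finite T" "T \<subseteq> carrier Qbar"
    "\<And>s. s \<in> carrier G_Q \<Longrightarrow> (\<And>x. x \<in> T \<Longrightarrow> s x = x) \<Longrightarrow> c s = c ?id"
    using locally_constant_at_one[of Qbar \<rat> "{0..<int p}" c] cc idG unfolding G_Q_def by metis
  \<comment> \<open>A cocycle vanishes at the identity, so local constancy makes
    \<open>\<zeta> powi c s\<close> equal to one on the stabiliser of \<open>T\<close>.\<close>
  have idid: "?id \<otimes>\<^bsub>G_Q\<^esub> ?id = ?id"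
    by (rule GQ_extI[OF GQ_mult_closed[OF idG idG] idG]) (simp add: GQ_mult_apply id)
  have "\<zeta> powi \<chi> ?id = \<zeta> powi 1" using chi(1)[OF idG] \<zeta>_algebraic by (simp add: id)
  then have "[\<chi> ?id = 1] (mod int p)" unfolding \<zeta>_powi_eq_iff .
  then have "[c ?id + \<chi> ?id * c ?id = c ?id + 1 * c ?id] (mod int p)" by (intro cong_add cong_mult cong_refl)
  moreover have "[c ?id = c ?id + \<chi> ?id * c ?id] (mod int p)" using cc idG idid by (metis cong_mod_right cong_refl)
  ultimately have "[c ?id + 0 = c ?id + c ?id] (mod int p)" using cong_trans by force
  then have "[0 = c ?id] (mod int p)" unfolding cong_add_lcancel .
  then have "\<zeta> powi 0 = \<zeta> powi c ?id" unfolding \<zeta>_powi_eq_iff .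
  then have one: "\<zeta> powi c ?id = 1" by simp
  show ?thesis
  proof (rule hilbert90[of "\<lambda>s. \<zeta> powi c s" T])
    fix s assume s: "s \<in> carrier G_Q"
    show "algebraic (\<zeta> powi c s) \<and> \<zeta> powi c s \<noteq> 0" using \<zeta>_powi_algebraic[OF s] \<zeta>_nonzero by simp
    show "\<zeta> powi c s = 1" if "\<And>x. x \<in> T \<Longrightarrow> s x = x" using T(3)[OF s that] one by simp
    fix t assume t: "t \<in> carrier G_Q"
    have "c (s \<otimes>\<^bsub>G_Q\<^esub> t) = (c s + \<chi> s * c t) mod int p" using cc s t by blast
    then show "\<zeta> powi c (s \<otimes>\<^bsub>G_Q\<^esub> t) = \<zeta> powi c s * s (\<zeta> powi c t)"
      unfolding chi_powi[OF s] using \<zeta>_nonzero by (simp add: power_int_add)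
  qed (use T that in auto)
qed

text \<open>The \<open>p\<close>-th power of \<open>\<alpha>\<close> is rational because the roots
  of unity disappear in it. A rational factor does not affect the Galois action and turns this power
  into a positive integer.\<close>

lemma normalised_radical:
  assumes \<alpha>: "algebraic \<alpha>" "\<alpha> \<noteq> 0" "\<And>s. s \<in> carrier G_Q \<Longrightarrow> s \<alpha> = \<zeta> powi c s * \<alpha>"
  obtains \<beta> A where "algebraic \<beta>" "\<beta> ^ p = of_nat A" "0 < A"
    "\<And>s. s \<in> carrier G_Q \<Longrightarrow> s \<beta> = \<zeta> powi c s * \<beta>"
proof -
  have pow: "(\<zeta> powi k) ^ p = 1" for k
    using \<zeta>_powi_eq_1[of "k * int p"] by (simp add: power_int_mult cong_0_iff)
  have "\<alpha> ^ p \<in> \<rat>"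
  proof (rule GQ_fixed_rational)
    show "algebraic (\<alpha> ^ p)" using \<alpha>(1) by (rule algebraic_power_complex)
    show "s (\<alpha> ^ p) = \<alpha> ^ p" if s: "s \<in> carrier G_Q" for s
      using GQ_power[OF s \<alpha>(1), of p] \<alpha>(3)[OF s] pow by (simp add: power_mult_distrib)
  qed
  then obtain u v :: int where uv: "v \<noteq> 0" "\<alpha> ^ p = of_int u / of_int v"
    by (metis Rats_cases' of_int_0_less_iff less_irrefl)
  \<comment> \<open>Multiplying \<open>\<alpha>\<close> by the denominator \<open>v\<close> of its
    \<open>p\<close>-th power gives the integral radicand \<open>u * v ^ (p - 1)\<close>.\<close>
  define B where "B = u * v ^ (p - 1)"
  have "of_int v ^ p = (of_int v * of_int v ^ (p - 1) :: complex)"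
    using p_gt1 by (simp add: power_eq_if)
  then have B: "(of_int v * \<alpha>) ^ p = of_int B"
    unfolding power_mult_distrib uv(2) B_def using uv(1) by simp
  have B0: "B \<noteq> 0" using B \<alpha>(2) uv(1) p_gt1 by auto
  \<comment> \<open>For odd \<open>p\<close> a negative sign is itself a \<open>p\<close>-th power
    and can be moved into the radical.\<close>
  define r where "r = sgn B * v"
  have r0: "r \<noteq> 0" unfolding r_def using B0 uv(1) by (simp add: sgn_if)
  have sgn: "sgn B ^ p = sgn B" using odd_p p_gt1 by (auto simp: sgn_if)
  have "(of_int r * \<alpha>) ^ p = of_int (sgn B) ^ p * (of_int v * \<alpha>) ^ p"
    unfolding r_def by (simp add: power_mult_distrib)
  also have "\<dots> = of_int (sgn B ^ p * B)" unfolding B by simp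
  also have "\<dots> = of_nat (nat \<bar>B\<bar>)" unfolding sgn by (simp add: sgn_if)
  finally have eq: "(of_int r * \<alpha>) ^ p = of_nat (nat \<bar>B\<bar>)" .
  show ?thesis
  proof (rule that[OF _ eq])
    show "algebraic (of_int r * \<alpha>)" using \<alpha>(1) by (intro algebraic_times_complex) auto
    show "0 < nat \<bar>B\<bar>" using B0 by simp
    show "s (of_int r * \<alpha>) = \<zeta> powi c s * (of_int r * \<alpha>)" if s: "s \<in> carrier G_Q" for s
      using GQ_mult[OF s _ \<alpha>(1), of "of_int r"] GQ_rat[OF s, of "of_int r"] \<alpha>(3)[OF s] by simp
  qed
qed

abbreviation locally_trivial_on :: "nat \<Rightarrow> padic_bar set \<Rightarrow> ((complex \<Rightarrow> complex) \<Rightarrow> int) \<Rightarrow> bool" where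
  "locally_trivial_on l K c \<equiv> \<exists>a. \<forall>\<tau>\<in>inertia l K.
    [c (galois_restrict (\<iota> l) \<tau>) = (\<chi> (galois_restrict (\<iota> l) \<tau>) - 1) * a] (mod int p)"

lemma Ql_Lp: "Ql p \<subseteq> Lp p (\<iota> p) \<zeta> \<nu>"
  unfolding Lp_def by (auto intro: generate_field.incl)

lemma restrict_fixes_Lp:
  assumes \<tau>: "\<tau> \<in> inertia p (Lp p (\<iota> p) \<zeta> \<nu>)"
  shows "galois_restrict (\<iota> p) \<tau> \<in> carrier G_Q"
    "galois_restrict (\<iota> p) \<tau> \<zeta> = \<zeta>" "galois_restrict (\<iota> p) \<tau> \<nu> = \<nu>"
proof -
  interpret E: padic_embedding p "\<iota> p" by (rule padic_embedding_\<iota>[OF prime_p])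
  have \<tau>G: "\<tau> \<in> carrier (galois_group (Qlbar p) (Lp p (\<iota> p) \<zeta> \<nu>))" using \<tau> unfolding inertia_def by blast
  show "galois_restrict (\<iota> p) \<tau> \<in> carrier G_Q" by (rule E.restrict_GQ[OF \<tau>G Ql_Lp])
  have "\<iota> p \<zeta> \<in> Lp p (\<iota> p) \<zeta> \<nu>" "\<iota> p \<nu> \<in> Lp p (\<iota> p) \<zeta> \<nu>"
    unfolding Lp_def by (auto intro: generate_field.incl)
  then show "galois_restrict (\<iota> p) \<tau> \<zeta> = \<zeta>" "galois_restrict (\<iota> p) \<tau> \<nu> = \<nu>"
    using E.restrict_eqI[OF \<tau>G Ql_Lp] \<zeta>_algebraic \<nu>_algebraic E.P.galoisD(2)[OF \<tau>G] by auto
qed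

lemma chi_eq_1: "s \<in> carrier G_Q \<Longrightarrow> s \<zeta> = \<zeta> \<Longrightarrow> [\<chi> s = 1] (mod int p)"
  using chi(1)[of s] \<zeta>_powi_eq_iff[of "\<chi> s" 1] by simp

lemma kummer_eq_0: "s \<in> carrier G_Q \<Longrightarrow> s \<nu> = \<nu> \<Longrightarrow> \<kappa> s = 0"
  using kummer_apply[of s] \<nu>_nonzero \<zeta>_powi_eq_iff[of "\<kappa> s" 0] by (auto simp: cong_def)

text \<open>Inertia over \<open>Lp\<close> fixes \<open>\<nu>\<close>, which lies in
  \<open>Lp\<close>; at the other primes inertia fixes it by \<open>unramified_root\<close>. So
  \<open>\<kappa>\<close> vanishes on inertia and the coboundary constant is zero.\<close>

lemma kummer_locally_trivial:
  shows "prime l \<Longrightarrow> l \<noteq> N \<Longrightarrow> l \<noteq> p \<Longrightarrow> locally_trivial_on l (Ql l) (\<lambda>s. k * \<kappa> s)"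
    and "locally_trivial_on p (Lp p (\<iota> p) \<zeta> \<nu>) (\<lambda>s. k * \<kappa> s)"
proof -
  show "locally_trivial_on p (Lp p (\<iota> p) \<zeta> \<nu>) (\<lambda>s. k * \<kappa> s)"
    using restrict_fixes_Lp kummer_eq_0 by (intro exI[of _ 0]) simp
  assume l: "prime l" "l \<noteq> N" "l \<noteq> p"
  interpret E: padic_embedding l "\<iota> l" by (rule padic_embedding_\<iota>[OF l(1)])
  have "\<kappa> (galois_restrict (\<iota> l) \<tau>) = 0" if \<tau>: "\<tau> \<in> inertia l (Ql l)" for \<tau>
  proof (rule kummer_eq_0)
    show "galois_restrict (\<iota> l) \<tau> \<in> carrier G_Q" using \<tau> E.restrict_GQ unfolding inertia_def by blast
    show "galois_restrict (\<iota> l) \<tau> \<nu> = \<nu>"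
      using E.unramified_root[OF prime_p _ prime_N _ \<nu>_algebraic \<nu>_pow \<nu>_nonzero \<tau>] l by simp
  qed
  then show "locally_trivial_on l (Ql l) (\<lambda>s. k * \<kappa> s)" by (intro exI[of _ 0]) simp
qed

theorem locally_trivial_cocycle:
  assumes c: "c \<in> cocycles G_Q (Fp_module p) (twist p \<chi>)"
    and away: "\<And>l. prime l \<Longrightarrow> l \<noteq> N \<Longrightarrow> l \<noteq> p \<Longrightarrow> locally_trivial_on l (Ql l) c"
    and at_p: "locally_trivial_on p (Lp p (\<iota> p) \<zeta> \<nu>) c"
  shows "\<exists>k i. \<forall>s\<in>carrier G_Q. [c s = (\<chi> s - 1) * i + k * \<kappa> s] (mod int p)"
proof -
  obtain \<alpha> where "algebraic \<alpha>" "\<alpha> \<noteq> 0" "\<And>s. s \<in> carrier G_Q \<Longrightarrow> s \<alpha> = \<zeta> powi c s * \<alpha>"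
    using cocycle_radical[OF c] by blast
  then obtain \<beta> A where \<beta>: "algebraic \<beta>" "\<beta> ^ p = of_nat A" "0 < A"
      "\<And>s. s \<in> carrier G_Q \<Longrightarrow> s \<beta> = \<zeta> powi c s * \<beta>"
    using normalised_radical by blast
  have "p dvd multiplicity q A" if q: "prime q" "q \<noteq> N" for q
  proof (cases "q = p")
    case True
    interpret E: padic_embedding p "\<iota> p" by (rule padic_embedding_\<iota>[OF prime_p])
    obtain a where a: "\<And>\<tau>. \<tau> \<in> inertia p (Lp p (\<iota> p) \<zeta> \<nu>) \<Longrightarrow>
        [c (galois_restrict (\<iota> p) \<tau>) = (\<chi> (galois_restrict (\<iota> p) \<tau>) - 1) * a] (mod int p)"
      using at_p by blast
    have "galois_restrict (\<iota> p) \<tau> \<beta> = \<beta>" if \<tau>: "\<tau> \<in> inertia p (Lp p (\<iota> p) \<zeta> \<nu>)" for \<tau>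
    proof -
      note r = restrict_fixes_Lp[OF \<tau>]
      \<comment> \<open>Over \<open>Lp\<close> the character is trivial, so the coboundary vanishes
        and \<open>\<beta>\<close> itself is fixed, without a correcting power of
        \<open>\<zeta>\<close>.\<close>
      have "[(\<chi> (galois_restrict (\<iota> p) \<tau>) - 1) * a = (1 - 1) * a] (mod int p)"
        using chi_eq_1[OF r(1,2)] by (intro cong_mult cong_diff cong_refl)
      then have "[c (galois_restrict (\<iota> p) \<tau>) = 0] (mod int p)" using cong_trans[OF a[OF \<tau>]] by simp
      then have "\<zeta> powi c (galois_restrict (\<iota> p) \<tau>) = 1" unfolding \<zeta>_powi_eq_1 .
      then show ?thesis using \<beta>(4)[OF r(1)] by simp
    qed
    then have "p dvd multiplicity p A"
      by (rule E.radical_valuation_over_Lp[OF \<zeta>_pow \<zeta>_ne \<nu>_algebraic \<nu>_pow N_coprime \<beta>(1-3)])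
    then show ?thesis unfolding True .
  next
    case False
    interpret E: padic_embedding q "\<iota> q" by (rule padic_embedding_\<iota>[OF q(1)])
    obtain a where a: "\<And>\<tau>. \<tau> \<in> inertia q (Ql q) \<Longrightarrow>
        [c (galois_restrict (\<iota> q) \<tau>) = (\<chi> (galois_restrict (\<iota> q) \<tau>) - 1) * a] (mod int p)"
      using away[OF q False] by blast
    \<comment> \<open>Multiplying by \<open>\<zeta> powi (- a)\<close> cancels the coboundary on
      inertia and leaves the \<open>p\<close>-th power unchanged.\<close>
    let ?\<gamma> = "\<beta> * \<zeta> powi (- a)"
    have pow: "(\<zeta> powi k) ^ p = 1" for k
      using \<zeta>_powi_eq_1[of "k * int p"] by (simp add: power_int_mult cong_0_iff)
    have alg: "algebraic (\<zeta> powi k)" for k by (rule \<zeta>_powi_algebraic[OF GQ_id])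
    have \<gamma>: "algebraic ?\<gamma>" using \<beta>(1) alg by (rule algebraic_times_complex)
    have "?\<gamma> ^ p = of_nat A" unfolding power_mult_distrib \<beta>(2) pow by simp
    moreover have "galois_restrict (\<iota> q) \<tau> ?\<gamma> = ?\<gamma>" if \<tau>: "\<tau> \<in> inertia q (Ql q)" for \<tau>
    proof -
      have r: "galois_restrict (\<iota> q) \<tau> \<in> carrier G_Q" using \<tau> E.restrict_GQ unfolding inertia_def by blast
      let ?s = "galois_restrict (\<iota> q) \<tau>"
      have "[c ?s + \<chi> ?s * (- a) = (\<chi> ?s - 1) * a + \<chi> ?s * (- a)] (mod int p)"
        using a[OF \<tau>] by (intro cong_add cong_refl)
      moreover have "(\<chi> ?s - 1) * a + \<chi> ?s * (- a) = - a" by (simp add: algebra_simps)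
      ultimately have "\<zeta> powi (c ?s + \<chi> ?s * (- a)) = \<zeta> powi (- a)" unfolding \<zeta>_powi_eq_iff by simp
      moreover have "?s ?\<gamma> = \<zeta> powi (c ?s + \<chi> ?s * (- a)) * \<beta>"
        unfolding GQ_mult[OF r \<beta>(1) alg] chi_powi[OF r] \<beta>(4)[OF r] power_int_add[OF disjI1[OF \<zeta>_nonzero]]
        by (simp add: mult_ac)
      ultimately show ?thesis by (simp add: mult.commute)
    qed
    ultimately show ?thesis using E.unramified_valuation[OF prime_p \<gamma> _ \<beta>(3)] by blast
  qed
  then obtain k r where A: "A = N ^ k * r ^ p"
    using prime_times_power_decomposition[OF \<beta>(3) _ prime_N] p_gt1 by (metis gr_implies_not0 not_gr0)
  have r0: "r \<noteq> 0" using A \<beta>(3) p_gt1 by (auto simp: power_0_left)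
  \<comment> \<open>\<open>\<mu>\<close> has the same \<open>p\<close>-th power as
    \<open>\<beta>\<close>, so they differ by a power \<open>\<zeta> powi i\<close>, and this
    \<open>i\<close> is the coboundary constant in the conclusion.\<close>
  define \<mu> where "\<mu> = \<nu> ^ k * of_nat r"
  have \<mu>: "algebraic \<mu>" "\<mu> \<noteq> 0" unfolding \<mu>_def using \<nu>_algebraic \<nu>_nonzero r0
    by (auto intro: algebraic_times_complex algebraic_power_complex)
  have "\<mu> ^ p = (\<nu> ^ p) ^ k * of_nat r ^ p"
    unfolding \<mu>_def by (simp add: power_mult_distrib power_mult[symmetric] mult.commute)
  then have "\<mu> ^ p = \<beta> ^ p" unfolding \<beta>(2) \<nu>_pow A by simp
  then have "(\<beta> / \<mu>) ^ p = \<mu> ^ p / \<mu> ^ p" by (simp add: power_divide)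
  then have "(\<beta> / \<mu>) ^ p = 1" using \<mu>(2) by simp
  then obtain i where "\<beta> / \<mu> = \<zeta> powi i" using root_of_unity_powi by blast
  then have \<beta>_eq: "\<beta> = \<zeta> powi i * \<mu>" using \<mu>(2) by (simp add: field_simps)
  have "[c s = (\<chi> s - 1) * i + int k * \<kappa> s] (mod int p)" if s: "s \<in> carrier G_Q" for s
  proof -
    have "s \<mu> = s \<nu> ^ k * of_nat r"
      unfolding \<mu>_def using GQ_mult[OF s algebraic_power_complex[OF \<nu>_algebraic], of "of_nat r"]
        GQ_power[OF s \<nu>_algebraic] GQ_rat[OF s, of "of_nat r"] by simp
    also have "\<dots> = \<zeta> powi (int k * \<kappa> s) * \<mu>"
      unfolding kummer_apply(1)[OF s] \<mu>_def by (simp add: power_mult_distrib power_int_mult mult.commute[of "int k"])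
    finally have s\<mu>: "s \<mu> = \<zeta> powi (int k * \<kappa> s) * \<mu>" .
    have "\<zeta> powi c s * (\<zeta> powi i * \<mu>) = s (\<zeta> powi i * \<mu>)" using \<beta>(4)[OF s] unfolding \<beta>_eq by simp
    also have "\<dots> = \<zeta> powi (\<chi> s * i) * (\<zeta> powi (int k * \<kappa> s) * \<mu>)"
      unfolding GQ_mult[OF s \<zeta>_powi_algebraic[OF s] \<mu>(1)] chi_powi[OF s] s\<mu> ..
    finally have "\<zeta> powi (c s + i) = \<zeta> powi (\<chi> s * i + int k * \<kappa> s)"
      using \<mu>(2) \<zeta>_nonzero by (simp add: power_int_add)
    then have "[c s + i = ((\<chi> s - 1) * i + int k * \<kappa> s) + i] (mod int p)"
      unfolding \<zeta>_powi_eq_iff by (simp add: algebra_simps)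
    then show ?thesis unfolding cong_add_rcancel .
  qed
  then show ?thesis by blast
qed

text \<open>If a multiple of \<open>\<kappa>\<close> prime to \<open>p\<close> were a coboundary,
  then so would be \<open>\<kappa>\<close>, and \<open>\<nu>\<close> times a power of
  \<open>\<zeta>\<close> would be a rational \<open>p\<close>-th root of \<open>N\<close>.\<close>

theorem kummer_not_coboundary:
  assumes "\<And>s. s \<in> carrier G_Q \<Longrightarrow> [k * \<kappa> s = (\<chi> s - 1) * a] (mod int p)"
  shows "[k = 0] (mod int p)"
proof (rule ccontr)
  assume "\<not> [k = 0] (mod int p)"
  then have "\<not> int p dvd k" by (simp add: cong_0_iff)
  then have "coprime k (int p)" using prime_p
    by (metis coprime_commute prime_imp_coprime prime_nat_int_transfer)
  then obtain t where t: "[k * t = 1] (mod int p)" using cong_solve_coprime_int by blast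
  \<comment> \<open>\<open>t\<close> inverts \<open>k\<close> modulo \<open>p\<close>, so
    \<open>\<kappa>\<close> is the coboundary with constant \<open>t * a\<close>, which the factor
    undoes.\<close>
  let ?x = "\<nu> * \<zeta> powi (- (t * a))"
  have alg: "algebraic (\<zeta> powi k)" for k by (rule \<zeta>_powi_algebraic[OF GQ_id])
  have "?x \<in> \<rat>"
  proof (rule GQ_fixed_rational)
    show "algebraic ?x" using \<nu>_algebraic alg by (rule algebraic_times_complex)
    fix s assume s: "s \<in> carrier G_Q"
    have "[k * t * \<kappa> s = 1 * \<kappa> s] (mod int p)" using t by (intro cong_mult cong_refl)
    moreover have "[t * (k * \<kappa> s) = t * ((\<chi> s - 1) * a)] (mod int p)"
      using assms[OF s] by (rule cong_scalar_left)
    ultimately have "[\<kappa> s = t * ((\<chi> s - 1) * a)] (mod int p)"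
      by (metis cong_sym cong_trans mult.assoc mult.commute mult_1)
    then have "[\<kappa> s + \<chi> s * (- (t * a)) = t * ((\<chi> s - 1) * a) + \<chi> s * (- (t * a))] (mod int p)"
      by (intro cong_add cong_refl)
    moreover have "t * ((\<chi> s - 1) * a) + \<chi> s * (- (t * a)) = - (t * a)" by (simp add: algebra_simps)
    ultimately have "\<zeta> powi (\<kappa> s + \<chi> s * (- (t * a))) = \<zeta> powi (- (t * a))" unfolding \<zeta>_powi_eq_iff by simp
    moreover have "s ?x = \<zeta> powi (\<kappa> s + \<chi> s * (- (t * a))) * \<nu>"
      unfolding GQ_mult[OF s \<nu>_algebraic alg] chi_powi[OF s] kummer_apply(1)[OF s] power_int_add[OF disjI1[OF \<zeta>_nonzero]]
      by (simp add: mult_ac)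
    ultimately show "s ?x = ?x" by (simp add: mult.commute)
  qed
  moreover have "(\<zeta> powi k) ^ p = 1" for k
    using \<zeta>_powi_eq_1[of "k * int p"] by (simp add: power_int_mult cong_0_iff)
  then have "?x ^ p = of_nat N" unfolding power_mult_distrib \<nu>_pow by simp
  ultimately show False using prime_no_rational_root[OF prime_N p_gt1] by blast
qed

end

text \<open>Local triviality depends only on the class, so it can be tested on any representing
  function: a cocycle in one direction, the unreduced multiple of \<open>\<kappa>\<close> in the
  other.\<close>

lemma (in kummer_setting) H1_Lambda_carrier:
  "carrier (H1_Lambda p N \<iota> \<zeta> \<nu> (Fp_module p) (twist p \<chi>)) =
    (\<lambda>k. cochain_class p (carrier G_Q) \<chi> (\<lambda>s. k * \<kappa> s)) ` carrier (residue_ring (int p))" (is "?S = ?\<Psi> ` ?F")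
proof -
  have F: "?F = {0..<int p}" by (auto simp: residue_ring_def)
  have unr_l: "unramified_over l (\<iota> l) (Ql l) (Fp_module p) (twist p \<chi>) (cochain_class p (carrier G_Q) \<chi> c) \<longleftrightarrow>
      locally_trivial_on l (Ql l) c" if "prime l" for l c
    by (rule padic_embedding.unramified_over_twist_iff[OF padic_embedding_\<iota>[OF that] p_gt1 order_refl])
  have unr_p: "unramified_over p (\<iota> p) (Lp p (\<iota> p) \<zeta> \<nu>) (Fp_module p) (twist p \<chi>) (cochain_class p (carrier G_Q) \<chi> c) \<longleftrightarrow>
      locally_trivial_on p (Lp p (\<iota> p) \<zeta> \<nu>) c" for c
    by (rule padic_embedding.unramified_over_twist_iff[OF padic_embedding_\<iota>[OF prime_p] p_gt1 Ql_Lp])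
  have mem: "\<xi> \<in> ?S \<longleftrightarrow> (\<exists>c\<in>cocycles G_Q (Fp_module p) (twist p \<chi>). \<xi> = cochain_class p (carrier G_Q) \<chi> c \<and>
      (\<forall>l. prime l \<and> l \<noteq> N \<and> l \<noteq> p \<longrightarrow> locally_trivial_on l (Ql l) c) \<and>
      locally_trivial_on p (Lp p (\<iota> p) \<zeta> \<nu>) c)" for \<xi>
  proof -
    have "\<xi> \<in> ?S \<longleftrightarrow> (\<exists>c\<in>cocycles G_Q (Fp_module p) (twist p \<chi>). \<xi> = cochain_class p (carrier G_Q) \<chi> c \<and>
        (\<forall>l. prime l \<and> l \<noteq> N \<and> l \<noteq> p \<longrightarrow> unramified_over l (\<iota> l) (Ql l) (Fp_module p) (twist p \<chi>) \<xi>) \<and>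
        unramified_over p (\<iota> p) (Lp p (\<iota> p) \<zeta> \<nu>) (Fp_module p) (twist p \<chi>) \<xi>)"
      unfolding H1_Lambda_def H1_carrier_twist[OF p_gt1] by auto
    then show ?thesis by (simp add: unr_l unr_p cong: conj_cong)
  qed
  show ?thesis
  proof (intro equalityI subsetI)
    fix \<xi> assume "\<xi> \<in> ?S"
    then obtain c where c: "c \<in> cocycles G_Q (Fp_module p) (twist p \<chi>)" "\<xi> = cochain_class p (carrier G_Q) \<chi> c"
      "\<And>l. prime l \<Longrightarrow> l \<noteq> N \<Longrightarrow> l \<noteq> p \<Longrightarrow> locally_trivial_on l (Ql l) c"
      "locally_trivial_on p (Lp p (\<iota> p) \<zeta> \<nu>) c"
      unfolding mem by blast
    obtain k i where ki: "\<forall>s\<in>carrier G_Q. [c s = (\<chi> s - 1) * i + k * \<kappa> s] (mod int p)"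
      using locally_trivial_cocycle[OF c(1,3,4)] by blast
    have "\<xi> = ?\<Psi> k" unfolding c(2) cochain_class_eq_iff using ki by blast
    also have "\<dots> = ?\<Psi> (k mod int p)" by (rule cochain_class_cong) (simp add: cong_def mod_simps)
    finally show "\<xi> \<in> ?\<Psi> ` ?F" using p_gt1 unfolding F by auto
  next
    fix \<xi> assume "\<xi> \<in> ?\<Psi> ` ?F"
    then obtain k where k: "\<xi> = ?\<Psi> k" by blast
    let ?c = "\<lambda>s\<in>carrier G_Q. k * \<kappa> s mod int p"
    have c: "\<xi> = cochain_class p (carrier G_Q) \<chi> ?c"
      unfolding k by (rule cochain_class_cong) simp
    have "unramified_over l (\<iota> l) (Ql l) (Fp_module p) (twist p \<chi>) \<xi>" if "prime l" "l \<noteq> N" "l \<noteq> p" for l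
      unfolding k unr_l[OF that(1)] by (rule kummer_locally_trivial(1)[OF that])
    moreover have "unramified_over p (\<iota> p) (Lp p (\<iota> p) \<zeta> \<nu>) (Fp_module p) (twist p \<chi>) \<xi>"
      unfolding k unr_p by (rule kummer_locally_trivial(2))
    ultimately show "\<xi> \<in> ?S"
      using c kummer_multiple_cocycle
      unfolding H1_Lambda_def H1_carrier_twist[OF p_gt1] by simp
  qed
qed

theorem theorem4p14:
  fixes p N :: nat
    and \<zeta> \<nu> :: complex
    and \<iota> :: "nat \<Rightarrow> complex \<Rightarrow> padic_bar"
  defines "F \<equiv> residue_ring (int p)"
    and "S \<equiv> H1_Lambda p N \<iota> \<zeta> \<nu> (Fp_module p) (Fp1_action p \<zeta>)"
    and "b \<equiv> H1_class G_Q (Fp_module p) (Fp1_action p \<zeta>) (kummer_cocycle p \<zeta> \<nu>)"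
  assumes "prime p" and "odd p"
    and "prime N" and "[N = 1] (mod p)"
    and "\<zeta> ^ p = 1" and "\<zeta> \<noteq> 1"
    and "\<nu> ^ p = of_nat N"
    and "\<And>l. prime l \<Longrightarrow> \<iota> l \<in> ring_hom Qbar (Qlbar l)"
  shows "vectorspace F S \<and> vectorspace.dim F S = 1 \<and>
         b \<in> carrier S \<and> LinearCombinations.module.span F S {b} = carrier S"
proof -
  interpret kummer_setting p \<zeta> N \<nu> \<iota> by unfold_locales fact+
  interpret F: residues_prime p F using prime_p unfolding F_def by unfold_locales
  \<comment> \<open>The parametrisation of the Selmer group by \<open>F\<close>: surjective by
    \<open>H1_Lambda_carrier\<close>, injective by \<open>kummer_not_coboundary\<close>.\<close>
  define \<Psi> where "\<Psi> k = cochain_class p (carrier G_Q) \<chi> (\<lambda>s. k * \<kappa> s)" for k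
  have \<Psi>_cong: "\<Psi> a = \<Psi> b" if "[a = b] (mod int p)" for a b
    unfolding \<Psi>_def using that by (intro cochain_class_cong cong_scalar_right)
  have F_simps: "x \<oplus>\<^bsub>F\<^esub> y = (x + y) mod int p" "x \<otimes>\<^bsub>F\<^esub> y = (x * y) mod int p" for x y
    by (simp_all add: F.res_add_eq F.res_mult_eq)
  have S: "S = H1_Lambda p N \<iota> \<zeta> \<nu> (Fp_module p) (twist p \<chi>)"
    unfolding S_def Fp1_action_twist ..
  have carrier_S: "\<Psi> ` carrier F = carrier S"
    unfolding S H1_Lambda_carrier F_def \<Psi>_def ..
  have b: "b = \<Psi> \<one>\<^bsub>F\<^esub>"
    unfolding b_def Fp1_action_twist H1_class_twist[OF p_gt1] \<Psi>_def F.res_one_eq by simp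
  have inj: "inj_on \<Psi> (carrier F)"
  proof (rule inj_onI)
    fix k m assume km: "k \<in> carrier F" "m \<in> carrier F" "\<Psi> k = \<Psi> m"
    then obtain a where a: "\<forall>s\<in>carrier G_Q. [k * \<kappa> s = (\<chi> s - 1) * a + m * \<kappa> s] (mod int p)"
      unfolding \<Psi>_def cochain_class_eq_iff by blast
    have "[(k - m) * \<kappa> s = (\<chi> s - 1) * a] (mod int p)" if "s \<in> carrier G_Q" for s
      using a that by (simp add: cong_iff_dvd_diff algebra_simps)
    then have "[k - m = 0] (mod int p)" by (rule kummer_not_coboundary)
    then have "[k = m] (mod int p)" by (simp add: cong_iff_dvd_diff)
    then show "k = m" using km(1,2) by (simp add: F.res_carrier_eq cong_def)
  qed
  have add: "\<Psi> x \<oplus>\<^bsub>S\<^esub> \<Psi> y = \<Psi> (x \<oplus>\<^bsub>F\<^esub> y)" for x y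
  proof -
    have "\<Psi> x \<oplus>\<^bsub>S\<^esub> \<Psi> y = \<Psi> (x + y)"
      unfolding S H1_Lambda_def \<Psi>_def by (simp add: H1_add_twist[OF p_gt1] distrib_right)
    then show ?thesis using \<Psi>_cong[of "x + y" "x \<oplus>\<^bsub>F\<^esub> y"] by (simp add: F_simps)
  qed
  have smult: "x \<odot>\<^bsub>S\<^esub> \<Psi> y = \<Psi> (x \<otimes>\<^bsub>F\<^esub> y)" for x y
  proof -
    have "x \<odot>\<^bsub>S\<^esub> \<Psi> y = \<Psi> (x * y)"
      unfolding S H1_Lambda_def \<Psi>_def by (simp add: H1_smult_twist[OF p_gt1] mult.assoc)
    then show ?thesis using \<Psi>_cong[of "x * y" "x \<otimes>\<^bsub>F\<^esub> y"] by (simp add: F_simps)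
  qed
  have zero: "\<zero>\<^bsub>S\<^esub> = \<Psi> \<zero>\<^bsub>F\<^esub>"
    unfolding S H1_Lambda_def \<Psi>_def F.res_zero_eq by (simp add: H1_def coboundaries_twist[OF p_gt1])
  note vs = one_dimensional_vectorspace[OF F.is_field carrier_S inj add smult zero]
  show ?thesis using vs carrier_S unfolding b by blast
qed

end
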